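(* Let $n\ge 2$, let $I\subset\mathbb{R}$ be an interval with $|I|=1$, and let $n'=n/(n-1)$. Let $X(I^{n-1})$ and $Z(I^n)$ be rearrangement invariant (r.i.) spaces. Then the following statements are equivalent: (i) $W^1Z(I^n)\hookrightarrow \mathcal{R}(X,L^\infty)$; (ii) there is a constant $C>0$ such that for every $f\in Z(I^n)$, $$\left\|\int_{t^{n'}}^1 f^*(s)\,s^{-1/n'}\,ds\right\|_{\overline{X}(0,1)}\le C\,\|f^*\|_{\overline{Z}(0,1)},$$ where the function inside the left-hand norm is a function of $t\in(0,1)$.
   Context: Rearrangements: for a measurable real function $f$ on $I^m$ ($m\ge1$, $|I|=1$), $\lambda_f(t)=|\{x:|f(x)|>t\}|$ and $f^*(t)=\inf\{s\ge 0:\lambda_f(s)\le t\}$. R.i. spaces: a Banach function norm is a map $\rho$ from non-negative measurable functions on $I^m$ to $[0,\infty]$ with: $\rho(f)=0$ iff $f=0$ a.e., $\rho(f+g)\le\rho(f)+\rho(g)$, $\rho(\alpha f)=\alpha\rho(f)$ for $\alpha\ge0$; $0\le g\le f$ a.e. implies $\rho(g)\le\rho(f)$; $0\le f_j\uparrow f$ a.e. implies $\rho(f_j)\uparrow\rho(f)$; $\rho(\chi_{I^m})<\infty$; $\int_{I^m}f\,dx\le C\rho(f)$ for a constant $C$. The space $X(I^m)=\{f \text{ measurable}:\|f\|_{X(I^m)}:=\rho(|f|)<\infty\}$ is rearrangement invariant (r.i.) if $\|f\|_{X(I^m)}=\|g\|_{X(I^m)}$ whenever $\lambda_f=\lambda_g$.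 R.i. spaces on $(0,1)$ are defined in the same way. By the Luxemburg representation theorem, for an r.i. space $X(I^m)$ there is an r.i. space $\overline{X}(0,1)$ with $\|f\|_{X(I^m)}=\|f^*\|_{\overline{X}(0,1)}$ for all $f$. Sobolev space: $W^1Z(I^n)=\{u\in Z(I^n):|\nabla u|\in Z(I^n)\}$ ($\nabla u$ the distributional gradient, $|\cdot|$ Euclidean length), with norm $\|u\|_{W^1Z(I^n)}=\|u\|_{Z(I^n)}+\||\nabla u|\|_{Z(I^n)}$. Mixed norm spaces: for $x\in I^n$ and $k\in\{1,\dots,n\}$ let $\widehat{x}_k\in I^{n-1}$ be $x$ with its $k$th coordinate removed. For r.i. spaces $X(I^{n-1})$, $Y(I)$, let $\psi_k(f,Y)(\widehat{x}_k)=\|f(\widehat{x}_k,\cdot)\|_{Y(I)}$ (norm in the $k$th variable), $\|f\|_{\mathcal{R}_k(X,Y)}=\|\psi_k(f,Y)\|_{X(I^{n-1})}$, $\mathcal{R}_k(X,Y)=\{f:\|f\|_{\mathcal{R}_k(X,Y)}<\infty\}$, and $\mathcal{R}(X,Y)=\bigcap_{k=1}^n\mathcal{R}_k(X,Y)$ with norm $\|f\|_{\mathcal{R}(X,Y)}=\sum_{k=1}^n\|f\|_{\mathcal{R}_k(X,Y)}$. $A\hookrightarrow B$ denotes a continuous embedding: $A\subset B$ and $\|f\|_B\le C\|f\|_A$ for all $f\in A$. *)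

theory Defs
  imports "HOL-Analysis.Analysis" "HOL-Probability.Essential_Supremum"
begin

section \<open>Rearrangements and rearrangement invariant spaces\<close>

definition distribution_fun :: "'a measure \<Rightarrow> ('a \<Rightarrow> real) \<Rightarrow> real \<Rightarrow> ennreal" where
  "distribution_fun M f t = emeasure M {x \<in> space M. \<bar>f x\<bar> > t}"

text \<open>On a finite measure space the set below is nonempty for every \<open>t > 0\<close> and measurable \<open>f\<close>,
  so the real infimum is the intended one; at \<open>t = 0\<close>, where the infimum may be infinite in the
  literature, the value is never used.\<close>

definition rearrangement :: "'a measure \<Rightarrow> ('a \<Rightarrow> real) \<Rightarrow> real \<Rightarrow> real" where
  "rearrangement M f t = Inf {s. s \<ge> 0 \<and> distribution_fun M f s \<le> ennreal t}"

text \<open>Function norms act on measurable functions with values in \<open>[0,\<infinity>]\<close>; nothing is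
  assumed about their values on nonmeasurable functions.\<close>

definition banach_function_norm :: "'a measure \<Rightarrow> (('a \<Rightarrow> ennreal) \<Rightarrow> ennreal) \<Rightarrow> bool" where
  "banach_function_norm M \<rho> \<longleftrightarrow>
     (\<forall>f \<in> borel_measurable M. \<rho> f = 0 \<longleftrightarrow> (AE x in M. f x = 0)) \<and>
     (\<forall>f \<in> borel_measurable M. \<forall>g \<in> borel_measurable M. \<rho> (\<lambda>x. f x + g x) \<le> \<rho> f + \<rho> g) \<and>
     (\<forall>f \<in> borel_measurable M. \<forall>a::real. a \<ge> 0 \<longrightarrow> \<rho> (\<lambda>x. ennreal a * f x) = ennreal a * \<rho> f) \<and>
     (\<forall>f \<in> borel_measurable M. \<forall>g \<in> borel_measurable M.
        (AE x in M. g x \<le> f x) \<longrightarrow> \<rho> g \<le> \<rho> f) \<and>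
     (\<forall>F f. (\<forall>j::nat. F j \<in> borel_measurable M) \<and> f \<in> borel_measurable M \<and>
        (AE x in M. incseq (\<lambda>j. F j x) \<and> (\<lambda>j. F j x) \<longlonglongrightarrow> f x) \<longrightarrow>
        incseq (\<lambda>j. \<rho> (F j)) \<and> (\<lambda>j. \<rho> (F j)) \<longlonglongrightarrow> \<rho> f) \<and>
     \<rho> (indicator (space M)) < \<infinity> \<and>
     (\<exists>C::real. C > 0 \<and> (\<forall>f \<in> borel_measurable M. (\<integral>\<^sup>+x. f x \<partial>M) \<le> ennreal C * \<rho> f))"

definition fnorm :: "(('a \<Rightarrow> ennreal) \<Rightarrow> ennreal) \<Rightarrow> ('a \<Rightarrow> real) \<Rightarrow> ennreal" where
  "fnorm \<rho> f = \<rho> (\<lambda>x. ennreal \<bar>f x\<bar>)"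

definition fspace :: "'a measure \<Rightarrow> (('a \<Rightarrow> ennreal) \<Rightarrow> ennreal) \<Rightarrow> ('a \<Rightarrow> real) set" where
  "fspace M \<rho> = {f \<in> borel_measurable M. fnorm \<rho> f < \<infinity>}"

definition ri_norm :: "'a measure \<Rightarrow> (('a \<Rightarrow> ennreal) \<Rightarrow> ennreal) \<Rightarrow> bool" where
  "ri_norm M \<rho> \<longleftrightarrow> banach_function_norm M \<rho> \<and>
     (\<forall>f \<in> borel_measurable M. \<forall>g \<in> borel_measurable M.
        (\<forall>t\<ge>0. distribution_fun M f t = distribution_fun M g t) \<longrightarrow> fnorm \<rho> f = fnorm \<rho> g)"

abbreviation unit_measure :: "real measure" where
  "unit_measure \<equiv> lebesgue_on {0<..<1}"

definition luxemburg_representation ::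
    "'a measure \<Rightarrow> (('a \<Rightarrow> ennreal) \<Rightarrow> ennreal) \<Rightarrow> ((real \<Rightarrow> ennreal) \<Rightarrow> ennreal) \<Rightarrow> bool" where
  "luxemburg_representation M \<rho> \<sigma> \<longleftrightarrow> ri_norm unit_measure \<sigma> \<and>
     (\<forall>f \<in> borel_measurable M. fnorm \<rho> f = fnorm \<sigma> (rearrangement M f))"

definition continuously_embedded ::
    "'b set \<Rightarrow> ('b \<Rightarrow> ennreal) \<Rightarrow> 'b set \<Rightarrow> ('b \<Rightarrow> ennreal) \<Rightarrow> bool" where
  "continuously_embedded A normA B normB \<longleftrightarrow>
     A \<subseteq> B \<and> (\<exists>C::real. C > 0 \<and> (\<forall>f\<in>A. normB f \<le> ennreal C * normA f))"


section \<open>The cube\<close>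

text \<open>Points of \<open>\<real>\<^sup>m\<close> are the functions in \<open>extensional {..<m}\<close>. The following is Lebesgue
  measure, on the Lebesgue measurable subsets of \<open>I\<^sup>m\<close>.\<close>

definition cube :: "nat \<Rightarrow> real set \<Rightarrow> (nat \<Rightarrow> real) measure" where
  "cube m I = completion (\<Pi>\<^sub>M i\<in>{..<m}. restrict_space lborel I)"

definition cube_interior :: "nat \<Rightarrow> real set \<Rightarrow> (nat \<Rightarrow> real) set" where
  "cube_interior m I = (\<Pi>\<^sub>E i\<in>{..<m}. interior I)"


section \<open>Sobolev spaces\<close>

definition partial_deriv :: "nat \<Rightarrow> ((nat \<Rightarrow> real) \<Rightarrow> real) \<Rightarrow> (nat \<Rightarrow> real) \<Rightarrow> real" where
  "partial_deriv i \<phi> x = deriv (\<lambda>t. \<phi> (x(i := t))) (x i)"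

text \<open>\<open>\<phi>\<close> is of class \<open>C\<^sup>k\<close> on \<open>\<real>\<^sup>n\<close>; the product topology on \<open>nat \<Rightarrow> real\<close>
  induces the Euclidean topology on \<open>extensional {..<n}\<close>.\<close>

primrec Ck :: "nat \<Rightarrow> nat \<Rightarrow> ((nat \<Rightarrow> real) \<Rightarrow> real) \<Rightarrow> bool" where
  "Ck n 0 \<phi> \<longleftrightarrow> continuous_on (extensional {..<n}) \<phi>"
| "Ck n (Suc k) \<phi> \<longleftrightarrow> continuous_on (extensional {..<n}) \<phi> \<and>
     (\<forall>i<n. (\<forall>x \<in> extensional {..<n}. (\<lambda>t. \<phi> (x(i := t))) differentiable (at (x i))) \<and>
            Ck n k (partial_deriv i \<phi>))"

definition test_function :: "nat \<Rightarrow> real set \<Rightarrow> ((nat \<Rightarrow> real) \<Rightarrow> real) \<Rightarrow> bool" where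
  "test_function n I \<phi> \<longleftrightarrow> (\<forall>k. Ck n k \<phi>) \<and>
     (\<exists>K. compact K \<and> K \<subseteq> cube_interior n I \<and> (\<forall>x \<in> extensional {..<n} - K. \<phi> x = 0))"

definition locally_integrable :: "nat \<Rightarrow> real set \<Rightarrow> ((nat \<Rightarrow> real) \<Rightarrow> real) \<Rightarrow> bool" where
  "locally_integrable n I f \<longleftrightarrow> f \<in> borel_measurable (cube n I) \<and>
     (\<forall>K. compact K \<and> K \<subseteq> cube_interior n I \<longrightarrow> set_integrable (cube n I) K f)"

definition is_weak_gradient ::
    "nat \<Rightarrow> real set \<Rightarrow> ((nat \<Rightarrow> real) \<Rightarrow> real) \<Rightarrow> ((nat \<Rightarrow> real) \<Rightarrow> nat \<Rightarrow> real) \<Rightarrow> bool" where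
  "is_weak_gradient n I u g \<longleftrightarrow> locally_integrable n I u \<and>
     (\<forall>i<n. locally_integrable n I (\<lambda>x. g x i) \<and>
        (\<forall>\<phi>. test_function n I \<phi> \<longrightarrow>
           (\<integral>x. u x * partial_deriv i \<phi> x \<partial>cube n I) = - (\<integral>x. g x i * \<phi> x \<partial>cube n I)))"

text \<open>The distributional gradient, when it is a function, is unique up to null sets;
  \<open>weak_gradient\<close> selects a representative.\<close>

definition weak_gradient ::
    "nat \<Rightarrow> real set \<Rightarrow> ((nat \<Rightarrow> real) \<Rightarrow> real) \<Rightarrow> (nat \<Rightarrow> real) \<Rightarrow> nat \<Rightarrow> real" where
  "weak_gradient n I u = (SOME g. is_weak_gradient n I u g)"

definition gradient_length ::
    "nat \<Rightarrow> real set \<Rightarrow> ((nat \<Rightarrow> real) \<Rightarrow> real) \<Rightarrow> (nat \<Rightarrow> real) \<Rightarrow> real" where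
  "gradient_length n I u x = L2_set (weak_gradient n I u x) {..<n}"

definition W1_space ::
    "nat \<Rightarrow> real set \<Rightarrow> (((nat \<Rightarrow> real) \<Rightarrow> ennreal) \<Rightarrow> ennreal) \<Rightarrow> ((nat \<Rightarrow> real) \<Rightarrow> real) set" where
  "W1_space n I \<rho> = {u \<in> fspace (cube n I) \<rho>.
     (\<exists>g. is_weak_gradient n I u g) \<and> gradient_length n I u \<in> fspace (cube n I) \<rho>}"

definition W1_norm ::
    "nat \<Rightarrow> real set \<Rightarrow> (((nat \<Rightarrow> real) \<Rightarrow> ennreal) \<Rightarrow> ennreal) \<Rightarrow> ((nat \<Rightarrow> real) \<Rightarrow> real) \<Rightarrow> ennreal" where
  "W1_norm n I \<rho> u = fnorm \<rho> u + fnorm \<rho> (gradient_length n I u)"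


section \<open>Mixed norm spaces\<close>

text \<open>Coordinates are numbered \<open>0, \<dots>, n - 1\<close>. The point of \<open>\<real>\<^sup>n\<close> whose coordinate \<open>k\<close> is \<open>t\<close> and
  whose remaining coordinates, in order, are those of \<open>y\<close>, a point of \<open>\<real>\<^sup>n\<^sup>-\<^sup>1\<close>.\<close>

definition insert_coord :: "nat \<Rightarrow> nat \<Rightarrow> (nat \<Rightarrow> real) \<Rightarrow> real \<Rightarrow> nat \<Rightarrow> real" where
  "insert_coord n k y t =
     (\<lambda>i\<in>{..<n}. if i < k then y i else if i = k then t else y (i - 1))"

definition \<psi> ::
    "nat \<Rightarrow> nat \<Rightarrow> ((real \<Rightarrow> ennreal) \<Rightarrow> ennreal) \<Rightarrow> ((nat \<Rightarrow> real) \<Rightarrow> real) \<Rightarrow> (nat \<Rightarrow> real) \<Rightarrow> ennreal" where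
  "\<psi> n k \<rho>Y f y = fnorm \<rho>Y (\<lambda>t. f (insert_coord n k y t))"

definition mixed_norm_k ::
    "nat \<Rightarrow> nat \<Rightarrow> (((nat \<Rightarrow> real) \<Rightarrow> ennreal) \<Rightarrow> ennreal) \<Rightarrow> ((real \<Rightarrow> ennreal) \<Rightarrow> ennreal) \<Rightarrow>
     ((nat \<Rightarrow> real) \<Rightarrow> real) \<Rightarrow> ennreal" where
  "mixed_norm_k n k \<rho>X \<rho>Y f = \<rho>X (\<psi> n k \<rho>Y f)"

definition mixed_space_k ::
    "nat \<Rightarrow> real set \<Rightarrow> nat \<Rightarrow> (((nat \<Rightarrow> real) \<Rightarrow> ennreal) \<Rightarrow> ennreal) \<Rightarrow>
     ((real \<Rightarrow> ennreal) \<Rightarrow> ennreal) \<Rightarrow> ((nat \<Rightarrow> real) \<Rightarrow> real) set" where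
  "mixed_space_k n I k \<rho>X \<rho>Y =
     {f \<in> borel_measurable (cube n I). mixed_norm_k n k \<rho>X \<rho>Y f < \<infinity>}"

definition mixed_space ::
    "nat \<Rightarrow> real set \<Rightarrow> (((nat \<Rightarrow> real) \<Rightarrow> ennreal) \<Rightarrow> ennreal) \<Rightarrow>
     ((real \<Rightarrow> ennreal) \<Rightarrow> ennreal) \<Rightarrow> ((nat \<Rightarrow> real) \<Rightarrow> real) set" where
  "mixed_space n I \<rho>X \<rho>Y = (\<Inter>k<n. mixed_space_k n I k \<rho>X \<rho>Y)"

definition mixed_norm ::
    "nat \<Rightarrow> (((nat \<Rightarrow> real) \<Rightarrow> ennreal) \<Rightarrow> ennreal) \<Rightarrow> ((real \<Rightarrow> ennreal) \<Rightarrow> ennreal) \<Rightarrow>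
     ((nat \<Rightarrow> real) \<Rightarrow> real) \<Rightarrow> ennreal" where
  "mixed_norm n \<rho>X \<rho>Y f = (\<Sum>k<n. mixed_norm_k n k \<rho>X \<rho>Y f)"

text \<open>The function norm of \<open>L\<^sup>\<infinity>(I)\<close>. \<^const>\<open>esssup\<close> is \<open>\<infinity>\<close> on nonmeasurable functions, which only
  occur as sections of a Lebesgue measurable function over a null set of base points.\<close>

definition Linf :: "real set \<Rightarrow> (real \<Rightarrow> ennreal) \<Rightarrow> ennreal" where
  "Linf I g = esssup (lebesgue_on I) g"

end

theory Submission
  imports Defs "HOL-Probability.Probability" "HOL-Real_Asymp.Real_Asymp"
begin

text \<open>Write \<open>p = 1 / n' = 1 - 1 / n\<close> and let \<open>hardy p f\<^sup>*\<close> be the function of \<open>t\<close> in the second statement.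

  The inequality implies the embedding because of an estimate which no longer mentions \<open>X\<close> and \<open>Z\<close>: for
  \<open>u\<close> in the Sobolev space, \<open>F = \<bar>u\<bar> + \<bar>\<nabla>u\<bar>\<close> and every \<open>k\<close>, the integral over \<open>(0, t)\<close> of the rearrangement of
  \<open>\<psi>\<^sub>k(u, L\<^sup>\<infinity>)\<close> is at most a constant times that of \<open>hardy p F\<^sup>*\<close>
  (\<open>nn_integral_rearrangement_line_esssup_le\<close>). By the principle of Hardy, Littlewood and Polya the norm of
  \<open>\<psi>\<^sub>k(u, L\<^sup>\<infinity>)\<close> in \<open>X\<close> is then bounded by the norm of \<open>hardy p F\<^sup>*\<close>, to which the inequality applies. The
  estimate rests on absolute continuity along lines (\<open>weak_derivative_primitive\<close>): on almost every line, the
  supremum of \<open>\<bar>u\<bar>\<close> exceeds a level \<open>s\<close> by at most the integral of \<open>F\<close> over the part of the line where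
  \<open>\<bar>u\<bar> > s\<close> (\<open>line_estimate\<close>). This is used twice. Integrated over the lines, it bounds the part of \<open>\<psi>\<^sub>k\<close>
  above the level \<open>s\<close> by an integral of \<open>F\<close> over \<open>{\<bar>u\<bar> > s}\<close>. Applied in all directions, it bounds the measures
  of the projections of the level sets of \<open>u\<close>, whence the Loomis--Whitney inequality bounds the measures of
  the level sets; iterated over dyadic measures, this gives a pointwise estimate of \<open>u\<^sup>*\<close> by \<open>F\<^sup>*\<close>
  (\<open>rearrangement_le_potential\<close>). With a value of \<open>u\<^sup>*\<close> as the level \<open>s\<close>, that estimate controls the part of
  \<open>\<psi>\<^sub>k\<close> below \<open>s\<close>.

  The embedding implies the inequality because of extremal functions. For \<open>f\<close> in \<open>Z\<close> let \<open>u(x)\<close> be the value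
  of \<open>hardy p f\<^sup>*\<close> at \<open>d(x)\<^sup>n\<^sup>-\<^sup>1\<close>, where \<open>d(x)\<close> is twice the distance of \<open>x\<close> from the centre of the cube in the
  maximum norm. The exponents match in such a way that \<open>\<bar>u\<bar>\<close> and \<open>\<bar>\<nabla>u\<bar>\<close> are at most multiples of \<open>f\<^sup>*(d(x)\<^sup>n)\<close>;
  this function is equimeasurable with \<open>f\<close>, since \<open>d\<^sup>n\<close> is uniformly distributed on the cube. On the line over
  a point \<open>y\<close> of the cube of one dimension less, \<open>d\<close> is constantly equal to \<open>d(y)\<close> on a set of positive measure.
  So \<open>\<psi>\<^sub>k(u, L\<^sup>\<infinity>)(y)\<close> is at least the value of \<open>hardy p f\<^sup>*\<close> at \<open>d(y)\<^sup>n\<^sup>-\<^sup>1\<close>, again a uniformly distributed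
  argument, and its norm in \<open>X\<close> is at least that of \<open>hardy p f\<^sup>*\<close>.\<close>

section \<open>Rearrangements on a probability space\<close>

lemma distribution_fun_antimono:
  assumes "f \<in> borel_measurable M" "s \<le> t"
  shows "distribution_fun M f t \<le> distribution_fun M f s"
  unfolding distribution_fun_def using assms by (intro emeasure_mono) auto

text \<open>The level sets \<open>{\<bar>f\<bar> > r}\<close> increase to \<open>{\<bar>f\<bar> > s}\<close> as \<open>r\<close> decreases to \<open>s\<close>.\<close>

lemma distribution_fun_right_continuous:
  assumes [measurable]: "f \<in> borel_measurable M" and c: "c < distribution_fun M f s"
  shows "\<exists>r>s. c < distribution_fun M f r"
proof -
  define A where "A k = {x \<in> space M. \<bar>f x\<bar> > s + 1 / Suc k}" for k :: nat
  have un: "(\<Union>k. A k) = {x \<in> space M. \<bar>f x\<bar> > s}"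
  proof (intro equalityI subsetI)
    fix x assume x: "x \<in> {x \<in> space M. \<bar>f x\<bar> > s}"
    then obtain k where "inverse (real (Suc k)) < \<bar>f x\<bar> - s"
      using reals_Archimedean[of "\<bar>f x\<bar> - s"] by auto
    then have "x \<in> A k" using x by (auto simp: A_def inverse_eq_divide)
    then show "x \<in> (\<Union>k. A k)" by auto
  next
    fix x assume "x \<in> (\<Union>k. A k)"
    then obtain k where "x \<in> space M" "s + 1 / Suc k < \<bar>f x\<bar>" by (auto simp: A_def)
    moreover have "s < s + 1 / real (Suc k)" by simp
    ultimately show "x \<in> {x \<in> space M. \<bar>f x\<bar> > s}"
      by (metis (no_types, lifting) less_trans mem_Collect_eq)
  qed
  have "incseq A"
  proof (rule incseq_SucI, rule subsetI)
    fix k x assume "x \<in> A k"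
    then have "x \<in> space M" "s + 1 / Suc k < \<bar>f x\<bar>" by (auto simp: A_def)
    moreover have "1 / real (Suc (Suc k)) \<le> 1 / Suc k" by (simp add: frac_le)
    ultimately show "x \<in> A (Suc k)" by (auto simp: A_def)
  qed
  moreover have "range A \<subseteq> sets M" unfolding A_def by auto
  ultimately have "(SUP k. emeasure M (A k)) = distribution_fun M f s"
    unfolding distribution_fun_def un[symmetric] by (intro SUP_emeasure_incseq) auto
  then obtain k where "c < emeasure M (A k)"
    using c by (metis less_SUP_iff)
  then show ?thesis
    by (intro exI[of _ "s + 1 / Suc k"]) (auto simp: A_def distribution_fun_def)
qed

context prob_space
begin

lemma distribution_fun_le_1: "distribution_fun M f t \<le> 1"
  unfolding distribution_fun_def using measure_le_1 by (simp add: emeasure_eq_measure)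

lemma distribution_fun_vanishes:
  assumes [measurable]: "f \<in> borel_measurable M" and "t > 0"
  shows "\<exists>s\<ge>0. distribution_fun M f s \<le> ennreal t"
proof -
  define A where "A k = {x \<in> space M. \<bar>f x\<bar> > real k}" for k :: nat
  have "(\<Inter>k. A k) = {}"
  proof -
    have "\<exists>k. \<not> \<bar>f x\<bar> > real k" for x
      using real_arch_simple[of "\<bar>f x\<bar>"] by (auto simp: not_less)
    then show ?thesis by (auto simp: A_def)
  qed
  moreover have "decseq A" by (auto simp: A_def decseq_def)
  moreover have "range A \<subseteq> sets M" unfolding A_def by auto
  ultimately have "(\<lambda>k. emeasure M (A k)) \<longlonglongrightarrow> 0"
    using Lim_emeasure_decseq[of A M] by (simp add: emeasure_eq_measure)
  then have "eventually (\<lambda>k. emeasure M (A k) < ennreal t) sequentially"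
    using \<open>t > 0\<close> by (intro order_tendstoD) auto
  then obtain k where "emeasure M (A k) < ennreal t" by (auto dest: eventually_happens)
  then show ?thesis
    by (intro exI[of _ "real k"]) (auto simp: A_def distribution_fun_def)
qed

text \<open>The rearrangement inverts the distribution function; all later facts about it come from
  this equivalence, in which the right continuity of the distribution function is essential.\<close>

lemma less_rearrangement_iff:
  assumes [measurable]: "f \<in> borel_measurable M" and "0 < t" "0 \<le> s"
  shows "s < rearrangement M f t \<longleftrightarrow> ennreal t < distribution_fun M f s"
proof -
  define S where "S = {s. s \<ge> 0 \<and> distribution_fun M f s \<le> ennreal t}"
  have ne: "S \<noteq> {}" using distribution_fun_vanishes[of f t] assms by (auto simp: S_def)
  have bdd: "bdd_below S" by (auto simp: S_def)
  have R: "rearrangement M f t = Inf S" by (simp add: rearrangement_def S_def)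
  show ?thesis
  proof
    assume "s < rearrangement M f t"
    then have "s \<notin> S" using R bdd cInf_lower[of s S] by auto
    then show "ennreal t < distribution_fun M f s" using assms by (auto simp: S_def)
  next
    assume "ennreal t < distribution_fun M f s"
    then obtain r where r: "r > s" "ennreal t < distribution_fun M f r"
      using distribution_fun_right_continuous assms(1) by blast
    have "r \<le> x" if "x \<in> S" for x
    proof (rule ccontr)
      assume "\<not> r \<le> x"
      then have "distribution_fun M f r \<le> distribution_fun M f x"
        by (intro distribution_fun_antimono) auto
      then show False using that r by (auto simp: S_def)
    qed
    then have "r \<le> Inf S" using ne by (intro cInf_greatest) auto
    then show "s < rearrangement M f t" using r R by simp
  qed
qed

lemma rearrangement_nonneg:
  assumes "f \<in> borel_measurable M" "0 < t"
  shows "0 \<le> rearrangement M f t"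
  unfolding rearrangement_def
  using distribution_fun_vanishes[OF assms] by (intro cInf_greatest) auto

lemma distribution_fun_rearrangement_le:
  assumes "f \<in> borel_measurable M" "0 < t"
  shows "distribution_fun M f (rearrangement M f t) \<le> ennreal t"
  using less_rearrangement_iff[OF assms rearrangement_nonneg[OF assms]] by (simp add: not_less)

lemma rearrangement_antimono:
  assumes "f \<in> borel_measurable M" "0 < t" "t \<le> u"
  shows "rearrangement M f u \<le> rearrangement M f t"
proof (rule ccontr)
  assume "\<not> rearrangement M f u \<le> rearrangement M f t"
  then have "ennreal u < distribution_fun M f (rearrangement M f t)"
    using less_rearrangement_iff[of f u "rearrangement M f t"] rearrangement_nonneg assms by simp
  also have "\<dots> \<le> ennreal t" using distribution_fun_rearrangement_le assms by simp
  finally show False using assms by (simp add: ennreal_less_iff)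
qed

lemma rearrangement_eq_0:
  assumes "f \<in> borel_measurable M" "1 \<le> t"
  shows "rearrangement M f t = 0"
proof (rule ccontr)
  assume "rearrangement M f t \<noteq> 0"
  then have "0 < rearrangement M f t" using rearrangement_nonneg[of f t] assms by simp
  then have "ennreal t < distribution_fun M f 0"
    using less_rearrangement_iff[of f t 0] assms by simp
  also have "\<dots> \<le> ennreal 1" using distribution_fun_le_1 by simp
  finally show False using assms by (simp add: ennreal_less_iff)
qed

lemma rearrangement_right_continuous:
  assumes f: "f \<in> borel_measurable M" and "0 < t" "s < rearrangement M f t"
  shows "\<exists>u>t. s < rearrangement M f u"
proof (cases "s < 0")
  case True
  then show ?thesis using rearrangement_nonneg[OF f, of "t + 1"] assms
    by (intro exI[of _ "t + 1"]) auto
next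
  case False
  then have "ennreal t < distribution_fun M f s"
    using less_rearrangement_iff assms by simp
  then obtain c where c: "ennreal t < c" "c < distribution_fun M f s" using dense by blast
  then have "c < \<top>" using distribution_fun_le_1[of f s] by (meson less_le_trans order_less_trans ennreal_one_less_top le_less_trans less_top)
  then obtain u where u: "c = ennreal u" "0 \<le> u" by (cases c) auto
  then show ?thesis using c less_rearrangement_iff[OF f, of u s] False assms
    by (intro exI[of _ u]) (auto simp: ennreal_less_iff)
qed

lemma borel_measurable_rearrangement:
  assumes "f \<in> borel_measurable M"
  shows "rearrangement M f \<in> borel_measurable (restrict_space borel {0<..})"
proof -
  have "(\<lambda>t. - rearrangement M f t) \<in> borel_measurable (restrict_space borel {0<..})"
    by (rule borel_measurable_mono_on_fnc)
       (auto intro!: mono_onI simp: rearrangement_antimono[OF assms])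
  then show ?thesis by simp
qed

end

lemma prob_space_unit_measure: "prob_space unit_measure"
  by (rule prob_spaceI) (simp add: emeasure_restrict_space)

lemma nn_integral_unit_measure:
  "(\<integral>\<^sup>+t. h t \<partial>unit_measure) = (\<integral>\<^sup>+t\<in>{0<..<1}. h t \<partial>lborel)"
  by (simp add: nn_integral_restrict_space nn_integral_completion)

lemma borel_measurable_unit_measureI:
  assumes "h \<in> borel_measurable (restrict_space borel {0<..<1})"
  shows "h \<in> borel_measurable unit_measure"
proof -
  have "id \<in> measurable unit_measure (restrict_space borel {0<..<1})"
    by (intro measurable_restrict_space2 measurable_restrict_space1) (auto simp: measurable_completion)
  from measurable_comp[OF this assms] show ?thesis by (simp add: comp_def)
qed

text \<open>Equimeasurable functions on two probability spaces have the same law, so that integrals of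
  functions of them agree.\<close>

lemma nn_integral_equimeasurable:
  assumes "prob_space M" "prob_space M'"
    and [measurable]: "f \<in> borel_measurable M" "g \<in> borel_measurable M'"
    and eq: "\<And>t. t \<ge> 0 \<Longrightarrow> distribution_fun M f t = distribution_fun M' g t"
    and [measurable]: "\<phi> \<in> borel_measurable borel"
  shows "(\<integral>\<^sup>+x. \<phi> \<bar>f x\<bar> \<partial>M) = (\<integral>\<^sup>+x. \<phi> \<bar>g x\<bar> \<partial>M')"
proof -
  interpret M: prob_space M by fact
  interpret M': prob_space M' by fact
  define D D' where "D = distr M borel (\<lambda>x. \<bar>f x\<bar>)" and "D' = distr M' borel (\<lambda>x. \<bar>g x\<bar>)"
  have D: "real_distribution D" "real_distribution D'"
    unfolding D_def D'_def by (auto intro!: M.real_distribution_distr M'.real_distribution_distr)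
  have "cdf D x = cdf D' x" for x
  proof (cases "x < 0")
    case True
    have "(\<lambda>a. \<bar>f a\<bar>) -` {..x} \<inter> space M = {}" "(\<lambda>a. \<bar>g a\<bar>) -` {..x} \<inter> space M' = {}"
      using True by auto
    then show ?thesis by (simp add: cdf_def D_def D'_def measure_distr)
  next
    case False
    have "(\<lambda>a. \<bar>f a\<bar>) -` {..x} \<inter> space M = space M - {a \<in> space M. \<bar>f a\<bar> > x}"
      "(\<lambda>a. \<bar>g a\<bar>) -` {..x} \<inter> space M' = space M' - {a \<in> space M'. \<bar>g a\<bar> > x}"
      by auto
    moreover have "measure M {a \<in> space M. \<bar>f a\<bar> > x} = measure M' {a \<in> space M'. \<bar>g a\<bar> > x}"
      using eq[of x] False by (simp add: distribution_fun_def measure_def)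
    ultimately show ?thesis
      by (simp add: cdf_def D_def D'_def measure_distr M.prob_compl M'.prob_compl)
  qed
  then have "D = D'" using cdf_unique[OF D] by blast
  then have "(\<integral>\<^sup>+y. \<phi> y \<partial>D) = (\<integral>\<^sup>+y. \<phi> y \<partial>D')" by simp
  then show ?thesis by (simp add: D_def D'_def nn_integral_distr)
qed

context prob_space
begin

lemma measurable_rearrangement_borel [measurable]:
  assumes "f \<in> borel_measurable M"
  shows "(\<lambda>t. rearrangement M f t * indicator {0<..} t) \<in> borel_measurable borel"
  using borel_measurable_rearrangement[OF assms]
  by (subst (asm) borel_measurable_restrict_space_iff) (auto simp: mult.commute)

lemma measurable_rearrangement_unit:
  assumes "f \<in> borel_measurable M"
  shows "rearrangement M f \<in> borel_measurable unit_measure"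
proof (rule borel_measurable_unit_measureI)
  have "(\<lambda>t. rearrangement M f t * indicator {0<..} t) \<in> borel_measurable (restrict_space borel {0<..<1})"
    using measurable_rearrangement_borel[OF assms] by (rule measurable_restrict_space1)
  then show "rearrangement M f \<in> borel_measurable (restrict_space borel {0<..<1})"
    by (rule measurable_cong[THEN iffD1, rotated]) (auto simp: space_restrict_space)
qed

lemma rearrangement_equimeasurable:
  assumes f: "f \<in> borel_measurable M" and "0 \<le> s"
  shows "distribution_fun unit_measure (rearrangement M f) s = distribution_fun M f s"
proof -
  obtain l where l: "distribution_fun M f s = ennreal l" "0 \<le> l" "l \<le> 1"
    using distribution_fun_le_1[of f s] by (cases "distribution_fun M f s") (auto simp: ennreal_le_1 top_unique)
  have "{t \<in> space unit_measure. \<bar>rearrangement M f t\<bar> > s} = {0<..<l}"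
    using less_rearrangement_iff[OF f _ \<open>0 \<le> s\<close>] rearrangement_nonneg[OF f] l
    by (auto simp: space_restrict_space ennreal_less_iff)
  moreover have "emeasure unit_measure {0<..<l} = ennreal l"
    using l by (subst emeasure_restrict_space) auto
  ultimately show ?thesis using l by (simp add: distribution_fun_def)
qed

lemma nn_integral_rearrangement:
  assumes f: "f \<in> borel_measurable M" and \<phi>: "\<phi> \<in> borel_measurable borel"
  shows "(\<integral>\<^sup>+x. \<phi> \<bar>f x\<bar> \<partial>M) = (\<integral>\<^sup>+t\<in>{0<..<1}. \<phi> (rearrangement M f t) \<partial>lborel)"
proof -
  have "(\<integral>\<^sup>+x. \<phi> \<bar>f x\<bar> \<partial>M) = (\<integral>\<^sup>+t. \<phi> \<bar>rearrangement M f t\<bar> \<partial>unit_measure)"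
    by (rule nn_integral_equimeasurable[OF prob_space_axioms prob_space_unit_measure f
          measurable_rearrangement_unit[OF f] _ \<phi>])
       (simp add: rearrangement_equimeasurable f)
  also have "\<dots> = (\<integral>\<^sup>+t\<in>{0<..<1}. \<phi> (rearrangement M f t) \<partial>lborel)"
    unfolding nn_integral_unit_measure
    by (rule nn_integral_cong) (auto simp: indicator_def rearrangement_nonneg[OF f])
  finally show ?thesis .
qed

text \<open>The Hardy--Littlewood inequality for a set. At the level \<open>s = f\<^sup>*(v)\<close> one has
  \<open>\<bar>f\<bar> \<le> s + (\<bar>f\<bar> - s)\<^sub>+\<close>, with equality of integrals for the rearrangement on \<open>(0, v)\<close>.\<close>

lemma nn_integral_le_rearrangement:
  assumes [measurable]: "f \<in> borel_measurable M" "E \<in> sets M"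
    and v: "emeasure M E \<le> ennreal v" "0 < v" "v \<le> 1"
  shows "(\<integral>\<^sup>+x\<in>E. ennreal \<bar>f x\<bar> \<partial>M) \<le> (\<integral>\<^sup>+t\<in>{0<..<v}. ennreal (rearrangement M f t) \<partial>lborel)"
proof -
  define R where "R = (\<lambda>t. rearrangement M f t * indicator {0<..} t)"
  have [measurable]: "R \<in> borel_measurable borel" unfolding R_def by measurable
  have R: "rearrangement M f t = R t" if "t > 0" for t using that by (simp add: R_def)
  define s where "s = R v"
  have s: "0 \<le> s" using rearrangement_nonneg[of f v] v by (simp add: s_def R_def)
  have "(\<integral>\<^sup>+x\<in>E. ennreal \<bar>f x\<bar> \<partial>M)
      \<le> (\<integral>\<^sup>+x. ennreal s * indicator E x + ennreal (max 0 (\<bar>f x\<bar> - s)) \<partial>M)"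
    using s by (intro nn_integral_mono) (auto simp: indicator_def ennreal_plus[symmetric] max_def
          intro!: ennreal_leI simp del: ennreal_plus)
  also have "\<dots> = ennreal s * emeasure M E + (\<integral>\<^sup>+x. ennreal (max 0 (\<bar>f x\<bar> - s)) \<partial>M)"
    by (simp add: nn_integral_add nn_integral_cmult_indicator)
  also have "\<dots> \<le> ennreal s * ennreal v + (\<integral>\<^sup>+t\<in>{0<..<1}. ennreal (max 0 (R t - s)) \<partial>lborel)"
  proof (intro add_mono mult_left_mono)
    have "(\<integral>\<^sup>+x. ennreal (max 0 (\<bar>f x\<bar> - s)) \<partial>M)
        = (\<integral>\<^sup>+t\<in>{0<..<1}. ennreal (max 0 (rearrangement M f t - s)) \<partial>lborel)"
      by (rule nn_integral_rearrangement) auto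
    also have "\<dots> = (\<integral>\<^sup>+t\<in>{0<..<1}. ennreal (max 0 (R t - s)) \<partial>lborel)"
      by (rule nn_integral_cong) (auto simp: R indicator_def)
    finally show "(\<integral>\<^sup>+x. ennreal (max 0 (\<bar>f x\<bar> - s)) \<partial>M) \<le> \<dots>" by simp
  qed (use v in auto)
  also have "ennreal s * ennreal v = (\<integral>\<^sup>+t. ennreal s * indicator {0<..<v} t \<partial>lborel)"
    using v by (simp add: nn_integral_cmult_indicator)
  also have "(\<integral>\<^sup>+t\<in>{0<..<1}. ennreal (max 0 (R t - s)) \<partial>lborel)
      = (\<integral>\<^sup>+t. ennreal (R t - s) * indicator {0<..<v} t \<partial>lborel)"
  proof (rule nn_integral_cong)
    fix t :: real
    have "R t \<le> s" if "v \<le> t"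
      using that rearrangement_antimono[of f v t] v by (simp add: s_def R_def)
    moreover have "s \<le> R t" if "0 < t" "t \<le> v"
      using that rearrangement_antimono[of f t v] v by (simp add: s_def R_def)
    ultimately show "ennreal (max 0 (R t - s)) * indicator {0<..<1} t = ennreal (R t - s) * indicator {0<..<v} t"
      using v by (cases "v \<le> t") (auto simp: indicator_def max_def)
  qed
  also have "(\<integral>\<^sup>+t. ennreal s * indicator {0<..<v} t \<partial>lborel) + \<dots>
     = (\<integral>\<^sup>+t. ennreal s * indicator {0<..<v} t + ennreal (R t - s) * indicator {0<..<v} t \<partial>lborel)"
    by (rule nn_integral_add[symmetric]) auto
  also have "\<dots> = (\<integral>\<^sup>+t\<in>{0<..<v}. ennreal (rearrangement M f t) \<partial>lborel)"
  proof (rule nn_integral_cong)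
    fix t :: real
    have "s \<le> R t" if "0 < t" "t \<le> v"
      using that rearrangement_antimono[of f t v] v by (simp add: s_def R_def)
    then show "ennreal s * indicator {0<..<v} t + ennreal (R t - s) * indicator {0<..<v} t
      = ennreal (rearrangement M f t) * indicator {0<..<v} t"
      using s by (auto simp: indicator_def R ennreal_plus[symmetric] simp del: ennreal_plus)
  qed
  finally show ?thesis .
qed

end

section \<open>Function norms\<close>

lemma
  assumes "ri_norm M \<rho>"
  shows ri_norm_add: "f \<in> borel_measurable M \<Longrightarrow> g \<in> borel_measurable M \<Longrightarrow> \<rho> (\<lambda>x. f x + g x) \<le> \<rho> f + \<rho> g"
    and ri_norm_cmult: "f \<in> borel_measurable M \<Longrightarrow> a \<ge> 0 \<Longrightarrow> \<rho> (\<lambda>x. ennreal a * f x) = ennreal a * \<rho> f"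
    and ri_norm_mono_AE: "f \<in> borel_measurable M \<Longrightarrow> g \<in> borel_measurable M \<Longrightarrow>
      (AE x in M. f x \<le> g x) \<Longrightarrow> \<rho> f \<le> \<rho> g"
    and ri_norm_Fatou: "(\<And>j. F j \<in> borel_measurable M) \<Longrightarrow> h \<in> borel_measurable M \<Longrightarrow>
      (AE x in M. incseq (\<lambda>j. F j x) \<and> (\<lambda>j. F j x) \<longlonglongrightarrow> h x) \<Longrightarrow> (\<lambda>j. \<rho> (F j)) \<longlonglongrightarrow> \<rho> h"
    and ri_norm_L1: "\<exists>C>0. \<forall>f \<in> borel_measurable M. (\<integral>\<^sup>+x. f x \<partial>M) \<le> ennreal C * \<rho> f"
    and ri_norm_equimeasurable: "u \<in> borel_measurable M \<Longrightarrow> v \<in> borel_measurable M \<Longrightarrow>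
      (\<And>t. t \<ge> 0 \<Longrightarrow> distribution_fun M u t = distribution_fun M v t) \<Longrightarrow> fnorm \<rho> u = fnorm \<rho> v"
proof -
  note B = assms[unfolded ri_norm_def banach_function_norm_def, THEN conjunct1, THEN conjunct2]
  show "f \<in> borel_measurable M \<Longrightarrow> g \<in> borel_measurable M \<Longrightarrow> \<rho> (\<lambda>x. f x + g x) \<le> \<rho> f + \<rho> g"
    using B[THEN conjunct1] by blast
  show "f \<in> borel_measurable M \<Longrightarrow> a \<ge> 0 \<Longrightarrow> \<rho> (\<lambda>x. ennreal a * f x) = ennreal a * \<rho> f"
    using B[THEN conjunct2, THEN conjunct1] by blast
  show "f \<in> borel_measurable M \<Longrightarrow> g \<in> borel_measurable M \<Longrightarrow>
      (AE x in M. f x \<le> g x) \<Longrightarrow> \<rho> f \<le> \<rho> g"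
    using B[THEN conjunct2, THEN conjunct2, THEN conjunct1] by blast
  show "(\<And>j. F j \<in> borel_measurable M) \<Longrightarrow> h \<in> borel_measurable M \<Longrightarrow>
      (AE x in M. incseq (\<lambda>j. F j x) \<and> (\<lambda>j. F j x) \<longlonglongrightarrow> h x) \<Longrightarrow> (\<lambda>j. \<rho> (F j)) \<longlonglongrightarrow> \<rho> h"
    using B[THEN conjunct2, THEN conjunct2, THEN conjunct2, THEN conjunct1, rule_format, of F h] by blast
  show "\<exists>C>0. \<forall>f \<in> borel_measurable M. (\<integral>\<^sup>+x. f x \<partial>M) \<le> ennreal C * \<rho> f"
    using B[THEN conjunct2, THEN conjunct2, THEN conjunct2, THEN conjunct2, THEN conjunct2] by blast
  show "u \<in> borel_measurable M \<Longrightarrow> v \<in> borel_measurable M \<Longrightarrow>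
      (\<And>t. t \<ge> 0 \<Longrightarrow> distribution_fun M u t = distribution_fun M v t) \<Longrightarrow> fnorm \<rho> u = fnorm \<rho> v"
    using assms[unfolded ri_norm_def, THEN conjunct2] by blast
qed

lemma ri_norm_cong_AE:
  assumes "ri_norm M \<rho>" "f \<in> borel_measurable M" "g \<in> borel_measurable M" "AE x in M. f x = g x"
  shows "\<rho> f = \<rho> g"
  by (rule antisym; rule ri_norm_mono_AE[OF assms(1)]) (use assms in \<open>auto elim: eventually_mono\<close>)

section \<open>The Hardy--Littlewood--Polya principle\<close>

text \<open>Weak majorization of finite sequences is reduced to transfers of mass from a position to a
  position holding less. If \<open>j\<close> is the first index with \<open>x\<^sub>j > y\<^sub>j\<close>, the partial sums provide some \<open>i < j\<close>
  with \<open>y\<^sub>i > x\<^sub>i\<close>; moving the largest admissible amount from \<open>y\<^sub>i\<close> to \<open>y\<^sub>j\<close> makes \<open>y\<close> agree with \<open>x\<close> at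
  one more index. Since the partial sums of \<open>y - x\<close> increase up to \<open>j\<close>, the hypothesis survives, and only
  \<open>x\<close> has to be monotone.\<close>

lemma weak_majorization:
  fixes \<nu> :: "(nat \<Rightarrow> real) \<Rightarrow> ennreal"
  assumes mono: "\<And>x y. (\<forall>l<N. 0 \<le> x l \<and> x l \<le> y l) \<Longrightarrow> \<nu> x \<le> \<nu> y"
    and transfer: "\<And>y i j \<delta>. i < N \<Longrightarrow> j < N \<Longrightarrow> i \<noteq> j \<Longrightarrow> 0 \<le> \<delta> \<Longrightarrow> \<delta> \<le> y i - y j \<Longrightarrow>
      (\<forall>l<N. 0 \<le> y l) \<Longrightarrow> \<nu> (y(i := y i - \<delta>, j := y j + \<delta>)) \<le> \<nu> y"
    and x: "\<And>i j. i \<le> j \<Longrightarrow> j < N \<Longrightarrow> x j \<le> x i" "\<And>j. j < N \<Longrightarrow> 0 \<le> x j"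
  shows "(\<forall>l<N. 0 \<le> y l) \<Longrightarrow> (\<forall>k\<le>N. (\<Sum>l<k. x l) \<le> (\<Sum>l<k. y l)) \<Longrightarrow> \<nu> x \<le> \<nu> y"
proof (induction "card {l. l < N \<and> x l \<noteq> y l}" arbitrary: y rule: less_induct)
  case less
  show ?case
  proof (cases "\<forall>l<N. x l \<le> y l")
    case True
    then show ?thesis using x(2) by (intro mono) auto
  next
    case False
    define j where "j = (LEAST j. j < N \<and> y j < x j)"
    have j: "j < N" "y j < x j" using False LeastI_ex[of "\<lambda>j. j < N \<and> y j < x j"]
      by (auto simp: j_def not_le)
    have below: "x l \<le> y l" if "l < j" for l
      using not_less_Least[of l "\<lambda>j. j < N \<and> y j < x j"] that j by (auto simp: j_def not_less)
    have "\<exists>i<j. x i < y i"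
    proof (rule ccontr)
      assume "\<not> (\<exists>i<j. x i < y i)"
      then have "(\<Sum>l<j. y l) \<le> (\<Sum>l<j. x l)" by (intro sum_mono) (metis lessThan_iff not_le)
      then show False using less.prems(2)[rule_format, of "Suc j"] j by simp
    qed
    then obtain i where i: "i < j" "x i < y i" by blast
    define \<delta> where "\<delta> = min (y i - x i) (x j - y j)"
    define y' where "y' = y(i := y i - \<delta>, j := y j + \<delta>)"
    have "x j \<le> x i" using x(1)[of i j] i j by auto
    have \<delta>: "0 < \<delta>" "\<delta> \<le> y i - y j" using i j \<open>x j \<le> x i\<close> by (auto simp: \<delta>_def)
    have "\<nu> y' \<le> \<nu> y" unfolding y'_def using i j \<delta> less.prems by (intro transfer) auto
    moreover have "\<nu> x \<le> \<nu> y'"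
    proof (rule less.hyps)
      have "{l. l < N \<and> x l \<noteq> y' l} \<subseteq> {l. l < N \<and> x l \<noteq> y l}"
        using i j by (auto simp: y'_def split: if_splits)
      moreover have "\<exists>l\<in>{i, j}. x l = y' l" using i by (auto simp: y'_def \<delta>_def min_def)
      ultimately have "{l. l < N \<and> x l \<noteq> y' l} \<subset> {l. l < N \<and> x l \<noteq> y l}" using i j by auto
      then show "card {l. l < N \<and> x l \<noteq> y' l} < card {l. l < N \<and> x l \<noteq> y l}"
        by (intro psubset_card_mono) auto
      show "\<forall>l<N. 0 \<le> y' l"
        using less.prems(1) x(2)[of i] x(2)[of j] i j \<delta>
        by (auto simp: y'_def \<delta>_def intro: order_trans[of 0 "x i"])
      show "\<forall>k\<le>N. (\<Sum>l<k. x l) \<le> (\<Sum>l<k. y' l)"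
      proof (intro allI impI)
        fix k assume "k \<le> N"
        have y': "y' l = y l + (if l = j then \<delta> else 0) - (if l = i then \<delta> else 0)" for l
          using i by (auto simp: y'_def)
        have S: "(\<Sum>l<k. y' l) = (\<Sum>l<k. y l) + (if j < k then \<delta> else 0) - (if i < k then \<delta> else 0)"
          by (simp add: y' sum.distrib sum_subtractf)
        show "(\<Sum>l<k. x l) \<le> (\<Sum>l<k. y' l)"
        proof (cases "i < k \<and> k \<le> j")
          case True
          have "\<delta> \<le> (\<Sum>l\<in>{i}. y l - x l)" by (simp add: \<delta>_def)
          also have "\<dots> \<le> (\<Sum>l<k. y l - x l)"
            using True below by (intro sum_mono2) auto
          finally show ?thesis using S True by (simp add: sum_subtractf)
        next
          case False
          then show ?thesis using S less.prems(2) \<open>k \<le> N\<close> i by auto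
        qed
      qed
    qed
    ultimately show ?thesis by simp
  qed
qed

definition cell :: "nat \<Rightarrow> real \<Rightarrow> nat" where
  "cell N t = nat \<lfloor>real N * t\<rfloor>"

lemma cell_eq_iff:
  assumes "N > 0" "t \<ge> 0"
  shows "cell N t = j \<longleftrightarrow> real j / N \<le> t \<and> t < (real j + 1) / N"
proof -
  have "cell N t = j \<longleftrightarrow> \<lfloor>real N * t\<rfloor> = int j"
    using assms by (auto simp: cell_def)
  also have "\<dots> \<longleftrightarrow> real j \<le> real N * t \<and> real N * t < real j + 1"
    by (auto simp: floor_eq_iff)
  finally show ?thesis using assms by (simp add: field_simps)
qed

lemma cell_less: "N > 0 \<Longrightarrow> 0 \<le> t \<Longrightarrow> t < 1 \<Longrightarrow> cell N t < N"
  by (simp add: cell_def nat_less_iff floor_less_iff)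

lemma cell_bounds:
  assumes "N > 0" "t \<ge> 0"
  shows "real (cell N t) / N \<le> t" "t < (real (cell N t) + 1) / N"
  using cell_eq_iff[OF assms, of "cell N t"] by auto

lemma cell_div:
  assumes "L > 0"
  shows "cell (N * L) t div L = cell N t"
proof -
  have "\<lfloor>real N * t\<rfloor> = \<lfloor>real (N * L) * t / of_int (int L)\<rfloor>" using assms by simp
  also have "\<dots> = \<lfloor>real (N * L) * t\<rfloor> div int L" by (rule floor_divide_real_eq_div) simp
  finally show ?thesis unfolding cell_def by (simp add: nat_div_distrib')
qed

lemma measurable_cell [measurable]: "cell N \<in> measurable borel (count_space UNIV)"
  unfolding cell_def by measurable

lemma nn_integral_cell:
  fixes x :: "nat \<Rightarrow> ennreal"
  assumes "N > 0"
  shows "(\<integral>\<^sup>+t\<in>{0<..<real k / N}. x (cell N t) \<partial>lborel) = ennreal (1 / N) * (\<Sum>j<k. x j)"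
proof (induction k)
  case (Suc k)
  let ?a = "real k / N" and ?b = "real (Suc k) / N"
  have ab: "0 \<le> ?a" "?a < ?b" using assms by (auto simp: divide_strict_right_mono)
  have "(\<integral>\<^sup>+t\<in>{0<..<?b}. x (cell N t) \<partial>lborel)
      = (\<integral>\<^sup>+t. x (cell N t) * indicator {0<..<?a} t + x k * indicator {?a<..<?b} t \<partial>lborel)"
  proof (rule nn_integral_cong_AE)
    show "AE t in lborel. x (cell N t) * indicator {0<..<?b} t
      = x (cell N t) * indicator {0<..<?a} t + x k * indicator {?a<..<?b} t"
      using AE_lborel_singleton[of ?a]
    proof eventually_elim
      case (elim t)
      have "cell N t = k" if "?a < t" "t < ?b"
        using that ab cell_eq_iff[OF assms, of t k] order_trans[OF ab(1), of t]
        by (auto simp: add.commute)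
      then show ?case using elim ab le_less_trans[OF ab(1), of t] by (auto simp: indicator_def)
    qed
  qed
  also have "\<dots> = ennreal (1 / N) * (\<Sum>j<k. x j) + x k * ennreal (?b - ?a)"
    using ab by (subst nn_integral_add) (auto simp: Suc nn_integral_cmult_indicator)
  also have "?b - ?a = 1 / N" by (simp add: add_divide_distrib)
  finally show ?case by (simp add: distrib_left mult.commute)
qed simp

lemma fnorm_step_permute:
  assumes \<sigma>: "ri_norm unit_measure \<sigma>" and "N > 0" and "bij_betw p {..<N} {..<N}"
  shows "fnorm \<sigma> (\<lambda>t. x (p (cell N t))) = fnorm \<sigma> (\<lambda>t. x (cell N t))"
proof -
  have D: "distribution_fun unit_measure (\<lambda>t. z (cell N t)) s
      = ennreal (1 / N) * (\<Sum>j<N. indicator {y. \<bar>y\<bar> > s} (z j))" for z s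
  proof -
    have "distribution_fun unit_measure (\<lambda>t. z (cell N t)) s
      = (\<integral>\<^sup>+t. indicator {y. \<bar>y\<bar> > s} (z (cell N t)) \<partial>unit_measure)"
    proof -
      have "(\<lambda>t. z (cell N t)) \<in> borel_measurable unit_measure"
        by (intro measurable_restrict_space1) (auto intro: measurable_completion)
      then have "{t \<in> space unit_measure. \<bar>z (cell N t)\<bar> > s} \<in> sets unit_measure" by measurable
      from nn_integral_indicator[OF this] show ?thesis
        unfolding distribution_fun_def
        by (subst (asm) nn_integral_cong[of _ _ "\<lambda>t. indicator {y. \<bar>y\<bar> > s} (z (cell N t))"])
           (auto simp: indicator_def)
    qed
    also have "\<dots> = ennreal (1 / N) * (\<Sum>j<N. indicator {y. \<bar>y\<bar> > s} (z j))"
      using nn_integral_cell[OF \<open>N > 0\<close>, where k = N and x = "\<lambda>j. indicator {y. \<bar>y\<bar> > s} (z j)"] \<open>N > 0\<close>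
      by (simp add: nn_integral_unit_measure)
    finally show ?thesis .
  qed
  have "distribution_fun unit_measure (\<lambda>t. x (p (cell N t))) s
      = distribution_fun unit_measure (\<lambda>t. x (cell N t)) s" for s
    unfolding D[of x] D[of "\<lambda>j. x (p j)"]
    by (subst sum.reindex_bij_betw[OF assms(3), symmetric]) simp
  moreover have "(\<lambda>t. z (cell N t)) \<in> borel_measurable unit_measure" for z :: "nat \<Rightarrow> real"
    by (intro measurable_restrict_space1) (auto intro: measurable_completion)
  ultimately show ?thesis by (intro ri_norm_equimeasurable[OF \<sigma>])
qed

lemma measurable_step:
  "(\<lambda>t. z (cell N t)) \<in> borel_measurable (unit_measure :: real measure)" for z :: "nat \<Rightarrow> real"
  by (intro measurable_restrict_space1) (auto intro: measurable_completion)

text \<open>A transfer between two positions is a convex combination of the identity and a transposition,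
  so it decreases every rearrangement invariant norm of step functions; hence so does passing to a
  weakly majorized sequence.\<close>

lemma fnorm_step_weak_majorization:
  assumes \<sigma>: "ri_norm unit_measure \<sigma>" and N: "N > 0"
    and x: "\<And>i j. i \<le> j \<Longrightarrow> j < N \<Longrightarrow> x j \<le> x i" "\<And>j. j < N \<Longrightarrow> 0 \<le> x j"
    and y: "\<forall>j<N. 0 \<le> y j" and le: "\<forall>k\<le>N. (\<Sum>l<k. x l) \<le> (\<Sum>l<k. y l)"
  shows "fnorm \<sigma> (\<lambda>t. x (cell N t)) \<le> fnorm \<sigma> (\<lambda>t. y (cell N t))"
proof (rule weak_majorization[where \<nu> = "\<lambda>x. fnorm \<sigma> (\<lambda>t. x (cell N t))", OF _ _ x y le])
  have in_range: "AE t in unit_measure. cell N t < N"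
    using N by (intro AE_I2) (auto simp: cell_less)
  fix u v :: "nat \<Rightarrow> real" assume uv: "\<forall>l<N. 0 \<le> u l \<and> u l \<le> v l"
  show "fnorm \<sigma> (\<lambda>t. u (cell N t)) \<le> fnorm \<sigma> (\<lambda>t. v (cell N t))"
    unfolding fnorm_def
  proof (rule ri_norm_mono_AE[OF \<sigma>])
    show "AE t in unit_measure. ennreal \<bar>u (cell N t)\<bar> \<le> ennreal \<bar>v (cell N t)\<bar>"
      using in_range by eventually_elim (use uv in \<open>force intro!: ennreal_leI\<close>)
  qed (use measurable_step[of u] measurable_step[of v] in measurable)
next
  fix z :: "nat \<Rightarrow> real" and i j and \<delta> :: real
  assume ij: "i < N" "j < N" "i \<noteq> j" and \<delta>: "0 \<le> \<delta>" "\<delta> \<le> z i - z j" and z: "\<forall>l<N. 0 \<le> z l"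
  show "fnorm \<sigma> (\<lambda>t. (z(i := z i - \<delta>, j := z j + \<delta>)) (cell N t)) \<le> fnorm \<sigma> (\<lambda>t. z (cell N t))"
  proof (cases "\<delta> = 0")
    case False
    define c where "c = \<delta> / (z i - z j)"
    define p where "p = Transposition.transpose i j"
    have c: "0 \<le> c" "c \<le> 1" "c * (z i - z j) = \<delta>" using \<delta> False by (auto simp: c_def)
    have eq: "(z(i := z i - \<delta>, j := z j + \<delta>)) l = (1 - c) * z l + c * z (p l)" for l
      using c(3) ij by (auto simp: p_def Transposition.transpose_def algebra_simps)
    have p: "bij_betw p {..<N} {..<N}"
      using ij by (auto simp: p_def intro!: bij_betw_transpose_iff)
    let ?a = "\<lambda>t. ennreal \<bar>z (cell N t)\<bar>" and ?b = "\<lambda>t. ennreal \<bar>z (p (cell N t))\<bar>"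
    have [measurable]: "?a \<in> borel_measurable unit_measure" "?b \<in> borel_measurable unit_measure"
      "(\<lambda>t. (z(i := z i - \<delta>, j := z j + \<delta>)) (cell N t)) \<in> borel_measurable unit_measure"
      using measurable_step[of z] measurable_step[of "\<lambda>l. z (p l)"]
        measurable_step[of "z(i := z i - \<delta>, j := z j + \<delta>)"] by measurable
    have "fnorm \<sigma> (\<lambda>t. (z(i := z i - \<delta>, j := z j + \<delta>)) (cell N t))
        \<le> \<sigma> (\<lambda>t. ennreal (1 - c) * ?a t + ennreal c * ?b t)"
      unfolding fnorm_def
    proof (rule ri_norm_mono_AE[OF \<sigma>], measurable, rule AE_I2)
      fix t
      have "\<bar>(z(i := z i - \<delta>, j := z j + \<delta>)) (cell N t)\<bar>
          \<le> (1 - c) * \<bar>z (cell N t)\<bar> + c * \<bar>z (p (cell N t))\<bar>"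
        unfolding eq using c by (intro order_trans[OF abs_triangle_ineq]) (auto simp: abs_mult)
      then show "ennreal \<bar>(z(i := z i - \<delta>, j := z j + \<delta>)) (cell N t)\<bar>
          \<le> ennreal (1 - c) * ?a t + ennreal c * ?b t"
        using c by (simp add: ennreal_mult[symmetric] ennreal_plus[symmetric] ennreal_leI del: ennreal_plus)
    qed
    also have "\<dots> \<le> \<sigma> (\<lambda>t. ennreal (1 - c) * ?a t) + \<sigma> (\<lambda>t. ennreal c * ?b t)"
      by (rule ri_norm_add[OF \<sigma>]) measurable
    also have "\<dots> = ennreal (1 - c) * fnorm \<sigma> (\<lambda>t. z (cell N t)) + ennreal c * fnorm \<sigma> (\<lambda>t. z (p (cell N t)))"
      unfolding fnorm_def using c by (intro arg_cong2[of _ _ _ _ "(+)"] ri_norm_cmult[OF \<sigma>]) (measurable; simp)+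
    also have "\<dots> = (ennreal (1 - c) + ennreal c) * fnorm \<sigma> (\<lambda>t. z (cell N t))"
      by (simp add: fnorm_step_permute[OF \<sigma> N p] distrib_right)
    also have "\<dots> = fnorm \<sigma> (\<lambda>t. z (cell N t))"
      using c by (simp add: ennreal_plus[symmetric] del: ennreal_plus)
    finally show ?thesis .
  qed (simp add: fun_upd_idem)
qed

text \<open>A step function below a decreasing function on \<open>(0, 1)\<close>, taking the value at the right end of each of
  \<open>N\<close> equal steps; it vanishes on the last step, whose right end \<open>1\<close> is not in the domain.\<close>

definition lower_step :: "nat \<Rightarrow> (real \<Rightarrow> real) \<Rightarrow> nat \<Rightarrow> real" where
  "lower_step N H j = (if Suc j < N then H (Suc j / N) else 0)"

locale right_continuous_decreasing =
  fixes H :: "real \<Rightarrow> real"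
  assumes nonneg: "\<And>t. 0 < t \<Longrightarrow> t < 1 \<Longrightarrow> 0 \<le> H t"
    and decreasing: "\<And>s t. 0 < s \<Longrightarrow> s \<le> t \<Longrightarrow> t < 1 \<Longrightarrow> H t \<le> H s"
    and right_continuous: "\<And>s t. 0 < t \<Longrightarrow> t < 1 \<Longrightarrow> s < H t \<Longrightarrow> \<exists>u>t. u < 1 \<and> s < H u"
begin

lemma lower_step_nonneg: "0 \<le> lower_step N H j"
  by (auto simp: lower_step_def intro!: nonneg)

lemma lower_step_antimono:
  assumes "i \<le> j" shows "lower_step N H j \<le> lower_step N H i"
  using assms lower_step_nonneg[of N i]
  by (auto simp: lower_step_def intro!: decreasing divide_right_mono)

lemma lower_step_le:
  assumes "N > 0" "0 < t" "t < 1"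
  shows "lower_step N H (cell N t) \<le> H t"
  using cell_bounds[of N t] assms nonneg[of t]
  by (auto simp: lower_step_def add.commute intro!: decreasing)

lemma lower_step_refine:
  assumes "N > 0" "L > 0" "0 < t" "t < 1"
  shows "lower_step N H (cell N t) \<le> lower_step (N * L) H (cell (N * L) t)"
proof (cases "Suc (cell N t) < N")
  case True
  let ?j = "cell N t" and ?i = "cell (N * L) t"
  have "?i < Suc ?j * L"
    using cell_div[OF \<open>L > 0\<close>, of N t] assms by (metis dividend_less_times_div mult_Suc mult.commute)
  then have "Suc ?i \<le> Suc ?j * L" by simp
  also have "\<dots> < N * L" using True assms mult_less_mono1 by blast
  finally have 1: "Suc ?i < N * L" .
  have "real (Suc ?i) / real (N * L) \<le> real (Suc ?j * L) / real (N * L)"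
    using \<open>Suc ?i \<le> Suc ?j * L\<close> by (intro divide_right_mono) linarith+
  also have "\<dots> = real (Suc ?j) / N" using assms unfolding of_nat_mult by (rule_tac nonzero_mult_divide_mult_cancel_right) auto
  finally have "H (real (Suc ?j) / N) \<le> H (real (Suc ?i) / real (N * L))"
    using True assms by (intro decreasing) auto
  then show ?thesis using 1 True by (simp add: lower_step_def)
next
  case False
  then show ?thesis using lower_step_nonneg by (simp add: lower_step_def)
qed

lemma lower_step_incseq:
  assumes "N > 0" "0 < t" "t < 1"
  shows "incseq (\<lambda>m. lower_step (N * 2 ^ m) H (cell (N * 2 ^ m) t))"
proof (rule incseq_SucI)
  fix m
  show "lower_step (N * 2 ^ m) H (cell (N * 2 ^ m) t)
      \<le> lower_step (N * 2 ^ Suc m) H (cell (N * 2 ^ Suc m) t)"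
    using lower_step_refine[of "N * 2 ^ m" 2 t] assms by (simp add: ac_simps)
qed

lemma lower_step_tendsto:
  assumes N: "N > 0" and t: "0 < t" "t < 1"
  shows "(\<lambda>m. lower_step (N * 2 ^ m) H (cell (N * 2 ^ m) t)) \<longlonglongrightarrow> H t"
proof (rule order_tendstoI)
  fix s assume "s < H t"
  then obtain u where u: "t < u" "u < 1" "s < H u" using right_continuous t by blast
  have "(\<lambda>m. 1 / (real N * 2 ^ m)) \<longlonglongrightarrow> 0" using N by real_asymp
  then have "eventually (\<lambda>m. 1 / (real N * 2 ^ m) < u - t) sequentially"
    using u by (intro order_tendstoD) auto
  then show "eventually (\<lambda>m. s < lower_step (N * 2 ^ m) H (cell (N * 2 ^ m) t)) sequentially"
  proof eventually_elim
    case (elim m)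
    let ?M = "N * 2 ^ m" let ?v = "real (Suc (cell ?M t)) / ?M"
    have "?v = real (cell ?M t) / ?M + 1 / ?M" by (simp add: add_divide_distrib)
    also have "\<dots> \<le> t + 1 / ?M" using cell_bounds(1)[of ?M t] N t by simp
    also have "\<dots> < u" using elim by simp
    finally have v: "?v < u" .
    then have "?v < 1" using u by simp
    then have "Suc (cell ?M t) < ?M" using N by (simp add: field_simps flip: of_nat_Suc of_nat_power of_nat_mult)
    moreover have "H u \<le> H ?v" using v u N by (intro decreasing) auto
    ultimately show ?case using u by (simp add: lower_step_def)
  qed
next
  fix s assume "H t < s"
  then show "eventually (\<lambda>m. lower_step (N * 2 ^ m) H (cell (N * 2 ^ m) t) < s) sequentially"
    using lower_step_le[of "N * 2 ^ m" t for m] N t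
    by (intro always_eventually allI) (auto intro: le_less_trans)
qed

lemma measurable_unit: "H \<in> borel_measurable unit_measure"
proof (rule borel_measurable_LIMSEQ_real)
  show "(\<lambda>m. lower_step (1 * 2 ^ m) H (cell (1 * 2 ^ m) t)) \<longlonglongrightarrow> H t" if "t \<in> space unit_measure" for t
    using that by (intro lower_step_tendsto) auto
qed (rule measurable_step)

lemma nn_integral_lower_step_tendsto:
  assumes N: "N > 0" and v: "v \<le> 1"
  shows "(\<lambda>m. \<integral>\<^sup>+t\<in>{0<..<v}. ennreal (lower_step (N * 2 ^ m) H (cell (N * 2 ^ m) t)) \<partial>lborel)
    \<longlonglongrightarrow> (\<integral>\<^sup>+t\<in>{0<..<v}. ennreal (H t) \<partial>lborel)"
proof (rule nn_integral_LIMSEQ)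
  show "incseq (\<lambda>m t. ennreal (lower_step (N * 2 ^ m) H (cell (N * 2 ^ m) t)) * indicator {0<..<v} t)"
  proof (intro incseq_SucI le_funI)
    fix m and t :: real
    show "ennreal (lower_step (N * 2 ^ m) H (cell (N * 2 ^ m) t)) * indicator {0<..<v} t
      \<le> ennreal (lower_step (N * 2 ^ Suc m) H (cell (N * 2 ^ Suc m) t)) * indicator {0<..<v} t"
      using incseq_SucD[OF lower_step_incseq[OF N, of t], of m] v
      by (auto simp: indicator_def intro!: ennreal_leI)
  qed
  fix t :: real
  show "(\<lambda>m. ennreal (lower_step (N * 2 ^ m) H (cell (N * 2 ^ m) t)) * indicator {0<..<v} t)
    \<longlonglongrightarrow> ennreal (H t) * indicator {0<..<v} t"
    using lower_step_tendsto[OF N, of t] v by (cases "t \<in> {0<..<v}") (auto intro!: tendsto_ennrealI)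
qed measurable

end

text \<open>Decreasing functions are compared through step functions. A step minorant \<open>x\<close> of \<open>H\<close> on a coarse
  grid has partial integrals at most those of \<open>G\<close>; after shrinking \<open>x\<close> by a factor \<open>\<theta> < 1\<close> these are
  also dominated by the partial integrals of step minorants of \<open>G\<close> on a fine enough grid, first at
  the finitely many nodes of the coarse grid and then everywhere, because on each coarse step the
  difference of the partial integrals is concave.\<close>

theorem Hardy_Littlewood_Polya:
  assumes \<sigma>: "ri_norm unit_measure \<sigma>"
    and "right_continuous_decreasing H" "right_continuous_decreasing G"
    and le: "\<And>t. 0 < t \<Longrightarrow> t \<le> 1 \<Longrightarrow>
      (\<integral>\<^sup>+\<tau>\<in>{0<..<t}. ennreal (H \<tau>) \<partial>lborel) \<le> (\<integral>\<^sup>+\<tau>\<in>{0<..<t}. ennreal (G \<tau>) \<partial>lborel)"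
  shows "fnorm \<sigma> H \<le> fnorm \<sigma> G"
proof -
  interpret H: right_continuous_decreasing H by fact
  interpret G: right_continuous_decreasing G by fact
  have coarse: "ennreal \<theta> * fnorm \<sigma> (\<lambda>t. lower_step N H (cell N t)) \<le> fnorm \<sigma> G"
    if \<theta>: "0 < \<theta>" "\<theta> < 1" and N: "N > 0" for N \<theta>
  proof -
    define x where "x = lower_step N H"
    define z where "z m = lower_step (N * 2 ^ m) G" for m
    have node: "eventually (\<lambda>m. 2 ^ m * \<theta> * (\<Sum>j<k. x j) \<le> (\<Sum>i<k * 2 ^ m. z m i)) sequentially"
      if "k \<le> N" for k
    proof (cases "(\<Sum>j<k. x j) \<le> 0")
      case True
      have "2 ^ m * \<theta> * (\<Sum>j<k. x j) \<le> 0" for m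
        using True \<theta> by (intro mult_nonneg_nonpos) auto
      moreover have "0 \<le> (\<Sum>i<k * 2 ^ m. z m i)" for m
        unfolding z_def by (intro sum_nonneg G.lower_step_nonneg)
      ultimately show ?thesis by (intro always_eventually allI) (rule order_trans)
    next
      case False
      \<comment> \<open>The integral of the coarse step function up to the node \<open>k / N\<close>; the factor \<open>\<theta>\<close> makes the comparison with \<open>G\<close> strict, so that it survives the approximation of \<open>G\<close>.\<close>
      define B where "B = (\<Sum>j<k. x j) / N"
      have "k > 0" using False by (cases k) auto
      have v: "0 < real k / N" "real k / N \<le> 1" using \<open>k > 0\<close> that N by auto
      have B: "ennreal B \<le> (\<integral>\<^sup>+t\<in>{0<..<real k / N}. ennreal (G t) \<partial>lborel)"
      proof -
        have "ennreal B = ennreal (1 / N) * (\<Sum>j<k. ennreal (x j))"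
          by (simp add: B_def x_def H.lower_step_nonneg sum_ennreal ennreal_mult[symmetric] sum_nonneg)
        also have "\<dots> = (\<integral>\<^sup>+t\<in>{0<..<real k / N}. ennreal (x (cell N t)) \<partial>lborel)"
          by (rule nn_integral_cell[OF N, symmetric])
        also have "\<dots> \<le> (\<integral>\<^sup>+t\<in>{0<..<real k / N}. ennreal (H t) \<partial>lborel)"
          using H.lower_step_le[OF N] v
          by (intro nn_integral_mono) (auto simp: indicator_def x_def intro!: ennreal_leI)
        also have "\<dots> \<le> (\<integral>\<^sup>+t\<in>{0<..<real k / N}. ennreal (G t) \<partial>lborel)" using v by (rule le)
        finally show ?thesis .
      qed
      have "0 < B" using False N by (simp add: B_def)
      then have "\<theta> * B < 1 * B" using \<theta> by (intro mult_strict_right_mono) auto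
      then have "ennreal (\<theta> * B) < ennreal B" using \<theta> \<open>0 < B\<close> by (intro ennreal_lessI) auto
      then have "eventually (\<lambda>m. ennreal (\<theta> * B)
        < (\<integral>\<^sup>+t\<in>{0<..<real k / N}. ennreal (z m (cell (N * 2 ^ m) t)) \<partial>lborel)) sequentially"
        unfolding z_def
        by (intro order_tendstoD(1)[OF G.nn_integral_lower_step_tendsto[OF N v(2)]] less_le_trans[OF _ B])
      then show ?thesis
      proof eventually_elim
        case (elim m)
        have "real k / N = real (k * 2 ^ m) / real (N * 2 ^ m)" by simp
        then have "ennreal (\<theta> * B) < ennreal (1 / (N * 2 ^ m)) * (\<Sum>i<k * 2 ^ m. ennreal (z m i))"
          using elim nn_integral_cell[of "N * 2 ^ m" "\<lambda>i. ennreal (z m i)" "k * 2 ^ m"] N by simp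
        also have "\<dots> = ennreal (1 / (N * 2 ^ m) * (\<Sum>i<k * 2 ^ m. z m i))"
          by (simp add: z_def G.lower_step_nonneg sum_ennreal ennreal_mult[symmetric] sum_nonneg)
        finally have "\<theta> * B < 1 / (N * 2 ^ m) * (\<Sum>i<k * 2 ^ m. z m i)"
          using \<theta> \<open>0 < B\<close> by (simp add: ennreal_less_iff)
        then show ?case using N by (simp add: B_def field_simps)
      qed
    qed
    have "eventually (\<lambda>m. \<forall>k\<in>{..N}. 2 ^ m * \<theta> * (\<Sum>j<k. x j) \<le> (\<Sum>i<k * 2 ^ m. z m i)) sequentially"
      using node by (intro eventually_ball_finite) auto
    then obtain m where m: "\<And>k. k \<le> N \<Longrightarrow> 2 ^ m * \<theta> * (\<Sum>j<k. x j) \<le> (\<Sum>i<k * 2 ^ m. z m i)"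
      using eventually_happens[of _ sequentially] by (metis (no_types, lifting) atMost_iff sequentially_bot)
    define L :: nat where "L = 2 ^ m"
    define M where "M = N * L"
    define d where "d i = z m i - \<theta> * x (i div L)" for i
    define D where "D k = (\<Sum>i<k. d i)" for k
    have L: "L > 0" by (simp add: L_def)
    have blocks: "(\<Sum>i<k * L. x (i div L)) = L * (\<Sum>j<k. x j)" for k
    proof (induction k)
      case (Suc k)
      have "(\<Sum>i<Suc k * L. x (i div L)) = (\<Sum>i<k * L. x (i div L)) + (\<Sum>i=k * L..<Suc k * L. x (i div L))"
        by (simp add: sum.atLeastLessThan_concat flip: atLeast0LessThan)
      also have "(\<Sum>i=k * L..<Suc k * L. x (i div L)) = (\<Sum>i=k * L..<Suc k * L. x k)"
      proof (rule sum.cong[OF refl])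
        fix i assume "i \<in> {k * L..<Suc k * L}"
        then have "i div L = k" by (intro div_nat_eqI) (auto simp: mult.commute)
        then show "x (i div L) = x k" by simp
      qed
      finally show ?case using Suc by (simp add: distrib_left)
    qed simp
    have D_node: "0 \<le> D (k * L)" if "k \<le> N" for k
      using m[OF that] blocks[of k]
      by (simp add: D_def d_def sum_subtractf L_def mult.assoc sum_distrib_left[symmetric])
        (simp add: algebra_simps)
    have D_pos: "0 \<le> D k" if "k \<le> M" for k
    proof (cases "k = M")
      case True
      then show ?thesis using D_node[of N] by (simp add: M_def)
    next
      case False
      define j where "j = k div L"
      have j: "j * L \<le> k" "k < Suc j * L" "Suc j \<le> N"
        using that False L dividend_less_div_times[OF L, of k]
        by (auto simp: j_def M_def less_mult_imp_div_less Suc_le_eq add.commute)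
      have div: "i div L = j" if "j * L \<le> i" "i < Suc j * L" for i
        using that by (intro div_nat_eqI) (auto simp: mult.commute)
      have d_dec: "d i' \<le> d i" if "j * L \<le> i" "i \<le> i'" "i' < Suc j * L" for i i'
        using that div[of i] div[of i'] G.lower_step_antimono[of i i' "N * 2 ^ m"]
        by (simp add: d_def z_def)
      show ?thesis
      proof (cases "0 \<le> d k")
        case True
        have "D (j * L) \<le> D k" unfolding D_def using j True d_dec[of _ k]
          by (intro sum_mono2) (auto intro: order_trans)
        then show ?thesis using D_node[of j] j by simp
      next
        case False
        have "(\<Sum>i=k..<Suc j * L. d i) \<le> 0" using j False d_dec[of k] by (intro sum_nonpos) force
        moreover have "D (Suc j * L) = D k + (\<Sum>i=k..<Suc j * L. d i)"
          unfolding D_def lessThan_atLeast0 using j by (intro sum.atLeastLessThan_concat[symmetric]) auto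
        ultimately show ?thesis using D_node[of "Suc j"] j by simp
      qed
    qed
    have "ennreal \<theta> * fnorm \<sigma> (\<lambda>t. x (cell N t)) = fnorm \<sigma> (\<lambda>t. \<theta> * x (cell M t div L))"
      using \<theta> H.lower_step_nonneg measurable_step[of x N]
      by (simp add: M_def cell_div[OF L] fnorm_def abs_mult ennreal_mult ri_norm_cmult[OF \<sigma>])
    also have "\<dots> \<le> fnorm \<sigma> (\<lambda>t. z m (cell M t))"
    proof (rule fnorm_step_weak_majorization[OF \<sigma>, where x = "\<lambda>i. \<theta> * x (i div L)"])
      show "\<theta> * x (j div L) \<le> \<theta> * x (i div L)" if "i \<le> j" for i j
        using \<theta> that by (auto simp: x_def intro!: mult_left_mono H.lower_step_antimono div_le_mono)
      show "\<forall>k\<le>M. (\<Sum>l<k. \<theta> * x (l div L)) \<le> (\<Sum>l<k. z m l)"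
        using D_pos by (simp add: D_def d_def sum_subtractf)
    qed (use N L \<theta> in \<open>auto simp: M_def x_def z_def H.lower_step_nonneg G.lower_step_nonneg\<close>)
    also have "\<dots> \<le> fnorm \<sigma> G"
      unfolding fnorm_def
    proof (rule ri_norm_mono_AE[OF \<sigma>])
      show "AE t in unit_measure. ennreal \<bar>z m (cell M t)\<bar> \<le> ennreal \<bar>G t\<bar>"
        using G.lower_step_le[of M] N L
        by (intro AE_I2) (auto simp: z_def M_def L_def G.lower_step_nonneg G.nonneg intro!: ennreal_leI)
    qed (use G.measurable_unit measurable_step[of "z m" M] in measurable)
    finally show ?thesis by (simp add: x_def)
  qed
  \<comment> \<open>The factor \<open>\<theta>\<close> tends to \<open>1\<close>.\<close>
  have step: "fnorm \<sigma> (\<lambda>t. lower_step N H (cell N t)) \<le> fnorm \<sigma> G" if N: "N > 0" for N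
  proof (rule LIMSEQ_le_const2)
    let ?a = "fnorm \<sigma> (\<lambda>t. lower_step N H (cell N t))"
    have "(\<lambda>k. ennreal (1 - 1 / (real k + 2)) * ?a) \<longlonglongrightarrow> ennreal 1 * ?a"
    proof (rule tendsto_mult_ennreal)
      show "(\<lambda>k. ennreal (1 - 1 / (real k + 2))) \<longlonglongrightarrow> ennreal 1"
        by (rule tendsto_ennrealI) real_asymp
    qed simp_all
    then show "(\<lambda>k. ennreal (1 - 1 / (real k + 2)) * ?a) \<longlonglongrightarrow> ?a" by simp
    show "\<exists>k0. \<forall>k\<ge>k0. ennreal (1 - 1 / (real k + 2)) * ?a \<le> fnorm \<sigma> G"
      by (intro exI[of _ 0] allI impI coarse N) (auto simp: field_simps)
  qed
  have "(\<lambda>m. \<sigma> (\<lambda>t. ennreal \<bar>lower_step (1 * 2 ^ m) H (cell (1 * 2 ^ m) t)\<bar>)) \<longlonglongrightarrow> \<sigma> (\<lambda>t. ennreal \<bar>H t\<bar>)"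
  proof (rule ri_norm_Fatou[OF \<sigma>])
    show "(\<lambda>t. ennreal \<bar>lower_step (1 * 2 ^ m) H (cell (1 * 2 ^ m) t)\<bar>) \<in> borel_measurable unit_measure" for m
      using measurable_step[of "lower_step (1 * 2 ^ m) H" "1 * 2 ^ m"] by measurable
    show "AE t in unit_measure. incseq (\<lambda>m. ennreal \<bar>lower_step (1 * 2 ^ m) H (cell (1 * 2 ^ m) t)\<bar>)
      \<and> (\<lambda>m. ennreal \<bar>lower_step (1 * 2 ^ m) H (cell (1 * 2 ^ m) t)\<bar>) \<longlonglongrightarrow> ennreal \<bar>H t\<bar>"
    proof (intro AE_I2 conjI)
      fix t assume "t \<in> space unit_measure"
      then have t: "0 < t" "t < 1" by (auto simp: space_restrict_space)
      show "incseq (\<lambda>m. ennreal \<bar>lower_step (1 * 2 ^ m) H (cell (1 * 2 ^ m) t)\<bar>)"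
        using H.lower_step_incseq[of 1 t] t
        by (auto simp: incseq_def H.lower_step_nonneg intro!: ennreal_leI)
      show "(\<lambda>m. ennreal \<bar>lower_step (1 * 2 ^ m) H (cell (1 * 2 ^ m) t)\<bar>) \<longlonglongrightarrow> ennreal \<bar>H t\<bar>"
        using H.lower_step_tendsto[of 1 t] t by (intro tendsto_ennrealI tendsto_rabs) auto
    qed
  qed (use H.measurable_unit in measurable)
  then show ?thesis
    unfolding fnorm_def
    by (rule LIMSEQ_le_const2) (intro exI[of _ 0] allI impI step[unfolded fnorm_def], simp)
qed

section \<open>Coordinates and product measures on the cube\<close>

text \<open>The coordinate of \<open>insert_coord n k y t\<close> which holds \<open>y j\<close>.\<close>

definition skip :: "nat \<Rightarrow> nat \<Rightarrow> nat" where
  "skip k j = (if j < k then j else Suc j)"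

lemma bij_betw_skip: "k < n \<Longrightarrow> bij_betw (skip k) {..<n - 1} ({..<n} - {k})"
  by (rule bij_betw_byWitness[where f' = "\<lambda>j. if j < k then j else j - 1"])
     (auto simp: skip_def)

lemma insert_coord_skip: "k < n \<Longrightarrow> j < n - 1 \<Longrightarrow> insert_coord n k y t (skip k j) = y j"
  by (auto simp: insert_coord_def skip_def)

lemma insert_coord_same: "k < n \<Longrightarrow> insert_coord n k y t k = t"
  by (auto simp: insert_coord_def)

lemma insert_coord_update: "k < n \<Longrightarrow> (insert_coord n k y s)(k := t) = insert_coord n k y t"
  by (auto simp: insert_coord_def fun_eq_iff)

lemma insert_coord_commute:
  "i < n \<Longrightarrow> insert_coord (Suc n) n (insert_coord n i z s) t
    = insert_coord (Suc n) i (insert_coord n (n - 1) z t) s"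
  by (rule ext) (auto simp: insert_coord_def)

lemma insert_coord_in_PiE_iff:
  assumes "k < n" "y \<in> extensional {..<n - 1}"
  shows "insert_coord n k y t \<in> (\<Pi>\<^sub>E i\<in>{..<n}. A i) \<longleftrightarrow>
    y \<in> (\<Pi>\<^sub>E j\<in>{..<n - 1}. A (skip k j)) \<and> t \<in> A k"
proof
  assume *: "insert_coord n k y t \<in> (\<Pi>\<^sub>E i\<in>{..<n}. A i)"
  have "y j \<in> A (skip k j)" if "j < n - 1" for j
  proof -
    have "skip k j < n" using that by (auto simp: skip_def)
    then show ?thesis using * insert_coord_skip[OF assms(1) that, of y t] by (metis PiE_mem lessThan_iff)
  qed
  moreover have "t \<in> A k" using * insert_coord_same[OF assms(1), of y t] assms by (metis PiE_mem lessThan_iff)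
  ultimately show "y \<in> (\<Pi>\<^sub>E j\<in>{..<n - 1}. A (skip k j)) \<and> t \<in> A k"
    using assms(2) by (auto simp: PiE_iff)
next
  assume *: "y \<in> (\<Pi>\<^sub>E j\<in>{..<n - 1}. A (skip k j)) \<and> t \<in> A k"
  have "insert_coord n k y t i \<in> A i" if "i < n" for i
  proof (cases "i = k")
    case False
    then have "i \<in> skip k ` {..<n - 1}"
      using bij_betw_imp_surj_on[OF bij_betw_skip[OF assms(1)]] that by simp
    then obtain j where "j < n - 1" "skip k j = i" by auto
    then show ?thesis using * insert_coord_skip[OF assms(1), of j y t] by (auto simp: PiE_iff)
  qed (use * assms in \<open>auto simp: insert_coord_same\<close>)
  then show "insert_coord n k y t \<in> (\<Pi>\<^sub>E i\<in>{..<n}. A i)"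
    by (auto simp: insert_coord_def)
qed

text \<open>An interval of length one; its endpoints may or may not belong to it, but form a null set.\<close>

locale unit_interval =
  fixes I :: "real set" and a :: real
  assumes open_subset: "{a<..<a + 1} \<subseteq> I" and subset_closed: "I \<subseteq> {a..a + 1}"
begin

abbreviation line :: "real measure" where
  "line \<equiv> restrict_space lborel I"

text \<open>Lebesgue measure on the Borel subsets of the cube. Its completion is the measure of the statement, but
  Fubini's theorem is used for \<open>bcube\<close>, whose sections are all measurable.\<close>

abbreviation bcube :: "nat \<Rightarrow> (nat \<Rightarrow> real) measure" where
  "bcube n \<equiv> \<Pi>\<^sub>M i\<in>{..<n}. line"

lemma cube_eq: "cube n I = completion (bcube n)"
  by (simp add: cube_def)

lemma I_borel [measurable]: "I \<in> sets borel"
proof -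
  have "I = {a<..<a + 1} \<union> (I \<inter> {a, a + 1})" using open_subset subset_closed by force
  moreover have "finite (I \<inter> {a, a + 1})" by simp
  then have "I \<inter> {a, a + 1} \<in> sets borel" by (intro borel_closed finite_imp_closed)
  ultimately show ?thesis by (metis borel_open open_greaterThanLessThan sets.Un)
qed

lemma interior_I: "interior I = {a<..<a + 1}"
proof
  show "{a<..<a + 1} \<subseteq> interior I" using open_subset by (intro interior_maximal) auto
  show "interior I \<subseteq> {a<..<a + 1}" using interior_mono[OF subset_closed] by simp
qed

lemma space_line [simp]: "space line = I"
  by (simp add: space_restrict_space)

lemma space_bcube: "space (bcube n) = (\<Pi>\<^sub>E i\<in>{..<n}. I)"
  by (simp add: space_PiM)

lemma AE_line_interior: "AE t in line. t \<in> {a<..<a + 1}"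
proof -
  have "AE t in lborel. t \<noteq> a \<and> t \<noteq> a + 1"
    using AE_lborel_singleton[of a] AE_lborel_singleton[of "a + 1"] by eventually_elim auto
  then have "AE t in lborel. t \<in> I \<longrightarrow> t \<in> {a<..<a + 1}"
    by eventually_elim (use subset_closed in force)
  then show ?thesis by (subst AE_restrict_space_iff) auto
qed

lemma nn_integral_line: "(\<integral>\<^sup>+t. f t \<partial>line) = (\<integral>\<^sup>+t\<in>{a<..<a + 1}. f t \<partial>lborel)"
proof -
  have "(\<integral>\<^sup>+t. f t \<partial>line) = (\<integral>\<^sup>+t\<in>I. f t \<partial>lborel)"
    by (subst nn_integral_restrict_space) auto
  also have "\<dots> = (\<integral>\<^sup>+t\<in>{a<..<a + 1}. f t \<partial>lborel)"
  proof (rule nn_integral_cong_AE)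
    have "AE t in lborel. t \<noteq> a \<and> t \<noteq> a + 1"
      using AE_lborel_singleton[of a] AE_lborel_singleton[of "a + 1"] by eventually_elim auto
    then show "AE t in lborel. f t * indicator I t = f t * indicator {a<..<a + 1} t"
    proof eventually_elim
      case (elim t)
      then have "t \<in> I \<longleftrightarrow> t \<in> {a<..<a + 1}" using open_subset subset_closed by force
      then show ?case by (simp add: indicator_def)
    qed
  qed
  finally show ?thesis .
qed

lemma prob_space_line: "prob_space line"
proof (rule prob_spaceI)
  have "emeasure line (space line) = (\<integral>\<^sup>+t. 1 \<partial>line)" by simp
  also have "\<dots> = emeasure lborel {a<..<a + 1}" unfolding nn_integral_line by simp
  finally show "emeasure line (space line) = 1" by simp
qed

sublocale line: prob_space line by (rule prob_space_line)

sublocale product_prob_space "\<lambda>_::nat. line" UNIV ..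

lemma prob_space_bcube: "prob_space (bcube n)"
  by (rule prob_space_PiM) (rule prob_space_line)

lemma prob_space_cube: "prob_space (cube n I)"
proof -
  interpret prob_space "bcube n" by (rule prob_space_bcube)
  show ?thesis unfolding cube_eq
    by (rule prob_spaceI) (simp add: emeasure_space_1)
qed

lemma measurable_line_borel [measurable]: "id \<in> measurable line borel" "(\<lambda>x. x) \<in> measurable line borel"
  by (auto intro: measurable_restrict_space1)

lemma measurable_insert_coord:
  assumes "k < n"
  shows "(\<lambda>p. insert_coord n k (fst p) (snd p)) \<in> measurable (bcube (n - 1) \<Otimes>\<^sub>M line) (bcube n)"
  unfolding insert_coord_def
proof (rule measurable_restrict)
  fix i assume "i \<in> {..<n}"
  then consider "i < k" "i \<in> {..<n - 1}" | "i = k" | "k < i" "i - 1 \<in> {..<n - 1}"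
    using assms by force
  then show "(\<lambda>p. if i < k then fst p i else if i = k then snd p else fst p (i - 1))
    \<in> measurable (bcube (n - 1) \<Otimes>\<^sub>M line) line"
    by cases (auto intro: measurable_compose[OF measurable_fst measurable_component_singleton])
qed

text \<open>Both measures are products of Lebesgue measures, and the inverse image of a box is a box with the same
  sides.\<close>

lemma distr_insert_coord:
  assumes k: "k < n"
  shows "distr (bcube (n - 1) \<Otimes>\<^sub>M line) (bcube n) (\<lambda>p. insert_coord n k (fst p) (snd p)) = bcube n"
proof (rule PiM_eqI)
  fix A :: "nat \<Rightarrow> real set" assume A: "\<And>i. i \<in> {..<n} \<Longrightarrow> A i \<in> sets line"
  let ?T = "\<lambda>p. insert_coord n k (fst p) (snd p)"
  have skip: "skip k j < n" if "j < n - 1" for j using that by (auto simp: skip_def)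
  have [measurable]: "Pi\<^sub>E {..<n} A \<in> sets (bcube n)" using A by (intro sets_PiM_I_finite) auto
  have AI: "A i \<subseteq> I" if "i < n" for i using sets.sets_into_space[OF A, of i] that by simp
  have "?T -` (Pi\<^sub>E {..<n} A) \<inter> space (bcube (n - 1) \<Otimes>\<^sub>M line)
      = (\<Pi>\<^sub>E j\<in>{..<n - 1}. A (skip k j)) \<times> A k"
  proof (intro set_eqI iffI)
    fix p assume "p \<in> ?T -` (Pi\<^sub>E {..<n} A) \<inter> space (bcube (n - 1) \<Otimes>\<^sub>M line)"
    then have "insert_coord n k (fst p) (snd p) \<in> Pi\<^sub>E {..<n} A" "fst p \<in> extensional {..<n - 1}"
      by (auto simp: space_pair_measure space_bcube PiE_iff)
    then have "fst p \<in> (\<Pi>\<^sub>E j\<in>{..<n - 1}. A (skip k j)) \<and> snd p \<in> A k"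
      using insert_coord_in_PiE_iff[OF k] by blast
    then show "p \<in> (\<Pi>\<^sub>E j\<in>{..<n - 1}. A (skip k j)) \<times> A k" by (simp add: mem_Times_iff)
  next
    fix p assume "p \<in> (\<Pi>\<^sub>E j\<in>{..<n - 1}. A (skip k j)) \<times> A k"
    then have y: "fst p \<in> (\<Pi>\<^sub>E j\<in>{..<n - 1}. A (skip k j))" and t: "snd p \<in> A k"
      by (simp_all add: mem_Times_iff)
    then have "insert_coord n k (fst p) (snd p) \<in> Pi\<^sub>E {..<n} A"
      using insert_coord_in_PiE_iff[OF k, of "fst p" "snd p" A] PiE_iff by blast
    moreover have "snd p \<in> I" using t AI[OF k] by blast
    moreover have "fst p \<in> (\<Pi>\<^sub>E j\<in>{..<n - 1}. I)"
      using PiE_mono[of "{..<n - 1}" "\<lambda>j. A (skip k j)" "\<lambda>_. I"] AI[OF skip] y by blast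
    ultimately show "p \<in> ?T -` (Pi\<^sub>E {..<n} A) \<inter> space (bcube (n - 1) \<Otimes>\<^sub>M line)"
      by (simp add: space_pair_measure space_bcube mem_Times_iff)
  qed
  then have "emeasure (distr (bcube (n - 1) \<Otimes>\<^sub>M line) (bcube n) ?T) (Pi\<^sub>E {..<n} A)
      = emeasure (bcube (n - 1) \<Otimes>\<^sub>M line) ((\<Pi>\<^sub>E j\<in>{..<n - 1}. A (skip k j)) \<times> A k)"
    using measurable_insert_coord[OF k] by (subst emeasure_distr) auto
  also have "\<dots> = (\<Prod>j<n - 1. emeasure line (A (skip k j))) * emeasure line (A k)"
    using A skip k emeasure_PiM[of "{..<n - 1}" "\<lambda>j. A (skip k j)"]
    by (subst line.emeasure_pair_measure_Times) (auto intro!: sets_PiM_I_finite)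
  also have "(\<Prod>j<n - 1. emeasure line (A (skip k j))) = (\<Prod>i\<in>{..<n} - {k}. emeasure line (A i))"
    using prod.reindex_bij_betw[OF bij_betw_skip[OF k], of "\<lambda>i. emeasure line (A i)"] .
  also have "\<dots> * emeasure line (A k) = (\<Prod>i<n. emeasure line (A i))"
    using k prod.remove[of "{..<n}" k "\<lambda>i. emeasure line (A i)"] by (simp add: mult.commute)
  finally show "emeasure (distr (bcube (n - 1) \<Otimes>\<^sub>M line) (bcube n) ?T) (Pi\<^sub>E {..<n} A)
    = (\<Prod>i\<in>{..<n}. emeasure line (A i))" .
qed simp_all

lemma nn_integral_bcube:
  assumes k: "k < n" and [measurable]: "f \<in> borel_measurable (bcube n)"
  shows "(\<integral>\<^sup>+x. f x \<partial>bcube n) = (\<integral>\<^sup>+y. (\<integral>\<^sup>+t. f (insert_coord n k y t) \<partial>line) \<partial>bcube (n - 1))"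
proof -
  note [measurable] = measurable_insert_coord[OF k]
  have "(\<integral>\<^sup>+x. f x \<partial>bcube n) = (\<integral>\<^sup>+p. f (insert_coord n k (fst p) (snd p)) \<partial>(bcube (n - 1) \<Otimes>\<^sub>M line))"
    using nn_integral_distr[OF measurable_insert_coord[OF k], of f] assms(2)
    unfolding distr_insert_coord[OF k] by simp
  also have "\<dots> = (\<integral>\<^sup>+y. (\<integral>\<^sup>+t. f (insert_coord n k y t) \<partial>line) \<partial>bcube (n - 1))"
    using measurable_compose[OF measurable_insert_coord[OF k] assms(2)]
    by (subst line.nn_integral_fst[symmetric]) auto
  finally show ?thesis .
qed

lemma AE_bcube:
  assumes k: "k < n" and "AE x in bcube n. Q x"
  shows "AE y in bcube (n - 1). AE t in line. Q (insert_coord n k y t)"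
proof -
  interpret bcube: prob_space "bcube m" for m by (rule prob_space_bcube)
  interpret pair: pair_prob_space "bcube (n - 1)" line ..
  have "AE p in bcube (n - 1) \<Otimes>\<^sub>M line. Q (insert_coord n k (fst p) (snd p))"
    using AE_distrD[OF measurable_insert_coord[OF k], of Q] assms(2)
    unfolding distr_insert_coord[OF k] by simp
  then show ?thesis using pair.AE_pair by fastforce
qed

lemma measurable_section:
  assumes "k < n" "f \<in> measurable (bcube n) L"
  shows "y \<in> space (bcube (n - 1)) \<Longrightarrow> (\<lambda>t. f (insert_coord n k y t)) \<in> measurable line L"
    and "(\<lambda>p. f (insert_coord n k (fst p) (snd p))) \<in> measurable (bcube (n - 1) \<Otimes>\<^sub>M line) L"
proof -
  show 1: "(\<lambda>p. f (insert_coord n k (fst p) (snd p))) \<in> measurable (bcube (n - 1) \<Otimes>\<^sub>M line) L"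
    by (rule measurable_compose[OF measurable_insert_coord assms(2)]) fact
  show "(\<lambda>t. f (insert_coord n k y t)) \<in> measurable line L" if "y \<in> space (bcube (n - 1))"
    using measurable_compose[OF measurable_Pair1'[OF that] 1] by simp
qed

lemma integral_bcube:
  fixes f :: "(nat \<Rightarrow> real) \<Rightarrow> real"
  assumes k: "k < n" and f: "integrable (bcube n) f"
  shows "(\<integral>x. f x \<partial>bcube n) = (\<integral>y. (\<integral>t. f (insert_coord n k y t) \<partial>line) \<partial>bcube (n - 1))"
    and "AE y in bcube (n - 1). integrable line (\<lambda>t. f (insert_coord n k y t))"
proof -
  interpret bcube: prob_space "bcube m" for m by (rule prob_space_bcube)
  interpret pair: pair_prob_space "bcube (n - 1)" line ..
  note [measurable] = measurable_insert_coord[OF k]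
  have [measurable]: "f \<in> borel_measurable (bcube n)" using f by simp
  have int: "integrable (bcube (n - 1) \<Otimes>\<^sub>M line) (\<lambda>p. f (insert_coord n k (fst p) (snd p)))"
    using integrable_distr[OF measurable_insert_coord[OF k], of f] f
    unfolding distr_insert_coord[OF k] by simp
  have "(\<integral>x. f x \<partial>bcube n) = (\<integral>p. f (insert_coord n k (fst p) (snd p)) \<partial>(bcube (n - 1) \<Otimes>\<^sub>M line))"
    using integral_distr[OF measurable_insert_coord[OF k], of f] f
    unfolding distr_insert_coord[OF k] by simp
  also have "\<dots> = (\<integral>y. (\<integral>t. f (insert_coord n k y t) \<partial>line) \<partial>bcube (n - 1))"
    using pair.integral_fst'[OF int] by simp
  finally show "(\<integral>x. f x \<partial>bcube n) = (\<integral>y. (\<integral>t. f (insert_coord n k y t) \<partial>line) \<partial>bcube (n - 1))" .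
  show "AE y in bcube (n - 1). integrable line (\<lambda>t. f (insert_coord n k y t))"
    using pair.AE_integrable_fst'[OF int] by simp
qed

lemma measurable_update:
  assumes "k < n"
  shows "(\<lambda>p. (fst p)(k := snd p)) \<in> measurable (bcube n \<Otimes>\<^sub>M line) (bcube n)"
proof -
  have "(\<lambda>p. (fst p)(k := snd p)) \<in> measurable (bcube n \<Otimes>\<^sub>M line) (Pi\<^sub>M (insert k {..<n}) (\<lambda>_. line))"
    by (rule measurable_fun_upd) auto
  then show ?thesis using assms by (simp add: insert_absorb)
qed

text \<open>Since each factor is a probability measure, averaging over one coordinate and then over all
  of them changes nothing.\<close>

lemma nn_integral_bcube_update:
  assumes k: "k < n" and f: "f \<in> borel_measurable (bcube n)"
  shows "(\<integral>\<^sup>+x. (\<integral>\<^sup>+t. f (x(k := t)) \<partial>line) \<partial>bcube n) = (\<integral>\<^sup>+x. f x \<partial>bcube n)"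
proof -
  have "(\<lambda>p. f ((fst p)(k := snd p))) \<in> borel_measurable (bcube n \<Otimes>\<^sub>M line)"
    by (rule measurable_compose[OF measurable_update[OF k] f])
  then have [measurable]: "(\<lambda>x. \<integral>\<^sup>+t. f (x(k := t)) \<partial>line) \<in> borel_measurable (bcube n)"
    using line.borel_measurable_nn_integral_fst by fastforce
  have "(\<integral>\<^sup>+x. (\<integral>\<^sup>+t. f (x(k := t)) \<partial>line) \<partial>bcube n)
      = (\<integral>\<^sup>+y. (\<integral>\<^sup>+s. (\<integral>\<^sup>+t. f (insert_coord n k y t) \<partial>line) \<partial>line) \<partial>bcube (n - 1))"
    by (subst nn_integral_bcube[OF k]) (simp_all add: insert_coord_update[OF k])
  also have "\<dots> = (\<integral>\<^sup>+y. (\<integral>\<^sup>+t. f (insert_coord n k y t) \<partial>line) \<partial>bcube (n - 1))"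
    using line.emeasure_space_1 by simp
  also have "\<dots> = (\<integral>\<^sup>+x. f x \<partial>bcube n)" by (rule nn_integral_bcube[OF k f, symmetric])
  finally show ?thesis .
qed

end

text \<open>With \<open>c\<close> and \<open>d\<close> the infimum and the supremum of \<open>I\<close>, the measure of \<open>I\<close> lies between those of
  \<open>(c, d)\<close> and \<open>[c, d]\<close>, so that \<open>d - c = 1\<close>.\<close>

lemma is_interval_unit_length:
  assumes "is_interval I" "emeasure lborel I = 1"
  shows "\<exists>a. unit_interval I a"
proof -
  have between: "t \<in> I" if "x \<in> I" "y \<in> I" "x \<le> t" "t \<le> y" for x y t
    using assms(1) that unfolding is_interval_1 by blast
  have [measurable]: "I \<in> sets borel"
    using assms(2) emeasure_notin_sets[of I lborel] by fastforce
  have len: "y - x \<le> 1" if "x \<in> I" "y \<in> I" for x y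
  proof (cases "x \<le> y")
    case True
    have "{x..y} \<subseteq> I" using between[OF that] by auto
    then have "emeasure lborel {x..y} \<le> emeasure lborel I" by (intro emeasure_mono) auto
    then show ?thesis using True assms(2) by (simp add: ennreal_le_1)
  qed simp
  have "I \<noteq> {}" using assms(2) by auto
  then obtain x0 where x0: "x0 \<in> I" by blast
  have bdd: "bdd_below I" "bdd_above I"
    using len[OF x0] len[OF _ x0] by (auto intro!: bdd_belowI[of _ "x0 - 1"] bdd_aboveI[of _ "x0 + 1"] simp: algebra_simps)
  define c d where "c = Inf I" and "d = Sup I"
  have sub: "{c<..<d} \<subseteq> I" "I \<subseteq> {c..d}"
  proof -
    show "I \<subseteq> {c..d}" using bdd by (auto simp: c_def d_def cInf_lower cSup_upper)
    show "{c<..<d} \<subseteq> I"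
    proof
      fix t assume "t \<in> {c<..<d}"
      then obtain x y where "x \<in> I" "x < t" "y \<in> I" "t < y"
        using \<open>I \<noteq> {}\<close> bdd by (auto simp: c_def d_def cInf_less_iff less_cSup_iff)
      then show "t \<in> I" using between[of x y t] by simp
    qed
  qed
  have "c \<le> d" using x0 sub by force
  have "emeasure lborel {c<..<d} \<le> 1" "1 \<le> emeasure lborel {c..d}"
    using emeasure_mono[OF sub(1), of lborel] emeasure_mono[OF sub(2), of lborel] assms(2) by auto
  then have "d = c + 1" using \<open>c \<le> d\<close> by (auto simp: ennreal_le_1 ennreal_ge_1)
  then show ?thesis using sub by (intro exI[of _ c]) (simp add: unit_interval_def)
qed

section \<open>Smooth functions of one variable\<close>

primrec Cdiff :: "nat \<Rightarrow> (real \<Rightarrow> real) \<Rightarrow> bool" where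
  "Cdiff 0 f \<longleftrightarrow> continuous_on UNIV f"
| "Cdiff (Suc k) f \<longleftrightarrow> (\<exists>f'. (\<forall>x. (f has_real_derivative f' x) (at x)) \<and> Cdiff k f')"

definition smooth :: "(real \<Rightarrow> real) \<Rightarrow> bool" where
  "smooth f \<longleftrightarrow> (\<forall>k. Cdiff k f)"

lemma Cdiff_Suc_D: "Cdiff (Suc k) f \<Longrightarrow> Cdiff k f"
proof (induction k arbitrary: f)
  case 0
  then show ?case by (auto intro!: continuous_at_imp_continuous_on dest: DERIV_isCont)
next
  case (Suc k)
  then obtain f' where f': "\<And>x. (f has_real_derivative f' x) (at x)" "Cdiff (Suc k) f'" by force
  show ?case using f'(1) Suc.IH[OF f'(2)] by (auto intro!: exI[of _ f'])
qed

lemma Cdiff_add: "Cdiff k f \<Longrightarrow> Cdiff k g \<Longrightarrow> Cdiff k (\<lambda>x. f x + g x)"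
proof (induction k arbitrary: f g)
  case (Suc k)
  then obtain f' g' where "\<And>x. (f has_real_derivative f' x) (at x)" "Cdiff k f'"
    "\<And>x. (g has_real_derivative g' x) (at x)" "Cdiff k g'" by force
  then show ?case
    by (auto intro!: exI[of _ "\<lambda>x. f' x + g' x"] derivative_eq_intros Suc.IH)
qed (auto intro: continuous_intros)

lemma Cdiff_mult: "Cdiff k f \<Longrightarrow> Cdiff k g \<Longrightarrow> Cdiff k (\<lambda>x. f x * g x)"
proof (induction k arbitrary: f g)
  case (Suc k)
  from Suc.prems obtain f' g' where *: "\<And>x. (f has_real_derivative f' x) (at x)" "Cdiff k f'"
    "\<And>x. (g has_real_derivative g' x) (at x)" "Cdiff k g'" by force
  show ?case using * Cdiff_Suc_D[OF Suc.prems(1)] Cdiff_Suc_D[OF Suc.prems(2)]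
    by (auto intro!: exI[of _ "\<lambda>x. f' x * g x + f x * g' x"] derivative_eq_intros Cdiff_add Suc.IH)
qed (auto intro: continuous_intros)

lemma Cdiff_const: "Cdiff k (\<lambda>_. c)"
  by (induction k arbitrary: c) (auto intro!: exI[of _ "\<lambda>_. 0"])

lemma Cdiff_affine: "Cdiff k f \<Longrightarrow> Cdiff k (\<lambda>x. f (p * x + q))"
proof (induction k arbitrary: f)
  case 0
  then show ?case by (auto intro!: continuous_on_compose2[of UNIV f] continuous_intros)
next
  case (Suc k)
  then obtain f' where f': "\<And>x. (f has_real_derivative f' x) (at x)" "Cdiff k f'" by force
  have "((\<lambda>x. f (p * x + q)) has_real_derivative p * f' (p * x + q)) (at x)" for x
  proof -
    have "((\<lambda>x. p * x + q) has_real_derivative p) (at x)" by (auto intro!: derivative_eq_intros)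
    from DERIV_chain2[OF f'(1) this] show ?thesis by (simp add: mult.commute)
  qed
  moreover have "Cdiff k (\<lambda>x. p * f' (p * x + q))"
    by (intro Cdiff_mult Cdiff_const Suc.IH f'(2))
  ultimately show ?case by (auto intro!: exI[of _ "\<lambda>x. p * f' (p * x + q)"])
qed

lemma smooth_DERIV: "smooth f \<Longrightarrow> (f has_real_derivative deriv f x) (at x)"
  unfolding smooth_def by (drule spec[of _ "Suc 0"]) (auto, metis DERIV_imp_deriv)

lemma smooth_deriv: "smooth f \<Longrightarrow> smooth (deriv f)"
proof (unfold smooth_def, intro allI)
  fix k assume "\<forall>k. Cdiff k f"
  then have "Cdiff (Suc k) f" by blast
  then obtain f' where f': "\<And>x. (f has_real_derivative f' x) (at x)" "Cdiff k f'" by force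
  then have "deriv f = f'" by (auto simp: DERIV_imp_deriv)
  then show "Cdiff k (deriv f)" using f' by simp
qed

lemma smooth_antiderivative:
  assumes "\<And>x. (F has_real_derivative f x) (at x)" "smooth f"
  shows "smooth F"
  unfolding smooth_def
proof
  fix k show "Cdiff k F"
    using assms by (intro Cdiff_Suc_D[of k F]) (unfold Cdiff.simps smooth_def, blast)
qed

lemma smooth_continuous: "smooth f \<Longrightarrow> continuous_on UNIV f"
  unfolding smooth_def by (drule spec[of _ 0]) simp

lemma smooth_measurable: "smooth f \<Longrightarrow> f \<in> borel_measurable borel"
  by (intro borel_measurable_continuous_onI smooth_continuous)

lemma
  assumes "smooth f" "smooth g"
  shows smooth_add: "smooth (\<lambda>x. f x + g x)" and smooth_mult: "smooth (\<lambda>x. f x * g x)"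
    and smooth_affine: "smooth (\<lambda>x. f (p * x + q))" and smooth_const: "smooth (\<lambda>_. c)"
  using assms by (simp_all add: smooth_def Cdiff_add Cdiff_mult Cdiff_affine Cdiff_const)

text \<open>The functions \<open>x\<^sup>-\<^sup>k exp(-1/x)\<close>, extended by \<open>0\<close>, span a space closed under differentiation.\<close>

definition flat_exp :: "nat \<Rightarrow> real \<Rightarrow> real" where
  "flat_exp k x = (if 0 < x then exp (- 1 / x) / x ^ k else 0)"

lemma flat_exp_tendsto_0: "(flat_exp k \<longlongrightarrow> 0) (at 0)"
proof (rule filterlim_split_at)
  have "eventually (\<lambda>x. flat_exp k x = 0) (at_left 0)"
    by (auto simp: eventually_at_filter flat_exp_def)
  then show "(flat_exp k \<longlongrightarrow> 0) (at_left 0)" by (rule tendsto_eventually)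
  have "((\<lambda>x. inverse x ^ k / exp (inverse x)) \<longlongrightarrow> (0::real)) (at_right 0)"
    by (rule filterlim_compose[OF tendsto_power_div_exp_0 filterlim_inverse_at_top_right])
  moreover have "eventually (\<lambda>x. inverse x ^ k / exp (inverse x) = flat_exp k x) (at_right 0)"
    by (auto simp: eventually_at_filter flat_exp_def field_simps exp_minus power_inverse)
  ultimately show "(flat_exp k \<longlongrightarrow> 0) (at_right 0)" by (rule Lim_transform_eventually)
qed

lemma flat_exp_DERIV:
  "(flat_exp k has_real_derivative - real k * flat_exp (Suc k) x + flat_exp (Suc (Suc k)) x) (at x)"
proof -
  consider "x < 0" | "x = 0" | "0 < x" by linarith
  then show ?thesis
  proof cases
    case 1
    have "((\<lambda>_. 0) has_real_derivative 0) (at x)" by simp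
    then have "(flat_exp k has_real_derivative 0) (at x)"
      by (rule has_field_derivative_transform_within_open[of _ _ _ "{..<0}"])
         (use 1 in \<open>auto simp: flat_exp_def\<close>)
    then show ?thesis using 1 by (simp add: flat_exp_def)
  next
    case 2
    have "(\<lambda>h. (flat_exp k (0 + h) - flat_exp k 0) / h) = flat_exp (Suc k)"
      by (auto simp: flat_exp_def fun_eq_iff)
    then have "(flat_exp k has_real_derivative 0) (at 0)"
      using flat_exp_tendsto_0[of "Suc k"] by (simp add: DERIV_def)
    then show ?thesis using 2 by (simp add: flat_exp_def)
  next
    case 3
    have "((\<lambda>x. exp (- 1 / x) / x ^ k) has_real_derivative
      - real k * flat_exp (Suc k) x + flat_exp (Suc (Suc k)) x) (at x)"
    proof -
      have "((\<lambda>x. exp (- 1 / x) / x ^ k) has_real_derivative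
        ((exp (- 1 / x) * (1 / x\<^sup>2)) * x ^ k - exp (- 1 / x) * (real k * x ^ (k - 1))) / (x ^ k * x ^ k)) (at x)"
        using 3 by (auto intro!: derivative_eq_intros simp: power2_eq_square)
      also have "((exp (- 1 / x) * (1 / x\<^sup>2)) * x ^ k - exp (- 1 / x) * (real k * x ^ (k - 1))) / (x ^ k * x ^ k)
        = - real k * flat_exp (Suc k) x + flat_exp (Suc (Suc k)) x"
        using 3 by (cases k) (simp_all add: flat_exp_def field_simps power2_eq_square)
      finally show ?thesis .
    qed
    then show ?thesis
      by (rule has_field_derivative_transform_within_open[of _ _ _ "{0<..}"])
         (use 3 in \<open>auto simp: flat_exp_def\<close>)
  qed
qed

lemma smooth_flat_exp: "smooth (flat_exp k)"
proof -
  have "Cdiff m (flat_exp k)" for m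
  proof (induction m arbitrary: k)
    case 0
    then show ?case
      using DERIV_isCont[OF flat_exp_DERIV] by (auto intro!: continuous_at_imp_continuous_on)
  next
    case (Suc m)
    show ?case unfolding Cdiff.simps
      by (intro exI[of _ "\<lambda>x. - real k * flat_exp (Suc k) x + flat_exp (Suc (Suc k)) x"] conjI allI
          flat_exp_DERIV Cdiff_add Cdiff_mult Cdiff_const Suc)
  qed
  then show ?thesis by (simp add: smooth_def)
qed

definition smooth_supported :: "real \<Rightarrow> real \<Rightarrow> (real \<Rightarrow> real) \<Rightarrow> bool" where
  "smooth_supported \<alpha> \<beta> f \<longleftrightarrow> smooth f \<and> (\<exists>c d. \<alpha> < c \<and> d < \<beta> \<and> (\<forall>t. t \<notin> {c..d} \<longrightarrow> f t = 0))"

lemma smooth_supportedD: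
  "smooth_supported \<alpha> \<beta> f \<Longrightarrow> \<exists>c d. \<alpha> < c \<and> d < \<beta> \<and> (\<forall>t. t \<notin> {c..d} \<longrightarrow> f t = 0) \<and> smooth f"
  unfolding smooth_supported_def by blast

lemma smooth_supportedI:
  "smooth f \<Longrightarrow> \<alpha> < c \<Longrightarrow> d < \<beta> \<Longrightarrow> (\<And>t. t \<notin> {c..d} \<Longrightarrow> f t = 0) \<Longrightarrow> smooth_supported \<alpha> \<beta> f"
  unfolding smooth_supported_def by blast

lemma smooth_supported_bounded:
  assumes "smooth_supported \<alpha> \<beta> f"
  shows "\<exists>C. \<forall>t. \<bar>f t\<bar> \<le> C"
proof -
  obtain c d where cd: "\<And>t. t \<notin> {c..d} \<Longrightarrow> f t = 0" and "smooth f"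
    using smooth_supportedD[OF assms] by blast
  then have "compact (f ` {c..d})"
    using continuous_on_subset[OF smooth_continuous] by (intro compact_continuous_image) auto
  then obtain C where "\<And>t. t \<in> {c..d} \<Longrightarrow> \<bar>f t\<bar> \<le> C" using compact_imp_bounded bounded_real by (metis imageI)
  then have "\<bar>f t\<bar> \<le> max C 0" for t using cd[of t] by (cases "t \<in> {c..d}") force+
  then show ?thesis by blast
qed

lemma smooth_supported_deriv:
  assumes "smooth_supported \<alpha> \<beta> f"
  shows "smooth_supported \<alpha> \<beta> (deriv f)"
proof -
  obtain c d where cd: "\<alpha> < c" "d < \<beta>" "\<And>t. t \<notin> {c..d} \<Longrightarrow> f t = 0" and f: "smooth f"
    using smooth_supportedD[OF assms] by blast
  have "deriv f t = 0" if "t \<notin> {c..d}" for t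
  proof -
    have "((\<lambda>_. 0) has_real_derivative 0) (at t)" by simp
    then have "(f has_real_derivative 0) (at t)"
      by (rule has_field_derivative_transform_within_open[of _ _ _ "- {c..d}"])
         (use that cd in auto)
    then show ?thesis by (rule DERIV_imp_deriv)
  qed
  then show ?thesis by (rule smooth_supportedI[OF smooth_deriv[OF f] cd(1,2)])
qed

lemma smooth_supported_mono:
  assumes "smooth_supported \<alpha> \<beta> f" "\<alpha>' \<le> \<alpha>" "\<beta> \<le> \<beta>'"
  shows "smooth_supported \<alpha>' \<beta>' f"
proof -
  obtain c d where cd: "\<alpha> < c" "d < \<beta>" "\<And>t. t \<notin> {c..d} \<Longrightarrow> f t = 0" and f: "smooth f"
    using smooth_supportedD[OF assms(1)] by blast
  show ?thesis by (rule smooth_supportedI[OF f, of _ c d]) (use cd assms in auto)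
qed

lemma smooth_supported_linear:
  assumes "smooth_supported \<alpha> \<beta> f" "smooth_supported \<alpha> \<beta> g"
  shows "smooth_supported \<alpha> \<beta> (\<lambda>t. f t + r * g t)"
proof -
  obtain c d where cd: "\<alpha> < c" "d < \<beta>" "\<And>t. t \<notin> {c..d} \<Longrightarrow> f t = 0" "smooth f"
    using smooth_supportedD[OF assms(1)] by blast
  obtain c' d' where cd': "\<alpha> < c'" "d' < \<beta>" "\<And>t. t \<notin> {c'..d'} \<Longrightarrow> g t = 0" "smooth g"
    using smooth_supportedD[OF assms(2)] by blast
  have "smooth (\<lambda>t. f t + r * g t)"
    using cd cd' by (intro smooth_add smooth_mult smooth_const)
  then show ?thesis
  proof (rule smooth_supportedI[of _ _ "min c c'" "max d d'"])
    fix t assume "t \<notin> {min c c'..max d d'}"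
    then have "t \<notin> {c..d}" "t \<notin> {c'..d'}" by auto
    then show "f t + r * g t = 0" using cd(3)[of t] cd'(3)[of t] by simp
  qed (use cd cd' in auto)
qed

text \<open>Smooth functions between \<open>0\<close> and \<open>1\<close> converging to the indicator of \<open>(c, d)\<close>: the margins
  \<open>(d - c) / (m + 3)\<close> keep the support compact, and the dilation by \<open>m\<close> makes both factors tend to \<open>1\<close>.\<close>

definition bump :: "real \<Rightarrow> real \<Rightarrow> nat \<Rightarrow> real \<Rightarrow> real" where
  "bump c d m t = flat_exp 0 (real m * (t - (c + (d - c) / (real m + 3))))
    * flat_exp 0 (real m * (d - (d - c) / (real m + 3) - t))"

lemma bump_bounds: "0 \<le> bump c d m t" "bump c d m t \<le> 1"
proof -
  have "0 \<le> flat_exp 0 s" "flat_exp 0 s \<le> 1" for s by (auto simp: flat_exp_def)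
  then show "0 \<le> bump c d m t" "bump c d m t \<le> 1" unfolding bump_def by (auto intro: mult_le_one)
qed

lemma bump_eq_0:
  assumes "t \<notin> {c + (d - c) / (real m + 3)..d - (d - c) / (real m + 3)}"
  shows "bump c d m t = 0"
proof -
  have "flat_exp 0 (real m * s) = 0" if "s < 0" for s
    using that by (auto simp: flat_exp_def zero_less_mult_iff)
  then show ?thesis using assms by (auto simp: bump_def not_le)
qed

lemma bump_support:
  assumes "c < d"
  shows "c < c + (d - c) / (real m + 3)" "d - (d - c) / (real m + 3) < d"
  using assms by auto

lemma smooth_supported_bump:
  assumes "\<alpha> \<le> c" "c < d" "d \<le> \<beta>"
  shows "smooth_supported \<alpha> \<beta> (bump c d m)"
proof -
  define p q where "p = c + (d - c) / (real m + 3)" and "q = d - (d - c) / (real m + 3)"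
  have "bump c d m = (\<lambda>t. flat_exp 0 (real m * t + - real m * p) * flat_exp 0 (- real m * t + real m * q))"
    unfolding bump_def p_def[symmetric] q_def[symmetric] by (simp add: fun_eq_iff algebra_simps)
  moreover have "smooth \<dots>"
    by (intro smooth_mult smooth_affine[of _ "flat_exp 0"] smooth_flat_exp)
  ultimately have "smooth (bump c d m)" by simp
  moreover have "\<alpha> < p" "q < \<beta>" using bump_support[OF assms(2), of m] assms unfolding p_def q_def by linarith+
  ultimately show ?thesis
    by (rule smooth_supportedI) (use bump_eq_0[of _ c d m] in \<open>auto simp: p_def q_def\<close>)
qed

lemma bump_tendsto:
  assumes "c < d"
  shows "(\<lambda>m. bump c d m t) \<longlonglongrightarrow> indicator {c<..<d} t"
proof (cases "t \<in> {c<..<d}")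
  case False
  then have "bump c d m t = 0" for m using bump_support[OF assms, of m] by (intro bump_eq_0) auto
  then show ?thesis using False by simp
next
  case True
  have flat: "(\<lambda>m. flat_exp 0 (real m * x m)) \<longlonglongrightarrow> 1" if x: "x \<longlonglongrightarrow> l" "0 < l" for x :: "nat \<Rightarrow> real" and l
  proof -
    have "filterlim (\<lambda>m. real m * x m) at_top sequentially"
      by (subst mult.commute) (rule filterlim_tendsto_pos_mult_at_top[OF x filterlim_real_sequentially])
    then have *: "(\<lambda>m. exp (- inverse (real m * x m))) \<longlonglongrightarrow> exp (- 0)"
      by (intro tendsto_intros filterlim_compose[OF tendsto_inverse_0_at_top[OF filterlim_ident]])
    have "eventually (\<lambda>m. 0 < x m) sequentially" using x by (intro order_tendstoD)
    then have "eventually (\<lambda>m. exp (- inverse (real m * x m)) = flat_exp 0 (real m * x m)) sequentially"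
      using eventually_gt_at_top[of 0]
      by eventually_elim (auto simp: flat_exp_def inverse_eq_divide)
    with * show ?thesis using Lim_transform_eventually by fastforce
  qed
  have "(\<lambda>m. t - (c + (d - c) / (real m + 3))) \<longlonglongrightarrow> t - (c + 0)"
    by (intro tendsto_intros) real_asymp
  moreover have "(\<lambda>m. d - (d - c) / (real m + 3) - t) \<longlonglongrightarrow> d - 0 - t"
    by (intro tendsto_intros) real_asymp
  ultimately have "(\<lambda>m. bump c d m t) \<longlonglongrightarrow> 1 * 1"
    unfolding bump_def using True by (intro tendsto_mult flat) auto
  then show ?thesis using True by simp
qed

text \<open>The primitive is constant to the left and to the right of the support of \<open>f\<close>; on the right its value is
  the integral of \<open>f\<close>.\<close>

lemma smooth_supported_antiderivative:
  assumes f: "smooth_supported \<alpha> \<beta> f" and int: "integral {\<alpha>..\<beta>} f = 0" and "\<alpha> < \<beta>"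
  shows "\<exists>F. smooth_supported \<alpha> \<beta> F \<and> (\<forall>t. (F has_real_derivative f t) (at t))"
proof -
  obtain c d where cd: "\<alpha> < c" "d < \<beta>" "\<And>t. t \<notin> {c..d} \<Longrightarrow> f t = 0" "smooth f"
    using smooth_supportedD[OF f] by blast
  have cont: "continuous_on A f" for A
    using continuous_on_subset[OF smooth_continuous[OF cd(4)]] by blast
  define F where "F t = integral {\<alpha>..t} f" for t
  have zero_left: "F t = 0" if "t < c" for t
  proof -
    have "integral {\<alpha>..t} f = integral {\<alpha>..t} (\<lambda>_. 0)"
      using that by (intro integral_cong cd) auto
    then show ?thesis by (simp add: F_def)
  qed
  have zero_right: "F t = 0" if "d < t" for t
  proof (cases "t < c")
    case False
    define s where "s = max t \<beta>"
    have "F t + integral {t..s} f = integral {\<alpha>..s} f"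
      unfolding F_def s_def
      by (rule Henstock_Kurzweil_Integration.integral_combine) (use False cd integrable_continuous_real[OF cont] in auto)
    moreover have "integral {\<alpha>..\<beta>} f + integral {\<beta>..s} f = integral {\<alpha>..s} f"
      unfolding s_def
      by (rule Henstock_Kurzweil_Integration.integral_combine) (use \<open>\<alpha> < \<beta>\<close> integrable_continuous_real[OF cont] in auto)
    moreover have "integral {u..s} f = 0" if "d < u" for u
    proof -
      have "integral {u..s} f = integral {u..s} (\<lambda>_. 0)"
        using that by (intro integral_cong cd(3)) auto
      then show ?thesis by simp
    qed
    ultimately show ?thesis using int that cd(2) by simp
  qed (rule zero_left)
  have D: "(F has_real_derivative f t) (at t)" for t
  proof (cases "t < c")
    case True
    have "((\<lambda>_. 0) has_real_derivative 0) (at t)" by simp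
    then have "(F has_real_derivative 0) (at t)"
      by (rule has_field_derivative_transform_within_open[of _ _ _ "{..<c}"])
         (use True zero_left in auto)
    then show ?thesis using cd(3)[of t] True by simp
  next
    case False
    have "(F has_real_derivative f t) (at t within {\<alpha>..t + 1})"
      unfolding F_def using False cd by (intro integral_has_real_derivative cont) auto
    moreover have "t \<in> interior {\<alpha>..t + 1}" using False cd by simp
    ultimately show ?thesis by (metis at_within_interior)
  qed
  have "smooth F" using D cd by (intro smooth_antiderivative[of F f])
  then have "smooth_supported \<alpha> \<beta> F"
    by (rule smooth_supportedI[of _ _ c d]) (use cd zero_left zero_right in \<open>auto simp: not_le\<close>)
  then show ?thesis using D by blast
qed

section \<open>Test functions of product form\<close>

lemma partial_deriv_prod:
  assumes "i < n" "smooth (B i)"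
  shows "((\<lambda>t. \<Prod>j<n. B j ((x(i := t)) j)) has_real_derivative (\<Prod>j<n. (B(i := deriv (B i))) j (x j))) (at (x i))"
    and "partial_deriv i (\<lambda>x. \<Prod>j<n. B j (x j)) x = (\<Prod>j<n. (B(i := deriv (B i))) j (x j))"
proof -
  have split: "(\<Prod>j<n. C j (z j)) = C i (z i) * (\<Prod>j\<in>{..<n} - {i}. C j (z j))"
    for C :: "nat \<Rightarrow> real \<Rightarrow> real" and z
    using assms(1) by (subst prod.remove[of _ i]) auto
  have "(\<Prod>j\<in>{..<n} - {i}. B j ((x(i := t)) j)) = (\<Prod>j\<in>{..<n} - {i}. B j (x j))"
    "(\<Prod>j\<in>{..<n} - {i}. (B(i := deriv (B i))) j (x j)) = (\<Prod>j\<in>{..<n} - {i}. B j (x j))" for t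
    by (auto intro!: prod.cong)
  then show *: "((\<lambda>t. \<Prod>j<n. B j ((x(i := t)) j)) has_real_derivative (\<Prod>j<n. (B(i := deriv (B i))) j (x j))) (at (x i))"
    unfolding split using DERIV_cmult_right[OF smooth_DERIV[OF assms(2)]] by simp
  show "partial_deriv i (\<lambda>x. \<Prod>j<n. B j (x j)) x = (\<Prod>j<n. (B(i := deriv (B i))) j (x j))"
    unfolding partial_deriv_def by (rule DERIV_imp_deriv[OF *])
qed

lemma Ck_prod:
  assumes "\<And>i. i < n \<Longrightarrow> smooth (B i)"
  shows "Ck n k (\<lambda>x. \<Prod>j<n. B j (x j))"
  using assms
proof (induction k arbitrary: B)
  case (0 B)
  have "continuous_on (extensional {..<n}) (\<lambda>x. B j (x j))" if "j < n" for j
    by (rule continuous_on_compose2[OF smooth_continuous[OF 0[OF that]]])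
       (auto intro: continuous_on_subset[OF continuous_on_product_coordinates])
  then show ?case by (auto intro!: continuous_on_prod)
next
  case (Suc k B)
  have "Ck n 0 (\<lambda>x. \<Prod>j<n. B j (x j))"
  proof -
    have "continuous_on (extensional {..<n}) (\<lambda>x. B j (x j))" if "j < n" for j
      by (rule continuous_on_compose2[OF smooth_continuous[OF Suc.prems[OF that]]])
         (auto intro: continuous_on_subset[OF continuous_on_product_coordinates])
    then show ?thesis by (auto intro!: continuous_on_prod)
  qed
  moreover have "(\<lambda>t. \<Prod>j<n. B j ((x(i := t)) j)) differentiable (at (x i))" if "i < n" for i x
    using partial_deriv_prod(1)[where B = B and i = i and n = n and x = x] that Suc.prems real_differentiable_def by blast
  moreover have "Ck n k (partial_deriv i (\<lambda>x. \<Prod>j<n. B j (x j)))" if "i < n" for i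
  proof -
    have "partial_deriv i (\<lambda>x. \<Prod>j<n. B j (x j)) = (\<lambda>x. \<Prod>j<n. (B(i := deriv (B i))) j (x j))"
      using partial_deriv_prod(2)[where B = B and i = i and n = n] that Suc.prems by blast
    moreover have "smooth ((B(i := deriv (B i))) j)" if "j < n" for j
      using Suc.prems[OF that] Suc.prems[OF \<open>i < n\<close>] by (auto intro: smooth_deriv)
    ultimately show ?thesis using Suc.IH[of "B(i := deriv (B i))"] by simp
  qed
  ultimately show ?case by simp
qed

lemma compact_PiE_Icc: "compact (\<Pi>\<^sub>E i\<in>{..<n::nat}. {c i..d i :: real})"
proof -
  have "(\<Pi>\<^sub>E i\<in>{..<n}. {c i..d i}) = (\<Pi>\<^sub>E i\<in>UNIV. if i < n then {c i..d i} else {undefined})"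
  proof (intro set_eqI iffI)
    fix x assume "x \<in> (\<Pi>\<^sub>E i\<in>{..<n}. {c i..d i})"
    then have "x i \<in> (if i < n then {c i..d i} else {undefined})" for i
      by (cases "i < n") (simp_all add: PiE_iff extensional_def)
    then show "x \<in> (\<Pi>\<^sub>E i\<in>UNIV. if i < n then {c i..d i} else {undefined})" by (simp only: PiE_iff) simp
  next
    fix x assume "x \<in> (\<Pi>\<^sub>E i\<in>UNIV. if i < n then {c i..d i} else {undefined})"
    then have *: "x i \<in> (if i < n then {c i..d i} else {undefined})" for i by (simp only: PiE_iff) blast
    have "x i \<in> {c i..d i}" if "i < n" for i using *[of i] that by simp
    moreover have "x i = undefined" if "\<not> i < n" for i using *[of i] that by simp
    ultimately show "x \<in> (\<Pi>\<^sub>E i\<in>{..<n}. {c i..d i})" by (simp add: PiE_iff extensional_def)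
  qed
  moreover have "compactin (product_topology (\<lambda>_. euclidean) UNIV)
      (\<Pi>\<^sub>E i\<in>UNIV. if i < n then {c i..d i} else {undefined})"
    by (subst compactin_PiE) auto
  ultimately show ?thesis by (simp add: euclidean_product_topology)
qed

context unit_interval
begin

lemma cube_interior_eq: "cube_interior n I = (\<Pi>\<^sub>E i\<in>{..<n}. {a<..<a + 1})"
  by (simp add: cube_interior_def interior_I)

lemma test_function_prod:
  assumes "\<And>i. i < n \<Longrightarrow> smooth_supported a (a + 1) (B i)"
  shows "test_function n I (\<lambda>x. \<Prod>j<n. B j (x j))"
proof -
  have "\<forall>i. \<exists>c d. i < n \<longrightarrow> (a < c \<and> d < a + 1 \<and> (\<forall>t. t \<notin> {c..d} \<longrightarrow> B i t = 0))"
    using assms unfolding smooth_supported_def by blast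
  then obtain c d where cd: "\<And>i. i < n \<Longrightarrow> a < c i \<and> d i < a + 1 \<and> (\<forall>t. t \<notin> {c i..d i} \<longrightarrow> B i t = 0)"
    by metis
  let ?K = "\<Pi>\<^sub>E i\<in>{..<n}. {c i..d i}"
  have "?K \<subseteq> cube_interior n I"
    unfolding cube_interior_eq by (rule PiE_mono) (use cd in force)
  moreover have "(\<Prod>j<n. B j (x j)) = 0" if "x \<in> extensional {..<n} - ?K" for x
  proof -
    have "\<exists>i<n. x i \<notin> {c i..d i}" using that by (auto simp: PiE_iff)
    then obtain i where "i < n" "x i \<notin> {c i..d i}" by blast
    then show ?thesis using cd by (intro prod_zero) auto
  qed
  moreover have "Ck n k (\<lambda>x. \<Prod>j<n. B j (x j))" for k
    using assms by (intro Ck_prod) (auto simp: smooth_supported_def)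
  ultimately show ?thesis
    unfolding test_function_def by (intro conjI allI exI[of _ ?K] ballI compact_PiE_Icc)
qed

lemma sets_line: "sets line = sigma_sets I (range (\<lambda>(c, d). I \<inter> {c<..<d}))"
proof -
  have borel: "sets borel = sigma_sets UNIV (range (\<lambda>(c, d). {c<..<d :: real}))"
    by (subst borel_eq_box) (simp add: case_prod_unfold)
  have "sets line = (\<inter>) I ` sigma_sets UNIV (range (\<lambda>(c, d). {c<..<d}))"
    by (simp add: sets_restrict_space borel)
  also have "\<dots> = sigma_sets I ((\<inter>) I ` range (\<lambda>(c, d). {c<..<d}))"
    using I_borel borel by (intro sigma_sets_Int) auto
  also have "(\<inter>) I ` range (\<lambda>(c, d). {c<..<d}) = range (\<lambda>(c, d). I \<inter> {c<..<d})"
    by (auto simp: image_iff)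
  finally show ?thesis .
qed

lemma sets_bcube:
  "sets (bcube n) = sigma_sets (\<Pi>\<^sub>E i\<in>{..<n}. I)
     (range (\<lambda>(c, d). \<Pi>\<^sub>E i\<in>{..<n}. I \<inter> {c i<..<d i :: real}))"
proof -
  have box: "(\<Pi>\<^sub>E i\<in>{..<n}. I \<inter> {c i<..<d i}) = {f\<in>(\<Pi>\<^sub>E i\<in>{..<n}. I). \<forall>i\<in>{..<n}. f i \<in> I \<inter> {c i<..<d i}}"
    for c d :: "nat \<Rightarrow> real"
    unfolding PiE_def Pi_def by blast
  define E where "E = range (\<lambda>(c, d). I \<inter> {c<..<d :: real})"
  have E: "E \<subseteq> Pow I" by (auto simp: E_def)
  have IE: "I \<in> E" unfolding E_def
    using subset_closed by (intro image_eqI[of _ _ "(a - 1, a + 2)"]) auto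
  have "sets (bcube n) = sets (\<Pi>\<^sub>M i\<in>{..<n}. sigma I E)"
    using E by (intro sets_PiM_cong) (auto simp: sets_line E_def)
  also have "\<dots> = sets (sigma (\<Pi>\<^sub>E i\<in>{..<n}. I)
      {{f\<in>(\<Pi>\<^sub>E i\<in>{..<n}. I). \<forall>i\<in>j. f i \<in> A i} | A j. j \<in> {{..<n}} \<and> A \<in> Pi j (\<lambda>_. E)})"
    using E IE by (intro sets_PiM_sigma) (auto intro!: exI[of _ "{I}"])
  also have "{{f\<in>(\<Pi>\<^sub>E i\<in>{..<n}. I). \<forall>i\<in>j. f i \<in> A i} | A j. j \<in> {{..<n}} \<and> A \<in> Pi j (\<lambda>_. E)}
      = range (\<lambda>(c, d). \<Pi>\<^sub>E i\<in>{..<n}. I \<inter> {c i<..<d i})" (is "?L = ?R")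
  proof (intro set_eqI iffI)
    fix S assume "S \<in> ?L"
    then obtain A where S: "S = {f\<in>(\<Pi>\<^sub>E i\<in>{..<n}. I). \<forall>i\<in>{..<n}. f i \<in> A i}" and A: "\<forall>i<n. A i \<in> E"
      by auto
    have "\<forall>i. \<exists>c d. i < n \<longrightarrow> A i = I \<inter> {c<..<d}" using A by (fastforce simp: E_def)
    then obtain c d where cd: "\<And>i. i < n \<Longrightarrow> A i = I \<inter> {c i<..<d i}" by metis
    have "S = (\<Pi>\<^sub>E i\<in>{..<n}. I \<inter> {c i<..<d i})"
      unfolding S box by (rule Collect_cong) (use cd in \<open>auto dest: PiE_mem\<close>)
    then show "S \<in> ?R" by (intro image_eqI[of _ _ "(c, d)"]) auto
  next
    fix S assume "S \<in> ?R"
    then obtain c d where S: "S = (\<Pi>\<^sub>E i\<in>{..<n}. I \<inter> {c i<..<d i})" by auto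
    then have "S = {f\<in>(\<Pi>\<^sub>E i\<in>{..<n}. I). \<forall>i\<in>{..<n}. f i \<in> I \<inter> {c i<..<d i}}"
      by (simp only: box)
    moreover have "(\<lambda>i. I \<inter> {c i<..<d i}) \<in> Pi {..<n} (\<lambda>_. E)" by (auto simp: E_def)
    ultimately show "S \<in> ?L" unfolding mem_Collect_eq
      by (intro exI[of _ "\<lambda>i. I \<inter> {c i<..<d i}"] exI[of _ "{..<n}"] conjI) auto
  qed
  also have "sets (sigma (\<Pi>\<^sub>E i\<in>{..<n}. I) ?R) = sigma_sets (\<Pi>\<^sub>E i\<in>{..<n}. I) ?R"
    by (intro sets_measure_of) (auto simp: PiE_def Pi_def)
  finally show ?thesis .
qed

lemma measurable_prod_coord:
  assumes "\<And>i. i < n \<Longrightarrow> B i \<in> borel_measurable borel"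
  shows "(\<lambda>x. \<Prod>j<n. B j (x j) :: real) \<in> borel_measurable (bcube n)"
proof (rule borel_measurable_prod)
  fix j assume "j \<in> {..<n}"
  then have "(\<lambda>x. x j) \<in> measurable (bcube n) line" by simp
  then have "(\<lambda>x. x j) \<in> measurable (bcube n) borel"
    using measurable_comp[OF _ measurable_line_borel(2)] by (simp add: comp_def)
  then show "(\<lambda>x. B j (x j)) \<in> borel_measurable (bcube n)"
    using assms \<open>j \<in> {..<n}\<close> by (auto intro: measurable_compose)
qed

text \<open>The fundamental lemma of the calculus of variations, for test functions of product form. Bumps
  converge boundedly to indicators of intervals, so the integrals of \<open>h\<close> over all boxes vanish; thus
  the positive and the negative part of \<open>h\<close> are densities of measures agreeing on boxes.\<close>

lemma fundamental_lemma:
  assumes h: "integrable (bcube n) h" and sub: "a \<le> \<alpha>" "\<beta> \<le> a + 1"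
    and orth: "\<And>B. (\<And>i. i < n \<Longrightarrow> smooth_supported \<alpha> \<beta> (B i)) \<Longrightarrow>
      (\<integral>x. h x * (\<Prod>j<n. B j (x j)) \<partial>bcube n) = 0"
  shows "AE x in bcube n. x \<in> (\<Pi>\<^sub>E i\<in>{..<n}. {\<alpha><..<\<beta>}) \<longrightarrow> h x = 0"
proof -
  interpret bcube: prob_space "bcube n" by (rule prob_space_bcube)
  define Q where "Q c d = (\<Pi>\<^sub>E i\<in>{..<n}. I \<inter> {c i<..<d i})" for c d :: "nat \<Rightarrow> real"
  have Q_sets [measurable]: "Q c d \<in> sets (bcube n)" for c d
    unfolding Q_def by (intro sets_PiM_I_finite) (auto simp: sets_restrict_space)
  have [measurable]: "h \<in> borel_measurable (bcube n)" using h by simp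
  have box0: "(\<integral>x. h x * indicator (Q c d) x \<partial>bcube n) = 0"
    if cd: "\<And>i. i < n \<Longrightarrow> \<alpha> \<le> c i \<and> d i \<le> \<beta>" for c d
  proof (cases "\<forall>i<n. c i < d i")
    case False
    then have "\<exists>i\<in>{..<n}. I \<inter> {c i<..<d i} = {}" by (metis Int_empty_right greaterThanLessThan_empty_iff lessThan_iff not_le)
    then have "Q c d = {}" unfolding Q_def by (simp add: PiE_eq_empty_iff)
    then show ?thesis by simp
  next
    case True
    have Bm: "\<And>i. i < n \<Longrightarrow> smooth_supported \<alpha> \<beta> (bump (c i) (d i) m)" for m
      using True cd by (intro smooth_supported_bump) auto
    then have [measurable]: "(\<lambda>x. \<Prod>j<n. bump (c j) (d j) m (x j)) \<in> borel_measurable (bcube n)" for m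
      by (intro measurable_prod_coord smooth_measurable) (auto simp: smooth_supported_def)
    have "(\<lambda>m. \<integral>x. h x * (\<Prod>j<n. bump (c j) (d j) m (x j)) \<partial>bcube n)
        \<longlonglongrightarrow> (\<integral>x. h x * indicator (Q c d) x \<partial>bcube n)"
    proof (rule integral_dominated_convergence[where w = "\<lambda>x. \<bar>h x\<bar>"])
      show "AE x in bcube n. (\<lambda>m. h x * (\<Prod>j<n. bump (c j) (d j) m (x j))) \<longlonglongrightarrow> h x * indicator (Q c d) x"
      proof (rule AE_I2)
        fix x assume x: "x \<in> space (bcube n)"
        have "(\<lambda>m. \<Prod>j<n. bump (c j) (d j) m (x j)) \<longlonglongrightarrow> (\<Prod>j<n. indicator {c j<..<d j} (x j))"
          using True by (intro tendsto_prod bump_tendsto) auto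
        moreover have "(\<Prod>j<n. indicator {c j<..<d j} (x j)) = (indicator (Q c d) x :: real)"
          using x by (auto simp: indicator_def Q_def space_bcube PiE_iff prod_eq_1_iff intro!: prod_zero)
        ultimately show "(\<lambda>m. h x * (\<Prod>j<n. bump (c j) (d j) m (x j))) \<longlonglongrightarrow> h x * indicator (Q c d) x"
          by (intro tendsto_mult tendsto_const) simp
      qed
      show "AE x in bcube n. norm (h x * (\<Prod>j<n. bump (c j) (d j) m (x j))) \<le> \<bar>h x\<bar>" for m
      proof (rule AE_I2)
        fix x
        have "\<bar>\<Prod>j<n. bump (c j) (d j) m (x j)\<bar> \<le> 1"
          by (simp add: abs_prod bump_bounds prod_le_1)
        then show "norm (h x * (\<Prod>j<n. bump (c j) (d j) m (x j))) \<le> \<bar>h x\<bar>"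
          by (simp add: abs_mult mult_left_le)
      qed
    qed (use h in auto)
    moreover have "(\<integral>x. h x * (\<Prod>j<n. bump (c j) (d j) m (x j)) \<partial>bcube n) = 0" for m
      by (rule orth[of "\<lambda>j. bump (c j) (d j) m"]) (rule Bm)
    ultimately show ?thesis using LIMSEQ_unique[OF _ tendsto_const] by auto
  qed
  define G where "G = Q (\<lambda>_. \<alpha>) (\<lambda>_. \<beta>)"
  have [measurable]: "G \<in> sets (bcube n)" by (simp add: G_def)
  define D where "D s = density (bcube n) (\<lambda>x. ennreal (s * h x) * indicator G x)" for s :: real
  have eq: "D 1 = D (- 1)"
  proof (rule measure_eqI_generator_eq[where E = "range (\<lambda>(c, d). Q c d)"
        and \<Omega> = "\<Pi>\<^sub>E i\<in>{..<n}. I" and A = "\<lambda>_. Q (\<lambda>_. a - 1) (\<lambda>_. a + 2)"])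
    have int: "Q c d \<inter> Q c' d' = Q (\<lambda>i. max (c i) (c' i)) (\<lambda>i. min (d i) (d' i))" for c d c' d'
      unfolding Q_def PiE_Int by (rule PiE_cong) auto
    have in_range: "Q c d \<in> range (\<lambda>(c, d). Q c d)" for c d
      by (rule image_eqI[of _ _ "(c, d)"]) auto
    show "Int_stable (range (\<lambda>(c, d). Q c d))"
    proof (rule Int_stableI)
      fix X Y assume "X \<in> range (\<lambda>(c, d). Q c d)" "Y \<in> range (\<lambda>(c, d). Q c d)"
      then show "X \<inter> Y \<in> range (\<lambda>(c, d). Q c d)"
        by (elim rangeE) (simp only: case_prod_unfold int in_range[unfolded case_prod_unfold])
    qed
    fix X assume "X \<in> range (\<lambda>(c, d). Q c d)"
    then obtain c d where X: "X = Q c d" by auto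
    have GX: "G \<inter> X = Q (\<lambda>i. max \<alpha> (c i)) (\<lambda>i. min \<beta> (d i))" unfolding G_def X int ..
    have emD: "emeasure (D s) X = (\<integral>\<^sup>+x. ennreal (s * (h x * indicator (G \<inter> X) x)) \<partial>bcube n)" for s
      unfolding D_def X
      by (subst emeasure_density) (auto intro!: nn_integral_cong simp: indicator_def X)
    have int_h: "integrable (bcube n) (\<lambda>x. h x * indicator (G \<inter> X) x)"
      using h unfolding GX by (intro integrable_real_mult_indicator) auto
    have z: "(\<integral>x. h x * indicator (G \<inter> X) x \<partial>bcube n) = 0"
      unfolding GX by (rule box0) auto
    have emD': "emeasure (D 1) X = (\<integral>\<^sup>+x. ennreal (h x * indicator (G \<inter> X) x) \<partial>bcube n)"
      "emeasure (D (- 1)) X = (\<integral>\<^sup>+x. ennreal (- (h x * indicator (G \<inter> X) x)) \<partial>bcube n)"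
      unfolding emD by (simp_all only: mult_1 mult_minus1)
    have "0 = enn2real (emeasure (D 1) X) - enn2real (emeasure (D (- 1)) X)"
      using z real_lebesgue_integral_def[OF int_h] unfolding emD' by linarith
    moreover have "emeasure (D 1) X < \<infinity>" "emeasure (D (- 1)) X < \<infinity>"
      using int_h unfolding emD' real_integrable_def infinity_ennreal_def less_top[symmetric] by blast+
    ultimately show "emeasure (D 1) X = emeasure (D (- 1)) X"
      by (metis eq_iff_diff_eq_0[symmetric] ennreal_enn2real infinity_ennreal_def)
  next
    show "sets (D 1) = sigma_sets (\<Pi>\<^sub>E i\<in>{..<n}. I) (range (\<lambda>(c, d). Q c d))"
      "sets (D (- 1)) = sigma_sets (\<Pi>\<^sub>E i\<in>{..<n}. I) (range (\<lambda>(c, d). Q c d))"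
      by (simp_all add: D_def sets_bcube Q_def)
    have "I \<inter> {a - 1<..<a + 2} = I" using subset_closed by force
    then show "(\<Union>i::nat. Q (\<lambda>_. a - 1) (\<lambda>_. a + 2)) = (\<Pi>\<^sub>E i\<in>{..<n}. I)" by (simp add: Q_def)
    have "emeasure (D 1) (Q (\<lambda>_. a - 1) (\<lambda>_. a + 2)) \<le> (\<integral>\<^sup>+x. ennreal (norm (h x)) \<partial>bcube n)"
      unfolding D_def
      by (subst emeasure_density) (auto intro!: nn_integral_mono simp: indicator_def ennreal_leI)
    also have "\<dots> < \<infinity>" using h by (simp add: integrable_iff_bounded)
    finally show "emeasure (D 1) (Q (\<lambda>_. a - 1) (\<lambda>_. a + 2)) \<noteq> \<infinity>" by simp
    show "range (\<lambda>(c, d). Q c d) \<subseteq> Pow (\<Pi>\<^sub>E i\<in>{..<n}. I)"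
      by (auto simp: Q_def PiE_def Pi_def)
    show "range (\<lambda>i::nat. Q (\<lambda>_. a - 1) (\<lambda>_. a + 2)) \<subseteq> range (\<lambda>(c, d). Q c d)"
      by (intro image_subsetI image_eqI[of _ _ "(\<lambda>_. a - 1, \<lambda>_. a + 2)"]) auto
  qed
  have "AE x in bcube n. ennreal (1 * h x) * indicator G x = ennreal (- 1 * h x) * indicator G x"
    using eq unfolding D_def by (intro bcube.density_unique) auto
  then show ?thesis
  proof (rule AE_mp, intro AE_I2 impI)
    fix x assume x: "x \<in> space (bcube n)" "x \<in> (\<Pi>\<^sub>E i\<in>{..<n}. {\<alpha><..<\<beta>})"
      and eq: "ennreal (1 * h x) * indicator G x = ennreal (- 1 * h x) * indicator G x"
    have "x \<in> G" using x by (auto simp: G_def Q_def space_bcube PiE_iff)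
    then have "ennreal (h x) = ennreal (- h x)" using eq by simp
    then show "h x = 0"
      by (cases "h x \<ge> 0") (auto simp: ennreal_neg ennreal_eq_0_iff dest!: sym[of "0::ennreal"])
  qed
qed

end

section \<open>Weakly differentiable functions on lines\<close>

lemma smooth_supported_measurable: "smooth_supported \<alpha> \<beta> f \<Longrightarrow> f \<in> borel_measurable borel"
  by (simp add: smooth_supported_def smooth_measurable)

context unit_interval
begin

lemma integral_line_continuous:
  fixes f :: "real \<Rightarrow> real"
  assumes "continuous_on UNIV f"
  shows "integrable line f" "(\<integral>t. f t \<partial>line) = integral {a..a + 1} f"
proof -
  have f[measurable]: "f \<in> borel_measurable borel" by (rule borel_measurable_continuous_onI[OF assms])
  have si: "set_integrable lborel {a..a + 1} f"
    unfolding set_integrable_def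
    by (rule borel_integrable_compact[OF compact_Icc continuous_on_subset[OF assms subset_UNIV]])
  have ae: "AE t in lborel. indicator I t *\<^sub>R f t = indicator {a..a + 1} t *\<^sub>R f t"
  proof -
    have "AE t in lborel. t \<noteq> a \<and> t \<noteq> a + 1"
      using AE_lborel_singleton[of a] AE_lborel_singleton[of "a + 1"] by eventually_elim auto
    then show ?thesis
    proof eventually_elim
      case (elim t)
      then have "t \<in> I \<longleftrightarrow> t \<in> {a..a + 1}" using open_subset subset_closed by force
      then show ?case by (simp add: indicator_def)
    qed
  qed
  have "integrable lborel (\<lambda>t. indicator I t *\<^sub>R f t)"
    using si unfolding set_integrable_def
    by (rule integrable_cong_AE_imp) (use ae in \<open>auto elim: eventually_mono\<close>)
  then show "integrable line f" by (simp add: integrable_restrict_space)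
  have "(\<integral>t. f t \<partial>line) = (\<integral>t. indicator I t *\<^sub>R f t \<partial>lborel)"
    by (simp add: integral_restrict_space)
  also have "\<dots> = (\<integral>t. indicator {a..a + 1} t *\<^sub>R f t \<partial>lborel)"
    by (rule integral_cong_AE) (use ae in auto)
  also have "\<dots> = integral {a..a + 1} f"
    using set_borel_integral_eq_integral(2)[OF si] by (simp add: set_lebesgue_integral_def)
  finally show "(\<integral>t. f t \<partial>line) = integral {a..a + 1} f" .
qed

lemma exists_mollifier: "\<exists>\<omega>. smooth_supported a (a + 1) \<omega> \<and> (\<integral>t. \<omega> t \<partial>line) = 1"
proof -
  let ?b = "\<lambda>m. bump a (a + 1) m"
  have b: "smooth_supported a (a + 1) (?b m)" for m by (rule smooth_supported_bump) auto
  then have [measurable]: "?b m \<in> borel_measurable borel" for m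
    by (intro smooth_measurable) (simp add: smooth_supported_def)
  have "(\<lambda>m. \<integral>t. ?b m t \<partial>line) \<longlonglongrightarrow> (\<integral>t. indicator {a<..<a + 1} t \<partial>line)"
    by (rule integral_dominated_convergence[where w = "\<lambda>_. 1"])
       (auto simp: bump_tendsto bump_bounds intro: measurable_restrict_space1)
  moreover have "(\<integral>t. indicator {a<..<a + 1} t \<partial>line) = (\<integral>t. 1 \<partial>line :: real)"
    using AE_line_interior
    by (intro integral_cong_AE) (auto intro: measurable_restrict_space1 elim: eventually_mono)
  ultimately have "(\<lambda>m. \<integral>t. ?b m t \<partial>line) \<longlonglongrightarrow> 1" using line.prob_space by simp
  then have "eventually (\<lambda>m. 0 < (\<integral>t. ?b m t \<partial>line)) sequentially" by (rule order_tendstoD) simp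
  then obtain m where m: "0 < (\<integral>t. ?b m t \<partial>line)"
    using eventually_happens[of _ sequentially] by (metis (no_types, lifting) sequentially_bot)
  define r where "r = inverse (\<integral>t. ?b m t \<partial>line)"
  have "smooth_supported a (a + 1) (\<lambda>t. ?b m t + (r - 1) * ?b m t)"
    by (intro smooth_supported_linear b)
  moreover have "(\<lambda>t. ?b m t + (r - 1) * ?b m t) = (\<lambda>t. r * ?b m t)" by (auto simp: algebra_simps)
  ultimately show ?thesis using m by (intro exI[of _ "\<lambda>t. r * ?b m t"]) (auto simp: r_def)
qed

text \<open>By Fubini, since the integral of \<open>\<theta>'\<close> over \<open>[\<tau>, a + 1]\<close> is \<open>- \<theta>(\<tau>)\<close>.\<close>

lemma integral_primitive_by_parts:
  assumes \<gamma>: "integrable line \<gamma>" and \<theta>: "smooth_supported a (a + 1) \<theta>"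
  shows "(\<integral>t. (\<integral>\<tau>. \<gamma> \<tau> * indicator {..t} \<tau> \<partial>line) * deriv \<theta> t \<partial>line) = - (\<integral>\<tau>. \<gamma> \<tau> * \<theta> \<tau> \<partial>line)"
proof -
  interpret pair: pair_prob_space line line ..
  have sm: "smooth \<theta>" "smooth (deriv \<theta>)"
    using \<theta> smooth_supported_deriv[OF \<theta>] by (auto simp: smooth_supported_def)
  obtain C where C: "\<And>t. \<bar>deriv \<theta> t\<bar> \<le> C"
    using smooth_supported_bounded[OF smooth_supported_deriv[OF \<theta>]] by blast
  have [measurable]: "deriv \<theta> \<in> borel_measurable borel" "\<gamma> \<in> borel_measurable line"
    using sm \<gamma> by (auto intro: smooth_measurable)
  have [measurable]: "deriv \<theta> \<in> borel_measurable line" by (rule measurable_restrict_space1) simp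
  have "integrable (line \<Otimes>\<^sub>M line) (\<lambda>p. C * \<gamma> (snd p))"
  proof -
    have "integrable (line \<Otimes>\<^sub>M line) (\<lambda>p. \<gamma> (fst p))"
      using integrable_distr[OF measurable_fst, of line line \<gamma>, unfolded line.distr_pair_fst] \<gamma> by blast
    from pair.integrable_product_swap[OF this]
    have "integrable (line \<Otimes>\<^sub>M line) (\<lambda>p. \<gamma> (snd p))" by (simp add: case_prod_unfold)
    then show ?thesis by simp
  qed
  then have int: "integrable (line \<Otimes>\<^sub>M line) (case_prod (\<lambda>t \<tau>. \<gamma> \<tau> * indicator {..t} \<tau> * deriv \<theta> t))"
  proof (rule Bochner_Integration.integrable_bound)
    show "AE p in line \<Otimes>\<^sub>M line. norm ((case p of (t, \<tau>) \<Rightarrow> \<gamma> \<tau> * indicator {..t} \<tau> * deriv \<theta> t)) \<le> norm (C * \<gamma> (snd p))"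
    proof (rule AE_I2, clarsimp simp: abs_mult)
      fix t \<tau> show "\<bar>\<gamma> \<tau>\<bar> * indicator {..t} \<tau> * \<bar>deriv \<theta> t\<bar> \<le> \<bar>C\<bar> * \<bar>\<gamma> \<tau>\<bar>"
        using mult_left_mono[OF order_trans[OF C[of t] abs_ge_self[of C]], of "\<bar>\<gamma> \<tau>\<bar>"]
        by (simp add: indicator_def mult.commute)
    qed
    have [measurable]: "(\<lambda>p. fst p) \<in> borel_measurable (line \<Otimes>\<^sub>M line)"
      "(\<lambda>p. snd p) \<in> borel_measurable (line \<Otimes>\<^sub>M line)"
      by (auto intro: measurable_compose[OF measurable_fst measurable_line_borel(2)]
        measurable_compose[OF measurable_snd measurable_line_borel(2)])
    have "(\<lambda>p. if snd p \<le> fst p then 1 else 0 :: real) \<in> borel_measurable (line \<Otimes>\<^sub>M line)"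
      by measurable
    then have "(\<lambda>p. indicator {..fst p} (snd p) :: real) \<in> borel_measurable (line \<Otimes>\<^sub>M line)"
      by (simp add: indicator_def of_bool_def)
    then show "(\<lambda>(t, \<tau>). \<gamma> \<tau> * indicator {..t} \<tau> * deriv \<theta> t) \<in> borel_measurable (line \<Otimes>\<^sub>M line)"
      unfolding case_prod_unfold by measurable
  qed
  have "(\<integral>t. (\<integral>\<tau>. \<gamma> \<tau> * indicator {..t} \<tau> \<partial>line) * deriv \<theta> t \<partial>line)
      = (\<integral>t. (\<integral>\<tau>. \<gamma> \<tau> * indicator {..t} \<tau> * deriv \<theta> t \<partial>line) \<partial>line)"
    by simp
  also have "\<dots> = (\<integral>\<tau>. (\<integral>t. \<gamma> \<tau> * indicator {..t} \<tau> * deriv \<theta> t \<partial>line) \<partial>line)"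
    by (rule pair.Fubini_integral[OF int, symmetric])
  also have "\<dots> = (\<integral>\<tau>. - (\<gamma> \<tau> * \<theta> \<tau>) \<partial>line)"
  proof (rule integral_cong_AE)
    show "AE \<tau> in line. (\<integral>t. \<gamma> \<tau> * indicator {..t} \<tau> * deriv \<theta> t \<partial>line) = - (\<gamma> \<tau> * \<theta> \<tau>)"
      using AE_line_interior
    proof eventually_elim
      case (elim \<tau>)
      obtain c d where cd: "d < a + 1" "\<And>t. t \<notin> {c..d} \<Longrightarrow> \<theta> t = 0"
        using smooth_supportedD[OF \<theta>] by blast
      have si: "set_integrable lborel {\<tau>..a + 1} (deriv \<theta>)"
        unfolding set_integrable_def
        by (rule borel_integrable_compact[OF compact_Icc continuous_on_subset[OF smooth_continuous[OF sm(2)] subset_UNIV]])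
      have "(\<integral>t. indicator {..t} \<tau> * deriv \<theta> t \<partial>line) = (\<integral>t. indicator I t *\<^sub>R (indicator {..t} \<tau> * deriv \<theta> t) \<partial>lborel)"
        by (simp add: integral_restrict_space)
      also have "\<dots> = (\<integral>t. indicator {\<tau>..a + 1} t *\<^sub>R deriv \<theta> t \<partial>lborel)"
      proof (rule integral_cong_AE)
        have "AE t in lborel. t \<noteq> a + 1" by (rule AE_lborel_singleton)
        then show "AE t in lborel. indicator I t *\<^sub>R (indicator {..t} \<tau> * deriv \<theta> t) = indicator {\<tau>..a + 1} t *\<^sub>R deriv \<theta> t"
        proof eventually_elim
          case (elim t)
          have "t \<in> I \<and> \<tau> \<le> t \<longleftrightarrow> t \<in> {\<tau>..a + 1}"
            using elim \<open>\<tau> \<in> {a<..<a + 1}\<close> open_subset subset_closed by force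
          then show ?case by (auto simp: indicator_def)
        qed
        have "indicator {..t} \<tau> = (indicator {\<tau>..} t :: real)" for t by (simp add: indicator_def)
        then show "(\<lambda>t. indicator I t *\<^sub>R (indicator {..t} \<tau> * deriv \<theta> t)) \<in> borel_measurable lborel"
          using I_borel smooth_measurable[OF sm(2)]
          by (simp only:) (intro borel_measurable_scaleR borel_measurable_times; simp)
      qed simp
      also have "\<dots> = integral {\<tau>..a + 1} (deriv \<theta>)"
        using set_borel_integral_eq_integral(2)[OF si] by (simp add: set_lebesgue_integral_def)
      also have "\<dots> = \<theta> (a + 1) - \<theta> \<tau>"
      proof (rule integral_unique, rule fundamental_theorem_of_calculus)
        show "\<tau> \<le> a + 1" using elim by simp
        show "(\<theta> has_vector_derivative deriv \<theta> t) (at t within {\<tau>..a + 1})" for t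
          using smooth_DERIV[OF sm(1), of t]
          by (simp add: has_real_derivative_iff_has_vector_derivative has_vector_derivative_at_within)
      qed
      also have "\<theta> (a + 1) = 0" using cd by auto
      finally show ?case by (simp add: mult.assoc)
    qed
    show "(\<lambda>\<tau>. \<integral>t. \<gamma> \<tau> * indicator {..t} \<tau> * deriv \<theta> t \<partial>line) \<in> borel_measurable line"
      using pair.integrable_snd[OF int] by simp
    have "\<theta> \<in> borel_measurable line" using sm(1) by (intro measurable_restrict_space1) (simp add: smooth_measurable)
    then show "(\<lambda>\<tau>. - (\<gamma> \<tau> * \<theta> \<tau>)) \<in> borel_measurable line" by simp
  qed
  also have "\<dots> = - (\<integral>\<tau>. \<gamma> \<tau> * \<theta> \<tau> \<partial>line)" by simp
  finally show ?thesis .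
qed

text \<open>Averaging \<open>\<bar>g\<bar>\<close> in direction \<open>k\<close> preserves its integral over the cube, because the lines have length one.\<close>

lemma integrable_line_average:
  fixes F :: "(nat \<Rightarrow> real) \<Rightarrow> real \<Rightarrow> real"
  assumes k: "k < n" and g: "integrable (bcube n) g"
    and F: "(\<lambda>p. F (fst p) (snd p)) \<in> borel_measurable (bcube n \<Otimes>\<^sub>M line)"
    and le: "\<And>x \<tau>. \<bar>F x \<tau>\<bar> \<le> C * \<bar>g (x(k := \<tau>))\<bar>"
  shows "integrable (bcube n) (\<lambda>x. \<integral>\<tau>. F x \<tau> \<partial>line)"
proof (rule integrableI_bounded)
  interpret bcube: prob_space "bcube n" by (rule prob_space_bcube)
  show "(\<lambda>x. \<integral>\<tau>. F x \<tau> \<partial>line) \<in> borel_measurable (bcube n)"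
    using F by (intro line.borel_measurable_lebesgue_integral) (simp add: case_prod_unfold)
  have [measurable]: "g \<in> borel_measurable (bcube n)" using g by simp
  have "(\<integral>\<^sup>+x. norm (\<integral>\<tau>. F x \<tau> \<partial>line) \<partial>bcube n)
      \<le> (\<integral>\<^sup>+x. (\<integral>\<^sup>+\<tau>. ennreal (C * \<bar>g (x(k := \<tau>))\<bar>) \<partial>line) \<partial>bcube n)"
  proof (rule nn_integral_mono)
    fix x
    show "ennreal (norm (\<integral>\<tau>. F x \<tau> \<partial>line)) \<le> (\<integral>\<^sup>+\<tau>. ennreal (C * \<bar>g (x(k := \<tau>))\<bar>) \<partial>line)"
    proof (cases "integrable line (F x)")
      case True
      then have "ennreal (norm (\<integral>\<tau>. F x \<tau> \<partial>line)) \<le> (\<integral>\<^sup>+\<tau>. norm (F x \<tau>) \<partial>line)"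
        by (rule integral_norm_bound_ennreal)
      also have "\<dots> \<le> (\<integral>\<^sup>+\<tau>. ennreal (C * \<bar>g (x(k := \<tau>))\<bar>) \<partial>line)"
        using le by (intro nn_integral_mono ennreal_leI) simp
      finally show ?thesis .
    qed (simp add: not_integrable_integral_eq)
  qed
  also have "\<dots> = (\<integral>\<^sup>+x. ennreal (C * \<bar>g x\<bar>) \<partial>bcube n)"
    by (rule nn_integral_bcube_update[OF k]) measurable
  also have "\<dots> \<le> (\<integral>\<^sup>+x. ennreal (norm (C * g x)) \<partial>bcube n)"
    by (intro nn_integral_mono ennreal_leI) (simp add: abs_mult mult_right_mono)
  also have "\<dots> < \<infinity>" using integrable_mult_right[OF g, of C] unfolding integrable_iff_bounded by blast
  finally show "(\<integral>\<^sup>+x. norm (\<integral>\<tau>. F x \<tau> \<partial>line) \<partial>bcube n) < \<infinity>" .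
qed

lemma measurable_coord:
  assumes "i < n"
  shows "(\<lambda>x. x i) \<in> borel_measurable (bcube n)"
proof -
  have "(\<lambda>x. x i) \<in> measurable (bcube n) line" using assms by simp
  from measurable_comp[OF this measurable_line_borel(2)] show ?thesis by (simp add: comp_def)
qed

lemma AE_bcube_interior: "AE x in bcube n. x \<in> (\<Pi>\<^sub>E i\<in>{..<n}. {a<..<a + 1})"
proof -
  have "AE x in bcube n. \<forall>i\<in>{..<n}. x i \<in> {a<..<a + 1}"
    by (intro AE_finite_allI AE_PiM_component prob_space_line AE_line_interior) auto
  moreover have "AE x in bcube n. x \<in> space (bcube n)" by (rule AE_space)
  ultimately show ?thesis by eventually_elim (simp add: space_bcube PiE_iff)
qed

text \<open>The second factor does not depend on \<open>t\<close>: the coordinate \<open>k\<close>, to which an arbitrary value \<open>a\<close> is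
  given, does not occur in it.\<close>

lemma prod_split_coord:
  fixes B :: "nat \<Rightarrow> real \<Rightarrow> real"
  assumes "k < n"
  shows "(\<Prod>j<n. (B(k := f)) j (insert_coord n k y t j))
    = f t * (\<Prod>j\<in>{..<n} - {k}. B j (insert_coord n k y a j))"
proof -
  have "(\<Prod>j<n. (B(k := f)) j (insert_coord n k y t j))
      = f t * (\<Prod>j\<in>{..<n} - {k}. (B(k := f)) j (insert_coord n k y t j))"
    using assms by (subst prod.remove[of _ k]) (auto simp: insert_coord_same)
  also have "(\<Prod>j\<in>{..<n} - {k}. (B(k := f)) j (insert_coord n k y t j))
      = (\<Prod>j\<in>{..<n} - {k}. B j (insert_coord n k y a j))"
    by (rule prod.cong) (auto simp: insert_coord_def)
  finally show ?thesis .
qed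

lemma integrable_mult_prod:
  assumes g: "integrable (bcube n) g" and B: "\<And>i. i < n \<Longrightarrow> smooth_supported a (a + 1) (B i)"
  shows "integrable (bcube n) (\<lambda>x. g x * (\<Prod>j<n. B j (x j)))"
proof -
  have "\<forall>i. \<exists>C. i < n \<longrightarrow> (\<forall>t. \<bar>B i t\<bar> \<le> C)" using smooth_supported_bounded[OF B] by blast
  then obtain C where C: "\<And>i t. i < n \<Longrightarrow> \<bar>B i t\<bar> \<le> C i" by metis
  have [measurable]: "(\<lambda>x. \<Prod>j<n. B j (x j)) \<in> borel_measurable (bcube n)"
    using B by (intro measurable_prod_coord smooth_measurable) (auto simp: smooth_supported_def)
  show ?thesis
  proof (rule Bochner_Integration.integrable_bound)
    show "integrable (bcube n) (\<lambda>x. (\<Prod>j<n. C j) * g x)" using g by simp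
    show "AE x in bcube n. norm (g x * (\<Prod>j<n. B j (x j))) \<le> norm ((\<Prod>j<n. C j) * g x)"
    proof (rule AE_I2)
      fix x
      have "\<bar>\<Prod>j<n. B j (x j)\<bar> \<le> (\<Prod>j<n. C j)"
        unfolding abs_prod by (intro prod_mono) (auto intro: C)
      also have "\<dots> \<le> \<bar>\<Prod>j<n. C j\<bar>" by simp
      finally show "norm (g x * (\<Prod>j<n. B j (x j))) \<le> norm ((\<Prod>j<n. C j) * g x)"
        unfolding real_norm_def abs_mult by (subst mult.commute) (rule mult_right_mono, auto)
    qed
  qed (use g in auto)
qed

text \<open>On almost every line in direction \<open>k\<close>, a function with integrable weak derivative \<open>g\<close> is almost
  everywhere an indefinite integral of \<open>g\<close>. Subtracting the integral of \<open>g\<close> leaves a function \<open>W\<close> with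
  vanishing weak derivative. A test function \<open>\<zeta>\<close> of one variable is the derivative of a test function
  up to a multiple of a fixed \<open>\<omega>\<close>, so \<open>W\<close> minus its \<open>\<omega>\<close>-average along the lines is orthogonal to all
  test functions.\<close>

lemma weak_derivative_primitive:
  assumes k: "k < n" and u: "integrable (bcube n) u" and g: "integrable (bcube n) g"
    and weak: "\<And>B. (\<And>i. i < n \<Longrightarrow> smooth_supported a (a + 1) (B i)) \<Longrightarrow>
      (\<integral>x. u x * (\<Prod>j<n. (B(k := deriv (B k))) j (x j)) \<partial>bcube n) = - (\<integral>x. g x * (\<Prod>j<n. B j (x j)) \<partial>bcube n)"
  shows "AE y in bcube (n - 1). \<exists>c. AE t in line.
    u (insert_coord n k y t) = c + (\<integral>\<tau>. g (insert_coord n k y \<tau>) * indicator {..t} \<tau> \<partial>line)"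
proof -
  interpret bcube: prob_space "bcube m" for m by (rule prob_space_bcube)
  let ?ins = "insert_coord n k"
  have [measurable]: "u \<in> borel_measurable (bcube n)" "g \<in> borel_measurable (bcube n)" using u g by auto
  note [measurable] = measurable_update[OF k]
  have upd: "(?ins y t)(k := \<tau>) = ?ins y \<tau>" for y t \<tau> by (rule insert_coord_update[OF k])
  define G where "G x = (\<integral>\<tau>. g (x(k := \<tau>)) * indicator {..x k} \<tau> \<partial>line)" for x
  have G_ins: "G (?ins y t) = (\<integral>\<tau>. g (?ins y \<tau>) * indicator {..t} \<tau> \<partial>line)" for y t
    by (simp add: G_def upd insert_coord_same[OF k])
  have int_G: "integrable (bcube n) G"
    unfolding G_def
  proof (rule integrable_line_average[OF k g, where C = 1])
    have "(\<lambda>p. fst p k) \<in> measurable (bcube n \<Otimes>\<^sub>M line) line"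
      using k by (intro measurable_compose[OF measurable_fst measurable_component_singleton]) simp
    then have [measurable]: "(\<lambda>p. fst p k) \<in> borel_measurable (bcube n \<Otimes>\<^sub>M line)"
      "(\<lambda>p. snd p) \<in> borel_measurable (bcube n \<Otimes>\<^sub>M line)"
      by (auto intro: measurable_compose[OF _ measurable_line_borel(2)])
    have "(\<lambda>p. if snd p \<le> fst p k then 1 else 0 :: real) \<in> borel_measurable (bcube n \<Otimes>\<^sub>M line)"
      by measurable
    then show "(\<lambda>p. g ((fst p)(k := snd p)) * indicator {..fst p k} (snd p)) \<in> borel_measurable (bcube n \<Otimes>\<^sub>M line)"
      by (intro borel_measurable_times) (measurable, simp add: indicator_def of_bool_def)
  qed (auto simp: indicator_def)
  define W where "W x = u x - G x" for x
  have int_W: "integrable (bcube n) W" unfolding W_def using u int_G by simp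
  have [measurable]: "W \<in> borel_measurable (bcube n)" using int_W by simp
  have W_orth: "(\<integral>x. W x * (\<Prod>j<n. (B(k := deriv (B k))) j (x j)) \<partial>bcube n) = 0"
    if B: "\<And>i. i < n \<Longrightarrow> smooth_supported a (a + 1) (B i)" for B
  proof -
    define P where "P y = (\<Prod>j\<in>{..<n} - {k}. B j (?ins y a j))" for y
    have B': "smooth_supported a (a + 1) ((B(k := deriv (B k))) i)" if "i < n" for i
      using B[OF that] smooth_supported_deriv[OF B[OF k]] by auto
    have split: "(\<Prod>j<n. (B(k := f)) j (?ins y t j)) = f t * P y" for f y t
      unfolding P_def by (rule prod_split_coord[OF k])
    have "(\<integral>x. G x * (\<Prod>j<n. (B(k := deriv (B k))) j (x j)) \<partial>bcube n)
        = (\<integral>y. (\<integral>t. G (?ins y t) * (deriv (B k) t * P y) \<partial>line) \<partial>bcube (n - 1))"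
      using integral_bcube(1)[OF k integrable_mult_prod[OF int_G, of "B(k := deriv (B k))", OF B']] unfolding split .
    also have "\<dots> = (\<integral>y. (\<integral>t. G (?ins y t) * deriv (B k) t \<partial>line) * P y \<partial>bcube (n - 1))"
      by (simp add: mult.assoc[symmetric])
    also have "\<dots> = (\<integral>y. - (\<integral>\<tau>. g (?ins y \<tau>) * B k \<tau> \<partial>line) * P y \<partial>bcube (n - 1))"
    proof (rule integral_cong_AE)
      show "AE y in bcube (n - 1). (\<integral>t. G (?ins y t) * deriv (B k) t \<partial>line) * P y
        = - (\<integral>\<tau>. g (?ins y \<tau>) * B k \<tau> \<partial>line) * P y"
        using integral_bcube(2)[OF k g]
        by eventually_elim (simp add: G_ins integral_primitive_by_parts B k)
      have meas: "(\<lambda>y. \<integral>t. F (?ins y t) * f t \<partial>line) \<in> borel_measurable (bcube (n - 1))"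
        if "F \<in> borel_measurable (bcube n)" "f \<in> borel_measurable borel" for F :: "(nat \<Rightarrow> real) \<Rightarrow> real" and f :: "real \<Rightarrow> real"
      proof (rule line.borel_measurable_lebesgue_integral)
        have "(\<lambda>p. f (snd p)) \<in> borel_measurable (bcube (n - 1) \<Otimes>\<^sub>M line)"
          by (rule measurable_compose[OF measurable_compose[OF measurable_snd measurable_line_borel(2)] that(2)])
        then show "(\<lambda>(y, t). F (?ins y t) * f t) \<in> borel_measurable (bcube (n - 1) \<Otimes>\<^sub>M line)"
          using measurable_section(2)[OF k that(1)] by (simp add: case_prod_unfold)
      qed
      have P_meas: "P \<in> borel_measurable (bcube (n - 1))"
        unfolding P_def
      proof (rule borel_measurable_prod)
        fix j assume j: "j \<in> {..<n} - {k}"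
        have "(\<lambda>y. ?ins y a j) \<in> borel_measurable (bcube (n - 1))"
        proof -
          have "(\<lambda>y. y i) \<in> borel_measurable (bcube (n - 1))" if "i < n - 1" for i
            using that by (rule measurable_coord)
          moreover have "?ins y a j = y (if j < k then j else j - 1)" for y
            using j by (auto simp: insert_coord_def)
          ultimately show ?thesis using j k by auto
        qed
        moreover have "B j \<in> borel_measurable borel" using j by (intro smooth_supported_measurable[OF B]) simp
        ultimately show "(\<lambda>y. B j (?ins y a j)) \<in> borel_measurable (bcube (n - 1))"
          by (rule measurable_compose)
      qed
      have "B k \<in> borel_measurable borel" "deriv (B k) \<in> borel_measurable borel"
        by (rule smooth_supported_measurable[OF B[OF k]],
            rule smooth_supported_measurable[OF smooth_supported_deriv[OF B[OF k]]])
      then show "(\<lambda>y. (\<integral>t. G (?ins y t) * deriv (B k) t \<partial>line) * P y) \<in> borel_measurable (bcube (n - 1))"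
        "(\<lambda>y. - (\<integral>\<tau>. g (?ins y \<tau>) * B k \<tau> \<partial>line) * P y) \<in> borel_measurable (bcube (n - 1))"
        using P_meas int_G by (intro borel_measurable_times borel_measurable_uminus meas; simp)+
    qed
    also have "\<dots> = - (\<integral>y. (\<integral>\<tau>. g (?ins y \<tau>) * (B k \<tau> * P y) \<partial>line) \<partial>bcube (n - 1))"
      by (simp add: mult.assoc[symmetric])
    also have "\<dots> = - (\<integral>x. g x * (\<Prod>j<n. B j (x j)) \<partial>bcube n)"
    proof -
      have "(\<integral>x. g x * (\<Prod>j<n. (B(k := B k)) j (x j)) \<partial>bcube n)
          = (\<integral>y. (\<integral>\<tau>. g (?ins y \<tau>) * (B k \<tau> * P y) \<partial>line) \<partial>bcube (n - 1))"
        using integral_bcube(1)[OF k integrable_mult_prod[OF g, of "B(k := B k)"]] B unfolding split by simp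
      then show ?thesis by simp
    qed
    finally have eG: "(\<integral>x. G x * (\<Prod>j<n. (B(k := deriv (B k))) j (x j)) \<partial>bcube n)
      = - (\<integral>x. g x * (\<Prod>j<n. B j (x j)) \<partial>bcube n)" .
    have int: "integrable (bcube n) (\<lambda>x. v x * (\<Prod>j<n. (B(k := deriv (B k))) j (x j)))"
      if "integrable (bcube n) v" for v
      by (rule integrable_mult_prod[OF that B'])
    have eu: "(\<integral>x. u x * (\<Prod>j<n. (B(k := deriv (B k))) j (x j)) \<partial>bcube n)
      = - (\<integral>x. g x * (\<Prod>j<n. B j (x j)) \<partial>bcube n)"
      by (rule weak) (rule B)
    show ?thesis
      unfolding W_def left_diff_distrib Bochner_Integration.integral_diff[OF int[OF u] int[OF int_G]] eu eG by simp
  qed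
  obtain \<omega> where \<omega>: "smooth_supported a (a + 1) \<omega>" "(\<integral>t. \<omega> t \<partial>line) = 1"
    using exists_mollifier by blast
  obtain C where C: "\<And>t. \<bar>\<omega> t\<bar> \<le> C" using smooth_supported_bounded[OF \<omega>(1)] by blast
  \<comment> \<open>The constant value which \<open>W\<close> should have on the line through \<open>x\<close>.\<close>
  define K where "K x = (\<integral>\<tau>. W (x(k := \<tau>)) * \<omega> \<tau> \<partial>line)" for x
  have K_ins: "K (?ins y t) = (\<integral>\<tau>. W (?ins y \<tau>) * \<omega> \<tau> \<partial>line)" for y t
    by (simp add: K_def upd)
  have int_K: "integrable (bcube n) K"
    unfolding K_def
  proof (rule integrable_line_average[OF k int_W, where C = C])
    have "(\<lambda>p. \<omega> (snd p)) \<in> borel_measurable (bcube n \<Otimes>\<^sub>M line)"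
      using \<omega>(1) by (intro measurable_compose[OF measurable_compose[OF measurable_snd measurable_line_borel(2)]]
        smooth_measurable) (simp add: smooth_supported_def)
    then show "(\<lambda>p. W ((fst p)(k := snd p)) * \<omega> (snd p)) \<in> borel_measurable (bcube n \<Otimes>\<^sub>M line)"
      by measurable
    show "\<bar>W (x(k := \<tau>)) * \<omega> \<tau>\<bar> \<le> C * \<bar>W (x(k := \<tau>))\<bar>" for x \<tau>
      using mult_right_mono[OF C[of \<tau>], of "\<bar>W (x(k := \<tau>))\<bar>"] by (simp add: abs_mult mult.commute)
  qed
  have "AE x in bcube n. x \<in> (\<Pi>\<^sub>E i\<in>{..<n}. {a<..<a + 1}) \<longrightarrow> W x - K x = 0"
  proof (rule fundamental_lemma)
    fix B assume B: "\<And>i. i < n \<Longrightarrow> smooth_supported a (a + 1) (B i)"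
    define r where "r = (\<integral>t. B k t \<partial>line)"
    \<comment> \<open>Orthogonality to derivatives applies to \<open>\<eta>\<close>, which has vanishing integral.\<close>
    define \<eta> where "\<eta> t = B k t + - r * \<omega> t" for t
    have \<eta>: "smooth_supported a (a + 1) \<eta>"
      unfolding \<eta>_def by (intro smooth_supported_linear B k \<omega>)
    have cont: "continuous_on UNIV f" if "smooth_supported a (a + 1) f" for f
      using that by (simp add: smooth_supported_def smooth_continuous)
    have "integral {a..a + 1} \<eta> = (\<integral>t. \<eta> t \<partial>line)"
      by (rule integral_line_continuous(2)[OF cont[OF \<eta>], symmetric])
    also have "\<dots> = 0"
      using integral_line_continuous(1)[OF cont[OF B[OF k]]] integral_line_continuous(1)[OF cont[OF \<omega>(1)]] \<omega>(2)
      by (simp add: \<eta>_def r_def)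
    finally obtain \<theta> where \<theta>: "smooth_supported a (a + 1) \<theta>" "\<And>t. (\<theta> has_real_derivative \<eta> t) (at t)"
      using smooth_supported_antiderivative[OF \<eta>] by auto
    have d\<theta>: "deriv \<theta> = \<eta>" using \<theta>(2) by (auto simp: DERIV_imp_deriv)
    have up: "smooth_supported a (a + 1) ((B(k := f)) i)" if "smooth_supported a (a + 1) f" "i < n" for f i
      using B that by simp
    define P where "P y = (\<Prod>j\<in>{..<n} - {k}. B j (?ins y a j))" for y
    have split: "(\<Prod>j<n. (B(k := f)) j (?ins y t j)) = f t * P y" for f y t
      unfolding P_def by (rule prod_split_coord[OF k])
    have 0: "(\<integral>x. W x * (\<Prod>j<n. (B(k := \<eta>)) j (x j)) \<partial>bcube n) = 0"
      using W_orth[of "B(k := \<theta>)"] up[OF \<theta>(1)] by (simp add: d\<theta>)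
    have int_\<omega>: "integrable (bcube n) (\<lambda>x. W x * (\<Prod>j<n. (B(k := \<omega>)) j (x j)))"
      by (rule integrable_mult_prod[OF int_W up[OF \<omega>(1)]])
    have int_WB: "integrable (bcube n) (\<lambda>x. W x * (\<Prod>j<n. B j (x j)))"
      by (rule integrable_mult_prod[OF int_W B])
    have int_KB: "integrable (bcube n) (\<lambda>x. K x * (\<Prod>j<n. B j (x j)))"
      by (rule integrable_mult_prod[OF int_K B])
    have "(\<integral>x. K x * (\<Prod>j<n. (B(k := B k)) j (x j)) \<partial>bcube n)
        = (\<integral>y. (\<integral>t. K (?ins y t) * (B k t * P y) \<partial>line) \<partial>bcube (n - 1))"
      using integral_bcube(1)[OF k integrable_mult_prod[OF int_K, of "B(k := B k)", OF up[OF B[OF k]]]] unfolding split .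
    also have "\<dots> = (\<integral>y. r * ((\<integral>\<tau>. W (?ins y \<tau>) * \<omega> \<tau> \<partial>line) * P y) \<partial>bcube (n - 1))"
      unfolding K_ins r_def by (simp add: ac_simps)
    also have "\<dots> = r * (\<integral>y. (\<integral>\<tau>. W (?ins y \<tau>) * (\<omega> \<tau> * P y) \<partial>line) \<partial>bcube (n - 1))"
    proof -
      have "(\<integral>\<tau>. W (?ins y \<tau>) * (\<omega> \<tau> * P y) \<partial>line) = (\<integral>\<tau>. W (?ins y \<tau>) * \<omega> \<tau> \<partial>line) * P y" for y
        by (simp add: mult.assoc[symmetric])
      then show ?thesis by (simp only: integral_mult_right_zero)
    qed
    also have "(\<integral>y. (\<integral>\<tau>. W (?ins y \<tau>) * (\<omega> \<tau> * P y) \<partial>line) \<partial>bcube (n - 1))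
        = (\<integral>x. W x * (\<Prod>j<n. (B(k := \<omega>)) j (x j)) \<partial>bcube n)"
      using integral_bcube(1)[OF k int_\<omega>] unfolding split by (rule sym)
    finally have K: "(\<integral>x. K x * (\<Prod>j<n. B j (x j)) \<partial>bcube n)
        = r * (\<integral>x. W x * (\<Prod>j<n. (B(k := \<omega>)) j (x j)) \<partial>bcube n)" by simp
    have pr: "(\<Prod>j<n. (B(k := f)) j (x j)) = f (x k) * (\<Prod>j\<in>{..<n} - {k}. B j (x j))" for f x
      using k by (subst prod.remove[of _ k]) auto
    have prB: "(\<Prod>j<n. B j (x j)) = B k (x k) * (\<Prod>j\<in>{..<n} - {k}. B j (x j))" for x
      using k by (subst prod.remove[of _ k]) auto
    have "(\<integral>x. W x * (\<Prod>j<n. (B(k := \<eta>)) j (x j)) \<partial>bcube n)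
        = (\<integral>x. W x * (\<Prod>j<n. B j (x j)) - r * (W x * (\<Prod>j<n. (B(k := \<omega>)) j (x j))) \<partial>bcube n)"
      unfolding pr prB \<eta>_def by (rule Bochner_Integration.integral_cong[OF refl]) (simp add: algebra_simps)
    also have "\<dots> = (\<integral>x. W x * (\<Prod>j<n. B j (x j)) \<partial>bcube n) - (\<integral>x. K x * (\<Prod>j<n. B j (x j)) \<partial>bcube n)"
      unfolding K Bochner_Integration.integral_diff[OF int_WB integrable_mult_right[OF int_\<omega>]]
        integral_mult_right_zero ..
    also have "\<dots> = (\<integral>x. (W x - K x) * (\<Prod>j<n. B j (x j)) \<partial>bcube n)"
      unfolding left_diff_distrib by (rule Bochner_Integration.integral_diff[OF int_WB int_KB, symmetric])
    finally show "(\<integral>x. (W x - K x) * (\<Prod>j<n. B j (x j)) \<partial>bcube n) = 0" using 0 by simp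
  qed (use int_W int_K in auto)
  with AE_bcube_interior have "AE x in bcube n. W x = K x" by eventually_elim simp
  then have "AE y in bcube (n - 1). AE t in line. W (?ins y t) = K (?ins y t)" by (rule AE_bcube[OF k])
  then show ?thesis
  proof eventually_elim
    case (elim y)
    then have "AE t in line. u (?ins y t) = (\<integral>\<tau>. W (?ins y \<tau>) * \<omega> \<tau> \<partial>line)
        + (\<integral>\<tau>. g (?ins y \<tau>) * indicator {..t} \<tau> \<partial>line)"
      by eventually_elim (simp add: W_def K_ins[unfolded W_def] G_ins)
    then show ?case by blast
  qed
qed

end

section \<open>Essential suprema over lines\<close>

context unit_interval
begin

lemma AE_lebesgue_on_I: "(AE t in lebesgue_on I. Q t) \<longleftrightarrow> (AE t in line. Q t)"
  by (simp add: AE_restrict_space_iff AE_completion_iff)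

lemma measurable_line_lebesgue_on:
  "v \<in> borel_measurable line \<Longrightarrow> v \<in> borel_measurable (lebesgue_on I)"
proof -
  assume v: "v \<in> borel_measurable line"
  have "(\<lambda>x. x) \<in> measurable (lebesgue_on I) line"
    by (rule measurable_restrict_space3[OF measurable_completion]) auto
  from measurable_compose[OF this v] show ?thesis .
qed

lemma measurable_lebesgue_on_AE:
  fixes v w :: "real \<Rightarrow> 'b::topological_space"
  assumes v: "v \<in> borel_measurable line" and eq: "AE t in line. v t = w t"
  shows "w \<in> borel_measurable (lebesgue_on I)"
proof (rule measurableI)
  fix B :: "'b set" assume B: "B \<in> sets borel"
  have "v -` B \<inter> I \<in> sets (lebesgue_on I)"
    using measurable_sets[OF measurable_line_lebesgue_on[OF v] B] by simp
  then have A: "v -` B \<inter> I \<in> sets lebesgue" by (simp add: sets_restrict_space_iff)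
  have "AE t in lborel. t \<in> I \<longrightarrow> v t = w t" using eq by (subst (asm) AE_restrict_space_iff) auto
  then have "AE t in lebesgue. t \<in> I \<longrightarrow> v t = w t" by (rule AE_completion)
  then have "AE t in lebesgue. t \<in> v -` B \<inter> I \<longleftrightarrow> t \<in> w -` B \<inter> I" by eventually_elim auto
  from completion.in_sets_AE[OF this A] have "w -` B \<inter> I \<in> sets lebesgue" by simp
  then show "w -` B \<inter> space (lebesgue_on I) \<in> sets (lebesgue_on I)"
    by (simp add: sets_restrict_space_iff)
qed simp

text \<open>For a Borel function \<open>f\<close> this is the function \<open>\<psi>\<^sub>k(f, L\<^sup>\<infinity>)\<close>.\<close>

definition line_esssup :: "nat \<Rightarrow> nat \<Rightarrow> ((nat \<Rightarrow> real) \<Rightarrow> real) \<Rightarrow> (nat \<Rightarrow> real) \<Rightarrow> ennreal" where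
  "line_esssup n k f y = esssup line (\<lambda>t. ennreal \<bar>f (insert_coord n k y t)\<bar>)"

text \<open>The essential supremum over a line exceeds \<open>z\<close> if and only if the set \<open>{\<bar>f\<bar> > z}\<close> meets the line in a set of
  positive measure, and this measure is a measurable function of the line.\<close>

lemma measurable_line_esssup:
  assumes k: "k < n" and f: "f \<in> borel_measurable (bcube n)"
  shows "line_esssup n k f \<in> borel_measurable (bcube (n - 1))"
proof (rule borel_measurableI_greater)
  fix z :: ennreal
  have sec: "(\<lambda>t. ennreal \<bar>f (insert_coord n k y t)\<bar>) \<in> borel_measurable line" if "y \<in> space (bcube (n - 1))" for y
    using measurable_section(1)[OF k f that] by simp
  have "z < line_esssup n k f y \<longleftrightarrow>
      emeasure line (Pair y -` {p \<in> space (bcube (n - 1) \<Otimes>\<^sub>M line). z < ennreal \<bar>f (insert_coord n k (fst p) (snd p))\<bar>}) > 0"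
    (is "_ \<longleftrightarrow> emeasure line (Pair y -` ?S) > 0")
    if y: "y \<in> space (bcube (n - 1))" for y
  proof -
    have S: "Pair y -` ?S = {t \<in> space line. z < ennreal \<bar>f (insert_coord n k y t)\<bar>}"
      using y by (auto simp: space_pair_measure)
    show ?thesis unfolding S
    proof
      assume "z < line_esssup n k f y"
      then show "emeasure line {t \<in> space line. z < ennreal \<bar>f (insert_coord n k y t)\<bar>} > 0"
        unfolding line_esssup_def by (rule esssup_pos_measure[OF sec[OF y]])
    next
      assume pos: "emeasure line {t \<in> space line. z < ennreal \<bar>f (insert_coord n k y t)\<bar>} > 0"
      show "z < line_esssup n k f y"
      proof (rule ccontr)
        assume "\<not> z < line_esssup n k f y"
        then have "AE t in line. \<not> z < ennreal \<bar>f (insert_coord n k y t)\<bar>"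
          using esssup_AE[of "\<lambda>t. ennreal \<bar>f (insert_coord n k y t)\<bar>" line]
          unfolding line_esssup_def by (auto simp: not_less elim!: eventually_mono)
        then have "emeasure line {t \<in> space line. z < ennreal \<bar>f (insert_coord n k y t)\<bar>} = 0"
        proof (subst (asm) AE_iff_measurable[OF _ refl])
          have [measurable]: "(\<lambda>t. f (insert_coord n k y t)) \<in> borel_measurable line"
            by (rule measurable_section(1)[OF k f y])
          show "{t \<in> space line. \<not> \<not> z < ennreal \<bar>f (insert_coord n k y t)\<bar>} \<in> sets line" by measurable
        qed simp
        then show False using pos by simp
      qed
    qed
  qed
  moreover have "{y \<in> space (bcube (n - 1)). emeasure line (Pair y -` {p \<in> space (bcube (n - 1) \<Otimes>\<^sub>M line).
      z < ennreal \<bar>f (insert_coord n k (fst p) (snd p))\<bar>}) > 0} \<in> sets (bcube (n - 1))"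
  proof -
    have "{p \<in> space (bcube (n - 1) \<Otimes>\<^sub>M line). z < ennreal \<bar>f (insert_coord n k (fst p) (snd p))\<bar>}
      \<in> sets (bcube (n - 1) \<Otimes>\<^sub>M line)"
      using measurable_section(2)[OF k f] by measurable
    from line.measurable_emeasure_Pair[OF this] show ?thesis by measurable
  qed
  ultimately show "{y \<in> space (bcube (n - 1)). z < line_esssup n k f y} \<in> sets (bcube (n - 1))"
    by (simp cong: conj_cong)
qed

section \<open>An estimate on lines\<close>

lemma integral_line_Iic:
  fixes \<gamma> :: "real \<Rightarrow> real"
  assumes \<gamma>: "integrable line \<gamma>" and t: "t \<le> a + 1"
  shows "(\<integral>\<tau>. \<gamma> \<tau> * indicator {..t} \<tau> \<partial>line) = integral {a..t} (\<lambda>\<tau>. indicator I \<tau> * \<gamma> \<tau>)"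
    and "(\<lambda>\<tau>. indicator I \<tau> * \<gamma> \<tau>) integrable_on {a..t}"
proof -
  have int: "integrable lborel (\<lambda>\<tau>. indicator I \<tau> * \<gamma> \<tau>)"
    using \<gamma> by (simp add: integrable_restrict_space)
  then have si: "set_integrable lborel {a..t} (\<lambda>\<tau>. indicator I \<tau> * \<gamma> \<tau>)"
    unfolding set_integrable_def by (intro integrable_mult_indicator) auto
  show "(\<lambda>\<tau>. indicator I \<tau> * \<gamma> \<tau>) integrable_on {a..t}" by (rule set_borel_integral_eq_integral(1)[OF si])
  have "(\<integral>\<tau>. \<gamma> \<tau> * indicator {..t} \<tau> \<partial>line) = (\<integral>\<tau>. indicator I \<tau> *\<^sub>R (\<gamma> \<tau> * indicator {..t} \<tau>) \<partial>lborel)"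
    by (simp add: integral_restrict_space)
  also have "\<dots> = (\<integral>\<tau>. indicator {a..t} \<tau> *\<^sub>R (indicator I \<tau> * \<gamma> \<tau>) \<partial>lborel)"
    using subset_closed by (intro Bochner_Integration.integral_cong) (auto simp: indicator_def)
  also have "\<dots> = integral {a..t} (\<lambda>\<tau>. indicator I \<tau> * \<gamma> \<tau>)"
    using set_borel_integral_eq_integral(2)[OF si] by (simp add: set_lebesgue_integral_def)
  finally show "(\<integral>\<tau>. \<gamma> \<tau> * indicator {..t} \<tau> \<partial>line) = integral {a..t} (\<lambda>\<tau>. indicator I \<tau> * \<gamma> \<tau>)" .
qed

text \<open>An absolutely continuous \<open>V\<close> with derivative \<open>\<gamma>\<close>: going from a point with \<open>\<bar>V\<bar> > s\<close> to the nearest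
  point with \<open>\<bar>V\<bar> \<le> s\<close>, one passes only through points with \<open>\<bar>V\<bar> > s\<close>. If there is no such point, the
  length one of the interval gives a point where \<open>\<bar>V\<bar>\<close> is at most its mean.\<close>

lemma line_estimate:
  fixes \<gamma> V :: "real \<Rightarrow> real"
  assumes \<gamma>: "integrable line \<gamma>" and V: "\<And>t. V t = c + (\<integral>\<tau>. \<gamma> \<tau> * indicator {..t} \<tau> \<partial>line)"
    and "t1 \<in> I" "0 \<le> s"
  shows "ennreal \<bar>V t1\<bar> \<le> ennreal s + (\<integral>\<^sup>+\<tau>. ennreal (\<bar>V \<tau>\<bar> + \<bar>\<gamma> \<tau>\<bar>) * indicator {\<tau>. s < \<bar>V \<tau>\<bar>} \<tau> \<partial>line)"
proof -
  have [measurable]: "\<gamma> \<in> borel_measurable line" using \<gamma> by simp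
  have I_between: "t \<in> I" if "p \<in> I" "q \<in> I" "p \<le> t" "t \<le> q" for p q t
  proof (cases "t = p \<or> t = q")
    case False
    then have "a < t" "t < a + 1" using that subset_closed by force+
    then show ?thesis using open_subset by auto
  qed (use that in auto)
  have cont: "continuous_on {a..a + 1} V"
  proof -
    have "continuous_on {a..a + 1} (\<lambda>t. c + integral {a..t} (\<lambda>\<tau>. indicator I \<tau> * \<gamma> \<tau>))"
      by (intro continuous_intros indefinite_integral_continuous_1 integral_line_Iic(2)[OF \<gamma>]) simp
    then show ?thesis
      by (rule continuous_on_cong[THEN iffD1, OF refl, rotated]) (simp add: V integral_line_Iic(1)[OF \<gamma>])
  qed
  have [measurable]: "V \<in> borel_measurable line"
    using borel_measurable_continuous_on_restrict[OF continuous_on_subset[OF cont subset_closed]]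
    by (simp cong: measurable_cong_sets add: sets_restrict_space)
  have int_ind: "integrable line (\<lambda>\<tau>. \<gamma> \<tau> * indicator S \<tau>)" if "S \<in> sets borel" for S
  proof (rule Bochner_Integration.integrable_bound[OF \<gamma>])
    have "indicator S \<in> borel_measurable line" using that by (intro measurable_restrict_space1) simp
    then show "(\<lambda>\<tau>. \<gamma> \<tau> * indicator S \<tau> :: real) \<in> borel_measurable line" by measurable
  qed (auto simp: indicator_def)
  have diff: "ennreal \<bar>V q - V p\<bar> \<le> (\<integral>\<^sup>+\<tau>. ennreal \<bar>\<gamma> \<tau>\<bar> * indicator {p<..<q} \<tau> \<partial>line)" if "p \<le> q" for p q
  proof -
    have "V q - V p = (\<integral>\<tau>. \<gamma> \<tau> * indicator {..q} \<tau> - \<gamma> \<tau> * indicator {..p} \<tau> \<partial>line)"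
      unfolding V by (subst Bochner_Integration.integral_diff) (auto intro: int_ind)
    also have "\<dots> = (\<integral>\<tau>. \<gamma> \<tau> * indicator {p<..q} \<tau> \<partial>line)"
      using that by (intro Bochner_Integration.integral_cong) (auto simp: indicator_def)
    finally have "ennreal \<bar>V q - V p\<bar> \<le> (\<integral>\<^sup>+\<tau>. norm (\<gamma> \<tau> * indicator {p<..q} \<tau>) \<partial>line)"
      using integral_norm_bound_ennreal[OF int_ind, of "{p<..q}"] by simp
    also have "\<dots> \<le> (\<integral>\<^sup>+\<tau>. ennreal \<bar>\<gamma> \<tau>\<bar> * indicator {p<..<q} \<tau> \<partial>line)"
    proof (rule nn_integral_mono_AE)
      have "AE \<tau> in lborel. \<tau> \<noteq> q" by (rule AE_lborel_singleton)
      then have "AE \<tau> in line. \<tau> \<noteq> q" by (subst AE_restrict_space_iff) (auto elim: eventually_mono)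
      then show "AE \<tau> in line. ennreal (norm (\<gamma> \<tau> * indicator {p<..q} \<tau>)) \<le> ennreal \<bar>\<gamma> \<tau>\<bar> * indicator {p<..<q} \<tau>"
        by eventually_elim (auto simp: indicator_def)
    qed
    finally show ?thesis .
  qed
  have close: "ennreal \<bar>V t1\<bar> \<le> ennreal s + (\<integral>\<^sup>+\<tau>. ennreal (\<bar>V \<tau>\<bar> + \<bar>\<gamma> \<tau>\<bar>) * indicator {\<tau>. s < \<bar>V \<tau>\<bar>} \<tau> \<partial>line)"
    if le: "ennreal \<bar>V t1 - V t2\<bar> \<le> (\<integral>\<^sup>+\<tau>. ennreal \<bar>\<gamma> \<tau>\<bar> * indicator {p<..<q} \<tau> \<partial>line)"
      and t2: "\<bar>V t2\<bar> \<le> s" and pq: "\<And>\<tau>. \<tau> \<in> {p<..<q} \<Longrightarrow> s < \<bar>V \<tau>\<bar>" for t2 p q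
  proof -
    have "ennreal \<bar>V t1\<bar> \<le> ennreal (s + \<bar>V t1 - V t2\<bar>)" using t2 by (intro ennreal_leI) linarith
    also have "\<dots> = ennreal s + ennreal \<bar>V t1 - V t2\<bar>" using \<open>0 \<le> s\<close> by (intro ennreal_plus) auto
    also have "\<dots> \<le> ennreal s + (\<integral>\<^sup>+\<tau>. ennreal (\<bar>V \<tau>\<bar> + \<bar>\<gamma> \<tau>\<bar>) * indicator {\<tau>. s < \<bar>V \<tau>\<bar>} \<tau> \<partial>line)"
      using pq by (intro add_left_mono order_trans[OF le] nn_integral_mono) (auto simp: indicator_def intro!: ennreal_leI)
    finally show ?thesis .
  qed
  define S where "S p q = {p..q} \<inter> V -` {- s..s}" for p q
  have S_iff: "\<tau> \<in> S p q \<longleftrightarrow> p \<le> \<tau> \<and> \<tau> \<le> q \<and> \<bar>V \<tau>\<bar> \<le> s" for \<tau> p q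
    by (auto simp: S_def abs_le_iff)
  have compact_S: "compact (S p q)" if "p \<in> I" "q \<in> I" for p q
  proof -
    have "{p..q} \<subseteq> {a..a + 1}" using that subset_closed by force
    then have "closed (S p q)"
      unfolding S_def by (intro continuous_closed_preimage continuous_on_subset[OF cont]) auto
    moreover have "bounded (S p q)" unfolding S_def by (intro bounded_Int) simp
    ultimately show ?thesis by (simp add: compact_eq_bounded_closed)
  qed
  consider "\<bar>V t1\<bar> \<le> s" | "\<forall>\<tau>\<in>I. s < \<bar>V \<tau>\<bar>" | t0 where "t0 \<in> I" "\<bar>V t0\<bar> \<le> s" "t0 < t1" "s < \<bar>V t1\<bar>"
    | t0 where "t0 \<in> I" "\<bar>V t0\<bar> \<le> s" "t1 < t0" "s < \<bar>V t1\<bar>"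
    using \<open>t1 \<in> I\<close> by (metis linorder_neqE_linordered_idom not_le)
  then show ?thesis
  proof cases
    case 1
    then show ?thesis by (intro order_trans[OF ennreal_leI[OF 1]]) simp
  next
    case 2
    \<comment> \<open>The interval has length one, so \<open>\<bar>V t1\<bar>\<close> is at most the mean of \<open>\<bar>V\<bar>\<close> plus the total variation.\<close>
    let ?J = "\<integral>\<^sup>+\<tau>. ennreal \<bar>\<gamma> \<tau>\<bar> \<partial>line"
    have "ennreal \<bar>V t1\<bar> = (\<integral>\<^sup>+\<tau>. ennreal \<bar>V t1\<bar> \<partial>line)"
      using line.emeasure_space_1 by simp
    also have "\<dots> \<le> (\<integral>\<^sup>+\<tau>. ennreal \<bar>V \<tau>\<bar> + ?J \<partial>line)"
    proof (rule nn_integral_mono)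
      fix \<tau>
      have part: "(\<integral>\<^sup>+\<tau>. ennreal \<bar>\<gamma> \<tau>\<bar> * indicator {p<..<q} \<tau> \<partial>line) \<le> ?J" for p q
        by (intro nn_integral_mono) (auto simp: indicator_def)
      have "ennreal \<bar>V t1 - V \<tau>\<bar> \<le> ?J"
        using order_trans[OF diff part, of \<tau> t1] order_trans[OF diff part, of t1 \<tau>]
        by (cases "\<tau> \<le> t1") (simp_all add: abs_minus_commute)
      moreover have "ennreal \<bar>V t1\<bar> \<le> ennreal \<bar>V \<tau>\<bar> + ennreal \<bar>V t1 - V \<tau>\<bar>"
        by (subst ennreal_plus[symmetric]) (simp_all add: ennreal_leI del: ennreal_plus)
      ultimately show "ennreal \<bar>V t1\<bar> \<le> ennreal \<bar>V \<tau>\<bar> + ?J" by (meson add_left_mono order_trans)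
    qed
    also have "\<dots> = (\<integral>\<^sup>+\<tau>. ennreal \<bar>V \<tau>\<bar> + ennreal \<bar>\<gamma> \<tau>\<bar> \<partial>line)"
      using line.emeasure_space_1 by (simp add: nn_integral_add)
    also have "\<dots> = (\<integral>\<^sup>+\<tau>. ennreal (\<bar>V \<tau>\<bar> + \<bar>\<gamma> \<tau>\<bar>) * indicator {\<tau>. s < \<bar>V \<tau>\<bar>} \<tau> \<partial>line)"
      using 2 by (intro nn_integral_cong) (auto simp: indicator_def)
    finally show ?thesis by (rule order_trans) simp
  next
    case (3 t0)
    have "t0 \<in> S t0 t1" using 3 by (simp add: S_iff)
    then obtain t2 where t2: "t2 \<in> S t0 t1" "\<And>\<tau>. \<tau> \<in> S t0 t1 \<Longrightarrow> \<tau> \<le> t2"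
      using compact_attains_sup[OF compact_S[OF 3(1) \<open>t1 \<in> I\<close>]] by (metis empty_iff)
    have le: "t0 \<le> t2" "t2 \<le> t1" "\<bar>V t2\<bar> \<le> s" using t2(1) by (simp_all add: S_iff)
    have "s < \<bar>V \<tau>\<bar>" if "\<tau> \<in> {t2<..<t1}" for \<tau>
    proof (rule ccontr)
      assume "\<not> s < \<bar>V \<tau>\<bar>"
      then have "\<tau> \<in> S t0 t1" using that le by (simp add: S_iff)
      then show False using t2(2)[of \<tau>] that by simp
    qed
    then show ?thesis using diff[of t2 t1] le by (intro close[of t2 t2 t1])
  next
    case (4 t0)
    have "t0 \<in> S t1 t0" using 4 by (simp add: S_iff)
    then obtain t2 where t2: "t2 \<in> S t1 t0" "\<And>\<tau>. \<tau> \<in> S t1 t0 \<Longrightarrow> t2 \<le> \<tau>"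
      using compact_attains_inf[OF compact_S[OF \<open>t1 \<in> I\<close> 4(1)]] by (metis empty_iff)
    have le: "t1 \<le> t2" "t2 \<le> t0" "\<bar>V t2\<bar> \<le> s" using t2(1) by (simp_all add: S_iff)
    have "s < \<bar>V \<tau>\<bar>" if "\<tau> \<in> {t1<..<t2}" for \<tau>
    proof (rule ccontr)
      assume "\<not> s < \<bar>V \<tau>\<bar>"
      then have "\<tau> \<in> S t1 t0" using that le by (simp add: S_iff)
      then show False using t2(2)[of \<tau>] that by simp
    qed
    then show ?thesis using diff[of t1 t2] le by (intro close[of t2 t1 t2]) (simp_all add: abs_minus_commute)
  qed
qed

text \<open>On almost every line a weakly differentiable function agrees almost everywhere with an absolutely
  continuous one, to which the previous estimate applies.\<close>

lemma line_esssup_le: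
  assumes k: "k < n" and u: "integrable (bcube n) u" and g: "integrable (bcube n) g"
    and weak: "\<And>B. (\<And>i. i < n \<Longrightarrow> smooth_supported a (a + 1) (B i)) \<Longrightarrow>
      (\<integral>x. u x * (\<Prod>j<n. (B(k := deriv (B k))) j (x j)) \<partial>bcube n) = - (\<integral>x. g x * (\<Prod>j<n. B j (x j)) \<partial>bcube n)"
    and F: "\<And>x. \<bar>u x\<bar> + \<bar>g x\<bar> \<le> F x" and s: "0 \<le> s"
  shows "AE y in bcube (n - 1). line_esssup n k u y
    \<le> ennreal s + (\<integral>\<^sup>+t. ennreal (F (insert_coord n k y t)) * indicator {x. s < \<bar>u x\<bar>} (insert_coord n k y t) \<partial>line)"
proof -
  have "AE y in bcube (n - 1). \<exists>c. AE t in line.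
    u (insert_coord n k y t) = c + (\<integral>\<tau>. g (insert_coord n k y \<tau>) * indicator {..t} \<tau> \<partial>line)"
    by (rule weak_derivative_primitive[OF k u g]) (rule weak, blast)
  then show ?thesis using integral_bcube(2)[OF k g] AE_space
proof eventually_elim
  case (elim y)
  let ?ins = "insert_coord n k y"
  from elim(1) obtain c where c: "AE t in line. u (?ins t) = c + (\<integral>\<tau>. g (?ins \<tau>) * indicator {..t} \<tau> \<partial>line)"
    by blast
  define V where "V t = c + (\<integral>\<tau>. g (?ins \<tau>) * indicator {..t} \<tau> \<partial>line)" for t
  let ?R = "ennreal s + (\<integral>\<^sup>+\<tau>. ennreal (\<bar>V \<tau>\<bar> + \<bar>g (?ins \<tau>)\<bar>) * indicator {\<tau>. s < \<bar>V \<tau>\<bar>} \<tau> \<partial>line)"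
  have "AE t in line. ennreal \<bar>u (?ins t)\<bar> \<le> ?R"
    using c AE_space
  proof eventually_elim
    case (elim t)
    then show ?case
      using line_estimate[OF \<open>integrable line (\<lambda>t. g (?ins t))\<close> V_def _ s, of t] by (simp add: V_def)
  qed
  then have "line_esssup n k u y \<le> ?R"
    unfolding line_esssup_def using measurable_section(1)[OF k, of u borel y] u elim(3)
    by (intro esssup_I) simp_all
  also have "\<dots> \<le> ennreal s + (\<integral>\<^sup>+t. ennreal (F (?ins t)) * indicator {x. s < \<bar>u x\<bar>} (?ins t) \<partial>line)"
  proof (intro add_left_mono nn_integral_mono_AE)
    show "AE \<tau> in line. ennreal (\<bar>V \<tau>\<bar> + \<bar>g (?ins \<tau>)\<bar>) * indicator {\<tau>. s < \<bar>V \<tau>\<bar>} \<tau>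
      \<le> ennreal (F (?ins \<tau>)) * indicator {x. s < \<bar>u x\<bar>} (?ins \<tau>)"
      using c
    proof eventually_elim
      case (elim \<tau>)
      then have "V \<tau> = u (?ins \<tau>)" by (simp add: V_def)
      then show ?case using F[of "?ins \<tau>"]
        by (auto simp: indicator_def simp del: ennreal_plus intro!: ennreal_leI)
    qed
  qed
  finally show ?case .
qed
qed

text \<open>Integration over all lines in direction \<open>k\<close> turns the right-hand side into an integral over the cube.
  By Chebyshev's inequality this also bounds the measure of the essential projection of the set
  \<open>{\<bar>u\<bar> > r}\<close>, on which the supremum is at least \<open>r\<close>.\<close>

lemma line_esssup_excess:
  assumes k: "k < n" and s: "0 \<le> s"
    and u [measurable]: "u \<in> borel_measurable (bcube n)" and [measurable]: "F \<in> borel_measurable (bcube n)"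
    and le: "AE y in bcube (n - 1). line_esssup n k u y
    \<le> ennreal s + (\<integral>\<^sup>+t. ennreal (F (insert_coord n k y t)) * indicator {x. s < \<bar>u x\<bar>} (insert_coord n k y t) \<partial>line)"
  shows "(\<integral>\<^sup>+y. line_esssup n k u y - ennreal s \<partial>bcube (n - 1)) \<le> (\<integral>\<^sup>+x. ennreal (F x) * indicator {x. s < \<bar>u x\<bar>} x \<partial>bcube n)"
    and "s \<le> r \<Longrightarrow> ennreal (r - s) * emeasure (bcube (n - 1))
        {y \<in> space (bcube (n - 1)). emeasure line {t \<in> space line. r < \<bar>u (insert_coord n k y t)\<bar>} > 0}
      \<le> (\<integral>\<^sup>+x. ennreal (F x) * indicator {x. s < \<bar>u x\<bar>} x \<partial>bcube n)"
proof -
  have ind: "(\<lambda>x. ennreal (F x) * indicator {x. s < \<bar>u x\<bar>} x) \<in> borel_measurable (bcube n)"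
  proof -
    have "(\<lambda>x. ennreal (F x) * (if s < \<bar>u x\<bar> then 1 else 0)) \<in> borel_measurable (bcube n)" by measurable
    then show ?thesis by (simp add: indicator_def of_bool_def)
  qed
  have "(\<integral>\<^sup>+y. line_esssup n k u y - ennreal s \<partial>bcube (n - 1))
    \<le> (\<integral>\<^sup>+y. (\<integral>\<^sup>+t. ennreal (F (insert_coord n k y t)) * indicator {x. s < \<bar>u x\<bar>} (insert_coord n k y t) \<partial>line) \<partial>bcube (n - 1))"
    using le by (intro nn_integral_mono_AE) (auto simp: ennreal_minus_le_iff elim: eventually_mono)
  also have "\<dots> = (\<integral>\<^sup>+x. ennreal (F x) * indicator {x. s < \<bar>u x\<bar>} x \<partial>bcube n)"
    by (rule nn_integral_bcube[OF k ind, symmetric])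
  finally show 1: "(\<integral>\<^sup>+y. line_esssup n k u y - ennreal s \<partial>bcube (n - 1)) \<le> \<dots>" .
  assume "s \<le> r"
  let ?A = "{y \<in> space (bcube (n - 1)). emeasure line {t \<in> space line. r < \<bar>u (insert_coord n k y t)\<bar>} > 0}"
  have A: "ennreal r \<le> line_esssup n k u y" if "y \<in> ?A" for y
  proof (rule ccontr)
    assume "\<not> ennreal r \<le> line_esssup n k u y"
    then have less: "line_esssup n k u y < ennreal r" by simp
    have y: "y \<in> space (bcube (n - 1))" using that by simp
    have "(\<lambda>t. \<bar>u (insert_coord n k y t)\<bar>) \<in> borel_measurable line"
      by (intro borel_measurable_abs measurable_section(1)[OF k u y])
    then have sets: "{t \<in> space line. r < \<bar>u (insert_coord n k y t)\<bar>} \<in> sets line"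
      by (simp only: borel_measurable_iff_greater)
    have "AE t in line. \<not> r < \<bar>u (insert_coord n k y t)\<bar>"
      using esssup_AE[of "\<lambda>t. ennreal \<bar>u (insert_coord n k y t)\<bar>" line]
    proof eventually_elim
      case (elim t)
      then have "ennreal \<bar>u (insert_coord n k y t)\<bar> < ennreal r" using less by (simp add: line_esssup_def)
      then show ?case by (simp add: ennreal_less_iff)
    qed
    then have "emeasure line {t \<in> space line. \<not> \<not> r < \<bar>u (insert_coord n k y t)\<bar>} = 0"
      using sets by (subst (asm) AE_iff_measurable[OF _ refl]) simp_all
    then show False using that by simp
  qed
  have "ennreal (r - s) * emeasure (bcube (n - 1)) ?A \<le> (\<integral>\<^sup>+y. line_esssup n k u y - ennreal s \<partial>bcube (n - 1))"
  proof (cases "?A \<in> sets (bcube (n - 1))")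
    case True
    have "ennreal (r - s) * emeasure (bcube (n - 1)) ?A = (\<integral>\<^sup>+y. ennreal (r - s) * indicator ?A y \<partial>bcube (n - 1))"
      by (rule nn_integral_cmult_indicator[OF True, symmetric])
    also have "\<dots> \<le> (\<integral>\<^sup>+y. line_esssup n k u y - ennreal s \<partial>bcube (n - 1))"
    proof (rule nn_integral_mono)
      fix y
      show "ennreal (r - s) * indicator ?A y \<le> line_esssup n k u y - ennreal s"
      proof (cases "y \<in> ?A")
        case True
        have "ennreal (r - s) \<le> ennreal r - ennreal s"
          using s by (simp add: ennreal_minus)
        then show ?thesis using ennreal_minus_mono[OF A[OF True] order_refl, of "ennreal s"] True by simp
      qed simp
    qed
    finally show ?thesis .
  qed (simp add: emeasure_notin_sets)
  with 1 show "ennreal (r - s) * emeasure (bcube (n - 1)) ?A \<le> (\<integral>\<^sup>+x. ennreal (F x) * indicator {x. s < \<bar>u x\<bar>} x \<partial>bcube n)"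
    by (rule order_trans[rotated])
qed

end

section \<open>The Loomis--Whitney inequality\<close>

context unit_interval
begin

lemma emeasure_bcube_slices:
  assumes k: "k < n" and E: "E \<in> sets (bcube n)"
  shows "emeasure (bcube n) E
      = (\<integral>\<^sup>+t. emeasure (bcube (n - 1)) {y \<in> space (bcube (n - 1)). insert_coord n k y t \<in> E} \<partial>line)"
    and "(\<lambda>t. emeasure (bcube (n - 1)) {y \<in> space (bcube (n - 1)). insert_coord n k y t \<in> E}) \<in> borel_measurable line"
    and "t \<in> I \<Longrightarrow> {y \<in> space (bcube (n - 1)). insert_coord n k y t \<in> E} \<in> sets (bcube (n - 1))"
proof -
  interpret bcube: prob_space "bcube m" for m by (rule prob_space_bcube)
  interpret pair: pair_prob_space "bcube (n - 1)" line ..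
  let ?T = "\<lambda>p. insert_coord n k (fst p) (snd p)"
  define S where "S = ?T -` E \<inter> space (bcube (n - 1) \<Otimes>\<^sub>M line)"
  have S: "S \<in> sets (bcube (n - 1) \<Otimes>\<^sub>M line)"
    unfolding S_def by (rule measurable_sets[OF measurable_insert_coord[OF k] E])
  have slice: "(\<lambda>y. (y, t)) -` S = {y \<in> space (bcube (n - 1)). insert_coord n k y t \<in> E}" if "t \<in> I" for t
    using that by (auto simp: S_def space_pair_measure)
  have "emeasure (bcube n) E = emeasure (bcube (n - 1) \<Otimes>\<^sub>M line) S"
    using emeasure_distr[OF measurable_insert_coord[OF k] E] unfolding distr_insert_coord[OF k] S_def .
  also have "\<dots> = (\<integral>\<^sup>+t. emeasure (bcube (n - 1)) ((\<lambda>y. (y, t)) -` S) \<partial>line)"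
    by (rule pair.emeasure_pair_measure_alt2[OF S])
  also have "\<dots> = (\<integral>\<^sup>+t. emeasure (bcube (n - 1)) {y \<in> space (bcube (n - 1)). insert_coord n k y t \<in> E} \<partial>line)"
    by (rule nn_integral_cong) (simp add: slice)
  finally show "emeasure (bcube n) E = \<dots>" .
  have "(\<lambda>t. emeasure (bcube (n - 1)) ((\<lambda>y. (y, t)) -` S)) \<in> borel_measurable line"
    by (rule pair.measurable_emeasure_Pair2[OF S])
  then show "(\<lambda>t. emeasure (bcube (n - 1)) {y \<in> space (bcube (n - 1)). insert_coord n k y t \<in> E}) \<in> borel_measurable line"
    by (rule measurable_cong[THEN iffD1, rotated]) (simp add: slice)
  show "{y \<in> space (bcube (n - 1)). insert_coord n k y t \<in> E} \<in> sets (bcube (n - 1))" if "t \<in> I"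
    using sets_Pair2[OF S, of t] slice[OF that] by simp
qed

text \<open>A weak form, with the sum of the measures of the projections. Slicing orthogonally to the last
  coordinate, each slice is contained in the last projection and is estimated by induction through
  the slices of the others.\<close>

lemma Loomis_Whitney:
  assumes "n \<ge> 1" "E \<in> sets (bcube n)" "\<And>i. i < n \<Longrightarrow> A i \<in> sets (bcube (n - 1))"
    and "\<And>i y t. i < n \<Longrightarrow> y \<in> space (bcube (n - 1)) \<Longrightarrow> t \<in> I \<Longrightarrow> insert_coord n i y t \<in> E \<Longrightarrow> y \<in> A i"
    and "measure (bcube n) E > 0"
  shows "measure (bcube n) E ^ (n - 1) \<le> (\<Sum>i<n. measure (bcube (n - 1)) (A i)) ^ n"
  using assms
proof (induction n arbitrary: E A rule: nat_induct_at_least)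
  case (base E A)
  have "E \<noteq> {}" using base(4) by auto
  then obtain x where x: "x \<in> E" by blast
  then have xs: "x \<in> space (bcube 1)" using sets.sets_into_space[OF base(1)] by blast
  have "insert_coord 1 0 (\<lambda>_. undefined) (x 0) = x"
    using xs by (auto simp: insert_coord_def space_bcube PiE_iff extensional_def fun_eq_iff)
  then have "(\<lambda>_. undefined) \<in> A 0"
    using base(3)[of 0 "\<lambda>_. undefined" "x 0"] x xs by (simp add: space_bcube PiE_iff)
  moreover have "space (bcube 0) = {\<lambda>_. undefined}" by (simp add: space_PiM)
  ultimately have "A 0 = space (bcube 0)" using sets.sets_into_space[OF base(2)[of 0]] by auto
  then show ?case using prob_space.prob_space[OF prob_space_bcube[of 0]] by simp
next
  case (Suc n E A)
  interpret bcube: prob_space "bcube m" for m by (rule prob_space_bcube)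
  have "n \<ge> 1" by fact
  define Et where "Et t = {y \<in> space (bcube n). insert_coord (Suc n) n y t \<in> E}" for t
  define At where "At i t = {z \<in> space (bcube (n - 1)). insert_coord n (n - 1) z t \<in> A i}" for i t
  have A_sets: "A i \<in> sets (bcube n)" if "i < Suc n" for i using Suc.prems(2)[OF that] by simp
  have Et_sets: "Et t \<in> sets (bcube n)" if "t \<in> I" for t
    using emeasure_bcube_slices(3)[of n "Suc n" E t] Suc.prems(1) that by (simp add: Et_def)
  have At_sets: "At i t \<in> sets (bcube (n - 1))" if "t \<in> I" "i < n" for i t
    using emeasure_bcube_slices(3)[of "n - 1" n "A i" t] A_sets[of i] that by (simp add: At_def)
  define \<alpha> where "\<alpha> = measure (bcube n) (A n)"
  define r where "r = root n \<alpha>"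
  have r: "0 \<le> r" "r ^ n = \<alpha>" using \<open>n \<ge> 1\<close> by (auto simp: r_def \<alpha>_def real_root_pow_pos2)
  have slice: "measure (bcube n) (Et t) \<le> r * (\<Sum>i<n. measure (bcube (n - 1)) (At i t))" if t: "t \<in> I" for t
  proof (cases "measure (bcube n) (Et t) > 0")
    case False
    then have "measure (bcube n) (Et t) \<le> 0" by simp
    also have "0 \<le> r * (\<Sum>i<n. measure (bcube (n - 1)) (At i t))"
      using r by (intro mult_nonneg_nonneg sum_nonneg) auto
    finally show ?thesis .
  next
    case True
    let ?m = "measure (bcube n) (Et t)" and ?S = "\<Sum>i<n. measure (bcube (n - 1)) (At i t)"
    have "?m ^ (n - 1) \<le> ?S ^ n"
    proof (rule Suc.IH[OF Et_sets[OF t] At_sets[OF t] _ True])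
      fix i y s assume i: "i < n" and y: "y \<in> space (bcube (n - 1))" and s: "s \<in> I"
        and E: "insert_coord n i y s \<in> Et t"
      have "insert_coord (Suc n) i (insert_coord n (n - 1) y t) s \<in> E"
        using E insert_coord_commute[OF i, of y s t] by (simp add: Et_def)
      moreover have "insert_coord n (n - 1) y t \<in> space (bcube n)"
      proof -
        have "(y, t) \<in> space (bcube (n - 1) \<Otimes>\<^sub>M line)" using y t by (simp add: space_pair_measure)
        from measurable_space[OF measurable_insert_coord[of "n - 1" n] this] show ?thesis using i by simp
      qed
      ultimately have "insert_coord n (n - 1) y t \<in> A i" using Suc.prems(3)[of i _ s] i s by simp
      then show "y \<in> At i t" using y by (simp add: At_def)
    qed
    moreover have "?m \<le> \<alpha>"
      unfolding \<alpha>_def using Suc.prems(3)[of n _ t] t A_sets[of n]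
      by (intro bcube.finite_measure_mono) (auto simp: Et_def)
    ultimately have "?m * ?m ^ (n - 1) \<le> \<alpha> * ?S ^ n"
      by (intro mult_mono) (auto simp: \<alpha>_def)
    then have le: "?m ^ n \<le> (r * ?S) ^ n"
      using power_minus_mult[of n ?m] \<open>n \<ge> 1\<close> r(2) by (simp add: power_mult_distrib mult.commute)
    obtain m where m: "n = Suc m" using \<open>n \<ge> 1\<close> by (cases n) auto
    have "0 \<le> r * ?S" using r(1) by (intro mult_nonneg_nonneg sum_nonneg) auto
    then show ?thesis using le unfolding m by (rule power_le_imp_le_base[rotated])
  qed
  have "emeasure (bcube (Suc n)) E = (\<integral>\<^sup>+t. emeasure (bcube n) (Et t) \<partial>line)"
    using emeasure_bcube_slices(1)[of n "Suc n" E] Suc.prems(1) by (simp add: Et_def)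
  also have "\<dots> \<le> (\<integral>\<^sup>+t. ennreal r * (\<Sum>i<n. emeasure (bcube (n - 1)) (At i t)) \<partial>line)"
  proof (rule nn_integral_mono)
    fix t assume "t \<in> space line"
    then have "ennreal (measure (bcube n) (Et t)) \<le> ennreal (r * (\<Sum>i<n. measure (bcube (n - 1)) (At i t)))"
      using slice by (intro ennreal_leI) simp
    then show "emeasure (bcube n) (Et t) \<le> ennreal r * (\<Sum>i<n. emeasure (bcube (n - 1)) (At i t))"
      using r by (simp add: bcube.emeasure_eq_measure ennreal_mult sum_nonneg)
  qed
  also have "\<dots> = ennreal r * (\<Sum>i<n. \<integral>\<^sup>+t. emeasure (bcube (n - 1)) (At i t) \<partial>line)"
  proof -
    have m: "(\<lambda>t. emeasure (bcube (n - 1)) (At i t)) \<in> borel_measurable line" if "i < n" for i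
      using emeasure_bcube_slices(2)[of "n - 1" n "A i"] A_sets[of i] that by (simp add: At_def)
    have "(\<integral>\<^sup>+t. ennreal r * (\<Sum>i<n. emeasure (bcube (n - 1)) (At i t)) \<partial>line)
        = ennreal r * (\<integral>\<^sup>+t. (\<Sum>i<n. emeasure (bcube (n - 1)) (At i t)) \<partial>line)"
      using m by (intro nn_integral_cmult borel_measurable_sum) simp
    also have "(\<integral>\<^sup>+t. (\<Sum>i<n. emeasure (bcube (n - 1)) (At i t)) \<partial>line)
        = (\<Sum>i<n. \<integral>\<^sup>+t. emeasure (bcube (n - 1)) (At i t) \<partial>line)"
      using m by (intro nn_integral_sum) simp
    finally show ?thesis .
  qed
  also have "\<dots> = ennreal r * (\<Sum>i<n. emeasure (bcube n) (A i))"
  proof -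
    have "(\<integral>\<^sup>+t. emeasure (bcube (n - 1)) (At i t) \<partial>line) = emeasure (bcube n) (A i)" if "i < n" for i
      using emeasure_bcube_slices(1)[of "n - 1" n "A i"] A_sets[of i] that by (simp add: At_def)
    then show ?thesis by simp
  qed
  also have "\<dots> = ennreal (r * (\<Sum>i<n. measure (bcube n) (A i)))"
    using r by (simp add: bcube.emeasure_eq_measure ennreal_mult sum_nonneg)
  finally have le: "measure (bcube (Suc n)) E \<le> r * (\<Sum>i<n. measure (bcube n) (A i))"
    using r by (simp add: bcube.emeasure_eq_measure sum_nonneg)
  let ?S = "\<Sum>i<Suc n. measure (bcube n) (A i)"
  have "measure (bcube (Suc n)) E ^ n \<le> (r * (\<Sum>i<n. measure (bcube n) (A i))) ^ n"
    using le by (intro power_mono) auto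
  also have "\<dots> = \<alpha> * (\<Sum>i<n. measure (bcube n) (A i)) ^ n" using r by (simp add: power_mult_distrib)
  also have "\<dots> \<le> ?S * ?S ^ n"
    by (intro mult_mono power_mono) (auto simp: \<alpha>_def sum_nonneg)
  finally show ?case by simp
qed

text \<open>Projections of a set may be replaced by their essential parts: the points of the set lying on
  lines which it meets in a null set form a null set.\<close>

lemma Loomis_Whitney_essential:
  assumes n: "n \<ge> 1" and E: "E \<in> sets (bcube n)" and pos: "measure (bcube n) E > 0"
  shows "measure (bcube n) E ^ (n - 1) \<le> (\<Sum>i<n. measure (bcube (n - 1))
    {y \<in> space (bcube (n - 1)). emeasure line {t \<in> space line. insert_coord n i y t \<in> E} > 0}) ^ n"
proof -
  interpret bcube: prob_space "bcube m" for m by (rule prob_space_bcube)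
  define A where "A i = {y \<in> space (bcube (n - 1)). emeasure line {t \<in> space line. insert_coord n i y t \<in> E} > 0}" for i
  define P where "P i x = (\<integral>\<^sup>+t. indicator E (x(i := t)) \<partial>line)" for i x
  have ind: "indicator E \<in> borel_measurable (bcube n)" using E by simp
  have P_meas: "P i \<in> borel_measurable (bcube n)" if "i < n" for i
    unfolding P_def
    using measurable_compose[OF measurable_update[OF that] ind]
    by (intro line.borel_measurable_nn_integral) (simp add: case_prod_unfold)
  have P_ins: "P i (insert_coord n i y s) = emeasure line {t \<in> space line. insert_coord n i y t \<in> E}"
    if "i < n" "y \<in> space (bcube (n - 1))" for i y s
  proof -
    have "{t \<in> space line. insert_coord n i y t \<in> E} \<in> sets line"
      using measurable_sets[OF measurable_section(1)[OF that(1) measurable_ident that(2)] E]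
      by (simp add: vimage_def Int_def conj_commute)
    then have "emeasure line {t \<in> space line. insert_coord n i y t \<in> E}
        = (\<integral>\<^sup>+t. indicator {t \<in> space line. insert_coord n i y t \<in> E} t \<partial>line)" by simp
    also have "\<dots> = P i (insert_coord n i y s)"
      unfolding P_def insert_coord_update[OF that(1)]
      by (rule nn_integral_cong) (auto simp: indicator_def)
    finally show ?thesis ..
  qed
  define E' where "E' = {x \<in> E. \<forall>i<n. P i x > 0}"
  have E_space: "E = {x \<in> space (bcube n). x \<in> E}" using sets.sets_into_space[OF E] by auto
  have null: "AE x in bcube n. x \<in> E \<longrightarrow> P i x > 0" if i: "i < n" for i
  proof (rule AE_I)
    let ?N = "{x \<in> space (bcube n). \<not> (x \<in> E \<longrightarrow> P i x > 0)}"
    have N: "{x \<in> E. \<not> P i x > 0} \<in> sets (bcube n)"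
    proof -
      have "{x \<in> space (bcube n). \<not> P i x > 0} \<in> sets (bcube n)" using P_meas[OF i] by measurable
      then have "E \<inter> {x \<in> space (bcube n). \<not> P i x > 0} \<in> sets (bcube n)" using E by blast
      also have "E \<inter> {x \<in> space (bcube n). \<not> P i x > 0} = {x \<in> E. \<not> P i x > 0}" using E_space by blast
      finally show ?thesis .
    qed
    show "?N \<subseteq> {x \<in> E. \<not> P i x > 0}" by auto
    show "{x \<in> E. \<not> P i x > 0} \<in> sets (bcube n)" by (rule N)
    have "emeasure (bcube n) {x \<in> E. \<not> P i x > 0} = (\<integral>\<^sup>+x. indicator {x \<in> E. \<not> P i x > 0} x \<partial>bcube n)"
      using N by simp
    also have "\<dots> = (\<integral>\<^sup>+y. (\<integral>\<^sup>+t. indicator {x \<in> E. \<not> P i x > 0} (insert_coord n i y t) \<partial>line) \<partial>bcube (n - 1))"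
      using N by (intro nn_integral_bcube[OF i]) simp
    also have "\<dots> = (\<integral>\<^sup>+y. 0 \<partial>bcube (n - 1))"
    proof (rule nn_integral_cong)
      fix y assume y: "y \<in> space (bcube (n - 1))"
      show "(\<integral>\<^sup>+t. indicator {x \<in> E. \<not> P i x > 0} (insert_coord n i y t) \<partial>line) = 0"
      proof (cases "P i (insert_coord n i y a) > 0")
        case True
        then have "indicator {x \<in> E. \<not> P i x > 0} (insert_coord n i y t) = (0 :: ennreal)" for t
          by (simp add: P_ins[OF i y] indicator_def zero_less_iff_neq_zero)
        then show ?thesis by simp
      next
        case False
        have "(\<integral>\<^sup>+t. indicator {x \<in> E. \<not> P i x > 0} (insert_coord n i y t) \<partial>line) \<le> P i (insert_coord n i y a)"
          unfolding P_def insert_coord_update[OF i] by (intro nn_integral_mono) (auto simp: indicator_def)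
        then show ?thesis using False by simp
      qed
    qed
    finally show "emeasure (bcube n) {x \<in> E. \<not> P i x > 0} = 0" by simp
  qed
  have E'_sets: "E' \<in> sets (bcube n)"
  proof -
    have "{x \<in> space (bcube n). \<forall>i\<in>{..<n}. P i x > 0} \<in> sets (bcube n)"
      using P_meas by (intro sets.sets_Collect_finite_All) (auto intro: borel_measurable_less)
    then have "E \<inter> {x \<in> space (bcube n). \<forall>i\<in>{..<n}. P i x > 0} \<in> sets (bcube n)" using E by blast
    also have "E \<inter> {x \<in> space (bcube n). \<forall>i\<in>{..<n}. P i x > 0} = E'" using E_space unfolding E'_def by blast
    finally show ?thesis .
  qed
  have "AE x in bcube n. \<forall>i\<in>{..<n}. x \<in> E \<longrightarrow> P i x > 0"
    by (intro AE_finite_allI) (auto intro: null)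
  then have "AE x in bcube n. x \<in> E \<longleftrightarrow> x \<in> E'" by eventually_elim (auto simp: E'_def)
  then have eq: "measure (bcube n) E' = measure (bcube n) E"
    using E E'_sets by (intro bcube.finite_measure_eq_AE) auto
  have "measure (bcube n) E' ^ (n - 1) \<le> (\<Sum>i<n. measure (bcube (n - 1)) (A i)) ^ n"
  proof (rule Loomis_Whitney[OF n E'_sets])
    show "measure (bcube n) E' > 0" using pos eq by simp
    fix i assume i: "i < n"
    show "y \<in> A i" if "y \<in> space (bcube (n - 1))" "t \<in> I" "insert_coord n i y t \<in> E'" for y t
      using that P_ins[OF i that(1), of t] i by (auto simp: E'_def A_def)
    have "(\<lambda>y. P i (insert_coord n i y a')) \<in> borel_measurable (bcube (n - 1))" if "a' \<in> I" for a'
      using measurable_compose[OF measurable_Pair2'[of a' line "bcube (n - 1)"]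
        measurable_section(2)[OF i P_meas[OF i]]] that by simp
    moreover obtain a' where "a' \<in> I" using open_subset by (force intro: that[of "a + 1 / 2"])
    ultimately have "{y \<in> space (bcube (n - 1)). P i (insert_coord n i y a') > 0} \<in> sets (bcube (n - 1))"
      by measurable
    also have "{y \<in> space (bcube (n - 1)). P i (insert_coord n i y a') > 0} = A i"
      using P_ins[OF i] by (auto simp: A_def)
    finally show "A i \<in> sets (bcube (n - 1))" .
  qed
  then show ?thesis by (simp add: eq A_def)
qed

end

section \<open>The Hardy operator\<close>

lemma distribution_fun_completion:
  "f \<in> borel_measurable M \<Longrightarrow> distribution_fun (completion M) f = distribution_fun M f"
  by (auto simp: distribution_fun_def fun_eq_iff)

lemma rearrangement_cong:
  "(\<And>t. t \<ge> 0 \<Longrightarrow> distribution_fun M f t = distribution_fun M' g t) \<Longrightarrow> rearrangement M f = rearrangement M' g"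
  unfolding rearrangement_def by (rule ext, rule arg_cong[where f = Inf]) auto

text \<open>The operator of the theorem, with \<open>p\<close> for \<open>1 / n'\<close>.\<close>

definition hardy :: "real \<Rightarrow> (real \<Rightarrow> real) \<Rightarrow> real \<Rightarrow> ennreal" where
  "hardy p R t = (\<integral>\<^sup>+s\<in>{t powr (1 / p)..1}. ennreal (R s * s powr (- p)) \<partial>lborel)"

lemma powr_inverse_le_iff:
  assumes "0 < p" "0 < t" "0 < s"
  shows "t powr (1 / p) \<le> s \<longleftrightarrow> t \<le> (s :: real) powr p"
proof
  assume "t powr (1 / p) \<le> s"
  then have "(t powr (1 / p)) powr p \<le> s powr p" using assms by (intro powr_mono2) auto
  then show "t \<le> s powr p" using assms by (simp add: powr_powr)
next
  assume "t \<le> s powr p"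
  then have "t powr (1 / p) \<le> (s powr p) powr (1 / p)" using assms by (intro powr_mono2) auto
  then show "t powr (1 / p) \<le> s" using assms by (simp add: powr_powr)
qed

locale hardy_operator =
  fixes p :: real and R :: "real \<Rightarrow> real"
  assumes p: "0 < p" and R_nonneg: "\<And>t. 0 < t \<Longrightarrow> 0 \<le> R t"
    and R_measurable: "(\<lambda>t. R t * indicator {0<..} t) \<in> borel_measurable borel"
    and R_integrable: "(\<integral>\<^sup>+t\<in>{0<..<1}. ennreal (R t) \<partial>lborel) < \<infinity>"
begin

text \<open>A rearrangement is meaningful at positive arguments only; elsewhere it is replaced by \<open>0\<close>.\<close>

definition R0 :: "real \<Rightarrow> real" where
  "R0 t = R t * indicator {0<..} t"

lemma R0: "R0 \<in> borel_measurable borel" "0 \<le> R0 t" "0 < t \<Longrightarrow> R0 t = R t"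
proof -
  show "R0 \<in> borel_measurable borel" using R_measurable by (simp add: R0_def[abs_def])
  show "0 \<le> R0 t" using R_nonneg[of t] by (cases "0 < t") (auto simp: R0_def)
  show "0 < t \<Longrightarrow> R0 t = R t" by (simp add: R0_def)
qed

lemma hardy_R0:
  assumes "0 < t"
  shows "hardy p R t = (\<integral>\<^sup>+s. ennreal (R0 s * s powr (- p)) * indicator {t powr (1 / p)..1} s \<partial>lborel)"
  unfolding hardy_def
proof (rule nn_integral_cong)
  fix s :: real
  have "0 < t powr (1 / p)" using assms by simp
  then have "0 < s" if "t powr (1 / p) \<le> s" using that by (rule less_le_trans)
  then show "ennreal (R s * s powr (- p)) * indicator {t powr (1 / p)..1} s
    = ennreal (R0 s * s powr (- p)) * indicator {t powr (1 / p)..1} s"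
    by (cases "t powr (1 / p) \<le> s") (simp_all add: R0(3))
qed

lemma hardy_antimono: "0 < s \<Longrightarrow> s \<le> t \<Longrightarrow> hardy p R t \<le> hardy p R s"
proof -
  assume "0 < s" "s \<le> t"
  then have "s powr (1 / p) \<le> t powr (1 / p)" using p by (intro powr_mono2) auto
  then show ?thesis unfolding hardy_def by (intro nn_integral_mono) (auto simp: indicator_def)
qed

lemma integral_R0: "(\<integral>\<^sup>+s. ennreal (R0 s) * indicator {0<..1} s \<partial>lborel) < \<infinity>"
proof -
  have "(\<integral>\<^sup>+s. ennreal (R0 s) * indicator {0<..1} s \<partial>lborel) = (\<integral>\<^sup>+t\<in>{0<..<1}. ennreal (R t) \<partial>lborel)"
  proof (rule nn_integral_cong_AE)
    show "AE s in lborel. ennreal (R0 s) * indicator {0<..1} s = ennreal (R s) * indicator {0<..<1} s"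
      using AE_lborel_singleton[of 1] by eventually_elim (auto simp: R0_def indicator_def)
  qed
  then show ?thesis using R_integrable by simp
qed

text \<open>On the range of integration \<open>s powr (- p) \<le> 1 / t\<close>.\<close>

lemma hardy_finite:
  assumes "0 < t"
  shows "hardy p R t < \<infinity>"
proof -
  have "hardy p R t \<le> (\<integral>\<^sup>+s. ennreal (1 / t) * (ennreal (R0 s) * indicator {0<..1} s) \<partial>lborel)"
    unfolding hardy_R0[OF assms]
  proof (rule nn_integral_mono)
    fix s :: real
    show "ennreal (R0 s * s powr (- p)) * indicator {t powr (1 / p)..1} s
      \<le> ennreal (1 / t) * (ennreal (R0 s) * indicator {0<..1} s)"
    proof (cases "s \<in> {t powr (1 / p)..1}")
      case True
      then have "0 < s" using assms by (auto intro: less_le_trans[of 0 "t powr (1 / p)"])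
      then have "t \<le> s powr p" using True powr_inverse_le_iff[OF p assms, of s] by simp
      then have "s powr (- p) \<le> 1 / t"
        using assms \<open>0 < s\<close> by (simp add: powr_minus_divide frac_le)
      then have "R0 s * s powr (- p) \<le> 1 / t * R0 s"
        using mult_left_mono[of "s powr (- p)" "1 / t" "R0 s"] R0(2)[of s] by (simp add: mult.commute)
      then have "ennreal (R0 s * s powr (- p)) \<le> ennreal (1 / t) * ennreal (R0 s)"
        using assms R0(2)[of s] by (simp add: ennreal_mult[symmetric] ennreal_leI)
      then show ?thesis using True \<open>0 < s\<close> by simp
    qed simp
  qed
  also have "\<dots> = ennreal (1 / t) * (\<integral>\<^sup>+s. ennreal (R0 s) * indicator {0<..1} s \<partial>lborel)"
    using R0(1) by (intro nn_integral_cmult) simp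
  also have "\<dots> < \<infinity>" using integral_R0 by (simp add: ennreal_mult_less_top)
  finally show ?thesis .
qed

lemma measurable_hardy: "(\<lambda>t. hardy p R t * indicator {0<..<v} t) \<in> borel_measurable borel"
proof -
  have "(\<lambda>t. - enn2real (hardy p R t)) \<in> borel_measurable (restrict_space borel {0<..})"
    by (rule borel_measurable_mono_on_fnc)
       (auto intro!: mono_onI enn2real_mono hardy_antimono hardy_finite[unfolded infinity_ennreal_def])
  then have "(\<lambda>t. enn2real (hardy p R t)) \<in> borel_measurable (restrict_space borel {0<..})" by simp
  then have [measurable]: "(\<lambda>t. enn2real (hardy p R t) * indicator {0<..} t) \<in> borel_measurable borel"
    by (subst (asm) borel_measurable_restrict_space_iff) (auto simp: mult.commute)
  have "hardy p R t * indicator {0<..<v} t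
      = ennreal (enn2real (hardy p R t) * indicator {0<..} t) * indicator {0<..<v} t" for t
    using hardy_finite[of t] by (cases "0 < t") auto
  moreover have "(\<lambda>t. ennreal (enn2real (hardy p R t) * indicator {0<..} t) * indicator {0<..<v} t) \<in> borel_measurable borel"
    by measurable
  ultimately show ?thesis by simp
qed

text \<open>Monotone convergence along a sequence decreasing to \<open>t\<close>: the lower end of the range of integration is a
  continuous function of \<open>t\<close> and a null set.\<close>

lemma hardy_right_continuous:
  assumes t: "0 < t" "t < 1" and c: "c < hardy p R t"
  shows "\<exists>u>t. u < 1 \<and> c < hardy p R u"
proof -
  define w where "w j = t + (1 - t) / (real j + 2)" for j :: nat
  have w: "t < w j" "w j < 1" for j
  proof -
    show "t < w j" using t by (simp add: w_def)
    have "(1 - t) / (real j + 2) < (1 - t) / 1" using t by (intro divide_strict_left_mono) auto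
    then show "w j < 1" by (simp add: w_def)
  qed
  have w_dec: "w (Suc j) \<le> w j" for j using t by (auto simp: w_def intro!: divide_left_mono)
  have w_lim: "w \<longlonglongrightarrow> t" unfolding w_def by real_asymp
  let ?f = "\<lambda>s. ennreal (R0 s * s powr (- p))"
  have f[measurable]: "?f \<in> borel_measurable borel" using R0(1) by simp
  have "hardy p R t = (\<integral>\<^sup>+s. ?f s * indicator {t powr (1 / p)<..1} s \<partial>lborel)"
    unfolding hardy_R0[OF t(1)]
  proof (rule nn_integral_cong_AE)
    show "AE s in lborel. ?f s * indicator {t powr (1 / p)..1} s = ?f s * indicator {t powr (1 / p)<..1} s"
      using AE_lborel_singleton[of "t powr (1 / p)"] by eventually_elim (auto simp: indicator_def)
  qed
  also have "\<dots> = (\<integral>\<^sup>+s. (SUP j. ?f s * indicator {w j powr (1 / p)..1} s) \<partial>lborel)"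
  proof (rule nn_integral_cong)
    fix s :: real
    show "?f s * indicator {t powr (1 / p)<..1} s = (SUP j. ?f s * indicator {w j powr (1 / p)..1} s)"
    proof (cases "t powr (1 / p) < s \<and> s \<le> 1")
      case True
      have "(\<lambda>j. w j powr (1 / p)) \<longlonglongrightarrow> t powr (1 / p)"
        using t by (intro tendsto_powr w_lim tendsto_const) simp
      then have "eventually (\<lambda>j. w j powr (1 / p) < s) sequentially" using True by (intro order_tendstoD) auto
      then obtain j where "w j powr (1 / p) < s" by (auto simp: eventually_sequentially)
      then have "?f s \<le> (SUP j. ?f s * indicator {w j powr (1 / p)..1} s)"
        using True by (intro SUP_upper2[of j]) auto
      moreover have "(SUP j. ?f s * indicator {w j powr (1 / p)..1} s) \<le> ?f s"
        by (intro SUP_least) (auto simp: indicator_def)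
      ultimately show ?thesis using True by auto
    next
      case False
      have "\<not> (w j powr (1 / p) \<le> s \<and> s \<le> 1)" for j
      proof -
        have "t powr (1 / p) < w j powr (1 / p)" using w[of j] t p by (intro powr_less_mono2) auto
        then show ?thesis using False by auto
      qed
      then have "indicator {w j powr (1 / p)..1} s = (0 :: ennreal)" for j by (simp add: indicator_def)
      moreover have "indicator {t powr (1 / p)<..1} s = (0 :: ennreal)" using False by (simp add: indicator_def)
      ultimately show ?thesis by simp
    qed
  qed
  also have "\<dots> = (SUP j. \<integral>\<^sup>+s. ?f s * indicator {w j powr (1 / p)..1} s \<partial>lborel)"
  proof (rule nn_integral_monotone_convergence_SUP)
    show "incseq (\<lambda>j s. ?f s * indicator {w j powr (1 / p)..1} s)"
    proof (intro incseq_SucI le_funI)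
      fix j and s :: real
      have "w (Suc j) powr (1 / p) \<le> w j powr (1 / p)"
        using w_dec[of j] w(1)[of "Suc j"] t p by (intro powr_mono2) (simp_all add: less_imp_le)
      then show "?f s * indicator {w j powr (1 / p)..1} s \<le> ?f s * indicator {w (Suc j) powr (1 / p)..1} s"
        by (auto simp: indicator_def)
    qed
  qed measurable
  also have "\<dots> = (SUP j. hardy p R (w j))" by (simp only: hardy_R0[OF less_trans[OF t(1) w(1)]])
  finally have "c < (SUP j. hardy p R (w j))" using c by simp
  then obtain j where "c < hardy p R (w j)" by (auto simp: less_SUP_iff)
  then show ?thesis using w by blast
qed

text \<open>The integral of \<open>hardy p R\<close> over \<open>(0, t)\<close>, by Fubini.\<close>

lemma nn_integral_hardy:
  assumes t: "0 < t"
  shows "(\<integral>\<^sup>+\<tau>\<in>{0<..<t}. hardy p R \<tau> \<partial>lborel)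
    = (\<integral>\<^sup>+s\<in>{0<..<1}. ennreal (R s * min 1 (t * s powr (- p))) \<partial>lborel)"
proof -
  let ?g = "\<lambda>\<tau> s. ennreal (R0 s * s powr (- p)) * indicator {0<..<t} \<tau> * (if \<tau> \<le> s powr p then 1 else 0) * indicator {0<..1} s"
  have [measurable]: "R0 \<in> borel_measurable borel" by (rule R0(1))
  have "(\<integral>\<^sup>+\<tau>\<in>{0<..<t}. hardy p R \<tau> \<partial>lborel) = (\<integral>\<^sup>+\<tau>. (\<integral>\<^sup>+s. ?g \<tau> s \<partial>lborel) \<partial>lborel)"
  proof (rule nn_integral_cong)
    fix \<tau> :: real
    show "hardy p R \<tau> * indicator {0<..<t} \<tau> = (\<integral>\<^sup>+s. ?g \<tau> s \<partial>lborel)"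
    proof (cases "\<tau> \<in> {0<..<t}")
      case True
      then have \<tau>: "0 < \<tau>" by simp
      have "indicator {\<tau> powr (1 / p)..1} s = (if \<tau> \<le> s powr p then 1 else 0 :: ennreal) * indicator {0<..1} s" for s
        using powr_inverse_le_iff[OF p \<tau>, of s] \<tau> less_le_trans[of 0 "\<tau> powr (1 / p)" s]
        by (cases "0 < s") (auto simp: indicator_def)
      then show ?thesis using True by (simp add: hardy_R0[OF \<tau>] mult.assoc)
    qed simp
  qed
  also have "\<dots> = (\<integral>\<^sup>+s. (\<integral>\<^sup>+\<tau>. ?g \<tau> s \<partial>lborel) \<partial>lborel)"
    by (rule lborel_pair.Fubini') measurable
  also have "\<dots> = (\<integral>\<^sup>+s\<in>{0<..<1}. ennreal (R s * min 1 (t * s powr (- p))) \<partial>lborel)"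
  proof (rule nn_integral_cong_AE)
    show "AE s in lborel. (\<integral>\<^sup>+\<tau>. ?g \<tau> s \<partial>lborel)
      = ennreal (R s * min 1 (t * s powr (- p))) * indicator {0<..<1} s"
      using AE_lborel_singleton[of 1]
    proof eventually_elim
      case (elim s)
      show ?case
      proof (cases "0 < s \<and> s < 1")
        case True
        have "(\<integral>\<^sup>+\<tau>. ?g \<tau> s \<partial>lborel)
            = (\<integral>\<^sup>+\<tau>. ennreal (R0 s * s powr (- p)) * (indicator {0<..<t} \<tau> * indicator {..s powr p} \<tau>) \<partial>lborel)"
          using True by (intro nn_integral_cong) (auto simp: indicator_def)
        also have "\<dots> = ennreal (R0 s * s powr (- p)) * (\<integral>\<^sup>+\<tau>. indicator {0<..<t} \<tau> * indicator {..s powr p} \<tau> \<partial>lborel)"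
          by (intro nn_integral_cmult) simp
        also have "(\<integral>\<^sup>+\<tau>. indicator {0<..<t} \<tau> * indicator {..s powr p} \<tau> \<partial>lborel) = emeasure lborel {0<..<min t (s powr p)}"
        proof -
          have "(\<integral>\<^sup>+\<tau>. indicator {0<..<t} \<tau> * indicator {..s powr p} \<tau> \<partial>lborel)
              = (\<integral>\<^sup>+\<tau>. indicator {0<..<min t (s powr p)} \<tau> \<partial>lborel)"
          proof (rule nn_integral_cong_AE)
            show "AE \<tau> in lborel. indicator {0<..<t} \<tau> * indicator {..s powr p} \<tau>
              = (indicator {0<..<min t (s powr p)} \<tau> :: ennreal)"
              using AE_lborel_singleton[of "s powr p"] by eventually_elim (auto simp: indicator_def)
          qed
          then show ?thesis by simp
        qed
        also have "\<dots> = ennreal (min t (s powr p))" using t True by simp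
        also have "ennreal (R0 s * s powr (- p)) * ennreal (min t (s powr p))
            = ennreal (R0 s * (s powr (- p) * min t (s powr p)))"
          using R0(2)[of s] t by (simp add: ennreal_mult[symmetric] mult.assoc)
        also have "s powr (- p) * min t (s powr p) = min 1 (t * s powr (- p))"
          using True by (simp add: min_mult_distrib_left powr_add[symmetric] min.commute mult.commute)
        finally show ?thesis using True R0(3)[of s] by simp
      next
        case False
        then show ?thesis using elim by (auto simp: indicator_def)
      qed
    qed
  qed
  finally show ?thesis .
qed

lemma hardy_right_continuous_decreasing:
  assumes "0 \<le> C"
  shows "right_continuous_decreasing (\<lambda>t. C * enn2real (hardy p R t))"
proof (rule right_continuous_decreasing.intro)
  show "0 \<le> C * enn2real (hardy p R t)" for t using assms by simp
next
  fix s t :: real assume t: "0 < t" "t < 1" and s: "s < C * enn2real (hardy p R t)"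
  show "\<exists>u>t. u < 1 \<and> s < C * enn2real (hardy p R u)"
  proof (cases "s < 0")
    case True
    obtain u where "t < u" "u < 1" using t dense by blast
    then show ?thesis using True assms by (intro exI[of _ u]) (auto intro: less_le_trans)
  next
    case False
    then have "0 < C" using s assms by (cases "C = 0") auto
    then have "s / C < enn2real (hardy p R t)" using s by (simp add: field_simps)
    then have "ennreal (s / C) < hardy p R t"
      using False \<open>0 < C\<close> hardy_finite[OF t(1)]
      by (metis divide_nonneg_pos ennreal_enn2real ennreal_less_iff infinity_ennreal_def not_less)
    then obtain u where u: "t < u" "u < 1" "ennreal (s / C) < hardy p R u"
      using hardy_right_continuous[OF t] by blast
    then have "s / C < enn2real (hardy p R u)"
      using False \<open>0 < C\<close> hardy_finite[of u] t
      by (metis divide_nonneg_pos ennreal_enn2real ennreal_less_iff infinity_ennreal_def not_less less_trans)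
    then show ?thesis using u \<open>0 < C\<close> by (intro exI[of _ u]) (simp add: field_simps)
  qed
next
  fix s t :: real assume st: "0 < s" "s \<le> t" "t < 1"
  show "C * enn2real (hardy p R t) \<le> C * enn2real (hardy p R s)"
    using st hardy_antimono[of s t] hardy_finite[of s] assms
    by (intro mult_left_mono enn2real_mono) auto
qed

end

section \<open>Rearrangement estimates for weakly differentiable functions\<close>

text \<open>\<open>h\<^sup>* \<le> s + (h\<^sup>* - s)\<^sub>+\<close>, and the last term has the same integral as \<open>(\<bar>h\<bar> - s)\<^sub>+\<close> by equimeasurability.\<close>

lemma (in prob_space) nn_integral_rearrangement_le_excess:
  assumes h: "h \<in> borel_measurable M" and t: "0 < t" "t \<le> 1" and s: "0 \<le> s"
  shows "(\<integral>\<^sup>+\<tau>\<in>{0<..<t}. ennreal (rearrangement M h \<tau>) \<partial>lborel)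
    \<le> ennreal (t * s) + (\<integral>\<^sup>+x. ennreal (max 0 (\<bar>h x\<bar> - s)) \<partial>M)"
proof -
  define R where "R = (\<lambda>t. rearrangement M h t * indicator {0<..} t)"
  have [measurable]: "R \<in> borel_measurable borel" unfolding R_def using h by measurable
  have "(\<integral>\<^sup>+\<tau>\<in>{0<..<t}. ennreal (rearrangement M h \<tau>) \<partial>lborel)
      \<le> (\<integral>\<^sup>+\<tau>. ennreal s * indicator {0<..<t} \<tau> + ennreal (max 0 (R \<tau> - s)) * indicator {0<..<1} \<tau> \<partial>lborel)"
  proof (rule nn_integral_mono)
    fix \<tau> :: real
    have "rearrangement M h \<tau> \<le> s + max 0 (R \<tau> - s)" if "0 < \<tau>" using that by (simp add: R_def)
    then have "ennreal (rearrangement M h \<tau>) \<le> ennreal s + ennreal (max 0 (R \<tau> - s))" if "0 < \<tau>"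
      using that s by (subst ennreal_plus[symmetric]) (simp_all add: ennreal_leI del: ennreal_plus)
    then show "ennreal (rearrangement M h \<tau>) * indicator {0<..<t} \<tau>
      \<le> ennreal s * indicator {0<..<t} \<tau> + ennreal (max 0 (R \<tau> - s)) * indicator {0<..<1} \<tau>"
      using t by (cases "\<tau> \<in> {0<..<t}") auto
  qed
  also have "\<dots> = ennreal s * ennreal t + (\<integral>\<^sup>+\<tau>\<in>{0<..<1}. ennreal (max 0 (R \<tau> - s)) \<partial>lborel)"
    using t by (subst nn_integral_add) (auto simp: nn_integral_cmult_indicator)
  also have "(\<integral>\<^sup>+\<tau>\<in>{0<..<1}. ennreal (max 0 (R \<tau> - s)) \<partial>lborel)
      = (\<integral>\<^sup>+\<tau>\<in>{0<..<1}. ennreal (max 0 (rearrangement M h \<tau> - s)) \<partial>lborel)"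
    by (rule nn_integral_cong) (auto simp: R_def indicator_def)
  also have "\<dots> = (\<integral>\<^sup>+x. ennreal (max 0 (\<bar>h x\<bar> - s)) \<partial>M)"
    by (rule nn_integral_rearrangement[OF h, where \<phi> = "\<lambda>y. ennreal (max 0 (y - s))", symmetric]) simp
  also have "ennreal s * ennreal t = ennreal (t * s)" using s t by (simp add: ennreal_mult[symmetric] mult.commute)
  finally show ?thesis .
qed

text \<open>The rearrangement is decreasing, so its integral over \<open>(v/2, v)\<close> is at most that over \<open>(0, v/2)\<close>.\<close>

lemma (in prob_space) nn_integral_rearrangement_doubling:
  assumes h: "h \<in> borel_measurable M" and v: "0 < v"
  shows "(\<integral>\<^sup>+\<tau>\<in>{0<..<v}. ennreal (rearrangement M h \<tau>) \<partial>lborel)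
    \<le> 2 * (\<integral>\<^sup>+\<tau>\<in>{0<..<v / 2}. ennreal (rearrangement M h \<tau>) \<partial>lborel)"
proof -
  define R where "R = (\<lambda>t. rearrangement M h t * indicator {0<..} t)"
  have [measurable]: "R \<in> borel_measurable borel" unfolding R_def using h by measurable
  have R: "rearrangement M h t = R t" if "0 < t" for t using that by (simp add: R_def)
  have dec: "R t \<le> R s" if "0 < s" "s \<le> t" for s t
    using rearrangement_antimono[OF h that] that by (simp add: R_def)
  let ?L = "\<integral>\<^sup>+\<tau>\<in>{0<..<v / 2}. ennreal (R \<tau>) \<partial>lborel"
  have "(\<integral>\<^sup>+\<tau>\<in>{0<..<v}. ennreal (R \<tau>) \<partial>lborel)
      \<le> (\<integral>\<^sup>+\<tau>. ennreal (R \<tau>) * indicator {0<..<v / 2} \<tau> + ennreal (R (v / 2)) * indicator {v / 2..<v} \<tau> \<partial>lborel)"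
    using dec v by (intro nn_integral_mono) (auto simp: indicator_def intro!: ennreal_leI)
  also have "\<dots> = ?L + ennreal (R (v / 2)) * ennreal (v / 2)"
    using v by (subst nn_integral_add) (auto simp: nn_integral_cmult_indicator)
  also have "ennreal (R (v / 2)) * ennreal (v / 2) = (\<integral>\<^sup>+\<tau>. ennreal (R (v / 2)) * indicator {0<..<v / 2} \<tau> \<partial>lborel)"
    using v by (simp add: nn_integral_cmult_indicator)
  also have "\<dots> \<le> ?L"
    using dec[of _ "v / 2"] by (intro nn_integral_mono) (auto simp: indicator_def intro!: ennreal_leI)
  finally have "(\<integral>\<^sup>+\<tau>\<in>{0<..<v}. ennreal (R \<tau>) \<partial>lborel) \<le> 2 * ?L" by (simp add: mult_2 add_left_mono)
  moreover have "(\<integral>\<^sup>+\<tau>\<in>{0<..<w}. ennreal (rearrangement M h \<tau>) \<partial>lborel) = (\<integral>\<^sup>+\<tau>\<in>{0<..<w}. ennreal (R \<tau>) \<partial>lborel)" for w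
    by (rule nn_integral_cong) (auto simp: indicator_def R)
  ultimately show ?thesis by simp
qed

lemma (in prob_space) hardy_operator_rearrangement:
  assumes "0 < p" "h \<in> borel_measurable M" "(\<integral>\<^sup>+x. ennreal \<bar>h x\<bar> \<partial>M) < \<infinity>"
  shows "hardy_operator p (rearrangement M h)"
  using assms nn_integral_rearrangement[OF assms(2), of ennreal]
  by unfold_locales (auto simp: rearrangement_nonneg)

text \<open>Weakly differentiable functions enter the rearrangement estimates only through this control of their
  line suprema, in which \<open>F\<close> is \<open>\<bar>u\<bar> + \<bar>\<nabla>u\<bar>\<close>. The freedom in the level \<open>s\<close> replaces the use of truncations
  of \<open>u\<close>.\<close>

locale line_controlled = unit_interval +
  fixes n :: nat and u F :: "(nat \<Rightarrow> real) \<Rightarrow> real"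
  assumes n: "2 \<le> n" and u: "u \<in> borel_measurable (bcube n)" and F: "F \<in> borel_measurable (bcube n)"
    and F_nonneg: "\<And>x. 0 \<le> F x" and F_int: "(\<integral>\<^sup>+x. ennreal (F x) \<partial>bcube n) < \<infinity>"
    and control: "\<And>k s. k < n \<Longrightarrow> 0 \<le> s \<Longrightarrow> AE y in bcube (n - 1). line_esssup n k u y
    \<le> ennreal s + (\<integral>\<^sup>+t. ennreal (F (insert_coord n k y t)) * indicator {x. s < \<bar>u x\<bar>} (insert_coord n k y t) \<partial>line)"
begin

sublocale B: prob_space "bcube n" by (rule prob_space_bcube)

definition p :: real where "p = 1 - 1 / real n"

lemma p_bounds: "0 < p" "p < 1"
  using n by (simp_all add: p_def)

definition RF :: "real \<Rightarrow> real" where "RF = rearrangement (bcube n) F"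

definition IF :: "real \<Rightarrow> ennreal" where
  "IF v = (\<integral>\<^sup>+\<tau>\<in>{0<..<v}. ennreal (RF \<tau>) \<partial>lborel)"

sublocale hardy_operator p RF
  unfolding RF_def using F F_int F_nonneg by (intro B.hardy_operator_rearrangement p_bounds) auto

lemma IF_finite: "v \<le> 1 \<Longrightarrow> IF v < \<infinity>"
  unfolding IF_def
  by (rule le_less_trans[OF nn_integral_mono R_integrable]) (auto simp: indicator_def)

text \<open>The set \<open>{\<bar>u\<bar> > s}\<close> has measure at most \<open>v\<close>, to which the Hardy--Littlewood inequality for \<open>F\<close>
  applies.\<close>

lemma integral_above_level:
  assumes "0 < v" "v \<le> 1" "distribution_fun (bcube n) u s \<le> ennreal v"
  shows "(\<integral>\<^sup>+x. ennreal (F x) * indicator {x. s < \<bar>u x\<bar>} x \<partial>bcube n) \<le> IF v"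
proof -
  let ?E = "{x \<in> space (bcube n). s < \<bar>u x\<bar>}"
  have E: "?E \<in> sets (bcube n)" using u by measurable
  have "(\<integral>\<^sup>+x. ennreal (F x) * indicator {x. s < \<bar>u x\<bar>} x \<partial>bcube n) = (\<integral>\<^sup>+x\<in>?E. ennreal \<bar>F x\<bar> \<partial>bcube n)"
    by (rule nn_integral_cong) (simp add: indicator_def F_nonneg)
  also have "\<dots> \<le> IF v"
    unfolding IF_def RF_def
    by (rule B.nn_integral_le_rearrangement[OF F E]) (use assms in \<open>auto simp: distribution_fun_def\<close>)
  finally show ?thesis .
qed

text \<open>Each of the \<open>n\<close> essential projections of \<open>{\<bar>u\<bar> > r}\<close> has measure at most \<open>J / (r - s)\<close>; the Loomis--Whitney
  inequality bounds the measure of the set itself.\<close>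

lemma level_gap:
  fixes r s J :: real
  assumes s: "0 \<le> s" "s \<le> r" and J: "0 \<le> J" "(\<integral>\<^sup>+x. ennreal (F x) * indicator {x. s < \<bar>u x\<bar>} x \<partial>bcube n) \<le> ennreal J"
  shows "(r - s) * measure (bcube n) {x \<in> space (bcube n). r < \<bar>u x\<bar>} powr p \<le> n * J"
proof -
  interpret B': prob_space "bcube (n - 1)" by (rule prob_space_bcube)
  let ?E = "{x \<in> space (bcube n). r < \<bar>u x\<bar>}" let ?m = "measure (bcube n) ?E"
  let ?A = "\<lambda>k. {y \<in> space (bcube (n - 1)). emeasure line {t \<in> space line. r < \<bar>u (insert_coord n k y t)\<bar>} > 0}"
  have E: "?E \<in> sets (bcube n)" using u by measurable
  have gap: "(r - s) * measure (bcube (n - 1)) (?A k) \<le> J" if k: "k < n" for k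
  proof -
    have "ennreal (r - s) * emeasure (bcube (n - 1)) (?A k) \<le> ennreal J"
      using line_esssup_excess(2)[OF k s(1) u F control[OF k s(1)] s(2)] J(2) by (rule order_trans)
    then have "ennreal ((r - s) * measure (bcube (n - 1)) (?A k)) \<le> ennreal J"
      unfolding B'.emeasure_eq_measure using s by (simp add: ennreal_mult)
    then show ?thesis using J(1) by (simp only: ennreal_le_iff)
  qed
  show ?thesis
  proof (cases "?m > 0")
    case True
    have slice: "{y \<in> space (bcube (n - 1)). emeasure line {t \<in> space line. insert_coord n k y t \<in> ?E} > 0} = ?A k"
      if k: "k < n" for k
    proof -
      have "insert_coord n k y t \<in> space (bcube n)" if "y \<in> space (bcube (n - 1))" "t \<in> space line" for y t
        using measurable_space[OF measurable_insert_coord[OF k], of "(y, t)"] that by (simp add: space_pair_measure)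
      then have "{t \<in> space line. insert_coord n k y t \<in> ?E} = {t \<in> space line. r < \<bar>u (insert_coord n k y t)\<bar>}"
        if "y \<in> space (bcube (n - 1))" for y using that by blast
      then show ?thesis by (simp cong: conj_cong)
    qed
    let ?S = "\<Sum>k<n. measure (bcube (n - 1)) (?A k)"
    have "?m ^ (n - 1) \<le> ?S ^ n"
      using Loomis_Whitney_essential[OF _ E True] n slice by simp
    moreover have "?m ^ (n - 1) = (?m powr p) ^ n"
    proof -
      have "(?m powr p) ^ n = ?m powr (p * n)" using True by (simp add: powr_realpow[symmetric] powr_powr)
      also have "p * n = real (n - 1)" using n by (simp add: p_def field_simps of_nat_diff)
      finally show ?thesis using True by (simp add: powr_realpow)
    qed
    ultimately have "(?m powr p) ^ n \<le> ?S ^ n" by simp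
    moreover obtain n1 where "n = Suc n1" using n by (cases n) auto
    moreover have "0 \<le> ?S" by (intro sum_nonneg) simp
    ultimately have "?m powr p \<le> ?S" using power_le_imp_le_base by blast
    then have "(r - s) * ?m powr p \<le> (r - s) * ?S" using s by (intro mult_left_mono) auto
    also have "\<dots> = (\<Sum>k<n. (r - s) * measure (bcube (n - 1)) (?A k))" by (rule sum_distrib_left)
    also have "\<dots> \<le> (\<Sum>k<n. J)" using gap by (intro sum_mono) simp
    finally show ?thesis by simp
  next
    case False
    then have "?m = 0" using measure_nonneg[of "bcube n" ?E] by linarith
    then show ?thesis using J by simp
  qed
qed

text \<open>The previous lemma with \<open>s = u\<^sup>*(2\<^sup>-\<^sup>m)\<close> and levels \<open>r\<close> below \<open>u\<^sup>*(2\<^sup>-\<^sup>m\<^sup>-\<^sup>1)\<close>, where the measure of \<open>{\<bar>u\<bar> > r}\<close>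
  exceeds \<open>2\<^sup>-\<^sup>m\<^sup>-\<^sup>1\<close>.\<close>

lemma rearrangement_step:
  "ennreal (rearrangement (bcube n) u (1 / 2 ^ Suc m))
    \<le> ennreal (rearrangement (bcube n) u (1 / 2 ^ m)) + ennreal (n * (2 ^ Suc m) powr p) * IF (1 / 2 ^ m)"
proof -
  define s where "s = rearrangement (bcube n) u (1 / 2 ^ m)"
  define q where "q = rearrangement (bcube n) u (1 / 2 ^ Suc m)"
  define J where "J = enn2real (IF (1 / 2 ^ m))"
  have J: "IF (1 / 2 ^ m) = ennreal J" "0 \<le> J" using IF_finite[of "1 / 2 ^ m"] by (auto simp: J_def)
  have s: "0 \<le> s" "distribution_fun (bcube n) u s \<le> ennreal (1 / 2 ^ m)"
    unfolding s_def using u by (auto intro!: B.rearrangement_nonneg B.distribution_fun_rearrangement_le)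
  have above: "(\<integral>\<^sup>+x. ennreal (F x) * indicator {x. s < \<bar>u x\<bar>} x \<partial>bcube n) \<le> ennreal J"
    unfolding J(1)[symmetric] using s by (intro integral_above_level) auto
  have "q \<le> s + n * (2 ^ Suc m) powr p * J"
  proof (rule dense_le)
    fix r assume r: "r < q"
    show "r \<le> s + n * (2 ^ Suc m) powr p * J"
    proof (cases "s \<le> r")
      case False
      have "0 \<le> real n * (2 ^ Suc m) powr p * J" using J by simp
      then show ?thesis using False by linarith
    next
      case True
      have "ennreal (1 / 2 ^ Suc m) < distribution_fun (bcube n) u r"
        using r s True B.less_rearrangement_iff[OF u, of "1 / 2 ^ Suc m" r] by (simp add: q_def)
      then have "1 / 2 ^ Suc m < measure (bcube n) {x \<in> space (bcube n). r < \<bar>u x\<bar>}"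
        by (simp add: distribution_fun_def B.emeasure_eq_measure ennreal_less_iff)
      then have "(1 / 2 ^ Suc m) powr p \<le> measure (bcube n) {x \<in> space (bcube n). r < \<bar>u x\<bar>} powr p"
        using p by (intro powr_mono2) auto
      then have "(r - s) * (1 / 2 ^ Suc m) powr p \<le> (r - s) * measure (bcube n) {x \<in> space (bcube n). r < \<bar>u x\<bar>} powr p"
        using True by (intro mult_left_mono) auto
      also have "\<dots> \<le> n * J" by (rule level_gap[OF s(1) True J(2) above])
      finally have "(r - s) * ((1 / 2 ^ Suc m) powr p * (2 ^ Suc m) powr p) \<le> n * J * (2 ^ Suc m) powr p"
        unfolding mult.assoc[symmetric] by (intro mult_right_mono) auto
      moreover have "(1 / 2 ^ Suc m) powr p * (2 ^ Suc m) powr p = (1 :: real)"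
        by (simp add: powr_mult[symmetric] del: power_Suc)
      ultimately have "r - s \<le> n * J * (2 ^ Suc m) powr p" by (simp only: mult_1_right)
      also have "\<dots> = n * (2 ^ Suc m) powr p * J" by (simp only: ac_simps)
      finally show ?thesis by linarith
    qed
  qed
  then have "ennreal q \<le> ennreal (s + n * (2 ^ Suc m) powr p * J)" by (rule ennreal_leI)
  also have "\<dots> = ennreal s + ennreal (n * (2 ^ Suc m) powr p) * ennreal J"
    using s J by (simp add: ennreal_mult[symmetric])
  finally show ?thesis by (simp add: q_def s_def J(1))
qed

text \<open>Summing the steps bounds \<open>u\<^sup>*(2\<^sup>-\<^sup>m)\<close> by a constant multiple of the sum of the terms \<open>2\<^sup>j\<^sup>p IF(2\<^sup>-\<^sup>j)\<close> with \<open>j \<le> m\<close>, in which \<open>F\<^sup>*(\<tau>)\<close> has a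
  weight of the order of \<open>max \<tau> 2\<^sup>-\<^sup>m\<close> to the power \<open>- p\<close>.\<close>

definition potential :: "nat \<Rightarrow> ennreal" where
  "potential m = (\<integral>\<^sup>+\<tau>\<in>{0<..<1}. ennreal (RF \<tau> * max \<tau> (1 / 2 ^ m) powr (- p)) \<partial>lborel)"

lemma potential_step:
  "potential m + ennreal ((2 powr p - 1) * (2 ^ m) powr p) * IF (1 / 2 ^ Suc m) \<le> potential (Suc m)"
proof -
  have [measurable]: "R0 \<in> borel_measurable borel" by (rule R0)
  have pot: "potential j = (\<integral>\<^sup>+\<tau>. ennreal (R0 \<tau> * max \<tau> (1 / 2 ^ j) powr (- p)) * indicator {0<..<1} \<tau> \<partial>lborel)" for j
    unfolding potential_def by (rule nn_integral_cong) (auto simp: indicator_def R0)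
  have IF0: "IF v = (\<integral>\<^sup>+\<tau>. ennreal (R0 \<tau>) * indicator {0<..<v} \<tau> \<partial>lborel)" for v
    unfolding IF_def by (rule nn_integral_cong) (auto simp: indicator_def R0)
  let ?c = "(2 powr p - 1) * (2 ^ m) powr p"
  have c: "0 \<le> ?c" using p ge_one_powr_ge_zero[of 2 p] by simp
  have "potential m + ennreal ?c * IF (1 / 2 ^ Suc m)
      = (\<integral>\<^sup>+\<tau>. ennreal (R0 \<tau> * max \<tau> (1 / 2 ^ m) powr (- p)) * indicator {0<..<1} \<tau>
          + ennreal ?c * (ennreal (R0 \<tau>) * indicator {0<..<1 / 2 ^ Suc m} \<tau>) \<partial>lborel)"
    unfolding pot IF0 by (subst nn_integral_add) (auto simp: nn_integral_cmult)
  also have "\<dots> \<le> potential (Suc m)"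
    unfolding pot
  proof (rule nn_integral_mono)
    fix \<tau> :: real
    show "ennreal (R0 \<tau> * max \<tau> (1 / 2 ^ m) powr (- p)) * indicator {0<..<1} \<tau>
          + ennreal ?c * (ennreal (R0 \<tau>) * indicator {0<..<1 / 2 ^ Suc m} \<tau>)
      \<le> ennreal (R0 \<tau> * max \<tau> (1 / 2 ^ Suc m) powr (- p)) * indicator {0<..<1} \<tau>"
    proof (cases "0 < \<tau> \<and> \<tau> < 1 / 2 ^ Suc m")
      case True
      have half: "1 / 2 ^ Suc m < (1 / 2 ^ m :: real)" "1 / 2 ^ m \<le> (1 :: real)" by (simp_all add: field_simps)
      then have \<tau>: "\<tau> < 1" "max \<tau> (1 / 2 ^ m) = 1 / 2 ^ m" "max \<tau> (1 / 2 ^ Suc m) = 1 / 2 ^ Suc m" using True by linarith+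
      have powr: "(1 / 2 ^ j) powr (- p) = (2 ^ j) powr p" for j :: nat
        by (simp add: powr_minus_divide powr_divide)
      have "(2 ^ m) powr p + ?c = (2 ^ Suc m) powr p" by (simp add: powr_mult algebra_simps)
      then have "R0 \<tau> * (2 ^ m) powr p + ?c * R0 \<tau> = R0 \<tau> * (2 ^ Suc m) powr p"
        by (metis distrib_left mult.commute)
      then have "ennreal (R0 \<tau> * (2 ^ m) powr p) + ennreal ?c * ennreal (R0 \<tau>) = ennreal (R0 \<tau> * (2 ^ Suc m) powr p)"
        using c R0(2)[of \<tau>] by (simp add: ennreal_mult[symmetric] ennreal_plus[symmetric] del: ennreal_plus power_Suc)
      then show ?thesis using True \<tau>(1) unfolding \<tau>(2,3) powr by simp
    next
      case False
      have "1 / 2 ^ Suc m \<le> (1 / 2 ^ m :: real)" by (simp add: field_simps)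
      then have "max \<tau> (1 / 2 ^ Suc m) \<le> max \<tau> (1 / 2 ^ m)" by (intro max.mono) auto
      then have "max \<tau> (1 / 2 ^ m) powr (- p) \<le> max \<tau> (1 / 2 ^ Suc m) powr (- p)"
        using p by (intro powr_mono2') (simp_all add: less_max_iff_disj del: power_Suc)
      then have "R0 \<tau> * max \<tau> (1 / 2 ^ m) powr (- p) \<le> R0 \<tau> * max \<tau> (1 / 2 ^ Suc m) powr (- p)"
        using R0(2)[of \<tau>] by (intro mult_left_mono)
      then show ?thesis using False by (auto simp: indicator_def intro!: ennreal_leI)
    qed
  qed
  finally show ?thesis .
qed

text \<open>The constant is chosen so that \<open>C0 (2\<^sup>p - 1) 2\<^sup>m\<^sup>p = 2 n 2\<^sup>(\<^sup>m\<^sup>+\<^sup>1\<^sup>)\<^sup>p\<close>: then \<open>C0\<close> times an increment of the potential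
  dominates a step of the rearrangement, the factor \<open>2\<close> coming from the doubling inequality.\<close>

definition C0 :: real where "C0 = 2 * n * 2 powr p / (2 powr p - 1)"

lemma two_powr_p: "1 < 2 powr p"
  using p powr_less_mono[of 0 p 2] by simp

lemma C0_nonneg: "0 \<le> C0"
  using two_powr_p by (simp add: C0_def)

lemma rearrangement_le_potential:
  "ennreal (rearrangement (bcube n) u (1 / 2 ^ m)) \<le> ennreal C0 * potential m"
proof (induction m)
  case 0
  show ?case using B.rearrangement_eq_0[OF u] by simp
next
  case (Suc m)
  let ?c = "(2 powr p - 1) * (2 ^ m) powr p"
  have c: "0 \<le> ?c" using two_powr_p by simp
  have "ennreal (n * (2 ^ Suc m) powr p) * IF (1 / 2 ^ m) \<le> ennreal (n * (2 ^ Suc m) powr p) * (2 * IF (1 / 2 ^ Suc m))"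
    using B.nn_integral_rearrangement_doubling[OF F, of "1 / 2 ^ m"]
    unfolding IF_def RF_def by (intro mult_left_mono) (simp_all add: mult.commute)
  also have "\<dots> = ennreal (n * (2 ^ Suc m) powr p * 2) * IF (1 / 2 ^ Suc m)"
    by (simp add: ennreal_mult mult.assoc)
  also have "n * (2 ^ Suc m) powr p * 2 = C0 * ?c"
    using two_powr_p p by (simp add: C0_def powr_mult)
  finally have "ennreal (n * (2 ^ Suc m) powr p) * IF (1 / 2 ^ m) \<le> ennreal C0 * (ennreal ?c * IF (1 / 2 ^ Suc m))"
    using c C0_nonneg by (simp add: ennreal_mult mult.assoc)
  with rearrangement_step[of m] Suc
  have "ennreal (rearrangement (bcube n) u (1 / 2 ^ Suc m))
      \<le> ennreal C0 * potential m + ennreal C0 * (ennreal ?c * IF (1 / 2 ^ Suc m))"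
    by (meson add_mono order_trans)
  also have "\<dots> = ennreal C0 * (potential m + ennreal ?c * IF (1 / 2 ^ Suc m))" by (rule distrib_left[symmetric])
  also have "\<dots> \<le> ennreal C0 * potential (Suc m)" by (intro mult_left_mono potential_step) simp
  finally show ?case .
qed

text \<open>The level \<open>s\<close> is the value of the rearrangement of \<open>u\<close> at the largest dyadic point below \<open>t\<^sup>1\<^sup>/\<^sup>p\<close>.
  Below this level the line suprema contribute at most \<open>t s\<close>, and above it at most the integral of \<open>F\<close>
  over a set of measure \<open>t\<^sup>1\<^sup>/\<^sup>p\<close>; both are controlled by the integral of the Hardy operator.\<close>

theorem nn_integral_rearrangement_line_esssup_le:
  assumes k: "k < n" and h: "h \<in> borel_measurable (bcube (n - 1))"
    and eq: "AE y in bcube (n - 1). ennreal \<bar>h y\<bar> = line_esssup n k u y"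
    and t: "0 < t" "t \<le> 1"
  shows "(\<integral>\<^sup>+\<tau>\<in>{0<..<t}. ennreal (rearrangement (bcube (n - 1)) h \<tau>) \<partial>lborel)
    \<le> ennreal (2 * C0 + 1) * (\<integral>\<^sup>+\<tau>\<in>{0<..<t}. hardy p RF \<tau> \<partial>lborel)"
proof -
  interpret B': prob_space "bcube (n - 1)" by (rule prob_space_bcube)
  have [measurable]: "R0 \<in> borel_measurable borel" by (rule R0)
  let ?T = "t powr (1 / p)" and ?H = "\<integral>\<^sup>+\<tau>\<in>{0<..<t}. hardy p RF \<tau> \<partial>lborel"
  have T: "0 < ?T" "?T \<le> 1" using t p by (auto simp: powr_le1)
  have H: "?H = (\<integral>\<^sup>+\<sigma>. ennreal (R0 \<sigma> * min 1 (t * \<sigma> powr (- p))) * indicator {0<..<1} \<sigma> \<partial>lborel)"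
    unfolding nn_integral_hardy[OF t(1)] by (rule nn_integral_cong) (auto simp: indicator_def R0)
  define m where "m = (LEAST m. 1 / 2 ^ m \<le> ?T)"
  have "\<exists>m. 1 / 2 ^ m \<le> ?T"
    using real_arch_pow_inv[OF T(1), of "1 / 2"] by (auto simp: power_one_over intro: less_imp_le)
  then have m: "1 / 2 ^ m \<le> ?T" unfolding m_def by (rule LeastI_ex)
  have m2: "?T < 2 / 2 ^ m"
  proof (cases m)
    case 0
    then show ?thesis using T by simp
  next
    case (Suc j)
    then have "\<not> 1 / 2 ^ j \<le> ?T" using not_less_Least[of j "\<lambda>m. 1 / 2 ^ m \<le> ?T"] by (simp add: m_def)
    then show ?thesis using Suc by simp
  qed
  define s where "s = rearrangement (bcube n) u (1 / 2 ^ m)"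
  have s: "0 \<le> s" "distribution_fun (bcube n) u s \<le> ennreal (1 / 2 ^ m)"
    unfolding s_def using u by (auto intro!: B.rearrangement_nonneg B.distribution_fun_rearrangement_le)
  have "ennreal (t * s) \<le> ennreal (2 * C0) * ?H"
  proof -
    have "ennreal (t * s) = ennreal t * ennreal s" using t s by (intro ennreal_mult) auto
    also have "\<dots> \<le> ennreal t * (ennreal C0 * potential m)"
      unfolding s_def by (intro mult_left_mono rearrangement_le_potential) simp
    also have "\<dots> = ennreal C0 * (ennreal t * potential m)" by (simp add: ac_simps)
    also have "ennreal t * potential m
        = (\<integral>\<^sup>+\<tau>. ennreal t * (ennreal (R0 \<tau> * max \<tau> (1 / 2 ^ m) powr (- p)) * indicator {0<..<1} \<tau>) \<partial>lborel)"
      unfolding potential_def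
      by (subst nn_integral_cmult) (auto intro!: arg_cong[where f = "\<lambda>x. ennreal t * x"] nn_integral_cong simp: indicator_def R0)
    also have "\<dots> \<le> (\<integral>\<^sup>+\<sigma>. 2 * (ennreal (R0 \<sigma> * min 1 (t * \<sigma> powr (- p))) * indicator {0<..<1} \<sigma>) \<partial>lborel)"
    proof (rule nn_integral_mono)
      fix \<tau> :: real
      show "ennreal t * (ennreal (R0 \<tau> * max \<tau> (1 / 2 ^ m) powr (- p)) * indicator {0<..<1} \<tau>)
        \<le> 2 * (ennreal (R0 \<tau> * min 1 (t * \<tau> powr (- p))) * indicator {0<..<1} \<tau>)"
      proof (cases "0 < \<tau> \<and> \<tau> < 1")
        case True
        have "max \<tau> (1 / 2 ^ m) powr (- p) \<le> \<tau> powr (- p)"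
          using True p by (intro powr_mono2') auto
        then have 1: "t * max \<tau> (1 / 2 ^ m) powr (- p) \<le> 2 * (t * \<tau> powr (- p))"
          using t mult_left_mono[of _ _ t] powr_ge_zero[of \<tau> "- p"] by (smt (verit) mult_nonneg_nonneg)
        \<comment> \<open>The choice of \<open>m\<close> costs the factor \<open>2 powr p \<le> 2\<close>.\<close>
        have "max \<tau> (1 / 2 ^ m) powr (- p) \<le> (?T / 2) powr (- p)"
          using T m2 p by (intro powr_mono2') auto
        also have "(?T / 2) powr (- p) = 2 powr p / t"
          using t p by (simp add: powr_divide powr_powr powr_minus_divide)
        also have "\<dots> \<le> 2 / t"
        proof (rule divide_right_mono)
          have "2 powr p \<le> 2 powr (1 :: real)" using less_imp_le[OF p_bounds(2)] by (intro powr_mono) auto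
          then show "2 powr p \<le> 2" by simp
        qed (use t in simp)
        finally have 2: "t * max \<tau> (1 / 2 ^ m) powr (- p) \<le> 2"
          using t by (simp add: field_simps)
        have "t * max \<tau> (1 / 2 ^ m) powr (- p) \<le> 2 * min 1 (t * \<tau> powr (- p))" using 1 2 by (simp add: min_def)
        then have "R0 \<tau> * (t * max \<tau> (1 / 2 ^ m) powr (- p)) \<le> R0 \<tau> * (2 * min 1 (t * \<tau> powr (- p)))"
          by (intro mult_left_mono R0)
        then have "ennreal (t * (R0 \<tau> * max \<tau> (1 / 2 ^ m) powr (- p))) \<le> ennreal (2 * (R0 \<tau> * min 1 (t * \<tau> powr (- p))))"
          by (intro ennreal_leI) (simp add: ac_simps)
        then show ?thesis using True t R0(2)[of \<tau>] by (simp add: ennreal_mult)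
      qed (auto simp: indicator_def)
    qed
    also have "\<dots> = 2 * ?H" unfolding H by (rule nn_integral_cmult) (use R0(1) in simp)
    finally have "ennreal (t * s) \<le> ennreal C0 * (2 * ?H)" by (simp add: mult_left_mono)
    also have "\<dots> = ennreal (2 * C0) * ?H" using C0_nonneg by (simp add: ennreal_mult ac_simps)
    finally show ?thesis .
  qed
  moreover have "(\<integral>\<^sup>+y. ennreal (max 0 (\<bar>h y\<bar> - s)) \<partial>bcube (n - 1)) \<le> ?H"
  proof -
    have "(\<integral>\<^sup>+y. ennreal (max 0 (\<bar>h y\<bar> - s)) \<partial>bcube (n - 1)) = (\<integral>\<^sup>+y. line_esssup n k u y - ennreal s \<partial>bcube (n - 1))"
    proof (rule nn_integral_cong_AE)
      show "AE y in bcube (n - 1). ennreal (max 0 (\<bar>h y\<bar> - s)) = line_esssup n k u y - ennreal s"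
        using eq
      proof eventually_elim
        case (elim y)
        then show ?case using s by (simp add: elim[symmetric] ennreal_minus max_def ennreal_neg)
      qed
    qed
    also have "\<dots> \<le> (\<integral>\<^sup>+x. ennreal (F x) * indicator {x. s < \<bar>u x\<bar>} x \<partial>bcube n)"
      by (rule line_esssup_excess(1)[OF k s(1) u F control[OF k s(1)]])
    also have "\<dots> \<le> IF ?T"
      using T m s by (intro integral_above_level) (auto intro: order_trans ennreal_leI)
    also have "\<dots> \<le> ?H"
      unfolding H IF_def
    proof (rule nn_integral_mono)
      fix \<sigma> :: real
      have "1 \<le> t * \<sigma> powr (- p)" if "0 < \<sigma>" "\<sigma> < ?T"
      proof -
        have "\<sigma> powr p \<le> t" using powr_inverse_le_iff[OF p t(1) that(1)] that by linarith
        then show ?thesis using that by (simp add: powr_minus_divide)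
      qed
      then show "ennreal (RF \<sigma>) * indicator {0<..<?T} \<sigma> \<le> ennreal (R0 \<sigma> * min 1 (t * \<sigma> powr (- p))) * indicator {0<..<1} \<sigma>"
        using T by (auto simp: indicator_def R0)
    qed
    finally show ?thesis .
  qed
  ultimately have "(\<integral>\<^sup>+\<tau>\<in>{0<..<t}. ennreal (rearrangement (bcube (n - 1)) h \<tau>) \<partial>lborel) \<le> ennreal (2 * C0) * ?H + ?H"
    using B'.nn_integral_rearrangement_le_excess[OF h t s(1)] by (meson add_mono order_trans)
  also have "\<dots> = ennreal (2 * C0 + 1) * ?H" using C0_nonneg by (simp add: distrib_right)
  finally show ?thesis .
qed

end

section \<open>Lebesgue measurable functions and their Borel versions\<close>

lemma borel_measurable_completion_AE:
  fixes f g :: "'a \<Rightarrow> 'b::topological_space"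
  assumes f: "f \<in> borel_measurable M" and eq: "AE x in M. f x = g x"
  shows "g \<in> borel_measurable (completion M)"
proof (rule measurableI)
  fix B :: "'b set" assume B: "B \<in> sets borel"
  have A: "f -` B \<inter> space M \<in> sets (completion M)"
    using measurable_sets[OF f B] by (rule sets_completionI_sets)
  have "AE x in completion M. f x = g x" using eq by (rule AE_completion)
  then have "AE x in completion M. x \<in> f -` B \<inter> space M \<longleftrightarrow> x \<in> g -` B \<inter> space M" by eventually_elim auto
  from completion.in_sets_AE[OF this A] show "g -` B \<inter> space (completion M) \<in> sets (completion M)" by simp
qed simp

lemma fnorm_finite_imp_integrable:
  assumes "ri_norm M \<rho>" "f \<in> fspace M \<rho>"
  shows "integrable M f"
proof -
  obtain C where C: "0 < C" "\<forall>f \<in> borel_measurable M. (\<integral>\<^sup>+x. f x \<partial>M) \<le> ennreal C * \<rho> f"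
    using ri_norm_L1[OF assms(1)] by blast
  have f: "f \<in> borel_measurable M" "\<rho> (\<lambda>x. ennreal \<bar>f x\<bar>) < \<infinity>"
    using assms(2) by (auto simp: fspace_def fnorm_def)
  then have "(\<integral>\<^sup>+x. ennreal \<bar>f x\<bar> \<partial>M) \<le> ennreal C * \<rho> (\<lambda>x. ennreal \<bar>f x\<bar>)"
    using C(2) by (auto intro: borel_measurable_abs)
  also have "\<dots> < \<infinity>" using f by (simp add: ennreal_mult_less_top)
  finally show ?thesis using f by (simp add: integrable_iff_bounded)
qed

lemma (in prob_space) right_continuous_decreasing_rearrangement:
  assumes h: "h \<in> borel_measurable M"
  shows "right_continuous_decreasing (rearrangement M h)"
proof (rule right_continuous_decreasing.intro)
  show "0 \<le> rearrangement M h t" if "0 < t" for t using rearrangement_nonneg[OF h that] .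
  show "rearrangement M h t \<le> rearrangement M h s" if "0 < s" "s \<le> t" for s t
    using rearrangement_antimono[OF h that] .
  fix s t :: real assume t: "0 < t" "t < 1" and s: "s < rearrangement M h t"
  obtain u where u: "t < u" "s < rearrangement M h u"
    using rearrangement_right_continuous[OF h t(1) s] by blast
  define v where "v = min u ((t + 1) / 2)"
  have v: "t < v" "v < 1" "v \<le> u" using u t by (auto simp: v_def min_less_iff_disj)
  then have "s < rearrangement M h v"
    using rearrangement_antimono[OF h, of v u] t u by simp
  then show "\<exists>u>t. u < 1 \<and> s < rearrangement M h u" using v by blast
qed

context unit_interval
begin

lemma Borel_version:
  assumes "f \<in> borel_measurable (cube n I)"
  shows "\<exists>f'\<in>borel_measurable (bcube n). AE x in bcube n. f x = (f' x :: real)"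
  using completion_ex_borel_measurable_real[of f "bcube n"] assms unfolding cube_eq by blast

lemma AE_cube: "(AE x in cube n I. Q x) \<longleftrightarrow> (AE x in bcube n. Q x)"
  unfolding cube_eq by (rule AE_completion_iff)

lemma measurable_cube: "f \<in> borel_measurable (bcube n) \<Longrightarrow> f \<in> borel_measurable (cube n I)"
  unfolding cube_eq by (rule measurable_completion)

lemma integral_cube:
  assumes f: "f \<in> borel_measurable (cube n I)" and f': "f' \<in> borel_measurable (bcube n)"
    and eq: "AE x in bcube n. f x = (f' x :: real)"
  shows "(\<integral>x. f x \<partial>cube n I) = (\<integral>x. f' x \<partial>bcube n)"
proof -
  have "(\<integral>x. f x \<partial>cube n I) = (\<integral>x. f' x \<partial>cube n I)"
    by (rule integral_cong_AE[OF f measurable_cube[OF f']]) (simp add: AE_cube eq)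
  also have "\<dots> = (\<integral>x. f' x \<partial>bcube n)" unfolding cube_eq by (rule integral_completion[OF f'])
  finally show ?thesis .
qed

lemma integrable_cube:
  assumes "integrable (cube n I) f" and f': "f' \<in> borel_measurable (bcube n)"
    and eq: "AE x in bcube n. f x = (f' x :: real)"
  shows "integrable (bcube n) f'"
proof -
  have "integrable (cube n I) f'"
    by (rule integrable_cong_AE_imp[OF assms(1) measurable_cube[OF f']]) (use eq in \<open>auto simp: AE_cube elim: eventually_mono\<close>)
  then show ?thesis unfolding cube_eq by (simp add: integrable_completion f')
qed

lemma rearrangement_cube:
  "f \<in> borel_measurable (bcube n) \<Longrightarrow> rearrangement (cube n I) f = rearrangement (bcube n) f"
  by (rule rearrangement_cong) (simp add: cube_eq distribution_fun_completion)

lemma esssup_lebesgue_on_I: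
  fixes v w :: "real \<Rightarrow> ennreal"
  assumes v: "v \<in> borel_measurable line" and eq: "AE t in line. v t = w t"
  shows "esssup (lebesgue_on I) w = esssup line v"
proof -
  have w: "w \<in> borel_measurable (lebesgue_on I)" by (rule measurable_lebesgue_on_AE[OF v eq])
  have "(AE t in line. w t \<le> z) \<longleftrightarrow> (AE t in line. v t \<le> z)" for z
    using eq by (intro eventually_subst) (auto elim: eventually_mono)
  then show ?thesis
    unfolding esssup_eq_AE[OF v] esssup_eq_AE[OF w] AE_lebesgue_on_I by simp
qed

lemma \<psi>_eq_line_esssup:
  assumes k: "k < n" and f': "f' \<in> borel_measurable (bcube n)" and eq: "AE x in bcube n. f x = f' x"
  shows "AE y in bcube (n - 1). \<psi> n k (Linf I) f y = line_esssup n k f' y"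
  using AE_bcube[OF k eq] AE_space
proof eventually_elim
  case (elim y)
  have "esssup (lebesgue_on I) (\<lambda>t. ennreal \<bar>f (insert_coord n k y t)\<bar>)
      = esssup line (\<lambda>t. ennreal \<bar>f' (insert_coord n k y t)\<bar>)"
    using measurable_section(1)[OF k f' elim(2)] elim(1)
    by (intro esssup_lebesgue_on_I) (auto elim: eventually_mono)
  then show ?case by (simp add: \<psi>_def fnorm_def Linf_def line_esssup_def)
qed

lemma measurable_\<psi>:
  assumes k: "k < n" and f: "f \<in> borel_measurable (cube n I)"
  shows "\<psi> n k (Linf I) f \<in> borel_measurable (cube (n - 1) I)"
proof -
  obtain f' where f': "f' \<in> borel_measurable (bcube n)" "AE x in bcube n. f x = f' x"
    using Borel_version[OF f] by blast
  show ?thesis unfolding cube_eq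
    using \<psi>_eq_line_esssup[OF k f'] by (intro borel_measurable_completion_AE[OF measurable_line_esssup[OF k f'(1)]])
      (auto elim: eventually_mono)
qed

section \<open>From the Hardy inequality to the embedding\<close>

text \<open>The defining identity of the weak gradient for test functions of product form, passed on to Borel
  representatives.\<close>

lemma weak_gradient_prod:
  assumes wg: "is_weak_gradient n I u g" and k: "k < n"
    and u': "u' \<in> borel_measurable (bcube n)" "AE x in bcube n. u x = u' x"
    and g': "g' \<in> borel_measurable (bcube n)" "AE x in bcube n. g x k = g' x"
    and B: "\<And>i. i < n \<Longrightarrow> smooth_supported a (a + 1) (B i)"
  shows "(\<integral>x. u' x * (\<Prod>j<n. (B(k := deriv (B k))) j (x j)) \<partial>bcube n)
    = - (\<integral>x. g' x * (\<Prod>j<n. B j (x j)) \<partial>bcube n)"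
proof -
  let ?\<phi> = "\<lambda>x. \<Prod>j<n. B j (x j)" and ?d = "\<lambda>x. \<Prod>j<n. (B(k := deriv (B k))) j (x j)"
  have B': "smooth_supported a (a + 1) ((B(k := deriv (B k))) i)" if "i < n" for i
    using B[OF that] smooth_supported_deriv[OF B[OF k]] by auto
  have \<phi>: "?\<phi> \<in> borel_measurable (bcube n)" "?d \<in> borel_measurable (bcube n)"
    by (intro measurable_prod_coord smooth_supported_measurable[OF B] smooth_supported_measurable[OF B']; assumption)+
  have pd: "partial_deriv k ?\<phi> = ?d"
    using partial_deriv_prod(2)[OF k, of B] B[OF k] by (auto simp: smooth_supported_def)
  have u: "u \<in> borel_measurable (cube n I)" and g: "(\<lambda>x. g x k) \<in> borel_measurable (cube n I)"
    using wg k by (auto simp: is_weak_gradient_def locally_integrable_def)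
  have "(\<integral>x. u x * partial_deriv k ?\<phi> x \<partial>cube n I) = - (\<integral>x. g x k * ?\<phi> x \<partial>cube n I)"
  proof -
    have "\<forall>\<phi>. test_function n I \<phi> \<longrightarrow> (\<integral>x. u x * partial_deriv k \<phi> x \<partial>cube n I) = - (\<integral>x. g x k * \<phi> x \<partial>cube n I)"
      using wg k by (simp add: is_weak_gradient_def)
    moreover have "test_function n I ?\<phi>" by (rule test_function_prod[OF B])
    ultimately show ?thesis by blast
  qed
  moreover have "(\<integral>x. u x * ?d x \<partial>cube n I) = (\<integral>x. u' x * ?d x \<partial>bcube n)"
    using u u' \<phi> measurable_cube[OF \<phi>(2)] by (intro integral_cube) (auto elim: eventually_mono)
  moreover have "(\<integral>x. g x k * ?\<phi> x \<partial>cube n I) = (\<integral>x. g' x * ?\<phi> x \<partial>bcube n)"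
    using g g' \<phi> measurable_cube[OF \<phi>(1)] by (intro integral_cube) (auto elim: eventually_mono)
  ultimately show ?thesis unfolding pd by simp
qed

text \<open>The gradient length dominates every partial derivative, so the same \<open>F\<close> serves for all directions.\<close>

lemma W1_space_controlled:
  assumes n: "2 \<le> n" and Z: "ri_norm (cube n I) Z" and u: "u \<in> W1_space n I Z"
  shows "\<exists>u' F. line_controlled I a n u' F \<and> (AE x in bcube n. u x = u' x)
    \<and> (AE x in bcube n. F x = \<bar>u x\<bar> + gradient_length n I u x)"
proof -
  define g where "g = weak_gradient n I u"
  define L where "L = gradient_length n I u"
  have wg: "is_weak_gradient n I u g"
    using u someI_ex[of "is_weak_gradient n I u"] by (auto simp: W1_space_def g_def weak_gradient_def)
  have L: "L x = L2_set (g x) {..<n}" for x by (simp add: L_def g_def gradient_length_def)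
  have int_u: "integrable (cube n I) u" and int_L: "integrable (cube n I) L"
    using u fnorm_finite_imp_integrable[OF Z] by (auto simp: W1_space_def L_def)
  obtain u' where u': "u' \<in> borel_measurable (bcube n)" "AE x in bcube n. u x = u' x"
    using Borel_version[OF borel_measurable_integrable[OF int_u]] by blast
  have "\<forall>k. \<exists>g'. k < n \<longrightarrow> g' \<in> borel_measurable (bcube n) \<and> (AE x in bcube n. g x k = g' x)"
  proof
    fix k
    show "\<exists>g'. k < n \<longrightarrow> g' \<in> borel_measurable (bcube n) \<and> (AE x in bcube n. g x k = g' x)"
    proof (cases "k < n")
      case True
      then have "(\<lambda>x. g x k) \<in> borel_measurable (cube n I)"
        using wg by (auto simp: is_weak_gradient_def locally_integrable_def)
      then show ?thesis using Borel_version by blast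
    qed simp
  qed
  from choice[OF this] obtain g' where
    g'_all: "\<forall>k. k < n \<longrightarrow> g' k \<in> borel_measurable (bcube n) \<and> (AE x in bcube n. g x k = g' k x)" ..
  have g': "g' k \<in> borel_measurable (bcube n)" "AE x in bcube n. g x k = g' k x" if "k < n" for k
    using g'_all[rule_format, OF that] by simp_all
  define L' where "L' x = L2_set (\<lambda>k. g' k x) {..<n}" for x
  have L'_meas: "L' \<in> borel_measurable (bcube n)"
  proof -
    have "(\<lambda>x. \<Sum>k<n. (g' k x)\<^sup>2) \<in> borel_measurable (bcube n)"
      by (intro borel_measurable_sum borel_measurable_power g') simp
    moreover have "sqrt \<in> borel_measurable borel"
      by (intro borel_measurable_continuous_onI continuous_intros)
    ultimately show ?thesis unfolding L'_def L2_set_def by (rule measurable_compose)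
  qed
  have "AE x in bcube n. \<forall>k\<in>{..<n}. g x k = g' k x"
    by (intro AE_finite_allI) (auto intro: g')
  then have L': "AE x in bcube n. L x = L' x"
    by eventually_elim (simp add: L L'_def L2_set_def)
  define F where "F x = \<bar>u' x\<bar> + L' x" for x
  have F_meas: "F \<in> borel_measurable (bcube n)"
    unfolding F_def using u'(1) L'_meas by (intro borel_measurable_add borel_measurable_abs)
  have F_nonneg: "0 \<le> F x" for x by (simp add: F_def L'_def L2_set_nonneg)
  have le: "\<bar>u' x\<bar> + \<bar>g' k x\<bar> \<le> F x" if "k < n" for k x
    using member_le_L2_set[of "{..<n}" k "\<lambda>k. \<bar>g' k x\<bar>"] that by (simp add: F_def L'_def L2_set_def)
  have int_u': "integrable (bcube n) u'" by (rule integrable_cube[OF int_u u'])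
  have int_L': "integrable (bcube n) L'" by (rule integrable_cube[OF int_L L'_meas L'])
  have int_F: "integrable (bcube n) F" unfolding F_def using int_u' int_L' by simp
  have int_g': "integrable (bcube n) (g' k)" if k: "k < n" for k
  proof (rule Bochner_Integration.integrable_bound[OF int_F g'(1)[OF k]])
    show "AE x in bcube n. norm (g' k x) \<le> norm (F x)"
    proof (rule AE_I2)
      fix x show "norm (g' k x) \<le> norm (F x)" using le[OF k, of x] F_nonneg[of x] by simp
    qed
  qed
  have "line_controlled I a n u' F"
  proof (unfold_locales)
    show "2 \<le> n" "u' \<in> borel_measurable (bcube n)" "F \<in> borel_measurable (bcube n)" "\<And>x. 0 \<le> F x"
      by fact+
    show "(\<integral>\<^sup>+x. ennreal (F x) \<partial>bcube n) < \<infinity>"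
      using int_F F_nonneg by (simp add: integrable_iff_bounded)
    fix k and s :: real assume k: "k < n" and s: "0 \<le> s"
    show "AE y in bcube (n - 1). line_esssup n k u' y
      \<le> ennreal s + (\<integral>\<^sup>+t. ennreal (F (insert_coord n k y t)) * indicator {x. s < \<bar>u' x\<bar>} (insert_coord n k y t) \<partial>line)"
      by (rule line_esssup_le[OF k int_u' int_g'[OF k] _ le[OF k] s])
         (rule weak_gradient_prod[OF wg k u' g'(1)[OF k] g'(2)[OF k]], blast)
  qed
  moreover have "AE x in bcube n. F x = \<bar>u x\<bar> + gradient_length n I u x"
    using u'(2) L' by eventually_elim (simp add: F_def L_def[symmetric])
  ultimately show ?thesis using u'(2) by blast
qed

text \<open>With \<open>F = \<bar>u\<bar> + \<bar>\<nabla>u\<bar>\<close>, the integrals of the rearrangement of \<open>\<psi>\<^sub>k(u, L\<^sup>\<infinity>)\<close> over \<open>(0, t)\<close> are at most constant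
  multiples of those of \<open>hardy p F\<^sup>*\<close>. The Hardy--Littlewood--Polya principle turns this into an inequality of
  norms, and the hypothesis is applied to \<open>F\<close>.\<close>

lemma embedding_of_hardy_bound:
  assumes n: "2 \<le> n" and n': "n' = real n / (real n - 1)"
    and X: "ri_norm (cube (n - 1) I) X" and Z: "ri_norm (cube n I) Z"
    and Xbar: "luxemburg_representation (cube (n - 1) I) X Xbar"
    and Zbar: "luxemburg_representation (cube n I) Z Zbar"
    and C: "C > 0" and bound: "\<And>f. f \<in> fspace (cube n I) Z \<Longrightarrow>
        Xbar (\<lambda>t. \<integral>\<^sup>+s\<in>{t powr n'..1}. ennreal (rearrangement (cube n I) f s * s powr (- 1 / n')) \<partial>lborel)
          \<le> ennreal C * fnorm Zbar (rearrangement (cube n I) f)"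
  shows "continuously_embedded (W1_space n I Z) (W1_norm n I Z)
           (mixed_space n I X (Linf I)) (mixed_norm n X (Linf I))"
proof -
  interpret B': prob_space "bcube (n - 1)" by (rule prob_space_bcube)
  have \<sigma>: "ri_norm unit_measure Xbar" using Xbar by (simp add: luxemburg_representation_def)
  define K where "K = (2 * (2 * n * 2 powr (1 - 1 / real n) / (2 powr (1 - 1 / real n) - 1)) + 1) * C"
  have main: "mixed_norm_k n k X (Linf I) u \<le> ennreal K * W1_norm n I Z u"
    if uW: "u \<in> W1_space n I Z" and k: "k < n" for u k
  proof -
    obtain u' F where "line_controlled I a n u' F" and u': "AE x in bcube n. u x = u' x"
      and F_eq: "AE x in bcube n. F x = \<bar>u x\<bar> + gradient_length n I u x"
      using W1_space_controlled[OF n Z uW] by blast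
    interpret line_controlled I a n u' F by fact
    have K: "K = (2 * C0 + 1) * C" by (simp add: K_def C0_def p_def)
    have u_meas: "u \<in> borel_measurable (cube n I)" and fu: "fnorm Z u < \<infinity>"
      and L_meas: "gradient_length n I u \<in> borel_measurable (cube n I)" and fL: "fnorm Z (gradient_length n I u) < \<infinity>"
      using uW by (auto simp: W1_space_def fspace_def)
    have L_nonneg: "0 \<le> gradient_length n I u x" for x by (simp add: gradient_length_def L2_set_nonneg)
    have F_cube: "F \<in> borel_measurable (cube n I)" by (rule measurable_cube[OF F])
    have FZ: "fnorm Z F \<le> W1_norm n I Z u"
    proof -
      have "fnorm Z F = Z (\<lambda>x. ennreal \<bar>u x\<bar> + ennreal \<bar>gradient_length n I u x\<bar>)"
        unfolding fnorm_def
      proof (rule ri_norm_cong_AE[OF Z])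
        show "AE x in cube n I. ennreal \<bar>F x\<bar> = ennreal \<bar>u x\<bar> + ennreal \<bar>gradient_length n I u x\<bar>"
          unfolding AE_cube using F_eq by eventually_elim (simp add: L_nonneg)
      qed (use F_cube u_meas L_meas in measurable)
      also have "\<dots> \<le> fnorm Z u + fnorm Z (gradient_length n I u)"
        unfolding fnorm_def using u_meas L_meas by (intro ri_norm_add[OF Z]) auto
      finally show ?thesis by (simp add: W1_norm_def)
    qed
    then have "F \<in> fspace (cube n I) Z"
      using F_cube fu fL by (auto simp: fspace_def W1_norm_def intro: le_less_trans)
    then have "Xbar (\<lambda>t. \<integral>\<^sup>+s\<in>{t powr n'..1}. ennreal (rearrangement (cube n I) F s * s powr (- 1 / n')) \<partial>lborel)
          \<le> ennreal C * fnorm Zbar (rearrangement (cube n I) F)" by (rule bound)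
    moreover have "n' = 1 / p" "- 1 / n' = - p"
      using n by (simp_all add: n' p_def field_simps)
    moreover have "fnorm Zbar (rearrangement (cube n I) F) = fnorm Z F"
      using Zbar F_cube by (simp add: luxemburg_representation_def)
    ultimately have hardy: "Xbar (hardy p RF) \<le> ennreal C * fnorm Z F"
      unfolding hardy_def[abs_def] RF_def by (simp add: rearrangement_cube[OF F])
    define h where "h y = enn2real (line_esssup n k u' y)" for y
    have le_meas: "line_esssup n k u' \<in> borel_measurable (bcube (n - 1))"
      by (rule measurable_line_esssup[OF k u])
    have h_meas: "h \<in> borel_measurable (bcube (n - 1))" unfolding h_def using le_meas by measurable
    have h_eq: "AE y in bcube (n - 1). ennreal \<bar>h y\<bar> = line_esssup n k u' y"
    proof -
      have "(\<integral>\<^sup>+y. line_esssup n k u' y - ennreal 0 \<partial>bcube (n - 1))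
          \<le> (\<integral>\<^sup>+x. ennreal (F x) * indicator {x. 0 < \<bar>u' x\<bar>} x \<partial>bcube n)"
        by (rule line_esssup_excess(1)[OF k order_refl u F control[OF k order_refl]])
      also have "\<dots> \<le> (\<integral>\<^sup>+x. ennreal (F x) \<partial>bcube n)" by (intro nn_integral_mono) (auto simp: indicator_def)
      finally have "(\<integral>\<^sup>+y. line_esssup n k u' y \<partial>bcube (n - 1)) \<noteq> \<infinity>" using F_int by (auto simp: top_unique)
      from nn_integral_noteq_infinite[OF le_meas this] show ?thesis
        by eventually_elim (simp add: h_def less_top)
    qed
    have "mixed_norm_k n k X (Linf I) u = fnorm X h"
      unfolding mixed_norm_k_def fnorm_def
    proof (rule ri_norm_cong_AE[OF X measurable_\<psi>[OF k u_meas]])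
      show "(\<lambda>y. ennreal \<bar>h y\<bar>) \<in> borel_measurable (cube (n - 1) I)"
        using h_meas by (intro measurable_cube) simp
      show "AE y in cube (n - 1) I. \<psi> n k (Linf I) u y = ennreal \<bar>h y\<bar>"
        unfolding AE_cube using \<psi>_eq_line_esssup[OF k u u'] h_eq by eventually_elim simp
    qed
    also have "\<dots> = fnorm Xbar (rearrangement (bcube (n - 1)) h)"
      using Xbar measurable_cube[OF h_meas] rearrangement_cube[OF h_meas] by (simp add: luxemburg_representation_def)
    also have "\<dots> \<le> fnorm Xbar (\<lambda>t. (2 * C0 + 1) * enn2real (hardy p RF t))"
    proof (rule Hardy_Littlewood_Polya[OF \<sigma> B'.right_continuous_decreasing_rearrangement[OF h_meas]])
      show "right_continuous_decreasing (\<lambda>t. (2 * C0 + 1) * enn2real (hardy p RF t))"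
        using C0_nonneg by (intro hardy_right_continuous_decreasing) simp
      fix t :: real assume t: "0 < t" "t \<le> 1"
      have "ennreal (2 * C0 + 1) * (\<integral>\<^sup>+\<tau>\<in>{0<..<t}. hardy p RF \<tau> \<partial>lborel)
          = (\<integral>\<^sup>+\<tau>\<in>{0<..<t}. ennreal ((2 * C0 + 1) * enn2real (hardy p RF \<tau>)) \<partial>lborel)"
      proof -
        have "ennreal (2 * C0 + 1) * (\<integral>\<^sup>+\<tau>. hardy p RF \<tau> * indicator {0<..<t} \<tau> \<partial>lborel)
            = (\<integral>\<^sup>+\<tau>. ennreal (2 * C0 + 1) * (hardy p RF \<tau> * indicator {0<..<t} \<tau>) \<partial>lborel)"
          using measurable_hardy[of t] by (intro nn_integral_cmult[symmetric]) simp
        also have "\<dots> = (\<integral>\<^sup>+\<tau>\<in>{0<..<t}. ennreal ((2 * C0 + 1) * enn2real (hardy p RF \<tau>)) \<partial>lborel)"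
        proof (rule nn_integral_cong)
          fix \<tau> :: real
          show "ennreal (2 * C0 + 1) * (hardy p RF \<tau> * indicator {0<..<t} \<tau>)
            = ennreal ((2 * C0 + 1) * enn2real (hardy p RF \<tau>)) * indicator {0<..<t} \<tau>"
            using hardy_finite[of \<tau>] C0_nonneg by (cases "\<tau> \<in> {0<..<t}") (simp_all add: ennreal_mult)
        qed
        finally show ?thesis .
      qed
      then show "(\<integral>\<^sup>+\<tau>\<in>{0<..<t}. ennreal (rearrangement (bcube (n - 1)) h \<tau>) \<partial>lborel)
          \<le> (\<integral>\<^sup>+\<tau>\<in>{0<..<t}. ennreal ((2 * C0 + 1) * enn2real (hardy p RF \<tau>)) \<partial>lborel)"
        using nn_integral_rearrangement_line_esssup_le[OF k h_meas h_eq t] by simp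
    qed
    also have "\<dots> = ennreal (2 * C0 + 1) * Xbar (hardy p RF)"
    proof -
      have m: "(\<lambda>t. enn2real (hardy p RF t)) \<in> borel_measurable unit_measure"
        using right_continuous_decreasing.measurable_unit[OF hardy_right_continuous_decreasing[of 1]] by simp
      have eq: "ennreal (enn2real (hardy p RF t)) = hardy p RF t" if "t \<in> space unit_measure" for t
        using hardy_finite[of t] that by (simp add: space_restrict_space)
      have hm: "hardy p RF \<in> borel_measurable unit_measure"
        by (rule measurable_cong[THEN iffD1, OF eq]) (use m in measurable)
      have "fnorm Xbar (\<lambda>t. (2 * C0 + 1) * enn2real (hardy p RF t)) = Xbar (\<lambda>t. ennreal (2 * C0 + 1) * hardy p RF t)"
        unfolding fnorm_def
      proof (rule ri_norm_cong_AE[OF \<sigma>])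
        show "AE t in unit_measure. ennreal \<bar>(2 * C0 + 1) * enn2real (hardy p RF t)\<bar> = ennreal (2 * C0 + 1) * hardy p RF t"
        proof (rule AE_I2)
          fix t assume t: "t \<in> space unit_measure"
          show "ennreal \<bar>(2 * C0 + 1) * enn2real (hardy p RF t)\<bar> = ennreal (2 * C0 + 1) * hardy p RF t"
            using C0_nonneg eq[OF t] by (simp add: abs_mult ennreal_mult)
        qed
      qed (use m hm in measurable)
      also have "\<dots> = ennreal (2 * C0 + 1) * Xbar (hardy p RF)"
        using C0_nonneg hm by (intro ri_norm_cmult[OF \<sigma>]) auto
      finally show ?thesis .
    qed
    also have "\<dots> \<le> ennreal (2 * C0 + 1) * (ennreal C * W1_norm n I Z u)"
      by (intro mult_left_mono order_trans[OF hardy] FZ) simp_all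
    also have "\<dots> = ennreal K * W1_norm n I Z u"
      unfolding K using C0_nonneg C by (simp add: ennreal_mult mult.assoc)
    finally show ?thesis .
  qed
  have finite: "W1_norm n I Z u < \<infinity>" if "u \<in> W1_space n I Z" for u
    using that by (auto simp: W1_space_def W1_norm_def fspace_def)
  have "u \<in> mixed_space n I X (Linf I)" if u: "u \<in> W1_space n I Z" for u
  proof -
    have "mixed_norm_k n k X (Linf I) u < \<infinity>" if "k < n" for k
      using main[OF u that] finite[OF u] by (auto simp: ennreal_mult_less_top intro: le_less_trans)
    then show ?thesis using u by (auto simp: mixed_space_def mixed_space_k_def W1_space_def fspace_def)
  qed
  moreover have "mixed_norm n X (Linf I) u \<le> ennreal (n * \<bar>K\<bar> + 1) * W1_norm n I Z u" if u: "u \<in> W1_space n I Z" for u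
  proof -
    have "mixed_norm n X (Linf I) u \<le> (\<Sum>k<n. ennreal \<bar>K\<bar> * W1_norm n I Z u)"
      unfolding mixed_norm_def
      by (intro sum_mono order_trans[OF main[OF u]] mult_right_mono ennreal_leI) auto
    also have "\<dots> = ennreal (n * \<bar>K\<bar>) * W1_norm n I Z u"
      by (simp add: ennreal_mult mult.assoc ennreal_of_nat_eq_real_of_nat)
    also have "\<dots> \<le> ennreal (n * \<bar>K\<bar> + 1) * W1_norm n I Z u"
      by (intro mult_right_mono ennreal_leI) auto
    finally show ?thesis .
  qed
  ultimately show ?thesis
    unfolding continuously_embedded_def
    by (intro conjI subsetI exI[of _ "real n * \<bar>K\<bar> + 1"] ballI) (auto intro: add_nonneg_pos)
qed

end

section \<open>Test functions and uniqueness of the weak gradient\<close>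

context unit_interval
begin

lemma measurable_identity_borel: "(\<lambda>x. x) \<in> borel_measurable (bcube n)"
proof (rule measurable_coordinatewise_then_product)
  fix i
  show "(\<lambda>x. x i) \<in> borel_measurable (bcube n)"
  proof (cases "i < n")
    case False
    have "(\<lambda>x. undefined) \<in> borel_measurable (bcube n)" by simp
    then show ?thesis
      by (rule measurable_cong[THEN iffD1, rotated]) (use False in \<open>auto simp: space_bcube PiE_iff extensional_def\<close>)
  qed (rule measurable_coord)
qed

lemma compact_sets_bcube:
  assumes "compact K" "K \<subseteq> cube_interior n I"
  shows "K \<in> sets (bcube n)" "K \<in> sets (cube n I)"
proof -
  have "K \<in> sets borel" using assms(1) compact_imp_closed borel_closed by blast
  from measurable_sets[OF measurable_identity_borel this]
  have "K \<inter> space (bcube n) \<in> sets (bcube n)" by (simp add: vimage_def Int_commute)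
  moreover have "K \<subseteq> space (bcube n)"
    using assms(2) PiE_mono[of "{..<n}" "\<lambda>_. {a<..<a + 1}" "\<lambda>_. I"] open_subset
    unfolding cube_interior_eq space_bcube by blast
  ultimately show "K \<in> sets (bcube n)" by (simp add: Int_absorb2)
  then show "K \<in> sets (cube n I)" unfolding cube_eq by (rule sets_completionI_sets)
qed

lemma measurable_continuous_extensional:
  assumes "continuous_on (extensional {..<n}) \<phi>"
  shows "\<phi> \<in> borel_measurable (bcube n)"
proof -
  have "(\<lambda>x. x) \<in> measurable (bcube n) (restrict_space borel (extensional {..<n}))"
    using measurable_identity_borel by (intro measurable_restrict_space2) (auto simp: space_bcube PiE_iff)
  from measurable_compose[OF this borel_measurable_continuous_on_restrict[OF assms]] show ?thesis .
qed

lemma locally_integrableI: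
  assumes "integrable (bcube n) f"
  shows "locally_integrable n I f"
  unfolding locally_integrable_def set_integrable_def
proof (intro conjI allI impI)
  show "f \<in> borel_measurable (cube n I)" using assms by (intro measurable_cube) simp
  have f: "integrable (cube n I) f" unfolding cube_eq using assms by (simp add: integrable_completion)
  fix K assume "compact K \<and> K \<subseteq> cube_interior n I"
  then have "K \<in> sets (cube n I)" by (intro compact_sets_bcube(2)) auto
  then show "integrable (cube n I) (\<lambda>x. indicator K x *\<^sub>R f x)" by (rule integrable_mult_indicator[OF _ f])
qed

lemma continuous_update: "continuous_on UNIV (\<lambda>t. (x :: nat \<Rightarrow> real)(k := t))"
proof (rule continuous_on_coordinatewise_then_product)
  fix i show "continuous_on UNIV (\<lambda>t. (x(k := t)) i)" by (cases "i = k") (auto intro: continuous_intros)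
qed

lemma test_function_section:
  assumes \<phi>: "test_function n I \<phi>" and k: "k < n" and x: "x \<in> extensional {..<n}"
  shows "((\<lambda>t. \<phi> (x(k := t))) has_real_derivative partial_deriv k \<phi> (x(k := t))) (at t)"
    and "continuous_on UNIV (\<lambda>t. partial_deriv k \<phi> (x(k := t)))"
proof -
  have ext: "x(k := t) \<in> extensional {..<n}" for t using x k by (auto simp: extensional_def)
  have Ck: "Ck n (Suc 0) \<phi>" using \<phi> unfolding test_function_def by blast
  have "\<forall>x\<in>extensional {..<n}. (\<lambda>t. \<phi> (x(k := t))) differentiable (at (x k))"
    using Ck k by simp
  from bspec[OF this ext[of t]] have "(\<lambda>s. \<phi> (x(k := s))) differentiable (at t)" by simp
  then have "((\<lambda>s. \<phi> (x(k := s))) has_real_derivative deriv (\<lambda>s. \<phi> (x(k := s))) t) (at t)"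
    by (simp add: DERIV_deriv_iff_real_differentiable)
  then show "((\<lambda>t. \<phi> (x(k := t))) has_real_derivative partial_deriv k \<phi> (x(k := t))) (at t)"
    by (simp add: partial_deriv_def)
  have "continuous_on (extensional {..<n}) (partial_deriv k \<phi>)" using Ck k by simp
  then show "continuous_on UNIV (\<lambda>t. partial_deriv k \<phi> (x(k := t)))"
    by (rule continuous_on_compose2[OF _ continuous_update]) (use ext in auto)
qed

text \<open>Continuous functions are bounded on the compact support \<open>K\<close>. The complement of \<open>K\<close> is open, so the partial
  derivatives vanish there as well.\<close>

lemma test_function_bounded:
  assumes \<phi>: "test_function n I \<phi>" and k: "k < n"
  shows "\<exists>C. \<forall>x\<in>extensional {..<n}. \<bar>\<phi> x\<bar> \<le> C \<and> \<bar>partial_deriv k \<phi> x\<bar> \<le> C"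
    and "\<phi> \<in> borel_measurable (bcube n)" "partial_deriv k \<phi> \<in> borel_measurable (bcube n)"
proof -
  have Ck: "Ck n (Suc 0) \<phi>" using \<phi> unfolding test_function_def by blast
  then have cont: "continuous_on (extensional {..<n}) \<phi>" "continuous_on (extensional {..<n}) (partial_deriv k \<phi>)"
    using k by simp_all
  then show "\<phi> \<in> borel_measurable (bcube n)" "partial_deriv k \<phi> \<in> borel_measurable (bcube n)"
    by (auto intro: measurable_continuous_extensional)
  obtain K where K: "compact K" "K \<subseteq> cube_interior n I" "\<forall>x \<in> extensional {..<n} - K. \<phi> x = 0"
    using \<phi> unfolding test_function_def by blast
  have ext: "K \<subseteq> extensional {..<n}" using K(2) by (auto simp: cube_interior_eq PiE_iff)
  have d0: "partial_deriv k \<phi> x = 0" if x: "x \<in> extensional {..<n} - K" for x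
  proof -
    let ?S = "(\<lambda>t. x(k := t)) -` (- K)"
    have "open ?S"
      by (rule open_vimage[OF open_Compl[OF compact_imp_closed[OF K(1)]] continuous_update])
    moreover have "x k \<in> ?S" using x by simp
    moreover have "0 = \<phi> (x(k := t))" if "t \<in> ?S" for t
    proof -
      have "x(k := t) \<in> extensional {..<n} - K" using that x k by (auto simp: extensional_def)
      then show ?thesis using K(3) by simp
    qed
    moreover have "((\<lambda>_. 0) has_real_derivative 0) (at (x k))" by simp
    ultimately have "((\<lambda>t. \<phi> (x(k := t))) has_real_derivative 0) (at (x k))"
      by (metis (no_types, lifting) has_field_derivative_transform_within_open)
    then show ?thesis unfolding partial_deriv_def by (rule DERIV_imp_deriv)
  qed
  have "bounded (\<phi> ` K)" "bounded (partial_deriv k \<phi> ` K)"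
    using compact_continuous_image[OF continuous_on_subset[OF cont(1) ext] K(1)]
      compact_continuous_image[OF continuous_on_subset[OF cont(2) ext] K(1)] compact_imp_bounded by blast+
  then obtain C C' where C: "\<forall>x\<in>K. \<bar>\<phi> x\<bar> \<le> C" "\<forall>x\<in>K. \<bar>partial_deriv k \<phi> x\<bar> \<le> C'"
    unfolding bounded_real by blast
  have "\<bar>\<phi> x\<bar> \<le> max 0 (max C C') \<and> \<bar>partial_deriv k \<phi> x\<bar> \<le> max 0 (max C C')" if "x \<in> extensional {..<n}" for x
    using that K(3) d0 C by (cases "x \<in> K") (auto simp: le_max_iff_disj)
  then show "\<exists>C. \<forall>x\<in>extensional {..<n}. \<bar>\<phi> x\<bar> \<le> C \<and> \<bar>partial_deriv k \<phi> x\<bar> \<le> C" by blast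
qed

lemma integrable_mult_bounded:
  assumes g: "integrable (bcube n) g" and \<phi>: "\<phi> \<in> borel_measurable (bcube n)"
    and C: "\<And>x. x \<in> extensional {..<n} \<Longrightarrow> \<bar>\<phi> x\<bar> \<le> (C :: real)"
  shows "integrable (bcube n) (\<lambda>x. g x * \<phi> x)"
proof (rule Bochner_Integration.integrable_bound)
  show "integrable (bcube n) (\<lambda>x. C * g x)" using g by simp
  show "(\<lambda>x. g x * \<phi> x) \<in> borel_measurable (bcube n)" using g \<phi> by simp
  show "AE x in bcube n. norm (g x * \<phi> x) \<le> norm (C * g x)"
  proof (rule AE_I2)
    fix x assume "x \<in> space (bcube n)"
    then have "\<bar>\<phi> x\<bar> \<le> \<bar>C\<bar>" using C[of x] by (auto simp: space_bcube PiE_iff)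
    then show "norm (g x * \<phi> x) \<le> norm (C * g x)" by (simp add: abs_mult mult.commute mult_right_mono)
  qed
qed

text \<open>The difference of two weak gradients is orthogonal to all test functions, but it is only locally
  integrable, so the fundamental lemma is applied on smaller cubes exhausting the open one.\<close>

lemma weak_gradient_unique:
  assumes g1: "is_weak_gradient n I u g1" and g2: "is_weak_gradient n I u g2" and k: "k < n"
  shows "AE x in bcube n. g1 x k = g2 x k"
proof -
  have li: "locally_integrable n I (\<lambda>x. g1 x k)" "locally_integrable n I (\<lambda>x. g2 x k)"
    using g1 g2 k by (auto simp: is_weak_gradient_def)
  then have cm: "(\<lambda>x. g1 x k) \<in> borel_measurable (cube n I)" "(\<lambda>x. g2 x k) \<in> borel_measurable (cube n I)"
    by (auto simp: locally_integrable_def)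
  obtain h1 where h1: "h1 \<in> borel_measurable (bcube n)" "AE x in bcube n. g1 x k = h1 x"
    using Borel_version[OF cm(1)] by blast
  obtain h2 where h2: "h2 \<in> borel_measurable (bcube n)" "AE x in bcube n. g2 x k = h2 x"
    using Borel_version[OF cm(2)] by blast
  \<comment> \<open>The margin is below \<open>1 / 2\<close>, so that the smaller intervals are never empty.\<close>
  define \<alpha> where "\<alpha> m = a + 1 / (real m + 3)" for m :: nat
  define \<beta> where "\<beta> m = a + 1 - 1 / (real m + 3)" for m :: nat
  have zero: "AE x in bcube n. x \<in> (\<Pi>\<^sub>E i\<in>{..<n}. {\<alpha> m<..<\<beta> m}) \<longrightarrow> h1 x - h2 x = 0" for m
  proof -
    let ?K = "\<Pi>\<^sub>E i\<in>{..<n}. {\<alpha> m..\<beta> m}"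
    have "a < \<alpha> m" "\<beta> m < a + 1" by (simp_all add: \<alpha>_def \<beta>_def)
    then have K: "compact ?K" "?K \<subseteq> cube_interior n I"
      unfolding cube_interior_eq by (auto intro!: compact_PiE_Icc PiE_mono)
    note K_sets = compact_sets_bcube[OF K]
    have intK: "integrable (bcube n) (\<lambda>x. indicator ?K x * h x)"
      if "locally_integrable n I (\<lambda>x. g x k)" "h \<in> borel_measurable (bcube n)" "AE x in bcube n. g x k = h x" for g h
    proof (rule integrable_cube)
      show "integrable (cube n I) (\<lambda>x. indicator ?K x * g x k)"
        using that(1) K by (simp add: locally_integrable_def set_integrable_def)
      show "(\<lambda>x. indicator ?K x * h x) \<in> borel_measurable (bcube n)" using that(2) K_sets by simp
      show "AE x in bcube n. indicator ?K x * g x k = indicator ?K x * h x"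
        using that(3) by eventually_elim simp
    qed
    have int1: "integrable (bcube n) (\<lambda>x. indicator ?K x * h1 x)" by (rule intK[of g1 h1, OF li(1) h1])
    have int2: "integrable (bcube n) (\<lambda>x. indicator ?K x * h2 x)" by (rule intK[of g2 h2, OF li(2) h2])
    have "AE x in bcube n. x \<in> (\<Pi>\<^sub>E i\<in>{..<n}. {\<alpha> m<..<\<beta> m}) \<longrightarrow> indicator ?K x * h1 x - indicator ?K x * h2 x = 0"
    proof (rule fundamental_lemma)
      show "integrable (bcube n) (\<lambda>x. indicator ?K x * h1 x - indicator ?K x * h2 x)" using int1 int2 by simp
      show "a \<le> \<alpha> m" "\<beta> m \<le> a + 1" by (simp_all add: \<alpha>_def \<beta>_def)
      fix B assume B: "\<And>i. i < n \<Longrightarrow> smooth_supported (\<alpha> m) (\<beta> m) (B i)"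
      have B': "smooth_supported a (a + 1) (B i)" if "i < n" for i
        by (rule smooth_supported_mono[OF B[OF that]]) (simp_all add: \<alpha>_def \<beta>_def)
      let ?\<phi> = "\<lambda>x. \<Prod>j<n. B j (x j)"
      have test: "test_function n I ?\<phi>" by (rule test_function_prod[OF B'])
      have \<phi>: "?\<phi> \<in> borel_measurable (bcube n)"
        by (intro measurable_prod_coord smooth_supported_measurable[OF B'])
      have off: "?\<phi> x = 0" if x: "x \<in> space (bcube n)" "x \<notin> ?K" for x
      proof -
        have "\<exists>i<n. x i \<notin> {\<alpha> m..\<beta> m}" using x by (auto simp: space_bcube PiE_iff)
        then obtain i where i: "i < n" "x i \<notin> {\<alpha> m..\<beta> m}" by blast
        obtain c d where "\<alpha> m < c" "d < \<beta> m" "\<forall>t. t \<notin> {c..d} \<longrightarrow> B i t = 0"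
          using smooth_supportedD[OF B[OF i(1)]] by blast
        then have "B i (x i) = 0" using i(2) by auto
        then show ?thesis using i(1) by (intro prod_zero) auto
      qed
      have eq: "(\<integral>x. g x k * ?\<phi> x \<partial>cube n I) = (\<integral>x. indicator ?K x * h x * ?\<phi> x \<partial>bcube n)"
        if "(\<lambda>x. g x k) \<in> borel_measurable (cube n I)" "h \<in> borel_measurable (bcube n)" "AE x in bcube n. g x k = h x" for g h
      proof (rule integral_cube)
        show "(\<lambda>x. g x k * ?\<phi> x) \<in> borel_measurable (cube n I)"
          using that(1) measurable_cube[OF \<phi>] by simp
        show "(\<lambda>x. indicator ?K x * h x * ?\<phi> x) \<in> borel_measurable (bcube n)" using that(2) \<phi> K_sets by simp
        show "AE x in bcube n. g x k * ?\<phi> x = indicator ?K x * h x * ?\<phi> x"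
          using that(3) AE_space by eventually_elim (use off in \<open>auto simp: indicator_def\<close>)
      qed
      have g12: "(\<integral>x. g1 x k * ?\<phi> x \<partial>cube n I) = (\<integral>x. g2 x k * ?\<phi> x \<partial>cube n I)"
      proof -
        have "- (\<integral>x. g1 x k * ?\<phi> x \<partial>cube n I) = (\<integral>x. u x * partial_deriv k ?\<phi> x \<partial>cube n I)"
          "- (\<integral>x. g2 x k * ?\<phi> x \<partial>cube n I) = (\<integral>x. u x * partial_deriv k ?\<phi> x \<partial>cube n I)"
          using g1 g2 k test by (simp_all add: is_weak_gradient_def)
        then show ?thesis by simp
      qed
      have i1: "integrable (bcube n) (\<lambda>x. indicator ?K x * h1 x * ?\<phi> x)"
        by (rule integrable_mult_prod[OF int1 B'])
      have i2: "integrable (bcube n) (\<lambda>x. indicator ?K x * h2 x * ?\<phi> x)"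
        by (rule integrable_mult_prod[OF int2 B'])
      have "(\<integral>x. indicator ?K x * h1 x * ?\<phi> x \<partial>bcube n) = (\<integral>x. indicator ?K x * h2 x * ?\<phi> x \<partial>bcube n)"
        using g12 eq[of g1 h1, OF cm(1) h1] eq[of g2 h2, OF cm(2) h2] by simp
      then show "(\<integral>x. (indicator ?K x * h1 x - indicator ?K x * h2 x) * ?\<phi> x \<partial>bcube n) = 0"
        unfolding left_diff_distrib Bochner_Integration.integral_diff[OF i1 i2] by simp
    qed
    then show ?thesis
    proof eventually_elim
      case (elim x)
      show ?case
      proof
        assume x: "x \<in> (\<Pi>\<^sub>E i\<in>{..<n}. {\<alpha> m<..<\<beta> m})"
        moreover have "(\<Pi>\<^sub>E i\<in>{..<n}. {\<alpha> m<..<\<beta> m}) \<subseteq> ?K" by (intro PiE_mono) auto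
        ultimately have "x \<in> ?K" by blast
        then show "h1 x - h2 x = 0" using elim x by simp
      qed
    qed
  qed
  have "AE x in bcube n. \<forall>m. x \<in> (\<Pi>\<^sub>E i\<in>{..<n}. {\<alpha> m<..<\<beta> m}) \<longrightarrow> h1 x - h2 x = 0"
    unfolding AE_all_countable using zero by blast
  then show ?thesis
    using AE_bcube_interior h1(2) h2(2)
  proof eventually_elim
    case (elim x)
    have "\<forall>i\<in>{..<n}. eventually (\<lambda>m. x i \<in> {\<alpha> m<..<\<beta> m}) sequentially"
    proof
      fix i assume "i \<in> {..<n}"
      then have xi: "a < x i" "x i < a + 1" using PiE_mem[OF elim(2), of i] by simp_all
      have "\<alpha> \<longlonglongrightarrow> a" "\<beta> \<longlonglongrightarrow> a + 1" unfolding \<alpha>_def \<beta>_def by real_asymp+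
      then have "eventually (\<lambda>m. \<alpha> m < x i) sequentially" "eventually (\<lambda>m. x i < \<beta> m) sequentially"
        using xi by (simp_all add: order_tendstoD)
      then show "eventually (\<lambda>m. x i \<in> {\<alpha> m<..<\<beta> m}) sequentially" by eventually_elim simp
    qed
    then have "eventually (\<lambda>m. \<forall>i\<in>{..<n}. x i \<in> {\<alpha> m<..<\<beta> m}) sequentially"
      by (intro eventually_ball_finite) auto
    then obtain m where "\<forall>i\<in>{..<n}. x i \<in> {\<alpha> m<..<\<beta> m}" by (auto simp: eventually_sequentially)
    then have "x \<in> (\<Pi>\<^sub>E i\<in>{..<n}. {\<alpha> m<..<\<beta> m})" using elim(2) by (simp add: PiE_iff)
    then have "h1 x - h2 x = 0" using elim(1) by blast
    then show ?case using elim(3,4) by simp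
  qed
qed

end

section \<open>The distance from the centre of the cube\<close>

context unit_interval
begin

text \<open>Twice the distance of a coordinate from the midpoint of the interval, and twice the distance in
  the maximum norm of a point from the centre of the cube.\<close>

definition off :: "real \<Rightarrow> real" where
  "off t = 2 * \<bar>t - (a + 1 / 2)\<bar>"

definition dist_max :: "nat \<Rightarrow> (nat \<Rightarrow> real) \<Rightarrow> real" where
  "dist_max n x = Max ((\<lambda>i. off (x i)) ` {..<n})"

lemma off_le_iff: "off t \<le> \<rho> \<longleftrightarrow> t \<in> {a + 1 / 2 - \<rho> / 2..a + 1 / 2 + \<rho> / 2}"
  by (auto simp: off_def abs_if field_simps)

lemma off_nonneg: "0 \<le> off t"
  by (simp add: off_def)

lemma off_le_1: "t \<in> I \<Longrightarrow> off t \<le> 1"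
  using subset_closed by (fastforce simp: off_def abs_if dest: subsetD)

lemma off_measurable: "off \<in> borel_measurable borel"
  unfolding off_def[abs_def] by (intro borel_measurable_continuous_onI continuous_intros)

lemma measurable_dist_max: "dist_max n \<in> borel_measurable (bcube n)"
  unfolding dist_max_def[abs_def]
  by (rule borel_measurable_Max) (auto intro: measurable_compose[OF measurable_coord off_measurable])

lemma dist_max_le_iff: "1 \<le> n \<Longrightarrow> dist_max n x \<le> c \<longleftrightarrow> (\<forall>i<n. off (x i) \<le> c)"
  unfolding dist_max_def by (subst Max_le_iff) (auto simp: lessThan_empty_iff)

lemma dist_max_nonneg: "1 \<le> n \<Longrightarrow> 0 \<le> dist_max n x"
  unfolding dist_max_def by (subst Max_ge_iff) (auto simp: lessThan_empty_iff off_nonneg intro!: exI[of _ 0])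

lemma dist_max_le_1: "1 \<le> n \<Longrightarrow> x \<in> space (bcube n) \<Longrightarrow> dist_max n x \<le> 1"
  by (auto simp: dist_max_le_iff space_bcube intro!: off_le_1 dest: PiE_mem)

lemma dist_max_insert_coord:
  assumes "k < n" "2 \<le> n"
  shows "dist_max n (insert_coord n k y t) = max (dist_max (n - 1) y) (off t)"
proof (rule order_antisym)
  have 1: "off (y j) \<le> dist_max (n - 1) y" if "j < n - 1" for j
    using dist_max_le_iff[of "n - 1" y "dist_max (n - 1) y"] that by auto
  have 2: "off (insert_coord n k y t i) \<le> dist_max n (insert_coord n k y t)" if "i < n" for i
    using dist_max_le_iff[of n "insert_coord n k y t" "dist_max n (insert_coord n k y t)"] that by auto
  have "off (insert_coord n k y t i) \<le> max (dist_max (n - 1) y) (off t)" if i: "i < n" for i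
  proof (cases "i = k")
    case False
    then have "i \<in> skip k ` {..<n - 1}"
      using bij_betw_imp_surj_on[OF bij_betw_skip[OF assms(1)]] i by simp
    then obtain j where "j < n - 1" "skip k j = i" by auto
    then show ?thesis using insert_coord_skip[OF assms(1), of j y t] 1[of j] by (simp add: le_max_iff_disj)
  qed (simp add: insert_coord_same[OF assms(1)])
  then show "dist_max n (insert_coord n k y t) \<le> max (dist_max (n - 1) y) (off t)"
    using assms by (subst dist_max_le_iff) auto
  have "off (y j) \<le> dist_max n (insert_coord n k y t)" if "j < n - 1" for j
  proof -
    have "skip k j < n" unfolding skip_def using that by presburger
    from 2[OF this] show ?thesis by (simp only: insert_coord_skip[OF assms(1) that])
  qed
  then have "dist_max (n - 1) y \<le> dist_max n (insert_coord n k y t)"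
    using assms by (subst dist_max_le_iff) auto
  moreover have "off t \<le> dist_max n (insert_coord n k y t)"
    using 2[OF assms(1)] by (simp add: insert_coord_same[OF assms(1)])
  ultimately show "max (dist_max (n - 1) y) (off t) \<le> dist_max n (insert_coord n k y t)" by simp
qed

text \<open>The cubes \<open>{dist_max \<le> c}\<close> have measure \<open>c\<^sup>n\<close>, so \<open>dist_max\<^sup>n\<close> is uniformly distributed.\<close>

lemma emeasure_dist_max_le:
  assumes n: "1 \<le> n" and c: "0 \<le> c" "c \<le> 1"
  shows "emeasure (bcube n) {x \<in> space (bcube n). dist_max n x \<le> c} = ennreal (c ^ n)"
proof -
  let ?J = "I \<inter> {a + 1 / 2 - c / 2..a + 1 / 2 + c / 2}"
  have J: "?J \<in> sets line" by (auto simp: sets_restrict_space)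
  have "{x \<in> space (bcube n). dist_max n x \<le> c} = (\<Pi>\<^sub>E i\<in>{..<n}. ?J)"
  proof -
    show ?thesis using n by (auto simp: dist_max_le_iff space_bcube PiE_def Pi_def off_le_iff)
  qed
  moreover have "emeasure line ?J = ennreal c"
  proof -
    have "emeasure line ?J = (\<integral>\<^sup>+t. indicator ?J t \<partial>line)" using J by simp
    also have "\<dots> = (\<integral>\<^sup>+t\<in>{a<..<a + 1}. indicator {a + 1 / 2 - c / 2..a + 1 / 2 + c / 2} t \<partial>lborel)"
      unfolding nn_integral_line using open_subset by (intro nn_integral_cong) (auto simp: indicator_def)
    also have "\<dots> = (\<integral>\<^sup>+t. indicator {a + 1 / 2 - c / 2..a + 1 / 2 + c / 2} t \<partial>lborel)"
    proof (rule nn_integral_cong_AE)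
      show "AE t in lborel. indicator {a + 1 / 2 - c / 2..a + 1 / 2 + c / 2} t * indicator {a<..<a + 1} t
        = (indicator {a + 1 / 2 - c / 2..a + 1 / 2 + c / 2} t :: ennreal)"
        using AE_lborel_singleton[of a] AE_lborel_singleton[of "a + 1"]
        by eventually_elim (use c in \<open>auto simp: indicator_def\<close>)
    qed
    also have "\<dots> = ennreal c" using c by simp
    finally show ?thesis .
  qed
  ultimately show ?thesis
    using J c by (simp add: emeasure_PiM ennreal_power)
qed

lemma uniform_distribution_fun:
  assumes n: "1 \<le> n" and t: "0 \<le> t"
  shows "distribution_fun (bcube n) (\<lambda>x. dist_max n x ^ n) t = distribution_fun unit_measure (\<lambda>s. s) t"
proof -
  interpret B: prob_space "bcube n" by (rule prob_space_bcube)
  define c where "c = root n (min t 1)"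
  have c: "0 \<le> c" "c \<le> 1" "c ^ n = min t 1"
    using n t by (auto simp: c_def real_root_pow_pos2)
  let ?S = "{x \<in> space (bcube n). dist_max n x \<le> c}"
  have S: "?S \<in> sets (bcube n)" using measurable_dist_max by measurable
  have lt: "\<bar>dist_max n x ^ n\<bar> > t \<longleftrightarrow> \<not> dist_max n x \<le> c" if x: "x \<in> space (bcube n)" for x
  proof -
    have d: "0 \<le> dist_max n x" "dist_max n x \<le> 1" using n x dist_max_nonneg dist_max_le_1 by auto
    have "dist_max n x \<le> c \<longleftrightarrow> dist_max n x ^ n \<le> c ^ n"
      by (rule power_mono_iff[symmetric]) (use d c n in auto)
    also have "\<dots> \<longleftrightarrow> dist_max n x ^ n \<le> t" using c(3) power_le_one[OF d, of n] by auto
    finally show ?thesis using d by (simp add: not_le)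
  qed
  have "distribution_fun (bcube n) (\<lambda>x. dist_max n x ^ n) t = emeasure (bcube n) (space (bcube n) - ?S)"
    unfolding distribution_fun_def using lt by (intro arg_cong[where f = "emeasure (bcube n)"]) auto
  also have "\<dots> = 1 - ennreal (c ^ n)"
    using emeasure_compl[OF S] emeasure_dist_max_le[OF n c(1,2)] B.emeasure_space_1 by simp
  also have "\<dots> = ennreal (1 - min t 1)" unfolding c(3) using t by (simp add: ennreal_minus flip: ennreal_1)
  also have "\<dots> = distribution_fun unit_measure (\<lambda>s. s) t"
  proof -
    have "{s \<in> space unit_measure. \<bar>s\<bar> > t} = {min t 1<..<1}"
      using t by (auto simp: space_restrict_space)
    moreover have "emeasure unit_measure {min t 1<..<1} = ennreal (1 - min t 1)"
      using t by (subst emeasure_restrict_space) auto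
    ultimately show ?thesis by (simp add: distribution_fun_def)
  qed
  finally show ?thesis .
qed

lemma equimeasurable_dist_max:
  fixes G :: "real \<Rightarrow> real"
  assumes n: "1 \<le> n" and G: "G \<in> borel_measurable borel"
  shows "distribution_fun (bcube n) (\<lambda>x. G (dist_max n x ^ n)) s = distribution_fun unit_measure G s"
proof -
  define \<phi> :: "real \<Rightarrow> ennreal" where "\<phi> t = indicator {y. s < \<bar>y\<bar>} (G t)" for t
  have \<phi>: "\<phi> \<in> borel_measurable borel"
  proof -
    have "{y. s < \<bar>y :: real\<bar>} \<in> sets borel" by measurable
    then show ?thesis unfolding \<phi>_def[abs_def] using G by (intro measurable_compose[OF G]) simp
  qed
  have dm: "(\<lambda>x. dist_max n x ^ n) \<in> borel_measurable (bcube n)" using measurable_dist_max by simp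
  have id: "(\<lambda>t. t) \<in> borel_measurable unit_measure"
    by (intro measurable_restrict_space1) (auto intro: measurable_completion)
  have D: "distribution_fun M h s = (\<integral>\<^sup>+x. indicator {y. s < \<bar>y\<bar>} (h x) \<partial>M)"
    if "h \<in> borel_measurable M" for M :: "'z measure" and h :: "'z \<Rightarrow> real"
  proof -
    have "{x \<in> space M. s < \<bar>h x\<bar>} \<in> sets M" using that by measurable
    then have "distribution_fun M h s = (\<integral>\<^sup>+x. indicator {x \<in> space M. s < \<bar>h x\<bar>} x \<partial>M)"
      by (simp add: distribution_fun_def)
    also have "\<dots> = (\<integral>\<^sup>+x. indicator {y. s < \<bar>y\<bar>} (h x) \<partial>M)"
      by (rule nn_integral_cong) (auto simp: indicator_def)
    finally show ?thesis .
  qed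
  have "distribution_fun (bcube n) (\<lambda>x. G (dist_max n x ^ n)) s = (\<integral>\<^sup>+x. \<phi> \<bar>dist_max n x ^ n\<bar> \<partial>bcube n)"
    using dist_max_nonneg[OF n] measurable_compose[OF dm G] by (subst D) (simp_all add: \<phi>_def)
  also have "\<dots> = (\<integral>\<^sup>+t. \<phi> \<bar>t\<bar> \<partial>unit_measure)"
    by (rule nn_integral_equimeasurable[OF prob_space_bcube prob_space_unit_measure dm id _ \<phi>])
       (rule uniform_distribution_fun[OF n])
  also have "\<dots> = (\<integral>\<^sup>+t. indicator {y. s < \<bar>y\<bar>} (G t) \<partial>unit_measure)"
    by (rule nn_integral_cong) (simp add: \<phi>_def space_restrict_space)
  also have "\<dots> = distribution_fun unit_measure G s"
    using measurable_compose[OF id G] by (subst D) simp_all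
  finally show ?thesis .
qed

end

section \<open>The extremal functions\<close>

context hardy_operator
begin

text \<open>The substitution \<open>s = \<theta>\<^sup>n\<close>. For \<open>R = f\<^sup>*\<close> it shows that almost everywhere minus the derivative of
  \<open>hardy p R (\<rho>\<^sup>n\<^sup>-\<^sup>1)\<close> with respect to \<open>\<rho>\<close> is \<open>n f\<^sup>*(\<rho>\<^sup>n)\<close>, with no power of \<open>\<rho>\<close> left over.\<close>

lemma hardy_substitution:
  assumes n: "2 \<le> n" and pn: "p = 1 - 1 / real n" and \<rho>: "0 < \<rho>" "\<rho> \<le> 1"
  shows "hardy p R (\<rho> ^ (n - 1)) = (\<integral>\<^sup>+\<theta>\<in>{\<rho>..1}. ennreal (n * R0 (\<theta> ^ n)) \<partial>lborel)"
proof -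
  have "(\<rho> ^ (n - 1)) powr (1 / p) = \<rho> ^ n"
  proof -
    have "(\<rho> ^ (n - 1)) powr (1 / p) = \<rho> powr (real (n - 1) * (1 / p))"
      using \<rho> by (simp add: powr_realpow[symmetric] powr_powr)
    also have "real (n - 1) * (1 / p) = real n" using n by (simp add: pn field_simps of_nat_diff)
    finally show ?thesis using \<rho> by (simp add: powr_realpow)
  qed
  then have "hardy p R (\<rho> ^ (n - 1)) = (\<integral>\<^sup>+s. ennreal (R0 s * s powr (- p)) * indicator {\<rho> ^ n..1 ^ n} s \<partial>lborel)"
    using \<rho> by (subst hardy_R0) simp_all
  also have "\<dots> = (\<integral>\<^sup>+s. ennreal (R0 s * s powr (- p) * indicator {\<rho> ^ n..1 ^ n} s) \<partial>lborel)"
    by (rule nn_integral_cong) (auto simp: indicator_def)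
  also have "\<dots> = (\<integral>\<^sup>+\<theta>. ennreal (R0 (\<theta> ^ n) * (\<theta> ^ n) powr (- p) * (n * \<theta> ^ (n - 1)) * indicator {\<rho>..1} \<theta>) \<partial>lborel)"
  proof (rule nn_integral_substitution[where g = "\<lambda>\<theta>. \<theta> ^ n" and g' = "\<lambda>\<theta>. n * \<theta> ^ (n - 1)"])
    have "(\<lambda>s. R0 s * s powr (- p)) \<in> borel_measurable borel" using R0(1) by simp
    then show "set_borel_measurable borel {\<rho> ^ n..1 ^ n} (\<lambda>s. R0 s * s powr (- p))"
      unfolding set_borel_measurable_def by simp
    show "((\<lambda>\<theta>. \<theta> ^ n) has_real_derivative n * \<theta> ^ (n - 1)) (at \<theta>)" for \<theta> :: real
      by (auto intro!: derivative_eq_intros)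
    show "continuous_on {\<rho>..1} (\<lambda>\<theta>. real n * \<theta> ^ (n - 1))" by (intro continuous_intros)
    show "0 \<le> real n * \<theta> ^ (n - 1)" if "\<theta> \<in> {\<rho>..1}" for \<theta> using that \<rho> by simp
  qed (use \<rho> in simp)
  also have "\<dots> = (\<integral>\<^sup>+\<theta>\<in>{\<rho>..1}. ennreal (n * R0 (\<theta> ^ n)) \<partial>lborel)"
  proof (rule nn_integral_cong)
    fix \<theta> :: real
    show "ennreal (R0 (\<theta> ^ n) * (\<theta> ^ n) powr (- p) * (n * \<theta> ^ (n - 1)) * indicator {\<rho>..1} \<theta>)
      = ennreal (n * R0 (\<theta> ^ n)) * indicator {\<rho>..1} \<theta>"
    proof (cases "\<theta> \<in> {\<rho>..1}")
      case True
      then have "0 < \<theta>" using \<rho> by simp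
      have "(\<theta> ^ n) powr (- p) * \<theta> ^ (n - 1) = \<theta> powr (real n * (- p) + real (n - 1))"
        unfolding powr_add using \<open>0 < \<theta>\<close> by (simp only: powr_realpow[symmetric] powr_powr)
      also have "real n * (- p) + real (n - 1) = 0" using n by (simp add: pn field_simps of_nat_diff)
      finally have one: "(\<theta> ^ n) powr (- p) * \<theta> ^ (n - 1) = 1" using \<open>0 < \<theta>\<close> by simp
      have eq: "R0 (\<theta> ^ n) * (\<theta> ^ n) powr (- p) * (n * \<theta> ^ (n - 1))
          = n * R0 (\<theta> ^ n) * ((\<theta> ^ n) powr (- p) * \<theta> ^ (n - 1))"
        by (simp only: ac_simps)
      show ?thesis unfolding eq one using True by simp
    qed simp
  qed
  finally show ?thesis .
qed

end

context unit_interval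
begin

declare measurable_line_borel [measurable del]

definition tail_integral :: "(real \<Rightarrow> real) \<Rightarrow> real \<Rightarrow> real" where
  "tail_integral K \<rho> = (\<integral>s. K s * indicator {\<rho>..1} s \<partial>lborel)"

text \<open>The gradient of \<open>tail_integral K (dist_max n x)\<close>, by the chain rule: only a coordinate realising the
  maximum contributes, and there \<open>off\<close> has derivative \<open>2\<close> or \<open>- 2\<close>.\<close>

definition radial_gradient :: "(real \<Rightarrow> real) \<Rightarrow> nat \<Rightarrow> (nat \<Rightarrow> real) \<Rightarrow> nat \<Rightarrow> real" where
  "radial_gradient K n x k =
    (if off (x k) = dist_max n x then - 2 * sgn (x k - (a + 1 / 2)) * K (dist_max n x) else 0)"

lemma measurable_tail_integral:
  assumes [measurable]: "K \<in> borel_measurable borel"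
  shows "tail_integral K \<in> borel_measurable borel"
proof -
  have "(\<lambda>p. K (snd p) * (if fst p \<le> snd p \<and> snd p \<le> 1 then 1 else 0)) \<in> borel_measurable (borel \<Otimes>\<^sub>M lborel)"
    by measurable
  then have "(\<lambda>\<rho>. \<integral>s. K s * (if \<rho> \<le> s \<and> s \<le> 1 then 1 else 0) \<partial>lborel) \<in> borel_measurable borel"
    by (intro lborel.borel_measurable_lebesgue_integral) (simp add: case_prod_unfold)
  also have "(\<lambda>\<rho>. \<integral>s. K s * (if \<rho> \<le> s \<and> s \<le> 1 then 1 else 0) \<partial>lborel) = tail_integral K"
    unfolding tail_integral_def by (intro ext Bochner_Integration.integral_cong) (auto simp: indicator_def)
  finally show ?thesis .
qed

lemma measurable_radial_gradient:
  assumes "k < n" and [measurable]: "K \<in> borel_measurable borel"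
  shows "(\<lambda>x. radial_gradient K n x k) \<in> borel_measurable (bcube n)"
proof -
  note [measurable] = measurable_dist_max[of n] measurable_coord[OF assms(1)] off_measurable
  show ?thesis unfolding radial_gradient_def sgn_if by measurable
qed

lemma integral_line_supported:
  fixes f :: "real \<Rightarrow> real"
  assumes [measurable]: "f \<in> borel_measurable borel" and zero: "\<And>t. t \<notin> {a..a + 1} \<Longrightarrow> f t = 0"
  shows "(\<integral>t. f t \<partial>line) = (\<integral>t. f t \<partial>lborel)"
proof -
  have "(\<integral>t. f t \<partial>line) = (\<integral>t. indicator I t *\<^sub>R f t \<partial>lborel)"
    by (rule integral_restrict_space) simp
  also have "\<dots> = (\<integral>t. f t \<partial>lborel)"
  proof (rule integral_cong_AE)
    show "AE t in lborel. indicator I t *\<^sub>R f t = f t"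
      using AE_lborel_singleton[of a] AE_lborel_singleton[of "a + 1"]
    proof eventually_elim
      case (elim t)
      then have "t \<in> I" if "t \<in> {a..a + 1}" using that open_subset by auto
      then show ?case using zero[of t] by (cases "t \<in> {a..a + 1}") simp_all
    qed
  qed (use assms(1) in simp_all)
  finally show ?thesis .
qed

text \<open>On a line at distance \<open>r\<close> from the centre the function \<open>tail_integral K \<circ> dist_max\<close> is
  \<open>\<integral> k(\<rho>) 1{off t \<le> \<rho>} d\<rho>\<close> with \<open>k\<close> the restriction of \<open>K\<close> to \<open>[r, 1]\<close>. Exchanging the integrations, the
  derivative of the test function is integrated over the interval \<open>{off \<le> \<rho>}\<close>, and the values at its
  two endpoints give the two halves of the gradient.\<close>

lemma tail_integral_by_parts:
  fixes K \<theta> \<theta>' :: "real \<Rightarrow> real"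
  assumes r: "0 < r" and K[measurable]: "K \<in> borel_measurable borel"
    and K_int: "integrable lborel (\<lambda>s. K s * indicator {r..1} s)"
    and deriv: "\<And>t. (\<theta> has_real_derivative \<theta>' t) (at t)" and cont: "continuous_on UNIV \<theta>'"
    and bounds: "\<And>t. \<bar>\<theta> t\<bar> \<le> C" "\<And>t. \<bar>\<theta>' t\<bar> \<le> C"
  shows "(\<integral>t. tail_integral K (max r (off t)) * \<theta>' t \<partial>line)
    = - (\<integral>t. - 2 * sgn (t - (a + 1 / 2)) * (K (off t) * indicator {r..1} (off t)) * \<theta> t \<partial>line)"
proof -
  let ?m = "a + 1 / 2"
  define k where "k s = K s * indicator {r..1} s" for s
  have k[measurable]: "k \<in> borel_measurable borel" unfolding k_def by measurable
  have k_int: "integrable lborel k" unfolding k_def[abs_def] by (rule K_int)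
  have k_0: "k s = 0" if "s \<le> 0 \<or> 1 < s" for s using that r by (auto simp: k_def)
  have [measurable]: "\<theta>' \<in> borel_measurable borel" by (rule borel_measurable_continuous_onI[OF cont])
  have \<theta>_cont: "continuous_on UNIV \<theta>"
    using deriv by (intro continuous_at_imp_continuous_on ballI DERIV_isCont) blast
  have [measurable]: "\<theta> \<in> borel_measurable borel" by (rule borel_measurable_continuous_onI[OF \<theta>_cont])
  note [measurable] = off_measurable
  let ?f = "\<lambda>\<rho> t. k \<rho> * (if off t \<le> \<rho> then \<theta>' t else 0)"
  \<comment> \<open>In \<open>?f \<rho> t\<close> the pair \<open>(\<rho>, t)\<close> ranges over the region \<open>off t \<le> \<rho>\<close>, and \<open>k\<close> vanishes outside \<open>[r, 1]\<close>.\<close>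
  have meas_f: "case_prod ?f \<in> borel_measurable (lborel \<Otimes>\<^sub>M lborel)"
    unfolding case_prod_unfold by measurable
  have ind: "integrable lborel (indicator {c..d} :: real \<Rightarrow> real)" for c d :: real
    by (rule integrable_real_indicator) (auto simp: emeasure_lborel_Icc_eq)
  have f_int: "integrable lborel (?f \<rho>)" for \<rho>
  proof (rule Bochner_Integration.integrable_bound)
    show "integrable lborel (\<lambda>t. k \<rho> * (C * indicator {?m - \<rho> / 2..?m + \<rho> / 2} t))" using ind by simp
    show "AE t in lborel. norm (?f \<rho> t) \<le> norm (k \<rho> * (C * indicator {?m - \<rho> / 2..?m + \<rho> / 2} t))"
    proof (rule AE_I2)
      fix t
      show "norm (?f \<rho> t) \<le> norm (k \<rho> * (C * indicator {?m - \<rho> / 2..?m + \<rho> / 2} t))"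
        using bounds(2)[of t] off_le_iff[of t \<rho>] by (auto simp: abs_mult intro!: mult_left_mono)
    qed
  qed measurable
  have f_bound: "norm (\<integral>t. norm (?f \<rho> t) \<partial>lborel) \<le> norm (C * k \<rho>)" for \<rho>
  proof (cases "0 < \<rho> \<and> \<rho> \<le> 1")
    case True
    have "(\<integral>t. norm (?f \<rho> t) \<partial>lborel) \<le> (\<integral>t. \<bar>k \<rho>\<bar> * (C * indicator {?m - \<rho> / 2..?m + \<rho> / 2} t) \<partial>lborel)"
    proof (rule integral_mono)
      show "integrable lborel (\<lambda>t. \<bar>k \<rho>\<bar> * (C * indicator {?m - \<rho> / 2..?m + \<rho> / 2} t))" using ind by simp
      show "norm (?f \<rho> t) \<le> \<bar>k \<rho>\<bar> * (C * indicator {?m - \<rho> / 2..?m + \<rho> / 2} t)" for t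
        using bounds(2)[of t] off_le_iff[of t \<rho>] by (auto simp: abs_mult intro!: mult_left_mono)
    qed (rule integrable_norm[OF f_int])
    also have "\<dots> = \<bar>k \<rho>\<bar> * C * \<rho>" using True by simp
    also have "\<dots> \<le> \<bar>k \<rho>\<bar> * C * 1" using True bounds(2)[of 0] by (intro mult_left_mono) auto
    also have "\<dots> \<le> norm (C * k \<rho>)" using bounds(2)[of 0] by (simp add: abs_mult)
    finally show ?thesis by simp
  qed (use k_0[of \<rho>] in auto)
  have int_f: "integrable (lborel \<Otimes>\<^sub>M lborel) (case_prod ?f)"
  proof (rule lborel_pair.Fubini_integrable[OF meas_f])
    show "integrable lborel (\<lambda>\<rho>. \<integral>t. norm (case (\<rho>, t) of (\<rho>, t) \<Rightarrow> ?f \<rho> t) \<partial>lborel)"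
    proof (rule Bochner_Integration.integrable_bound)
      show "integrable lborel (\<lambda>\<rho>. C * k \<rho>)" using k_int by simp
      show "AE \<rho> in lborel. norm (\<integral>t. norm (case (\<rho>, t) of (\<rho>, t) \<Rightarrow> ?f \<rho> t) \<partial>lborel) \<le> norm (C * k \<rho>)"
        using f_bound by simp
      show "(\<lambda>\<rho>. \<integral>t. norm (case (\<rho>, t) of (\<rho>, t) \<Rightarrow> ?f \<rho> t) \<partial>lborel) \<in> borel_measurable lborel"
        using meas_f by (intro lborel.borel_measurable_lebesgue_integral) (simp add: case_prod_unfold)
    qed
    show "AE \<rho> in lborel. integrable lborel (\<lambda>t. case (\<rho>, t) of (\<rho>, t) \<Rightarrow> ?f \<rho> t)" using f_int by simp
  qed
  have inner: "(\<integral>t. ?f \<rho> t \<partial>lborel) = k \<rho> * \<theta> (?m + \<rho> / 2) - k \<rho> * \<theta> (?m - \<rho> / 2)" for \<rho>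
  proof (cases "0 < \<rho>")
    case True
    have "(\<integral>t. ?f \<rho> t \<partial>lborel) = (\<integral>t. k \<rho> * (indicator {?m - \<rho> / 2..?m + \<rho> / 2} t *\<^sub>R \<theta>' t) \<partial>lborel)"
      by (rule Bochner_Integration.integral_cong) (simp_all add: off_le_iff indicator_def)
    also have "\<dots> = k \<rho> * (\<integral>t. indicator {?m - \<rho> / 2..?m + \<rho> / 2} t *\<^sub>R \<theta>' t \<partial>lborel)" by simp
    also have "(\<integral>t. indicator {?m - \<rho> / 2..?m + \<rho> / 2} t *\<^sub>R \<theta>' t \<partial>lborel) = \<theta> (?m + \<rho> / 2) - \<theta> (?m - \<rho> / 2)"
      using True
      by (intro integral_FTC_Icc has_field_derivative_at_within[OF deriv, THEN has_real_derivative_iff_has_vector_derivative[THEN iffD1]]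
            continuous_on_subset[OF cont]) auto
    finally show ?thesis by (simp add: right_diff_distrib)
  qed (use k_0[of \<rho>] in auto)
  have int_mult: "integrable lborel (\<lambda>s. k s * \<theta> (h s))" if [measurable]: "h \<in> borel_measurable borel" for h
  proof (rule Bochner_Integration.integrable_bound)
    show "integrable lborel (\<lambda>s. C * k s)" using k_int by simp
    show "AE s in lborel. norm (k s * \<theta> (h s)) \<le> norm (C * k s)"
    proof (rule AE_I2)
      fix s
      have "\<bar>\<theta> (h s)\<bar> \<le> \<bar>C\<bar>" using bounds(1)[of "h s"] by linarith
      then show "norm (k s * \<theta> (h s)) \<le> norm (C * k s)"
        using mult_left_mono[of "\<bar>\<theta> (h s)\<bar>" "\<bar>C\<bar>" "\<bar>k s\<bar>"] by (simp add: abs_mult mult.commute)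
    qed
  qed measurable
  have affine: "- 2 * ?m + 2 * t = 2 * (t - ?m)" "?m + 2 * (t - ?m) / 2 = t"
    "2 * ?m + - 2 * t = 2 * (?m - t)" "?m - 2 * (?m - t) / 2 = t" for t
    by (simp_all add: field_simps)
  have tail: "tail_integral K (max r (off t)) * \<theta>' t = (\<integral>\<rho>. ?f \<rho> t \<partial>lborel)" for t
  proof -
    have "tail_integral K (max r (off t)) * \<theta>' t = (\<integral>\<rho>. K \<rho> * indicator {max r (off t)..1} \<rho> * \<theta>' t \<partial>lborel)"
      unfolding tail_integral_def by simp
    also have "\<dots> = (\<integral>\<rho>. ?f \<rho> t \<partial>lborel)"
      by (rule Bochner_Integration.integral_cong) (auto simp: k_def indicator_def)
    finally show ?thesis .
  qed
  have out: "1 < off t" if "t \<notin> {a..a + 1}" for t using that by (auto simp: off_def abs_if)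
  have "(\<integral>t. tail_integral K (max r (off t)) * \<theta>' t \<partial>line) = (\<integral>t. tail_integral K (max r (off t)) * \<theta>' t \<partial>lborel)"
  proof (rule integral_line_supported)
    note [measurable] = measurable_tail_integral[OF K]
    show "(\<lambda>t. tail_integral K (max r (off t)) * \<theta>' t) \<in> borel_measurable borel" by measurable
    fix t assume "t \<notin> {a..a + 1}"
    then have "{max r (off t)..1} = {}" using out[of t] by auto
    then show "tail_integral K (max r (off t)) * \<theta>' t = 0" by (simp add: tail_integral_def)
  qed
  also have "\<dots> = (\<integral>t. (\<integral>\<rho>. ?f \<rho> t \<partial>lborel) \<partial>lborel)" unfolding tail ..
  also have "\<dots> = (\<integral>\<rho>. (\<integral>t. ?f \<rho> t \<partial>lborel) \<partial>lborel)" by (rule lborel_pair.Fubini_integral[OF int_f])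
  also have "\<dots> = (\<integral>\<rho>. k \<rho> * \<theta> (?m + \<rho> / 2) \<partial>lborel) - (\<integral>\<rho>. k \<rho> * \<theta> (?m - \<rho> / 2) \<partial>lborel)"
    unfolding inner by (rule Bochner_Integration.integral_diff; rule int_mult; measurable)
  also have "(\<integral>\<rho>. k \<rho> * \<theta> (?m + \<rho> / 2) \<partial>lborel) = (\<integral>t. 2 * (k (2 * (t - ?m)) * \<theta> t) \<partial>lborel)"
    by (subst lborel_integral_real_affine[of 2 _ "- 2 * ?m"]) (simp, simp only: affine, simp)
  also have "(\<integral>\<rho>. k \<rho> * \<theta> (?m - \<rho> / 2) \<partial>lborel) = (\<integral>t. 2 * (k (2 * (?m - t)) * \<theta> t) \<partial>lborel)"
    by (subst lborel_integral_real_affine[of "- 2" _ "2 * ?m"]) (simp, simp only: affine, simp)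
  also have "(\<integral>t. 2 * (k (2 * (t - ?m)) * \<theta> t) \<partial>lborel) - (\<integral>t. 2 * (k (2 * (?m - t)) * \<theta> t) \<partial>lborel)
      = (\<integral>t. 2 * (k (2 * (t - ?m)) * \<theta> t) - 2 * (k (2 * (?m - t)) * \<theta> t) \<partial>lborel)"
  proof (rule Bochner_Integration.integral_diff[symmetric])
    have "integrable lborel (\<lambda>t. k (2 * (t - ?m)) * \<theta> t)"
      using lborel_integrable_real_affine[OF int_mult[of "\<lambda>s. ?m + s / 2"], of 2 "- 2 * ?m"]
      by (simp only: affine) simp
    then show "integrable lborel (\<lambda>t. 2 * (k (2 * (t - ?m)) * \<theta> t))" by simp
    have "integrable lborel (\<lambda>t. k (2 * (?m - t)) * \<theta> t)"
      using lborel_integrable_real_affine[OF int_mult[of "\<lambda>s. ?m - s / 2"], of "- 2" "2 * ?m"]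
      by (simp only: affine) simp
    then show "integrable lborel (\<lambda>t. 2 * (k (2 * (?m - t)) * \<theta> t))" by simp
  qed
  also have "\<dots> = (\<integral>t. - (- 2 * sgn (t - ?m) * k (off t) * \<theta> t) \<partial>lborel)"
  proof (rule Bochner_Integration.integral_cong[OF refl])
    fix t :: real
    consider "t < ?m" | "t = ?m" | "?m < t" by linarith
    then show "2 * (k (2 * (t - ?m)) * \<theta> t) - 2 * (k (2 * (?m - t)) * \<theta> t) = - (- 2 * sgn (t - ?m) * k (off t) * \<theta> t)"
    proof cases
      case 1
      then have "off t = 2 * (?m - t)" "k (2 * (t - ?m)) = 0" by (auto simp: off_def intro: k_0)
      then show ?thesis using 1 by simp
    next
      case 3
      then have "off t = 2 * (t - ?m)" "k (2 * (?m - t)) = 0" by (auto simp: off_def intro: k_0)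
      then show ?thesis using 3 by simp
    qed simp
  qed
  also have "\<dots> = - (\<integral>t. - 2 * sgn (t - ?m) * k (off t) * \<theta> t \<partial>lborel)"
    by (rule Bochner_Integration.integral_minus)
  also have "(\<integral>t. - 2 * sgn (t - ?m) * k (off t) * \<theta> t \<partial>lborel) = (\<integral>t. - 2 * sgn (t - ?m) * k (off t) * \<theta> t \<partial>line)"
  proof (rule integral_line_supported[symmetric])
    show "(\<lambda>t. - 2 * sgn (t - ?m) * k (off t) * \<theta> t) \<in> borel_measurable borel" unfolding sgn_if by measurable
    show "- 2 * sgn (t - ?m) * k (off t) * \<theta> t = 0" if "t \<notin> {a..a + 1}" for t
      using k_0[of "off t"] out[OF that] by simp
  qed
  finally show ?thesis unfolding k_def .
qed

lemma AE_dist_max_pos: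
  assumes "1 \<le> n"
  shows "AE x in bcube n. 0 < dist_max n x"
proof -
  have "{x \<in> space (bcube n). dist_max n x \<le> 0} \<in> null_sets (bcube n)"
    using emeasure_dist_max_le[OF assms, of 0] measurable_dist_max[of n] assms by (intro null_setsI) auto
  then show ?thesis by (rule AE_I') (auto simp: not_less)
qed

text \<open>The identity of the previous lemma is integrated over the lines in direction \<open>k\<close>. Lines through the
  centre, where \<open>K\<close> need not be integrable, form a null set.\<close>

lemma radial_weak_gradient:
  assumes n: "2 \<le> n" and K[measurable]: "K \<in> borel_measurable borel"
    and K_int: "\<And>\<rho>. 0 < \<rho> \<Longrightarrow> integrable lborel (\<lambda>s. K s * indicator {\<rho>..1} s)"
    and u_int: "integrable (bcube n) (\<lambda>x. tail_integral K (dist_max n x))"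
    and g_int: "integrable (bcube n) (\<lambda>x. K (dist_max n x))"
  shows "is_weak_gradient n I (\<lambda>x. tail_integral K (dist_max n x)) (radial_gradient K n)"
  unfolding is_weak_gradient_def
proof (intro conjI allI impI)
  let ?u = "\<lambda>x. tail_integral K (dist_max n x)"
  show "locally_integrable n I ?u" by (rule locally_integrableI[OF u_int])
  fix k assume k: "k < n"
  have gk: "integrable (bcube n) (\<lambda>x. radial_gradient K n x k)"
  proof (rule Bochner_Integration.integrable_bound)
    show "integrable (bcube n) (\<lambda>x. 2 * K (dist_max n x))" using g_int by simp
    show "(\<lambda>x. radial_gradient K n x k) \<in> borel_measurable (bcube n)"
      by (rule measurable_radial_gradient[OF k K])
    show "AE x in bcube n. norm (radial_gradient K n x k) \<le> norm (2 * K (dist_max n x))"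
      by (rule AE_I2) (auto simp: radial_gradient_def abs_mult sgn_if)
  qed
  show "locally_integrable n I (\<lambda>x. radial_gradient K n x k)" by (rule locally_integrableI[OF gk])
  fix \<phi> assume \<phi>: "test_function n I \<phi>"
  obtain C where C: "\<And>x. x \<in> extensional {..<n} \<Longrightarrow> \<bar>\<phi> x\<bar> \<le> C"
      "\<And>x. x \<in> extensional {..<n} \<Longrightarrow> \<bar>partial_deriv k \<phi> x\<bar> \<le> C"
    using test_function_bounded(1)[OF \<phi> k] by blast
  note \<phi>_meas = test_function_bounded(2,3)[OF \<phi> k]
  have i1: "integrable (bcube n) (\<lambda>x. ?u x * partial_deriv k \<phi> x)"
    by (rule integrable_mult_bounded[OF u_int \<phi>_meas(2) C(2)])
  have i2: "integrable (bcube n) (\<lambda>x. radial_gradient K n x k * \<phi> x)"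
    by (rule integrable_mult_bounded[OF gk \<phi>_meas(1) C(1)])
  let ?J = "\<lambda>f y. \<integral>t. f (insert_coord n k y t) \<partial>line"
  have J_meas: "?J f \<in> borel_measurable (bcube (n - 1))" if "f \<in> borel_measurable (bcube n)" for f :: "_ \<Rightarrow> real"
    using measurable_section(2)[OF k that] by (intro line.borel_measurable_lebesgue_integral) (simp add: case_prod_unfold)
  have "(\<integral>x. ?u x * partial_deriv k \<phi> x \<partial>cube n I) = (\<integral>x. ?u x * partial_deriv k \<phi> x \<partial>bcube n)"
    using i1 by (intro integral_cube measurable_cube) simp_all
  also have "\<dots> = (\<integral>y. ?J (\<lambda>x. ?u x * partial_deriv k \<phi> x) y \<partial>bcube (n - 1))"
    by (rule integral_bcube(1)[OF k i1])
  also have "\<dots> = (\<integral>y. - ?J (\<lambda>x. radial_gradient K n x k * \<phi> x) y \<partial>bcube (n - 1))"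
  proof (rule integral_cong_AE)
    show "?J (\<lambda>x. ?u x * partial_deriv k \<phi> x) \<in> borel_measurable (bcube (n - 1))"
      using i1 by (intro J_meas) simp
    show "(\<lambda>y. - ?J (\<lambda>x. radial_gradient K n x k * \<phi> x) y) \<in> borel_measurable (bcube (n - 1))"
      using i2 by (intro borel_measurable_uminus J_meas) simp
    have "1 \<le> n - 1" using n by simp
    from AE_dist_max_pos[OF this]
    show "AE y in bcube (n - 1). ?J (\<lambda>x. ?u x * partial_deriv k \<phi> x) y = - ?J (\<lambda>x. radial_gradient K n x k * \<phi> x) y"
    proof eventually_elim
      case (elim y)
      let ?r = "dist_max (n - 1) y"
      define x0 where "x0 = insert_coord n k y 0"
      have x0: "x0 \<in> extensional {..<n}" by (simp add: x0_def insert_coord_def)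
      have x0t: "insert_coord n k y t = x0(k := t)" for t by (simp add: x0_def insert_coord_update[OF k])
      have ext: "x0(k := t) \<in> extensional {..<n}" for t using x0 k by (auto simp: extensional_def)
      have "?J (\<lambda>x. ?u x * partial_deriv k \<phi> x) y
          = (\<integral>t. tail_integral K (max ?r (off t)) * partial_deriv k \<phi> (x0(k := t)) \<partial>line)"
        unfolding dist_max_insert_coord[OF k n] unfolding x0t ..
      also have "\<dots> = - (\<integral>t. - 2 * sgn (t - (a + 1 / 2)) * (K (off t) * indicator {?r..1} (off t)) * \<phi> (x0(k := t)) \<partial>line)"
        by (rule tail_integral_by_parts[OF elim K K_int[OF elim] test_function_section(1,2)[OF \<phi> k x0] C(1)[OF ext] C(2)[OF ext]])
      also have "(\<integral>t. - 2 * sgn (t - (a + 1 / 2)) * (K (off t) * indicator {?r..1} (off t)) * \<phi> (x0(k := t)) \<partial>line)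
          = ?J (\<lambda>x. radial_gradient K n x k * \<phi> x) y"
      proof (rule Bochner_Integration.integral_cong[OF refl])
        fix t assume "t \<in> space line"
        then have "off t \<le> 1" by (intro off_le_1) (simp add: space_restrict_space)
        then show "- 2 * sgn (t - (a + 1 / 2)) * (K (off t) * indicator {?r..1} (off t)) * \<phi> (x0(k := t))
          = radial_gradient K n (insert_coord n k y t) k * \<phi> (insert_coord n k y t)"
          unfolding radial_gradient_def dist_max_insert_coord[OF k n] insert_coord_same[OF k]
          unfolding x0t
          by (auto simp: indicator_def max_def)
      qed
      finally show ?case .
    qed
  qed
  also have "\<dots> = - (\<integral>y. ?J (\<lambda>x. radial_gradient K n x k * \<phi> x) y \<partial>bcube (n - 1))"
    by (rule Bochner_Integration.integral_minus)
  also have "(\<integral>y. ?J (\<lambda>x. radial_gradient K n x k * \<phi> x) y \<partial>bcube (n - 1)) = (\<integral>x. radial_gradient K n x k * \<phi> x \<partial>bcube n)"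
    by (rule integral_bcube(1)[OF k i2, symmetric])
  also have "\<dots> = (\<integral>x. radial_gradient K n x k * \<phi> x \<partial>cube n I)"
    using i2 by (intro integral_cube[symmetric] measurable_cube) simp_all
  finally show "(\<integral>x. ?u x * partial_deriv k \<phi> x \<partial>cube n I) = - (\<integral>x. radial_gradient K n x k * \<phi> x \<partial>cube n I)" .
qed

text \<open>On the line over \<open>y\<close>, with \<open>r = dist_max (n - 1) y\<close>, the set \<open>{off t \<le> r}\<close> has measure \<open>r\<close>, and there
  \<open>dist_max n\<close> is constantly \<open>r\<close>.\<close>

lemma line_esssup_radial_ge:
  assumes k: "k < n" and n: "2 \<le> n" and v[measurable]: "v \<in> borel_measurable borel" and y: "y \<in> space (bcube (n - 1))"
    and r: "0 < dist_max (n - 1) y"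
  shows "ennreal \<bar>v (dist_max (n - 1) y)\<bar> \<le> line_esssup n k (\<lambda>x. v (dist_max n x)) y"
proof (rule ccontr)
  let ?r = "dist_max (n - 1) y" and ?L = "line_esssup n k (\<lambda>x. v (dist_max n x)) y"
  assume "\<not> ?thesis"
  then have less: "?L < ennreal \<bar>v ?r\<bar>" by simp
  have "AE t in line. ennreal \<bar>v (dist_max n (insert_coord n k y t))\<bar> \<le> ?L"
    unfolding line_esssup_def
    by (rule esssup_AE)
  moreover have "ennreal \<bar>v (dist_max n (insert_coord n k y t))\<bar> = ennreal \<bar>v ?r\<bar>" if "off t \<le> ?r" for t
    using that by (simp add: dist_max_insert_coord[OF k n] max_absorb1)
  ultimately have "AE t in line. \<not> off t \<le> ?r" using less by (auto elim!: eventually_mono)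
  then have "AE t in line. t \<notin> {a + 1 / 2 - ?r / 2..a + 1 / 2 + ?r / 2}"
    unfolding off_le_iff .
  then have *: "AE t in lborel. t \<in> I \<longrightarrow> t \<notin> {a + 1 / 2 - ?r / 2..a + 1 / 2 + ?r / 2}"
    by (simp add: AE_restrict_space_iff)
  have "?r \<le> 1" using n y by (intro dist_max_le_1) auto
  with * have "AE t in lborel. t \<notin> {a + 1 / 2 - ?r / 2<..<a + 1 / 2 + ?r / 2}"
    using open_subset by (elim eventually_mono) (auto simp: subset_iff field_simps)
  then have "emeasure lborel {a + 1 / 2 - ?r / 2<..<a + 1 / 2 + ?r / 2} = 0"
    by (subst (asm) AE_iff_measurable[where N = "{a + 1 / 2 - ?r / 2<..<a + 1 / 2 + ?r / 2}"]) auto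
  then show False using r by simp
qed

end

section \<open>From the embedding to the Hardy inequality\<close>

context unit_interval
begin

text \<open>The test is the radial function \<open>u\<close> with \<open>u(x) = hardy p f\<^sup>* (dist_max n x ^ (n - 1))\<close>. Up to a constant \<open>u\<close> and
  the length of its gradient are at most \<open>f\<^sup>* (dist_max n x ^ n)\<close>, a function equimeasurable with \<open>f\<close>. On the
  line over \<open>y\<close> the function \<open>u\<close> attains \<open>hardy p f\<^sup>* (dist_max (n - 1) y ^ (n - 1))\<close>, which as a function of \<open>y\<close>
  is equimeasurable with \<open>hardy p f\<^sup>*\<close>.\<close>

lemma hardy_bound_of_embedding:
  assumes n: "2 \<le> n" and n': "n' = real n / (real n - 1)"
    and X: "ri_norm (cube (n - 1) I) X" and Z: "ri_norm (cube n I) Z"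
    and Xbar: "luxemburg_representation (cube (n - 1) I) X Xbar"
    and Zbar: "luxemburg_representation (cube n I) Z Zbar"
    and emb: "continuously_embedded (W1_space n I Z) (W1_norm n I Z)
           (mixed_space n I X (Linf I)) (mixed_norm n X (Linf I))"
  shows "\<exists>C::real. C > 0 \<and> (\<forall>f \<in> fspace (cube n I) Z.
        Xbar (\<lambda>t. \<integral>\<^sup>+s\<in>{t powr n'..1}.
                    ennreal (rearrangement (cube n I) f s * s powr (- 1 / n')) \<partial>lborel)
          \<le> ennreal C * fnorm Zbar (rearrangement (cube n I) f))"
proof -
  have \<sigma>: "ri_norm unit_measure Xbar" using Xbar by (simp add: luxemburg_representation_def)
  obtain C0 where C0: "0 < C0"
    "\<And>u. u \<in> W1_space n I Z \<Longrightarrow> mixed_norm n X (Linf I) u \<le> ennreal C0 * W1_norm n I Z u"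
    using emb by (auto simp: continuously_embedded_def)
  define p where "p = 1 - 1 / real n"
  have p: "0 < p" using n by (simp add: p_def)
  have exponents: "n' = 1 / p" "- 1 / n' = - p" using n by (simp_all add: n' p_def field_simps)
  \<comment> \<open>The bounds \<open>n\<close> for the function and \<open>2 n\<close> for each of the \<open>n\<close> partial derivatives of the extremal function.\<close>
  define K0 where "K0 = real n + 2 * real n ^ 2"
  have n1: "1 \<le> n" "1 \<le> n - 1" using n by simp_all
  have "Xbar (\<lambda>t. \<integral>\<^sup>+s\<in>{t powr n'..1}. ennreal (rearrangement (cube n I) f s * s powr (- 1 / n')) \<partial>lborel)
      \<le> ennreal (C0 * K0) * fnorm Zbar (rearrangement (cube n I) f)"
    if f: "f \<in> fspace (cube n I) Z" for f
  proof -
    interpret N: prob_space "cube n I" by (rule prob_space_cube)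
    interpret N': prob_space "cube (n - 1) I" by (rule prob_space_cube)
    define R where "R = rearrangement (cube n I) f"
    have f_meas: "f \<in> borel_measurable (cube n I)" using f by (simp add: fspace_def)
    have "(\<integral>\<^sup>+x. ennreal \<bar>f x\<bar> \<partial>cube n I) < \<infinity>"
      using fnorm_finite_imp_integrable[OF Z f] by (simp add: integrable_iff_bounded)
    then interpret hardy_operator p R
      unfolding R_def by (intro N.hardy_operator_rearrangement p f_meas)
    have R0_antimono: "R0 t \<le> R0 s" if "0 < s" "s \<le> t" for s t
      using N.rearrangement_antimono[OF f_meas that, folded R_def] that by (simp add: R0(3))
    define H where "H x = R0 (dist_max n x ^ n)" for x
    have H_meas: "H \<in> borel_measurable (bcube n)"
      unfolding H_def[abs_def] by (intro measurable_compose[OF _ R0(1)]) (use measurable_dist_max[of n] in simp)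
    have H_nonneg: "0 \<le> H x" for x by (simp add: H_def R0(2))
    have H_norm: "fnorm Z H = fnorm Z f"
    proof (rule ri_norm_equimeasurable[OF Z measurable_cube[OF H_meas] f_meas])
      fix t :: real assume t: "0 \<le> t"
      have "distribution_fun (cube n I) H t = distribution_fun unit_measure R0 t"
        unfolding cube_eq distribution_fun_completion[OF H_meas] unfolding H_def[abs_def]
        by (rule equimeasurable_dist_max[OF n1(1) R0(1)])
      also have "\<dots> = distribution_fun unit_measure R t"
        unfolding distribution_fun_def
        by (intro arg_cong[where f = "emeasure unit_measure"]) (auto simp: space_restrict_space R0(3))
      also have "\<dots> = distribution_fun (cube n I) f t"
        unfolding R_def by (rule N.rearrangement_equimeasurable[OF f_meas t])
      finally show "distribution_fun (cube n I) H t = distribution_fun (cube n I) f t" .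
    qed
    have H_fspace: "H \<in> fspace (cube n I) Z"
      using f H_norm measurable_cube[OF H_meas] by (simp add: fspace_def)
    have H_int: "integrable (bcube n) H"
      by (rule integrable_cube[OF fnorm_finite_imp_integrable[OF Z H_fspace] H_meas]) simp

    define K where "K s = real n * R0 (s ^ n)" for s
    have K_meas: "K \<in> borel_measurable borel" unfolding K_def[abs_def] using R0(1) by simp
    have K_nonneg: "0 \<le> K s" for s by (simp add: K_def R0(2))
    have tail: "integrable lborel (\<lambda>s. K s * indicator {\<rho>..1} s)"
        "ennreal (tail_integral K \<rho>) = hardy p R (\<rho> ^ (n - 1))" if \<rho>: "0 < \<rho>" "\<rho> \<le> 1" for \<rho>
    proof -
      have eq: "(\<integral>\<^sup>+s. ennreal (K s * indicator {\<rho>..1} s) \<partial>lborel) = hardy p R (\<rho> ^ (n - 1))"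
        unfolding hardy_substitution[OF n p_def \<rho>]
        by (rule nn_integral_cong) (simp add: K_def indicator_def)
      show int: "integrable lborel (\<lambda>s. K s * indicator {\<rho>..1} s)"
      proof (rule integrableI_nonneg)
        show "(\<lambda>s. K s * indicator {\<rho>..1} s) \<in> borel_measurable lborel" using K_meas by simp
        show "(\<integral>\<^sup>+s. ennreal (K s * indicator {\<rho>..1} s) \<partial>lborel) < \<infinity>"
          unfolding eq using \<rho> by (intro hardy_finite) simp
      qed (simp add: K_nonneg)
      show "ennreal (tail_integral K \<rho>) = hardy p R (\<rho> ^ (n - 1))"
        unfolding tail_integral_def eq[symmetric]
        by (rule nn_integral_eq_integral[OF int, symmetric]) (simp add: K_nonneg)
    qed
    have K_int: "integrable lborel (\<lambda>s. K s * indicator {\<rho>..1} s)" if "0 < \<rho>" for \<rho>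
      using tail(1)[OF that] by (cases "\<rho> \<le> 1") simp_all
    have tail_nonneg: "0 \<le> tail_integral K \<rho>" for \<rho>
      unfolding tail_integral_def by (rule Bochner_Integration.integral_nonneg) (simp add: K_nonneg)
    have tail_le: "tail_integral K \<rho> \<le> K \<rho>" if \<rho>: "0 < \<rho>" "\<rho> \<le> 1" for \<rho>
    proof -
      have "tail_integral K \<rho> \<le> (\<integral>s. K \<rho> * indicator {\<rho>..1} s \<partial>lborel)"
        unfolding tail_integral_def
      proof (rule integral_mono[OF K_int[OF \<rho>(1)]])
        show "integrable lborel (\<lambda>s. K \<rho> * indicator {\<rho>..1} s)"
          by (intro integrable_mult_right integrable_real_indicator) (auto simp: emeasure_lborel_Icc_eq)
        show "K s * indicator {\<rho>..1} s \<le> K \<rho> * indicator {\<rho>..1} s" for s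
          using \<rho> by (auto simp: indicator_def K_def intro!: mult_left_mono R0_antimono power_mono)
      qed
      also have "\<dots> = K \<rho> * (1 - \<rho>)" using \<rho> by simp
      also have "\<dots> \<le> K \<rho> * 1" using \<rho> K_nonneg[of \<rho>] by (intro mult_left_mono) auto
      finally show ?thesis by simp
    qed

    define u where "u x = tail_integral K (dist_max n x)" for x
    let ?g = "radial_gradient K n"
    have u_meas: "u \<in> borel_measurable (bcube n)"
      unfolding u_def[abs_def] by (rule measurable_compose[OF measurable_dist_max measurable_tail_integral[OF K_meas]])
    have u_le: "AE x in bcube n. \<bar>u x\<bar> \<le> n * H x"
      using AE_dist_max_pos[OF n1(1)] AE_space
    proof eventually_elim
      case (elim x)
      then show ?case
        using tail_le[of "dist_max n x"] tail_nonneg[of "dist_max n x"] dist_max_le_1[OF n1(1)]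
        by (simp add: u_def K_def H_def)
    qed
    have g_le: "\<bar>?g x k\<bar> \<le> 2 * (n * H x)" for x k
      using R0(2)[of "dist_max n x ^ n"]
      by (auto simp: radial_gradient_def K_def H_def abs_mult sgn_if)
    have weak: "is_weak_gradient n I u ?g"
      unfolding u_def[abs_def]
    proof (rule radial_weak_gradient[OF n K_meas K_int])
      show "integrable (bcube n) (\<lambda>x. K (dist_max n x))" using H_int by (simp add: K_def H_def[abs_def])
      show "integrable (bcube n) (\<lambda>x. tail_integral K (dist_max n x))"
      proof (rule Bochner_Integration.integrable_bound)
        show "integrable (bcube n) (\<lambda>x. n * H x)" using H_int by simp
        show "(\<lambda>x. tail_integral K (dist_max n x)) \<in> borel_measurable (bcube n)"
          using u_meas by (simp add: u_def[abs_def])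
        show "AE x in bcube n. norm (tail_integral K (dist_max n x)) \<le> norm (n * H x)"
          using u_le by eventually_elim (simp add: u_def H_nonneg)
      qed
    qed
    then have "is_weak_gradient n I u (weak_gradient n I u)"
      unfolding weak_gradient_def by (rule someI[where P = "is_weak_gradient n I u"])
    then have "AE x in bcube n. \<forall>k\<in>{..<n}. weak_gradient n I u x k = ?g x k"
      by (intro AE_finite_allI weak_gradient_unique[OF _ weak]) auto
    then have length: "AE x in bcube n. L2_set (?g x) {..<n} = gradient_length n I u x"
      unfolding gradient_length_def by eventually_elim (auto intro!: L2_set_cong)
    have length_meas: "gradient_length n I u \<in> borel_measurable (cube n I)"
      unfolding cube_eq
    proof (rule borel_measurable_completion_AE[OF _ length])
      show "(\<lambda>x. L2_set (?g x) {..<n}) \<in> borel_measurable (bcube n)"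
        unfolding L2_set_def using measurable_radial_gradient[OF _ K_meas, of _ n]
        by (intro measurable_compose[OF _ borel_measurable_sqrt] borel_measurable_sum borel_measurable_power) auto
    qed
    have length_le: "AE x in bcube n. \<bar>gradient_length n I u x\<bar> \<le> 2 * real n ^ 2 * H x"
      using length
    proof eventually_elim
      case (elim x)
      have "L2_set (?g x) {..<n} \<le> (\<Sum>k<n. \<bar>?g x k\<bar>)" by (rule L2_set_le_sum_abs)
      also have "\<dots> \<le> (\<Sum>k<n. 2 * (n * H x))" by (intro sum_mono g_le)
      also have "\<dots> = 2 * real n ^ 2 * H x" by (simp add: power2_eq_square)
      finally show ?case using elim L2_set_nonneg[of "?g x" "{..<n}"] by simp
    qed
    have fnorm_le: "fnorm Z v \<le> ennreal c * fnorm Z f"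
      if "v \<in> borel_measurable (cube n I)" "0 \<le> c" "AE x in bcube n. \<bar>v x\<bar> \<le> c * H x" for v c
    proof -
      have "fnorm Z v \<le> Z (\<lambda>x. ennreal c * ennreal \<bar>H x\<bar>)"
        unfolding fnorm_def
      proof (rule ri_norm_mono_AE[OF Z])
        show "AE x in cube n I. ennreal \<bar>v x\<bar> \<le> ennreal c * ennreal \<bar>H x\<bar>"
          unfolding AE_cube using that(3)
          by eventually_elim (simp add: ennreal_mult[symmetric] that(2) H_nonneg ennreal_leI)
      qed (use that(1) measurable_cube[OF H_meas] in simp_all)
      also have "\<dots> = ennreal c * fnorm Z H"
        unfolding fnorm_def using measurable_cube[OF H_meas] that(2) by (intro ri_norm_cmult[OF Z]) simp_all
      finally show ?thesis unfolding H_norm .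
    qed
    have u_norm: "fnorm Z u \<le> ennreal n * fnorm Z f"
      using u_le by (intro fnorm_le measurable_cube u_meas) simp_all
    have length_norm: "fnorm Z (gradient_length n I u) \<le> ennreal (2 * real n ^ 2) * fnorm Z f"
      using length_le by (intro fnorm_le length_meas) simp_all
    have f_fin: "fnorm Z f < \<infinity>" using f by (simp add: fspace_def)
    have u_W1: "u \<in> W1_space n I Z"
      using u_norm length_norm f_fin weak measurable_cube[OF u_meas] length_meas
      by (auto simp: W1_space_def fspace_def ennreal_mult_less_top intro: le_less_trans)
    have "W1_norm n I Z u \<le> ennreal K0 * fnorm Z f"
    proof -
      have "W1_norm n I Z u \<le> ennreal n * fnorm Z f + ennreal (2 * real n ^ 2) * fnorm Z f"
        unfolding W1_norm_def by (intro add_mono u_norm length_norm)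
      also have "\<dots> = ennreal K0 * fnorm Z f"
        by (simp add: K0_def ennreal_plus distrib_right)
      finally show ?thesis .
    qed
    then have upper: "mixed_norm n X (Linf I) u \<le> ennreal (C0 * K0) * fnorm Z f"
      using order_trans[OF C0(2)[OF u_W1] mult_left_mono] C0(1)
      by (simp add: ennreal_mult K0_def mult.assoc)

    \<comment> \<open>A Borel function on the whole line; the bound \<open>2\<close> leaves room for the value \<open>t = 1\<close>, attained on the boundary of the cube.\<close>
    define G where "G t = enn2real (hardy p R t * indicator {0<..<2} t)" for t
    have G_meas: "G \<in> borel_measurable borel" unfolding G_def[abs_def] using measurable_hardy[of 2] by simp
    have G: "ennreal (G t) = hardy p R t" if "0 < t" "t \<le> 1" for t
      using that hardy_finite[of t] by (simp add: G_def)
    have G_nonneg: "0 \<le> G t" for t by (simp add: G_def)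
    define h where "h y = G (dist_max (n - 1) y ^ (n - 1))" for y
    have h_meas: "h \<in> borel_measurable (bcube (n - 1))"
      unfolding h_def[abs_def] by (intro measurable_compose[OF _ G_meas]) (use measurable_dist_max[of "n - 1"] in simp)
    have G_unit: "G \<in> borel_measurable unit_measure"
      by (intro borel_measurable_unit_measureI measurable_restrict_space1 G_meas)
    have "Xbar (hardy p R) = fnorm Xbar G"
      unfolding fnorm_def
    proof (rule ri_norm_cong_AE[OF \<sigma>])
      have eq: "ennreal \<bar>G t\<bar> = hardy p R t" if "t \<in> space unit_measure" for t
        using G[of t] G_nonneg[of t] that by (simp add: space_restrict_space)
      show "(\<lambda>t. ennreal \<bar>G t\<bar>) \<in> borel_measurable unit_measure" using G_unit by simp
      then show "hardy p R \<in> borel_measurable unit_measure" by (rule measurable_cong[THEN iffD1, rotated]) (rule eq)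
      show "AE t in unit_measure. hardy p R t = ennreal \<bar>G t\<bar>" by (rule AE_I2) (simp add: eq)
    qed
    also have "\<dots> = fnorm Xbar (rearrangement (cube (n - 1) I) h)"
    proof (rule ri_norm_equimeasurable[OF \<sigma> G_unit])
      show "rearrangement (cube (n - 1) I) h \<in> borel_measurable unit_measure"
        by (rule N'.measurable_rearrangement_unit[OF measurable_cube[OF h_meas]])
      fix t :: real assume t: "0 \<le> t"
      have "distribution_fun unit_measure (rearrangement (cube (n - 1) I) h) t = distribution_fun (cube (n - 1) I) h t"
        by (rule N'.rearrangement_equimeasurable[OF measurable_cube[OF h_meas] t])
      also have "\<dots> = distribution_fun unit_measure G t"
        unfolding cube_eq distribution_fun_completion[OF h_meas] unfolding h_def[abs_def]
        by (rule equimeasurable_dist_max[OF n1(2) G_meas])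
      finally show "distribution_fun unit_measure G t
        = distribution_fun unit_measure (rearrangement (cube (n - 1) I) h) t" ..
    qed
    also have "\<dots> = fnorm X h"
      using Xbar measurable_cube[OF h_meas] by (simp add: luxemburg_representation_def)
    also have "\<dots> \<le> mixed_norm_k n 0 X (Linf I) u"
      unfolding fnorm_def mixed_norm_k_def
    proof (rule ri_norm_mono_AE[OF X])
      show "(\<lambda>y. ennreal \<bar>h y\<bar>) \<in> borel_measurable (cube (n - 1) I)"
        using measurable_cube[OF h_meas] by simp
      have 0: "0 < n" using n by simp
      show "\<psi> n 0 (Linf I) u \<in> borel_measurable (cube (n - 1) I)"
        by (rule measurable_\<psi>[OF 0 measurable_cube[OF u_meas]])
      have "AE x in bcube n. u x = u x" by simp
      from \<psi>_eq_line_esssup[OF 0 u_meas this] AE_dist_max_pos[OF n1(2)] AE_space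
      show "AE y in cube (n - 1) I. ennreal \<bar>h y\<bar> \<le> \<psi> n 0 (Linf I) u y"
        unfolding AE_cube
      proof eventually_elim
        case (elim y)
        let ?r = "dist_max (n - 1) y"
        have r: "0 < ?r" "?r \<le> 1" using elim dist_max_le_1[OF n1(2)] by auto
        have "ennreal \<bar>h y\<bar> = hardy p R (?r ^ (n - 1))"
          using G[of "?r ^ (n - 1)"] r G_nonneg[of "?r ^ (n - 1)"] by (simp add: h_def power_le_one)
        also have "\<dots> = ennreal \<bar>tail_integral K ?r\<bar>" using tail(2)[OF r] tail_nonneg[of ?r] by simp
        also have "\<dots> \<le> line_esssup n 0 u y"
          unfolding u_def[abs_def]
          by (rule line_esssup_radial_ge[OF 0 n measurable_tail_integral[OF K_meas] elim(3) r(1)])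
        finally show ?case using elim(1) by simp
      qed
    qed
    also have "\<dots> \<le> mixed_norm n X (Linf I) u"
      unfolding mixed_norm_def using n
      by (intro member_le_sum[where f = "\<lambda>k. mixed_norm_k n k X (Linf I) u"]) auto
    also note upper
    also have "fnorm Z f = fnorm Zbar R"
      using Zbar f_meas by (simp add: luxemburg_representation_def R_def)
    finally show ?thesis unfolding exponents(2) unfolding exponents(1) hardy_def[abs_def] R_def .
  qed
  moreover have "0 < C0 * K0" using C0(1) n by (simp add: K0_def add_pos_nonneg)
  ultimately show ?thesis by blast
qed

end

theorem theorem4p2:
  fixes n :: nat and n' :: real and I :: "real set"
    and X Z :: "((nat \<Rightarrow> real) \<Rightarrow> ennreal) \<Rightarrow> ennreal"
    and Xbar Zbar :: "(real \<Rightarrow> ennreal) \<Rightarrow> ennreal"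
  assumes "n \<ge> 2"
    and "n' = real n / (real n - 1)"
    and "is_interval I" and "emeasure lborel I = 1"
    and "ri_norm (cube (n - 1) I) X"
    and "ri_norm (cube n I) Z"
    and "luxemburg_representation (cube (n - 1) I) X Xbar"
    and "luxemburg_representation (cube n I) Z Zbar"
  shows "continuously_embedded (W1_space n I Z) (W1_norm n I Z)
           (mixed_space n I X (Linf I)) (mixed_norm n X (Linf I))
     \<longleftrightarrow>
     (\<exists>C::real. C > 0 \<and> (\<forall>f \<in> fspace (cube n I) Z.
        Xbar (\<lambda>t. \<integral>\<^sup>+s\<in>{t powr n'..1}.
                    ennreal (rearrangement (cube n I) f s * s powr (- 1 / n')) \<partial>lborel)
          \<le> ennreal C * fnorm Zbar (rearrangement (cube n I) f)))"
proof
  obtain a where "unit_interval I a" using is_interval_unit_length[OF assms(3,4)] by blast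
  then interpret unit_interval I a .
  show "\<exists>C::real. C > 0 \<and> (\<forall>f \<in> fspace (cube n I) Z.
        Xbar (\<lambda>t. \<integral>\<^sup>+s\<in>{t powr n'..1}.
                    ennreal (rearrangement (cube n I) f s * s powr (- 1 / n')) \<partial>lborel)
          \<le> ennreal C * fnorm Zbar (rearrangement (cube n I) f))"
    if "continuously_embedded (W1_space n I Z) (W1_norm n I Z)
           (mixed_space n I X (Linf I)) (mixed_norm n X (Linf I))"
    by (rule hardy_bound_of_embedding[OF assms(1,2,5-8) that])
  show "continuously_embedded (W1_space n I Z) (W1_norm n I Z)
           (mixed_space n I X (Linf I)) (mixed_norm n X (Linf I))"
    if hardy: "\<exists>C::real. C > 0 \<and> (\<forall>f \<in> fspace (cube n I) Z.
        Xbar (\<lambda>t. \<integral>\<^sup>+s\<in>{t powr n'..1}.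
                    ennreal (rearrangement (cube n I) f s * s powr (- 1 / n')) \<partial>lborel)
          \<le> ennreal C * fnorm Zbar (rearrangement (cube n I) f))"
  proof -
    obtain C :: real where C: "0 < C" and bound: "\<forall>f \<in> fspace (cube n I) Z.
        Xbar (\<lambda>t. \<integral>\<^sup>+s\<in>{t powr n'..1}.
                    ennreal (rearrangement (cube n I) f s * s powr (- 1 / n')) \<partial>lborel)
          \<le> ennreal C * fnorm Zbar (rearrangement (cube n I) f)"
      using hardy by blast
    show ?thesis by (rule embedding_of_hardy_bound[OF assms(1,2,5-8) C bspec[OF bound]])
  qed
qed

end
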